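(* Assume that (A1)–(A5), as written out in the context, hold. Let $\nu$ be the function defined in the context and put $$M(t)=R(t)-\mathbb E R(t)+\nu(t,X(t)),\qquad t\ge0.$$ Then $\sup\{|\nu(t,x)|:t\ge0,\ x\in S\}<\infty$, and $(M(t):t\ge0)$ is a martingale adapted to $(\mathcal F_t:t\ge0)$, where $\mathcal F_t=\sigma(X(s):0\le s\le t)$.
   Context: Setting. $X=(X(t):t\ge 0)$ is a right-continuous Markov jump process on a finite set $S$, $|S|=d<\infty$, with time-dependent rate matrices $Q(t)=(Q(t,x,y):x,y\in S)$ (nonnegative off-diagonal entries, rows summing to $0$) and initial distribution $\mu$. Let $T_j$ be the time of the $j$th jump of $X$, $Y_j=X(T_j)$ for $j\ge1$, $Y_0=X(0)$, and $J(t)$ the number of jumps of $X$ in $[0,t]$. Given $X$, $N=(N(t):t\ge0)$ is a Poisson counting process with intensity $(\beta(t,X(t)):t\ge 0)$ and event times $(\Lambda_k:k\ge1)$. Let $0=t_0<t_1<t_2<\cdots$ be deterministic times with $t_i\to\infty$, and $n(t)=\sup\{i\ge0:t_i\le t\}$. Conditional on $X$ and $N$, the lump-sum rewards $\mathscr G(T_k,Y_{k-1},Y_k)$, $\mathscr H(t_k,X(t_k))$, $\mathscr K(\Lambda_k,X(\Lambda_k))$, $k\ge1$, are independent with respective conditional distribution functions $G(T_k,Y_{k-1},Y_k,\cdot)$, $H(t_k,X(t_k),\cdot)$, $K(\Lambda_k,X(\Lambda_k),\cdot)$, where $G(t,x,y,\cdot)$, $H(t,x,\cdot)$, $K(t,x,\cdot)$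 ($t\ge0$, $x,y\in S$) are given families of distribution functions. The cumulative reward is $$R(t)=\int_0^t r(s,X(s))\,ds+\sum_{j=1}^{J(t)}\mathscr G(T_j,Y_{j-1},Y_j)+\sum_{i=1}^{n(t)}\mathscr H(t_i,X(t_i))+\sum_{k=1}^{N(t)}\mathscr K(\Lambda_k,X(\Lambda_k)).$$ The filtration is $(\mathcal F_t:t\ge0)$ with $\mathcal F_t=\sigma(X(s):0\le s\le t)$. Assumptions. (A1) For $x,y\in S$, $z\in\mathbb R$, the functions $Q(\cdot,x,y)$, $r(\cdot,x)$, $G(\cdot,x,y,z)$, $K(\cdot,x,z)$, $\beta(\cdot,x)$ are measurable. (A2) $\mathcal B=\{(x,y):Q(t,x,y)>0\}$ does not depend on $t$, and $Q(1)$ (hence every $Q(t)$) is an irreducible rate matrix. (A3) For each $(x,y)\in\mathcal B$, $0<\inf_{t\ge0}Q(t,x,y)\le\sup_{t\ge0}Q(t,x,y)<\infty$. (A4) There is a finite-valued function $c=(c(x):x\in S)$ such that for all $x\in S$ (and $y \in S$): $0\le\inf_{t}r(t,x)\le\sup_t r(t,x)<\infty$; $0\le\inf_t\beta(t,x)\le\sup_t\beta(t,x)<\infty$; $\sup_t G(t,x,y,0-)=0$ and $\inf_t G(t,x,y,c(x))=1$; $\sup_t H(t,x,0-)=0$ and $\inf_t H(t,x,c(x))=1$; $\sup_t K(t,x,0-)=0$ and $\inf_t K(t,x,c(x))=1$ (i.e. lump-sum rewards take values in $[0,c(x)]$). Moreover, with $\gamma_1(t,x)=\sum_{y:(x,y)\in\mathcal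 B}Q(t,x,y)\int_0^\infty zG(t,x,y,dz)$, $\gamma_2(t,x)=\beta(t,x)\int_0^\infty zK(t,x,dz)$ and $\gamma=\gamma_1+\gamma_2$, one has $\inf_{t\ge0}r(t,x)+\inf_{t\ge0}\gamma(t,x)>0$ for all $x\in S$. (A5) $\inf\{t_i-t_{i-1}:i\ge1\}>0$. Definition of $\nu$. Let $\mathbb E_{t,x}$ denote expectation conditional on $X(t)=x$ and $\mathbb E=\sum_{x}\mu(x)\mathbb E_{0,x}$. Put $\tilde r(t,x)=r(t,x)+\gamma(t,x)$, $\tilde r_c(t,x)=\tilde r(t,x)-\mathbb E\,\tilde r(t,X(t))$, $h(t_i,x)=\int_0^\infty zH(t_i,x,dz)$, $\mathscr H_c(t_i,x)=\mathscr H(t_i,x)-\mathbb E\,h(t_i,X(t_i))$, and $$\nu(t,x)=\int_0^\infty\mathbb E_{t,x}\tilde r_c(t+u,X(t+u))\,du+\sum_{i:t_i>t}\mathbb E_{t,x}\mathscr H_c(t_i,X(t_i)).$$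
   Formalization: M need not be adapted to F_t=σ(X(s):s≤t), since R involves random rewards (one state, β=1, unit rewards: M(t)=N(t)−t), so M is shown to be a martingale for σ(X(s),R(s):s≤t), and E[M(t)−M(s)|F_s]=0 is shown for the original F_s. *)

theory Defs
  imports "HOL-Probability.Probability"
begin

text \<open>
  The time axis is \<open>[0, \<infinity>)\<close>, represented by the nonnegative reals; values of the time-dependent
  data at negative times are never used.  The finite state space is the universe of a finite type.
\<close>

definition rate_matrices :: "(real \<Rightarrow> 's::finite \<Rightarrow> 's \<Rightarrow> real) \<Rightarrow> bool" where
  "rate_matrices Q \<longleftrightarrow>
     (\<forall>t\<ge>0. (\<forall>x y. x \<noteq> y \<longrightarrow> 0 \<le> Q t x y) \<and> (\<forall>x. (\<Sum>y\<in>UNIV. Q t x y) = 0))"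

definition support_at :: "(real \<Rightarrow> 's \<Rightarrow> 's \<Rightarrow> real) \<Rightarrow> real \<Rightarrow> ('s \<times> 's) set" where
  "support_at Q t = {(x, y). 0 < Q t x y}"

definition irreducible_rates :: "('s \<Rightarrow> 's \<Rightarrow> real) \<Rightarrow> bool" where
  "irreducible_rates A \<longleftrightarrow> (\<forall>x y. (x, y) \<in> {(u, v). 0 < A u v}\<^sup>*)"

text \<open>
  \<open>p s t x y\<close> is the probability of moving from \<open>x\<close> at time \<open>s\<close> to \<open>y\<close> at time \<open>t\<close>.  Since the rates
  are merely measurable in time, the Kolmogorov forward equation is stated in integrated form.
\<close>

definition transition_function ::
  "(real \<Rightarrow> 's::finite \<Rightarrow> 's \<Rightarrow> real) \<Rightarrow> (real \<Rightarrow> real \<Rightarrow> 's \<Rightarrow> 's \<Rightarrow> real) \<Rightarrow> bool" where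
  "transition_function Q p \<longleftrightarrow>
     (\<forall>s t x. 0 \<le> s \<and> s \<le> t \<longrightarrow> (\<forall>y. 0 \<le> p s t x y) \<and> (\<Sum>y\<in>UNIV. p s t x y) = 1) \<and>
     (\<forall>s u t x y. 0 \<le> s \<and> s \<le> u \<and> u \<le> t \<longrightarrow> p s t x y = (\<Sum>z\<in>UNIV. p s u x z * p u t z y)) \<and>
     (\<forall>s t x y. 0 \<le> s \<and> s \<le> t \<longrightarrow>
        ((\<lambda>u. \<Sum>z\<in>UNIV. p s u x z * Q u z y) has_integral (p s t x y - of_bool (x = y))) {s..t})"

definition right_continuous_path :: "(real \<Rightarrow> 'b) \<Rightarrow> bool" where
  "right_continuous_path f \<longleftrightarrow> (\<forall>t\<ge>0. \<forall>\<^sub>F s in at_right t. f s = f t)"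

definition jump_times :: "(real \<Rightarrow> 'b) \<Rightarrow> real set" where
  "jump_times f = {t. 0 < t \<and> \<not> (\<forall>\<^sub>F s in at_left t. f s = f t)}"

definition jump_path :: "(real \<Rightarrow> 'b) \<Rightarrow> bool" where
  "jump_path f \<longleftrightarrow> right_continuous_path f \<and> (\<forall>t. finite (jump_times f \<inter> {0..t}))"

definition jump_count :: "(real \<Rightarrow> 'b) \<Rightarrow> real \<Rightarrow> nat" where
  "jump_count f t = card (jump_times f \<inter> {0..t})"

definition counting_path :: "(real \<Rightarrow> nat) \<Rightarrow> bool" where
  "counting_path f \<longleftrightarrow> f 0 = 0 \<and> (\<forall>s t. 0 \<le> s \<and> s \<le> t \<longrightarrow> f s \<le> f t) \<and>
     right_continuous_path f \<and> (\<forall>t>0. \<forall>\<^sub>F s in at_left t. f t \<le> Suc (f s))"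

text \<open>
  \<open>event_time f k\<close> is the time of the \<open>k\<close>th event counted by \<open>f\<close>; it is meaningful only if that event
  occurs at all.  The convention \<open>event_time f 0 = 0\<close> is automatic.
\<close>

definition event_occurs :: "(real \<Rightarrow> nat) \<Rightarrow> nat \<Rightarrow> bool" where
  "event_occurs f k \<longleftrightarrow> (\<exists>t\<ge>0. k \<le> f t)"

definition event_time :: "(real \<Rightarrow> nat) \<Rightarrow> nat \<Rightarrow> real" where
  "event_time f k = Inf {t. 0 \<le> t \<and> k \<le> f t}"

definition jump_time :: "(real \<Rightarrow> 'b) \<Rightarrow> nat \<Rightarrow> real" where
  "jump_time f = event_time (jump_count f)"

definition jump_chain :: "(real \<Rightarrow> 'b) \<Rightarrow> nat \<Rightarrow> 'b" where
  "jump_chain f j = f (jump_time f j)"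

definition generated_by :: "'w measure \<Rightarrow> 'b measure \<Rightarrow> (real \<Rightarrow> 'w \<Rightarrow> 'b) \<Rightarrow> real set \<Rightarrow> 'w measure" where
  "generated_by M E Y I = sigma (space M) (\<Union>s\<in>I. {Y s -` A \<inter> space M |A. A \<in> sets E})"

definition natural_filtration ::
  "'w measure \<Rightarrow> 'b measure \<Rightarrow> (real \<Rightarrow> 'w \<Rightarrow> 'b) \<Rightarrow> real \<Rightarrow> 'w measure" where
  "natural_filtration M E Y t = generated_by M E Y {0..t}"

definition martingale :: "'w measure \<Rightarrow> (real \<Rightarrow> 'w measure) \<Rightarrow> (real \<Rightarrow> 'w \<Rightarrow> real) \<Rightarrow> bool" where
  "martingale M F Z \<longleftrightarrow>
     filtration (space M) F \<and> (\<forall>t\<ge>0. subalgebra M (F t)) \<and>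
     (\<forall>t\<ge>0. Z t \<in> borel_measurable (F t)) \<and> (\<forall>t\<ge>0. integrable M (Z t)) \<and>
     (\<forall>s t. 0 \<le> s \<and> s \<le> t \<longrightarrow> (AE \<omega> in M. real_cond_exp M (F s) (Z t) \<omega> = Z s \<omega>))"

definition markov_jump_process ::
  "'w measure \<Rightarrow> (real \<Rightarrow> real \<Rightarrow> 's::finite \<Rightarrow> 's \<Rightarrow> real) \<Rightarrow> 's pmf \<Rightarrow> (real \<Rightarrow> 'w \<Rightarrow> 's) \<Rightarrow> bool" where
  "markov_jump_process M p \<mu> X \<longleftrightarrow>
     (\<forall>t\<ge>0. X t \<in> measurable M (count_space UNIV)) \<and>
     (\<forall>\<omega>\<in>space M. jump_path (\<lambda>t. X t \<omega>)) \<and>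
     (\<forall>x. measure M {\<omega>\<in>space M. X 0 \<omega> = x} = pmf \<mu> x) \<and>
     (\<forall>s t y. 0 \<le> s \<and> s \<le> t \<longrightarrow>
        (AE \<omega> in M. real_cond_exp M (natural_filtration M (count_space UNIV) X s)
                        (indicator {\<omega>\<in>space M. X t \<omega> = y}) \<omega> = p s t (X s \<omega>) y))"

text \<open>
  Conditionally on the whole path of \<open>X\<close>, the increments of \<open>N\<close> over successive intervals are
  independent and Poisson distributed, with means the integrals of the intensity.  The probability
  mass function is written out because the library's Poisson distribution excludes mean 0.
\<close>

definition cond_poisson_process ::
  "'w measure \<Rightarrow> (real \<Rightarrow> 's \<Rightarrow> real) \<Rightarrow> (real \<Rightarrow> 'w \<Rightarrow> 's) \<Rightarrow> (real \<Rightarrow> 'w \<Rightarrow> nat) \<Rightarrow> bool" where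
  "cond_poisson_process M \<beta> X N \<longleftrightarrow>
     (\<forall>t\<ge>0. N t \<in> measurable M (count_space UNIV)) \<and>
     (\<forall>\<omega>\<in>space M. counting_path (\<lambda>t. N t \<omega>)) \<and>
     (\<forall>(n::nat) u k. 0 \<le> u 0 \<and> (\<forall>i<n. u i \<le> u (Suc i)) \<longrightarrow>
        (AE \<omega> in M. real_cond_exp M (generated_by M (count_space UNIV) X {0..})
            (indicator {\<omega>\<in>space M. \<forall>i<n. N (u (Suc i)) \<omega> = N (u i) \<omega> + k i}) \<omega>
          = (\<Prod>i<n. let m = (LINT s:{u i..u (Suc i)}|lborel. \<beta> s (X s \<omega>))
                    in m ^ k i / fact (k i) * exp (- m))))"

text \<open>
  \<open>Gr k\<close>, \<open>Hr k\<close>, \<open>Kr k\<close> (for \<open>k \<ge> 1\<close>) are the lump-sum rewards earned at the \<open>k\<close>th jump, at the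
  \<open>k\<close>th deterministic time and at the \<open>k\<close>th Poisson event.  Their conditional independence given
  \<open>(X, N)\<close>, with the prescribed conditional distribution functions, is stated for arbitrary finite
  sets of indices, on the event that the jumps and Poisson events in question occur.
\<close>

definition lump_sum_rewards ::
  "'w measure \<Rightarrow> (real \<Rightarrow> 's \<Rightarrow> 's \<Rightarrow> real \<Rightarrow> real) \<Rightarrow> (real \<Rightarrow> 's \<Rightarrow> real \<Rightarrow> real) \<Rightarrow>
   (real \<Rightarrow> 's \<Rightarrow> real \<Rightarrow> real) \<Rightarrow> (nat \<Rightarrow> real) \<Rightarrow> (real \<Rightarrow> 'w \<Rightarrow> 's) \<Rightarrow> (real \<Rightarrow> 'w \<Rightarrow> nat) \<Rightarrow>
   (nat \<Rightarrow> 'w \<Rightarrow> real) \<Rightarrow> (nat \<Rightarrow> 'w \<Rightarrow> real) \<Rightarrow> (nat \<Rightarrow> 'w \<Rightarrow> real) \<Rightarrow> bool" where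
  "lump_sum_rewards M G H K \<tau> X N Gr Hr Kr \<longleftrightarrow>
     (\<forall>k\<ge>1. Gr k \<in> borel_measurable M \<and> Hr k \<in> borel_measurable M \<and> Kr k \<in> borel_measurable M) \<and>
     (\<forall>I1 I2 I3 a b c. finite I1 \<and> finite I2 \<and> finite I3 \<and> I1 \<union> I2 \<union> I3 \<subseteq> {1..} \<longrightarrow>
        (AE \<omega> in M.
           (\<forall>k\<in>I1. event_occurs (jump_count (\<lambda>t. X t \<omega>)) k) \<and>
           (\<forall>k\<in>I3. event_occurs (\<lambda>t. N t \<omega>) k) \<longrightarrow>
           real_cond_exp M (generated_by M (count_space UNIV) (\<lambda>t \<omega>. (X t \<omega>, N t \<omega>)) {0..})
             (indicator {\<omega>\<in>space M. (\<forall>k\<in>I1. Gr k \<omega> \<le> a k) \<and> (\<forall>k\<in>I2. Hr k \<omega> \<le> b k) \<and>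
                                    (\<forall>k\<in>I3. Kr k \<omega> \<le> c k)}) \<omega>
           = (\<Prod>k\<in>I1. let f = (\<lambda>t. X t \<omega>)
                      in G (jump_time f k) (jump_chain f (k - 1)) (jump_chain f k) (a k)) *
             (\<Prod>k\<in>I2. H (\<tau> k) (X (\<tau> k) \<omega>) (b k)) *
             (\<Prod>k\<in>I3. let l = event_time (\<lambda>t. N t \<omega>) k in K l (X l \<omega>) (c k))))"

definition reward_model ::
  "'w measure \<Rightarrow> (real \<Rightarrow> real \<Rightarrow> 's::finite \<Rightarrow> 's \<Rightarrow> real) \<Rightarrow> 's pmf \<Rightarrow> (real \<Rightarrow> 's \<Rightarrow> real) \<Rightarrow>
   (real \<Rightarrow> 's \<Rightarrow> 's \<Rightarrow> real \<Rightarrow> real) \<Rightarrow> (real \<Rightarrow> 's \<Rightarrow> real \<Rightarrow> real) \<Rightarrow>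
   (real \<Rightarrow> 's \<Rightarrow> real \<Rightarrow> real) \<Rightarrow> (nat \<Rightarrow> real) \<Rightarrow> (real \<Rightarrow> 'w \<Rightarrow> 's) \<Rightarrow> (real \<Rightarrow> 'w \<Rightarrow> nat) \<Rightarrow>
   (nat \<Rightarrow> 'w \<Rightarrow> real) \<Rightarrow> (nat \<Rightarrow> 'w \<Rightarrow> real) \<Rightarrow> (nat \<Rightarrow> 'w \<Rightarrow> real) \<Rightarrow> bool" where
  "reward_model M p \<mu> \<beta> G H K \<tau> X N Gr Hr Kr \<longleftrightarrow>
     prob_space M \<and> markov_jump_process M p \<mu> X \<and> cond_poisson_process M \<beta> X N \<and>
     lump_sum_rewards M G H K \<tau> X N Gr Hr Kr"

definition distribution_function :: "(real \<Rightarrow> real) \<Rightarrow> bool" where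
  "distribution_function F \<longleftrightarrow> mono F \<and> (\<forall>a. continuous (at_right a) F) \<and>
     (F \<longlongrightarrow> 0) at_bot \<and> (F \<longlongrightarrow> 1) at_top"

definition mean_pos :: "(real \<Rightarrow> real) \<Rightarrow> real" where
  "mean_pos F = (LINT z:{0..}|interval_measure F. z)"

definition gamma1 ::
  "(real \<Rightarrow> 's::finite \<Rightarrow> 's \<Rightarrow> real) \<Rightarrow> (real \<Rightarrow> 's \<Rightarrow> 's \<Rightarrow> real \<Rightarrow> real) \<Rightarrow> real \<Rightarrow> 's \<Rightarrow> real" where
  "gamma1 Q G t x = (\<Sum>y | (x, y) \<in> support_at Q 1. Q t x y * mean_pos (G t x y))"

definition gamma2 ::
  "(real \<Rightarrow> 's \<Rightarrow> real) \<Rightarrow> (real \<Rightarrow> 's \<Rightarrow> real \<Rightarrow> real) \<Rightarrow> real \<Rightarrow> 's \<Rightarrow> real" where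
  "gamma2 \<beta> K t x = \<beta> t x * mean_pos (K t x)"

definition gamma_rate ::
  "(real \<Rightarrow> 's::finite \<Rightarrow> 's \<Rightarrow> real) \<Rightarrow> (real \<Rightarrow> 's \<Rightarrow> real) \<Rightarrow> (real \<Rightarrow> 's \<Rightarrow> 's \<Rightarrow> real \<Rightarrow> real) \<Rightarrow>
   (real \<Rightarrow> 's \<Rightarrow> real \<Rightarrow> real) \<Rightarrow> real \<Rightarrow> 's \<Rightarrow> real" where
  "gamma_rate Q \<beta> G K t x = gamma1 Q G t x + gamma2 \<beta> K t x"

definition assumption_A1 ::
  "(real \<Rightarrow> 's \<Rightarrow> 's \<Rightarrow> real) \<Rightarrow> (real \<Rightarrow> 's \<Rightarrow> real) \<Rightarrow> (real \<Rightarrow> 's \<Rightarrow> real) \<Rightarrow>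
   (real \<Rightarrow> 's \<Rightarrow> 's \<Rightarrow> real \<Rightarrow> real) \<Rightarrow> (real \<Rightarrow> 's \<Rightarrow> real \<Rightarrow> real) \<Rightarrow> bool" where
  "assumption_A1 Q r \<beta> G K \<longleftrightarrow>
     (let T = restrict_space borel {0..} in
      \<forall>x y z. (\<lambda>t. Q t x y) \<in> borel_measurable T \<and> (\<lambda>t. r t x) \<in> borel_measurable T \<and>
              (\<lambda>t. G t x y z) \<in> borel_measurable T \<and> (\<lambda>t. K t x z) \<in> borel_measurable T \<and>
              (\<lambda>t. \<beta> t x) \<in> borel_measurable T)"

definition assumption_A2 :: "(real \<Rightarrow> 's \<Rightarrow> 's \<Rightarrow> real) \<Rightarrow> bool" where
  "assumption_A2 Q \<longleftrightarrow>
     (\<forall>s\<ge>0. \<forall>t\<ge>0. support_at Q s = support_at Q t) \<and> irreducible_rates (Q 1)"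

definition assumption_A3 :: "(real \<Rightarrow> 's \<Rightarrow> 's \<Rightarrow> real) \<Rightarrow> bool" where
  "assumption_A3 Q \<longleftrightarrow>
     (\<forall>(x, y)\<in>support_at Q 1.
        0 < (INF t\<in>{0..}. ereal (Q t x y)) \<and> (SUP t\<in>{0..}. ereal (Q t x y)) < \<infinity>)"

definition assumption_A4 ::
  "(real \<Rightarrow> 's::finite \<Rightarrow> 's \<Rightarrow> real) \<Rightarrow> (real \<Rightarrow> 's \<Rightarrow> real) \<Rightarrow> (real \<Rightarrow> 's \<Rightarrow> real) \<Rightarrow>
   (real \<Rightarrow> 's \<Rightarrow> 's \<Rightarrow> real \<Rightarrow> real) \<Rightarrow> (real \<Rightarrow> 's \<Rightarrow> real \<Rightarrow> real) \<Rightarrow>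
   (real \<Rightarrow> 's \<Rightarrow> real \<Rightarrow> real) \<Rightarrow> bool" where
  "assumption_A4 Q r \<beta> G H K \<longleftrightarrow>
     (\<exists>c :: 's \<Rightarrow> real. \<forall>x.
        0 \<le> (INF t\<in>{0..}. ereal (r t x)) \<and> (SUP t\<in>{0..}. ereal (r t x)) < \<infinity> \<and>
        0 \<le> (INF t\<in>{0..}. ereal (\<beta> t x)) \<and> (SUP t\<in>{0..}. ereal (\<beta> t x)) < \<infinity> \<and>
        (\<forall>y. (SUP t\<in>{0..}. Lim (at_left 0) (G t x y)) = 0 \<and> (INF t\<in>{0..}. G t x y (c x)) = 1) \<and>
        (SUP t\<in>{0..}. Lim (at_left 0) (H t x)) = 0 \<and> (INF t\<in>{0..}. H t x (c x)) = 1 \<and>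
        (SUP t\<in>{0..}. Lim (at_left 0) (K t x)) = 0 \<and> (INF t\<in>{0..}. K t x (c x)) = 1) \<and>
     (\<forall>x. 0 < (INF t\<in>{0..}. ereal (r t x)) + (INF t\<in>{0..}. ereal (gamma_rate Q \<beta> G K t x)))"

definition assumption_A5 :: "(nat \<Rightarrow> real) \<Rightarrow> bool" where
  "assumption_A5 \<tau> \<longleftrightarrow> 0 < (INF i\<in>{1..}. ereal (\<tau> i - \<tau> (i - 1)))"

definition cumulative_reward ::
  "(real \<Rightarrow> 's \<Rightarrow> real) \<Rightarrow> (nat \<Rightarrow> real) \<Rightarrow> (real \<Rightarrow> 'w \<Rightarrow> 's) \<Rightarrow> (real \<Rightarrow> 'w \<Rightarrow> nat) \<Rightarrow>
   (nat \<Rightarrow> 'w \<Rightarrow> real) \<Rightarrow> (nat \<Rightarrow> 'w \<Rightarrow> real) \<Rightarrow> (nat \<Rightarrow> 'w \<Rightarrow> real) \<Rightarrow> real \<Rightarrow> 'w \<Rightarrow> real" where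
  "cumulative_reward r \<tau> X N Gr Hr Kr t \<omega> =
     (LINT s:{0..t}|lborel. r s (X s \<omega>))
     + (\<Sum>j = 1..jump_count (\<lambda>s. X s \<omega>) t. Gr j \<omega>)
     + (\<Sum>i = 1..Sup {i. \<tau> i \<le> t}. Hr i \<omega>)
     + (\<Sum>k = 1..N t \<omega>. Kr k \<omega>)"

text \<open>
  Expectation conditional on \<open>X t = x\<close>.  At positive times this is elementary conditioning under the
  underlying probability \<open>M\<close>.  At time 0 it is expectation under the law \<open>P x\<close> of the model started
  in \<open>x\<close>, which also makes sense for states \<open>x\<close> that are not charged by the initial distribution.
\<close>

definition expectation_at ::
  "'w measure \<Rightarrow> ('s \<Rightarrow> 'w measure) \<Rightarrow> (real \<Rightarrow> 'w \<Rightarrow> 's) \<Rightarrow> real \<Rightarrow> 's \<Rightarrow> ('w \<Rightarrow> real) \<Rightarrow> real" where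
  "expectation_at M P X t x Z =
     (if t = 0 then (LINT \<omega>|P x. Z \<omega>)
      else (LINT \<omega>:{\<omega>\<in>space M. X t \<omega> = x}|M. Z \<omega>) / measure M {\<omega>\<in>space M. X t \<omega> = x})"

definition centered_rate ::
  "'w measure \<Rightarrow> (real \<Rightarrow> 's::finite \<Rightarrow> 's \<Rightarrow> real) \<Rightarrow> (real \<Rightarrow> 's \<Rightarrow> real) \<Rightarrow> (real \<Rightarrow> 's \<Rightarrow> real) \<Rightarrow>
   (real \<Rightarrow> 's \<Rightarrow> 's \<Rightarrow> real \<Rightarrow> real) \<Rightarrow> (real \<Rightarrow> 's \<Rightarrow> real \<Rightarrow> real) \<Rightarrow> (real \<Rightarrow> 'w \<Rightarrow> 's) \<Rightarrow>
   real \<Rightarrow> 's \<Rightarrow> real" where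
  "centered_rate M Q r \<beta> G K X t x =
     (let rt = (\<lambda>x. r t x + gamma_rate Q \<beta> G K t x) in rt x - (LINT \<omega>|M. rt (X t \<omega>)))"

definition centered_lump ::
  "'w measure \<Rightarrow> (real \<Rightarrow> 's \<Rightarrow> real \<Rightarrow> real) \<Rightarrow> (nat \<Rightarrow> real) \<Rightarrow> (real \<Rightarrow> 'w \<Rightarrow> 's) \<Rightarrow>
   (nat \<Rightarrow> 'w \<Rightarrow> real) \<Rightarrow> nat \<Rightarrow> 'w \<Rightarrow> real" where
  "centered_lump M H \<tau> X Hr i \<omega> = Hr i \<omega> - (LINT \<omega>|M. mean_pos (H (\<tau> i) (X (\<tau> i) \<omega>)))"

definition nu_integrand ::
  "'w measure \<Rightarrow> ('s \<Rightarrow> 'w measure) \<Rightarrow> (real \<Rightarrow> 's::finite \<Rightarrow> 's \<Rightarrow> real) \<Rightarrow> (real \<Rightarrow> 's \<Rightarrow> real) \<Rightarrow>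
   (real \<Rightarrow> 's \<Rightarrow> real) \<Rightarrow> (real \<Rightarrow> 's \<Rightarrow> 's \<Rightarrow> real \<Rightarrow> real) \<Rightarrow> (real \<Rightarrow> 's \<Rightarrow> real \<Rightarrow> real) \<Rightarrow>
   (real \<Rightarrow> 'w \<Rightarrow> 's) \<Rightarrow> real \<Rightarrow> 's \<Rightarrow> real \<Rightarrow> real" where
  "nu_integrand M P Q r \<beta> G K X t x u =
     expectation_at M P X t x (\<lambda>\<omega>. centered_rate M Q r \<beta> G K X (t + u) (X (t + u) \<omega>))"

definition nu_summand ::
  "'w measure \<Rightarrow> ('s \<Rightarrow> 'w measure) \<Rightarrow> (real \<Rightarrow> 's \<Rightarrow> real \<Rightarrow> real) \<Rightarrow> (nat \<Rightarrow> real) \<Rightarrow>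
   (real \<Rightarrow> 'w \<Rightarrow> 's) \<Rightarrow> (nat \<Rightarrow> 'w \<Rightarrow> real) \<Rightarrow> real \<Rightarrow> 's \<Rightarrow> nat \<Rightarrow> real" where
  "nu_summand M P H \<tau> X Hr t x i = expectation_at M P X t x (centered_lump M H \<tau> X Hr i)"

definition nu_fun ::
  "'w measure \<Rightarrow> ('s \<Rightarrow> 'w measure) \<Rightarrow> (real \<Rightarrow> 's::finite \<Rightarrow> 's \<Rightarrow> real) \<Rightarrow> (real \<Rightarrow> 's \<Rightarrow> real) \<Rightarrow>
   (real \<Rightarrow> 's \<Rightarrow> real) \<Rightarrow> (real \<Rightarrow> 's \<Rightarrow> 's \<Rightarrow> real \<Rightarrow> real) \<Rightarrow> (real \<Rightarrow> 's \<Rightarrow> real \<Rightarrow> real) \<Rightarrow>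
   (real \<Rightarrow> 's \<Rightarrow> real \<Rightarrow> real) \<Rightarrow> (nat \<Rightarrow> real) \<Rightarrow> (real \<Rightarrow> 'w \<Rightarrow> 's) \<Rightarrow> (nat \<Rightarrow> 'w \<Rightarrow> real) \<Rightarrow>
   real \<Rightarrow> 's \<Rightarrow> real" where
  "nu_fun M P Q r \<beta> G H K \<tau> X Hr t x =
     (LINT u:{0..}|lborel. nu_integrand M P Q r \<beta> G K X t x u)
     + (\<Sum>\<^sub>\<infinity>i\<in>{i. t < \<tau> i}. nu_summand M P H \<tau> X Hr t x i)"

end

theory Submission
  imports Defs
begin

text \<open>
  A transition function with irreducible rates bounded above and below forgets its initial state
  exponentially fast (Doeblin minorisation), so the integral and the sum defining \<open>\<nu>\<close>
  converge absolutely and uniformly.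

  Let \<open>\<F>\<^sub>s\<close> be generated by \<open>X\<close> and \<open>N\<close> up to time \<open>s\<close> and by the rewards earned by then; it contains
  the natural filtration of \<open>(X, R)\<close>.  For \<open>A \<in> \<F>\<^sub>s\<close>, rewards earned after \<open>s\<close> may be replaced by their
  conditional means (a \<open>\<pi>\<close>-\<open>\<lambda>\<close> argument over finitely many observed rewards), the number of jumps
  and Poisson events is compared with its compensator by refining a time grid, and Campbell's
  formula turns sums over events into integrals.  This gives
  \<open>E[1\<^sub>A (R(t) - R(s))] = \<integral>\<^sub>s\<^sup>t E[1\<^sub>A r'(u, X(u))] du + \<Sum> E[1\<^sub>A h(t\<^sub>i, X(t\<^sub>i))]\<close> with \<open>r' = r + \<gamma>\<close>, and
  by the Markov property \<open>E[1\<^sub>A \<nu>(t, X(t))]\<close> is the tail after \<open>t\<close> of the same expression, centred.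
  The sum of the two therefore does not depend on \<open>t\<close>.
\<close>

text \<open>Given the path of X, the lump sums in R are still random, so \<open>Z t\<close> is in
  general not measurable for \<open>F t\<close>. The martingale property is therefore stated for the
  filtration \<open>FR\<close> of (X, R), and for \<open>F\<close> as vanishing conditional means of
  increments. Both come from one identity tested on a larger \<sigma>-algebra.

  The hypotheses condition N on the whole path of X and the lump sums on the whole paths of (X, N),
  futures included, whereas a martingale conditions on a past. The bridge, used twice, replaces the
  indicator of past increments of N (or of observed rewards) by its conditional probability given X
  (or (X, N)). This involves the paths only up to s, so it is a bounded weight measurable for the
  smaller history, and an identity known on the smaller history carries over to the larger one.

  The grid arguments instead compare each cell with an integral over that cell, with an error
  quadratic in its length; the n errors add up to O(1/n).\<close>

section \<open>Counting paths, their event times, and jump chains\<close>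

text \<open>Covers the paths of N and the jump counts of X alike, so that event times, measurability
  and compensators are treated once for both.\<close>

definition step_path :: "(real \<Rightarrow> nat) \<Rightarrow> bool" where
  "step_path f \<longleftrightarrow> f 0 = 0 \<and> (\<forall>s t. 0 \<le> s \<and> s \<le> t \<longrightarrow> f s \<le> f t) \<and> right_continuous_path f"

lemma counting_path_imp_step_path: "counting_path f \<Longrightarrow> step_path f"
  by (auto simp: counting_path_def step_path_def)

lemma step_path_0: "step_path f \<Longrightarrow> f 0 = 0"
  by (simp add: step_path_def)

lemma step_path_mono: "step_path f \<Longrightarrow> 0 \<le> s \<Longrightarrow> s \<le> t \<Longrightarrow> f s \<le> f t"
  by (simp add: step_path_def)

text \<open>Right continuity is meant for the discrete topology, so it yields a genuine interval of
  constancy to the right of each time.\<close>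

lemma right_continuous_pathE:
  assumes "right_continuous_path f" "0 \<le> t"
  obtains e where "e > 0" "\<And>s. t \<le> s \<Longrightarrow> s < t + e \<Longrightarrow> f s = f t"
proof -
  from assms have "\<forall>\<^sub>F s in at_right t. f s = f t" by (auto simp: right_continuous_path_def)
  then obtain b where b: "b > t" "\<And>s. s > t \<Longrightarrow> s < b \<Longrightarrow> f s = f t"
    by (auto simp: eventually_at_right_field)
  show ?thesis
    by (rule that[of "b - t"]) (use b in \<open>auto simp: order_le_less\<close>)
qed

lemma step_path_right_continuous: "step_path f \<Longrightarrow> right_continuous_path f"
  by (simp add: step_path_def)

lemma event_time_le:
  assumes "0 \<le> t" "k \<le> f t"
  shows "event_time f k \<le> t"
  unfolding event_time_def using assms by (intro cInf_lower) (auto intro!: bdd_belowI[of _ 0])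

lemma event_time_nonneg:
  assumes "event_occurs f k"
  shows "0 \<le> event_time f k"
  unfolding event_time_def using assms by (intro cInf_greatest) (auto simp: event_occurs_def)

lemma event_occursI: "0 \<le> t \<Longrightarrow> k \<le> f t \<Longrightarrow> event_occurs f k"
  by (auto simp: event_occurs_def)

text \<open>Right continuity makes the infimum in \<open>event_time\<close> a minimum: some time
  with count at least k lies so close to the infimum that the path is constant in between.\<close>

lemma le_event_count:
  assumes f: "step_path f" and oc: "event_occurs f k" and le: "event_time f k \<le> t"
  shows "k \<le> f t"
proof -
  let ?S = "{t. 0 \<le> t \<and> k \<le> f t}" and ?T = "event_time f k"
  have T0: "0 \<le> ?T" using event_time_nonneg[OF oc] .
  have ne: "?S \<noteq> {}" using oc by (auto simp: event_occurs_def)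
  obtain e where e: "e > 0" "\<And>s. ?T \<le> s \<Longrightarrow> s < ?T + e \<Longrightarrow> f s = f ?T"
    by (rule right_continuous_pathE[OF step_path_right_continuous[OF f] T0]) blast
  have "Inf ?S < ?T + e" using e by (simp add: event_time_def)
  then obtain s where s: "s \<in> ?S" "s < ?T + e"
    using ne by (meson cInf_lessD)
  moreover have "?T \<le> s" using s by (auto intro: event_time_le)
  ultimately have "k \<le> f ?T" using e(2)[of s] by auto
  also have "\<dots> \<le> f t" using step_path_mono[OF f T0 le] .
  finally show ?thesis .
qed

text \<open>Turns every comparison of a random time with a deterministic one into a condition on the
  count at the deterministic time. \<open>event_occurs\<close> rules out the infimum of the empty
  set.\<close>

lemma event_time_le_iff:
  assumes "step_path f" "event_occurs f k" "0 \<le> t"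
  shows "event_time f k \<le> t \<longleftrightarrow> k \<le> f t"
  using assms le_event_count event_time_le by metis

lemma event_time_less_iff:
  assumes "step_path f" "event_occurs f k" "0 \<le> t"
  shows "t < event_time f k \<longleftrightarrow> f t < k"
  using event_time_le_iff[OF assms] by auto

lemma event_time_pos:
  assumes "step_path f" "event_occurs f k" "0 < k"
  shows "0 < event_time f k"
  using event_time_less_iff[OF assms(1,2), of 0] assms step_path_0 by force

lemma event_time_0: "event_time f 0 = 0"
proof -
  have "{t::real. 0 \<le> t \<and> 0 \<le> f t} = {0..}" for f :: "real \<Rightarrow> nat" by auto
  then show ?thesis by (simp add: event_time_def)
qed

text \<open>Right continuity and the absence of jumps make the path locally constant relative to
  [a, b], and [a, b] is connected.\<close>

lemma no_jump_imp_eq: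
  assumes f: "right_continuous_path f" and ab: "0 \<le> a" "a \<le> b" and nj: "jump_times f \<inter> {a<..b} = {}"
  shows "f b = f a"
proof (rule connected_induction_simple[of "{a..b}" a b "\<lambda>t. f t = f a"])
  fix t assume t: "t \<in> {a..b}"
  obtain e where e: "e > 0" "\<And>s. t \<le> s \<Longrightarrow> s < t + e \<Longrightarrow> f s = f t"
    using right_continuous_pathE[OF f, of t] t ab by auto
  \<comment> \<open>At t = a the part of [a, b] up to t is the point a alone, so a jump at a does no
    harm.\<close>
  have "\<exists>e'>0. \<forall>s. s \<in> {a..b} \<and> t - e' < s \<and> s \<le> t \<longrightarrow> f s = f t"
  proof (cases "t = a")
    case True
    then show ?thesis by (intro exI[of _ 1]) auto
  next
    case False
    with nj t ab have "t \<notin> jump_times f" "0 < t" by auto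
    then have "\<forall>\<^sub>F s in at_left t. f s = f t"
      by (simp add: jump_times_def)
    then obtain c where c: "c < t" "\<And>s. c < s \<Longrightarrow> s < t \<Longrightarrow> f s = f t"
      by (auto simp: eventually_at_left_field)
    then show ?thesis by (intro exI[of _ "t - c"]) (auto simp: order_le_less)
  qed
  then obtain e' where e': "e' > 0" "\<And>s. s \<in> {a..b} \<Longrightarrow> t - e' < s \<Longrightarrow> s \<le> t \<Longrightarrow> f s = f t" by blast
  let ?T = "{a..b} \<inter> {t - e' <..< t + e}"
  have "openin (top_of_set {a..b}) ?T" by (auto intro: openin_open_Int)
  moreover have "f s = f t" if "s \<in> ?T" for s
  proof (cases "s \<le> t")
    case True
    then show ?thesis using e'(2)[of s] that by simp
  next
    case False
    then show ?thesis using e(2)[of s] that by simp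
  qed
  moreover have "t \<in> ?T" using t e(1) e'(1) by simp
  ultimately show "\<exists>T. openin (top_of_set {a..b}) T \<and> t \<in> T \<and> (\<forall>x\<in>T. \<forall>y\<in>T. f x = f a \<longrightarrow> f y = f a)"
    by metis
qed (use ab in auto)

context
  fixes f :: "real \<Rightarrow> 'b"
  assumes f: "jump_path f"
begin

lemma jump_path_right_continuous: "right_continuous_path f"
  using f by (simp add: jump_path_def)

lemma finite_jump_times: "finite (jump_times f \<inter> {0..t})"
  using f by (simp add: jump_path_def)

lemma jump_count_mono: "s \<le> t \<Longrightarrow> jump_count f s \<le> jump_count f t"
  unfolding jump_count_def by (intro card_mono finite_jump_times) auto

lemma jump_count_eq_imp_no_jump:
  assumes "0 \<le> a" "a \<le> b" "jump_count f a = jump_count f b"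
  shows "jump_times f \<inter> {a<..b} = {}"
proof -
  have "jump_times f \<inter> {0..a} = jump_times f \<inter> {0..b}"
    using assms unfolding jump_count_def by (intro card_subset_eq finite_jump_times) auto
  then show ?thesis using assms by force
qed

lemma jump_count_eq_imp_eq:
  assumes "0 \<le> a" "0 \<le> b" "jump_count f a = jump_count f b"
  shows "f a = f b"
proof -
  have *: "f b = f a" if "0 \<le> a" "a \<le> b" "jump_count f a = jump_count f b" for a b
    by (rule no_jump_imp_eq[OF jump_path_right_continuous that(1,2) jump_count_eq_imp_no_jump[OF that]])
  show ?thesis using *[of a b] *[of b a, symmetric] assms by (metis linear)
qed

lemma no_jump_imp_jump_count_eq:
  assumes "0 \<le> a" "a \<le> b" "jump_times f \<inter> {a<..b} = {}"
  shows "jump_count f b = jump_count f a"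
proof -
  have "jump_times f \<inter> {0..b} = jump_times f \<inter> {0..a}" using assms by force
  then show ?thesis by (simp add: jump_count_def)
qed

lemma jump_free_right:
  assumes "0 \<le> t"
  obtains e where "e > 0" "jump_times f \<inter> {t<..<t + e} = {}"
proof -
  let ?S = "jump_times f \<inter> {0..t + 1} - {t}"
  have "finite ?S" using finite_jump_times by auto
  from finite_set_avoid[OF this, of t] obtain d where d: "d > 0" "\<And>x. x \<in> ?S \<Longrightarrow> x \<noteq> t \<Longrightarrow> d \<le> dist t x"
    by blast
  show ?thesis
  proof (rule that[of "min d 1"])
    have False if "x \<in> jump_times f" "t < x" "x < t + min d 1" for x
      using d(2)[of x] that assms by (simp add: dist_real_def min_def split: if_splits)
    then have "x \<notin> {t<..<t + min d 1}" if "x \<in> jump_times f" for x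
      using that by (metis greaterThanLessThan_iff)
    then show "jump_times f \<inter> {t<..<t + min d 1} = {}" by blast
  qed (use d(1) in simp)
qed

lemma jump_free_left:
  assumes "0 < t"
  obtains e where "0 \<le> e" "e < t" "jump_times f \<inter> {e<..<t} = {}"
proof -
  let ?S = "jump_times f \<inter> {0..t} - {t}"
  have "finite ?S" using finite_jump_times by auto
  from finite_set_avoid[OF this, of t] obtain d where d: "d > 0" "\<And>x. x \<in> ?S \<Longrightarrow> x \<noteq> t \<Longrightarrow> d \<le> dist t x"
    by blast
  show ?thesis
  proof (rule that[of "max (t - d) 0"])
    have False if "x \<in> jump_times f" "max (t - d) 0 < x" "x < t" for x
      using d(2)[of x] that assms by (auto simp: dist_real_def)
    then have "x \<notin> {max (t - d) 0<..<t}" if "x \<in> jump_times f" for x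
      using that by (metis greaterThanLessThan_iff)
    then show "jump_times f \<inter> {max (t - d) 0<..<t} = {}" by blast
  qed (use d(1) assms in simp_all)
qed

lemma step_path_jump_count: "step_path (jump_count f)"
  unfolding step_path_def
proof (intro conjI allI impI)
  have "jump_times f \<inter> {0..0} = {}" by (auto simp: jump_times_def)
  then show "jump_count f 0 = 0" by (simp add: jump_count_def)
  show "jump_count f s \<le> jump_count f t" if "0 \<le> s \<and> s \<le> t" for s t
    using that jump_count_mono by auto
  show "right_continuous_path (jump_count f)"
    unfolding right_continuous_path_def
  proof (intro allI impI)
    fix t :: real assume t: "0 \<le> t"
    obtain e where e: "e > 0" "jump_times f \<inter> {t<..<t + e} = {}" using jump_free_right[OF t] .
    show "\<forall>\<^sub>F s in at_right t. jump_count f s = jump_count f t"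
      unfolding eventually_at_right_field
      using e t by (intro exI[of _ "t + e"] conjI allI impI no_jump_imp_jump_count_eq) auto
  qed
qed

text \<open>Jumps are counted one at a time, because jump times are isolated; hence the count cannot
  skip the level k.\<close>

lemma jump_count_jump_time:
  assumes oc: "event_occurs (jump_count f) k"
  shows "jump_count f (jump_time f k) = k"
proof (cases "k = 0")
  case True
  then show ?thesis using step_path_0[OF step_path_jump_count] by (simp add: jump_time_def event_time_0)
next
  case False
  let ?T = "event_time (jump_count f) k"
  note sp = step_path_jump_count
  have T: "0 < ?T" using event_time_pos[OF sp oc] False by simp
  obtain e where e: "0 \<le> e" "e < ?T" "jump_times f \<inter> {e<..<?T} = {}" using jump_free_left[OF T] .
  have "jump_count f e < k" using event_time_less_iff[OF sp oc e(1)] e by simp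
  \<comment> \<open>Between e and the jump time nothing is added except the jump time
    itself.\<close>
  moreover have "jump_times f \<inter> {0..?T} \<subseteq> insert ?T (jump_times f \<inter> {0..e})" using e by force
  then have "jump_count f ?T \<le> Suc (jump_count f e)"
    unfolding jump_count_def
    using card_mono[OF finite.insertI[OF finite_jump_times]] card_insert_if[OF finite_jump_times]
    by (smt (verit) le_SucI order_refl order_trans)
  moreover have "k \<le> jump_count f ?T" using le_event_count[OF sp oc] by simp
  ultimately show ?thesis by (simp add: jump_time_def)
qed

text \<open>The count has not changed since the last jump, so neither has the state.\<close>

lemma jump_chain_jump_count:
  assumes "0 \<le> s"
  shows "jump_chain f (jump_count f s) = f s"
proof -
  have oc: "event_occurs (jump_count f) (jump_count f s)" using assms by (auto simp: event_occurs_def)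
  show ?thesis unfolding jump_chain_def
    using event_time_nonneg[OF oc]
    by (intro jump_count_eq_imp_eq jump_count_jump_time[OF oc] assms) (simp add: jump_time_def)
qed

text \<open>If two successive states agreed, the path would be constant up to and including the
  later jump time, which would then not be a jump time, and the count could not increase there. This
  is why pairs of distinct states account for all jumps.\<close>

lemma jump_chain_Suc_neq:
  assumes oc: "event_occurs (jump_count f) (Suc k)"
  shows "jump_chain f k \<noteq> jump_chain f (Suc k)"
proof
  let ?T = "event_time (jump_count f) (Suc k)"
  note sp = step_path_jump_count
  assume eq: "jump_chain f k = jump_chain f (Suc k)"
  have oc': "event_occurs (jump_count f) k" using oc by (auto simp: event_occurs_def)
  let ?S = "event_time (jump_count f) k"
  have S: "0 \<le> ?S" using event_time_nonneg[OF oc'] .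
  have less: "?S < ?T" using event_time_less_iff[OF sp oc S] jump_count_jump_time[OF oc'] by (simp add: jump_time_def)
  have const: "f s = f ?T" if "?S \<le> s" "s < ?T" for s
  proof -
    have "k \<le> jump_count f s" using le_event_count[OF sp oc' that(1)] .
    moreover have s: "0 \<le> s" using that(1) S by simp
    have "jump_count f s < Suc k" using event_time_less_iff[OF sp oc s] that(2) by simp
    ultimately have "jump_count f s = k" by simp
    then have "jump_chain f k = f s" using jump_chain_jump_count[OF s] by simp
    with eq show ?thesis by (simp add: jump_chain_def jump_time_def)
  qed
  then have "\<forall>\<^sub>F s in at_left ?T. f s = f ?T"
    unfolding eventually_at_left_field using less by (intro exI[of _ ?S]) auto
  then have "?T \<notin> jump_times f" by (simp add: jump_times_def)
  have "jump_times f \<inter> {?S<..?T} = {}"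
  proof -
    obtain e where e: "0 \<le> e" "e < ?T" "jump_times f \<inter> {e<..<?T} = {}"
      using jump_free_left[OF order_le_less_trans[OF S less]] .
    let ?m = "max e ?S"
    have m0: "0 \<le> ?m" "?S \<le> ?m" "?m < ?T" using e(1,2) less by simp_all
    have "k \<le> jump_count f ?m" by (rule le_event_count[OF sp oc' m0(2)])
    moreover have "jump_count f ?m < Suc k" using event_time_less_iff[OF sp oc m0(1)] m0(3) by simp
    ultimately have "jump_count f ?m = k" by simp
    moreover have "x \<notin> {?m<..?T}" if "x \<in> jump_times f" for x
    proof (cases "x = ?T")
      case True
      then show ?thesis using that \<open>?T \<notin> jump_times f\<close> by simp
    next
      case False
      have "x \<notin> {e<..<?T}" using e(3) that by blast
      then show ?thesis using False by (auto simp: not_less)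
    qed
    then have "jump_times f \<inter> {?m<..?T} = {}" by blast
    then have "jump_count f ?T = jump_count f ?m"
      using m0 by (intro no_jump_imp_jump_count_eq) simp_all
    ultimately show ?thesis using jump_count_jump_time[OF oc] by (simp add: jump_time_def)
  qed
  then have "jump_count f ?T = jump_count f ?S" using less S by (intro no_jump_imp_jump_count_eq) auto
  then show False using jump_count_jump_time[OF oc] jump_count_jump_time[OF oc'] by (simp add: jump_time_def)
qed

end

subsection \<open>Grid approximation\<close>

definition grid :: "real \<Rightarrow> real \<Rightarrow> nat \<Rightarrow> nat \<Rightarrow> real" where
  "grid a b n i = a + (b - a) * real i / real n"

lemma grid_0 [simp]: "grid a b n 0 = a"
  by (simp add: grid_def)

lemma grid_n [simp]: "0 < n \<Longrightarrow> grid a b n n = b"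
  by (simp add: grid_def)

lemma grid_diff: "0 < n \<Longrightarrow> grid a b n (Suc i) - grid a b n i = (b - a) / n"
  by (simp add: grid_def field_simps)

lemma grid_mono: "a \<le> b \<Longrightarrow> i \<le> j \<Longrightarrow> grid a b n i \<le> grid a b n j"
  unfolding grid_def by (intro add_left_mono divide_right_mono mult_left_mono) auto

lemma grid_bounds: "a \<le> b \<Longrightarrow> i \<le> n \<Longrightarrow> 0 < n \<Longrightarrow> a \<le> grid a b n i \<and> grid a b n i \<le> b"
  using grid_mono[of a b 0 i n] grid_mono[of a b i n n] by simp

lemma eventually_mesh_less: "e > 0 \<Longrightarrow> \<forall>\<^sub>F n in sequentially. (b - a) / real n < e"
proof -
  assume "e > 0"
  have "(\<lambda>n. (b - a) / real n) \<longlonglongrightarrow> 0" by (rule lim_const_over_n)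
  then show ?thesis using \<open>e > 0\<close> by (simp add: order_tendstoD(2))
qed

lemma sum_split_steps:
  fixes c :: "nat \<Rightarrow> nat" and g :: "nat \<Rightarrow> 'a::comm_monoid_add"
  assumes "\<And>i. i < n \<Longrightarrow> c i \<le> c (Suc i)"
  shows "(\<Sum>k\<in>{c 0<..c n}. g k) = (\<Sum>i<n. \<Sum>k\<in>{c i<..c (Suc i)}. g k)"
  using assms
proof (induction n)
  case (Suc n)
  have le: "c 0 \<le> c n"
  proof -
    have "c 0 \<le> c i" if "i \<le> n" for i using that
      by (induction i) (auto intro: order_trans[OF _ Suc.prems])
    then show ?thesis by simp
  qed
  have "{c 0<..c (Suc n)} = {c 0<..c n} \<union> {c n<..c (Suc n)}"
    using le Suc.prems[of n] by auto
  then have "sum g {c 0<..c (Suc n)} = sum g {c 0<..c n} + sum g {c n<..c (Suc n)}"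
    by (auto intro!: sum.union_disjoint)
  with Suc show ?case by simp
qed auto

lemma event_time_in_cell:
  assumes f: "step_path f" and u: "0 \<le> u" "0 \<le> v" and k: "k \<in> {f u<..f v}"
  shows "u < event_time f k" "event_time f k \<le> v" "event_occurs f k"
proof -
  show oc: "event_occurs f k" using k u by (auto simp: event_occurs_def)
  show "u < event_time f k" "event_time f k \<le> v"
    using event_time_less_iff[OF f oc] event_time_le_iff[OF f oc] u k by auto
qed

text \<open>The mark is read at the right end of the cell containing the event: for a fine grid this
  end still lies in the interval after the event on which g is constant. The two sides become equal,
  not merely close.\<close>

lemma grid_count_event_marks:
  fixes f :: "real \<Rightarrow> nat" and g :: "real \<Rightarrow> 'b"
  assumes f: "step_path f" and g: "right_continuous_path g" and ab: "0 \<le> a" "a \<le> b"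
  shows "\<forall>\<^sub>F n in sequentially.
    (\<Sum>i<n. of_bool (g (grid a b n (Suc i)) = x) * (real (f (grid a b n (Suc i))) - real (f (grid a b n i))))
      = (\<Sum>k\<in>{f a<..f b}. of_bool (g (event_time f k) = x))"
proof -
  have "\<exists>e>0. \<forall>s. event_time f k \<le> s \<and> s < event_time f k + e \<longrightarrow> g s = g (event_time f k)"
    if k: "k \<in> {f a<..f b}" for k
    using right_continuous_pathE[OF g event_time_nonneg[OF event_time_in_cell(3)[OF f _ _ k]]] ab
    by (metis order_trans)
  then obtain e where e: "\<And>k. k \<in> {f a<..f b} \<Longrightarrow> e k > 0"
    "\<And>k s. k \<in> {f a<..f b} \<Longrightarrow> event_time f k \<le> s \<Longrightarrow> s < event_time f k + e k \<Longrightarrow> g s = g (event_time f k)"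
    by metis
  \<comment> \<open>\<open>insert 1\<close> keeps the minimum defined when no event falls into (a,
    b].\<close>
  define d where "d = Min (insert 1 (e ` {f a<..f b}))"
  have d: "d > 0" using e(1) by (auto simp: d_def)
  have de: "d \<le> e k" if "k \<in> {f a<..f b}" for k
    unfolding d_def using that by (intro Min_le) auto
  show ?thesis
    using eventually_mesh_less[OF d, where a=a and b=b] eventually_gt_at_top[of 0]
  proof eventually_elim
    case (elim n)
    let ?u = "grid a b n"
    have mono: "f (?u i) \<le> f (?u j)" if "i \<le> j" for i j
      using ab grid_mono[OF ab(2) that] grid_mono[OF ab(2), of 0 i n]
      by (intro step_path_mono[OF f]) auto
    have u0: "0 \<le> ?u i" for i using grid_mono[OF ab(2), of 0 i n] ab by simp
    have "(\<Sum>k\<in>{f a<..f b}. of_bool (g (event_time f k) = x))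
        = (\<Sum>i<n. \<Sum>k\<in>{f (?u i)<..f (?u (Suc i))}. of_bool (g (event_time f k) = x) :: real)"
      using sum_split_steps[of n "\<lambda>i. f (?u i)"] mono elim by (simp del: sum_of_bool_eq)
    also have "\<dots> = (\<Sum>i<n. \<Sum>k\<in>{f (?u i)<..f (?u (Suc i))}. of_bool (g (?u (Suc i)) = x))"
    proof (intro sum.cong refl, goal_cases)
      case (1 i k)
      note c = event_time_in_cell[OF f u0 u0 1(2)]
      have k: "k \<in> {f a<..f b}" using 1 mono[of 0 i] mono[of "Suc i" n] elim by auto
      have "?u (Suc i) < event_time f k + e k"
        using c(1) grid_diff[of n a b i] elim de[OF k] by simp
      then show ?case using e(2)[OF k c(2)] by simp
    qed
    also have "\<dots> = (\<Sum>i<n. of_bool (g (?u (Suc i)) = x) * (real (f (?u (Suc i))) - real (f (?u i))))"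
      using mono by (intro sum.cong refl) (simp add: of_nat_diff)
    finally show ?case by simp
  qed
qed

text \<open>Once the mesh is below the smallest gap between successive jumps, a cell holds at most
  one jump, and the states at its two ends are the states before and after that jump.\<close>

lemma grid_count_jumps:
  fixes g :: "real \<Rightarrow> 'b"
  assumes g: "jump_path g" and ab: "0 \<le> a" "a \<le> b" and xy: "x \<noteq> y"
  shows "\<forall>\<^sub>F n in sequentially.
    (\<Sum>i<n. of_bool (g (grid a b n i) = x \<and> g (grid a b n (Suc i)) = y))
      = (\<Sum>k\<in>{jump_count g a<..jump_count g b}. of_bool (jump_chain g (k - 1) = x \<and> jump_chain g k = y) :: real)"
proof -
  let ?J = "jump_count g" and ?T = "event_time (jump_count g)"
  note sp = step_path_jump_count[OF g]
  \<comment> \<open>The index range is open at both ends: k and k + 1 must both be jumps in (a, b]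
    for the two to be able to share a cell.\<close>
  define d where "d = Min (insert 1 ((\<lambda>k. ?T (Suc k) - ?T k) ` {?J a<..<?J b}))"
  have gap: "?T k < ?T (Suc k)" if "k \<in> {?J a<..<?J b}" for k
  proof -
    have oc: "event_occurs ?J (Suc k)" "event_occurs ?J k"
      using that ab by (auto intro!: event_occursI[of b])
    then show ?thesis
      using event_time_less_iff[OF sp oc(1) event_time_nonneg[OF oc(2)]] jump_count_jump_time[OF g oc(2)]
      by (simp add: jump_time_def)
  qed
  have d0: "d > 0" using gap by (auto simp: d_def)
  have d: "d \<le> ?T (Suc k) - ?T k" if "k \<in> {?J a<..<?J b}" for k
    unfolding d_def using that by (intro Min_le) auto
  show ?thesis
    using eventually_mesh_less[OF d0, where a=a and b=b] eventually_gt_at_top[of 0]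
  proof eventually_elim
    case (elim n)
    let ?u = "grid a b n"
    have mono: "?J (?u i) \<le> ?J (?u j)" if "i \<le> j" for i j
      using jump_count_mono[OF g grid_mono[OF ab(2) that]] .
    have u0: "0 \<le> ?u i" for i using grid_mono[OF ab(2), of 0 i n] ab by simp
    have one: "?J (?u (Suc i)) \<le> Suc (?J (?u i))" if i: "i < n" for i
    proof (rule ccontr)
      assume "\<not> ?thesis"
      then have k: "Suc (?J (?u i)) \<in> {?J (?u i)<..?J (?u (Suc i))}"
        "Suc (Suc (?J (?u i))) \<in> {?J (?u i)<..?J (?u (Suc i))}" by auto
      have "Suc (?J (?u i)) \<in> {?J a<..<?J b}"
        using k mono[of 0 i] mono[of "Suc i" n] i elim by auto
      from d[OF this] show False
        using event_time_in_cell[OF sp u0 u0 k(1)] event_time_in_cell[OF sp u0 u0 k(2)]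
          grid_diff[of n a b i] elim by simp
    qed
    have "(\<Sum>k\<in>{?J a<..?J b}. of_bool (jump_chain g (k - 1) = x \<and> jump_chain g k = y))
        = (\<Sum>i<n. \<Sum>k\<in>{?J (?u i)<..?J (?u (Suc i))}. of_bool (jump_chain g (k - 1) = x \<and> jump_chain g k = y) :: real)"
      using sum_split_steps[of n "\<lambda>i. ?J (?u i)"] mono elim by (simp del: sum_of_bool_eq)
    also have "\<dots> = (\<Sum>i<n. of_bool (g (?u i) = x \<and> g (?u (Suc i)) = y))"
    proof (intro sum.cong refl, goal_cases)
      case (1 i)
      then have i: "i < n" by simp
      show ?case
      proof (cases "?J (?u (Suc i)) = ?J (?u i)")
        case True
        then have "g (?u (Suc i)) = g (?u i)" by (intro jump_count_eq_imp_eq[OF g] u0)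
        with True xy show ?thesis by auto
      next
        case False
        then have J: "?J (?u (Suc i)) = Suc (?J (?u i))" using one[OF i] mono[of i "Suc i"] by simp
        then have "{?J (?u i)<..?J (?u (Suc i))} = {?J (?u (Suc i))}" by auto
        moreover have "jump_chain g (?J (?u (Suc i)) - 1) = g (?u i)"
          using J jump_chain_jump_count[OF g u0[of i]] by simp
        ultimately show ?thesis using jump_chain_jump_count[OF g u0[of "Suc i"]] by simp
      qed
    qed
    finally show ?case by simp
  qed
qed

text \<open>Consecutive states of the jump chain differ, so each jump is counted for exactly one
  pair. The left side uses the path at finitely many times only, which gives both the measurability
  and the mean of the jump count.\<close>

lemma grid_count_all_jumps:
  fixes g :: "real \<Rightarrow> 's::finite"
  assumes g: "jump_path g" and ab: "0 \<le> a" "a \<le> b"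
  shows "\<forall>\<^sub>F n in sequentially.
    (\<Sum>z\<in>{z. fst z \<noteq> snd z}. \<Sum>i<n. of_bool (g (grid a b n i) = fst z \<and> g (grid a b n (Suc i)) = snd z))
      = real (card {jump_count g a<..jump_count g b})"
proof -
  let ?S = "{z :: 's \<times> 's. fst z \<noteq> snd z}"
  let ?K = "{jump_count g a<..jump_count g b}"
  have "\<forall>\<^sub>F n in sequentially. \<forall>z\<in>?S.
     (\<Sum>i<n. of_bool (g (grid a b n i) = fst z \<and> g (grid a b n (Suc i)) = snd z))
      = (\<Sum>k\<in>?K. of_bool (jump_chain g (k - 1) = fst z \<and> jump_chain g k = snd z) :: real)"
    by (intro eventually_ball_finite ballI grid_count_jumps[OF g]) (use ab in auto)
  then show ?thesis
  proof eventually_elim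
    case (elim n)
    have "(\<Sum>z\<in>?S. \<Sum>i<n. of_bool (g (grid a b n i) = fst z \<and> g (grid a b n (Suc i)) = snd z))
      = (\<Sum>z\<in>?S. \<Sum>k\<in>?K. of_bool (jump_chain g (k - 1) = fst z \<and> jump_chain g k = snd z) :: real)"
      using elim by (intro sum.cong[OF refl]) blast
    also have "\<dots> = (\<Sum>k\<in>?K. \<Sum>z\<in>?S. of_bool (jump_chain g (k - 1) = fst z \<and> jump_chain g k = snd z))"
      by (rule sum.swap)
    also have "\<dots> = (\<Sum>k\<in>?K. 1)"
    proof (intro sum.cong refl)
      fix k assume k: "k \<in> ?K"
      then obtain j where j: "k = Suc j" by (cases k) auto
      have "event_occurs (jump_count g) (Suc j)" using k ab unfolding j by (intro event_occursI[of b]) auto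
      from jump_chain_Suc_neq[OF g this]
      have "(jump_chain g (k - 1), jump_chain g k) \<in> ?S" by (simp add: j)
      then have "?S \<inter> {z. jump_chain g (k - 1) = fst z \<and> jump_chain g k = snd z} = {(jump_chain g (k - 1), jump_chain g k)}"
        by auto
      then show "(\<Sum>z\<in>?S. of_bool (jump_chain g (k - 1) = fst z \<and> jump_chain g k = snd z)) = (1 :: real)"
        by (simp add: sum_of_bool_eq)
    qed
    finally show ?case by simp
  qed
qed

text \<open>A bound valid for every n, whereas the exact count holds only eventually; it is the
  majorant for dominated convergence.\<close>

lemma grid_jumps_le:
  fixes g :: "real \<Rightarrow> 'b"
  assumes g: "jump_path g" and ab: "0 \<le> a" "a \<le> b" and n: "0 < n"
  shows "(\<Sum>i<n. of_bool (g (grid a b n i) \<noteq> g (grid a b n (Suc i)))) \<le> real (jump_count g b) - real (jump_count g a)"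
proof -
  let ?u = "grid a b n"
  have u0: "0 \<le> ?u i" for i using grid_mono[OF ab(2), of 0 i n] ab by simp
  have "(\<Sum>i<n. of_bool (g (?u i) \<noteq> g (?u (Suc i)))) \<le> (\<Sum>i<n. real (jump_count g (?u (Suc i))) - real (jump_count g (?u i)))"
  proof (intro sum_mono, goal_cases)
    case (1 i)
    have "jump_count g (?u i) \<noteq> jump_count g (?u (Suc i))" if "g (?u i) \<noteq> g (?u (Suc i))"
      using jump_count_eq_imp_eq[OF g u0 u0] that by metis
    then show ?case using jump_count_mono[OF g grid_mono[OF ab(2), of i "Suc i" n]] by auto
  qed
  also have "\<dots> = real (jump_count g b) - real (jump_count g a)"
    using n sum_lessThan_telescope[of "\<lambda>i. real (jump_count g (?u i))" n] by simp
  finally show ?thesis .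
qed

text \<open>Each of the n cells contributes an error of at most C ((b - a) / n)^2, so the total
  error is at most C (b - a)^2 / n.\<close>

lemma grid_sum_limit:
  fixes \<psi> :: "real \<Rightarrow> real"
  assumes ab: "a \<le> b" and int: "set_integrable lborel {a..b} \<psi>"
    and close: "\<And>u v. a \<le> u \<Longrightarrow> u \<le> v \<Longrightarrow> v \<le> b \<Longrightarrow> \<bar>\<phi> u v - (LINT w:{u..v}|lborel. \<psi> w)\<bar> \<le> C * (v - u)\<^sup>2"
  shows "(\<lambda>n. \<Sum>i<n. \<phi> (grid a b n i) (grid a b n (Suc i))) \<longlonglongrightarrow> (LINT w:{a..b}|lborel. \<psi> w)"
proof -
  have bound: "\<forall>\<^sub>F n in sequentially. norm ((\<Sum>i<n. \<phi> (grid a b n i) (grid a b n (Suc i))) - (LINT w:{a..b}|lborel. \<psi> w))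
     \<le> C * (b - a)\<^sup>2 / n"
    using eventually_gt_at_top[of 0]
  proof eventually_elim
    case (elim n)
    let ?u = "grid a b n"
    have split: "(LINT w:{a..?u i}|lborel. \<psi> w) = (\<Sum>j<i. LINT w:{?u j..?u (Suc j)}|lborel. \<psi> w)" if "i \<le> n" for i
      using that
    proof (induction i)
      case 0
      have "AE w in lborel. indicator {a..a} w *\<^sub>R \<psi> w = 0"
        using AE_lborel_singleton[of a] by eventually_elim (auto simp: indicator_def)
      then show ?case
        unfolding set_lebesgue_integral_def by (simp add: integral_eq_zero_AE)
    next
      case (Suc i)
      have le: "a \<le> ?u i" "?u i \<le> ?u (Suc i)" "?u (Suc i) \<le> b"
        using grid_bounds[OF ab, of i n] grid_mono[OF ab, of i "Suc i"] grid_bounds[OF ab, of "Suc i" n] Suc.prems elim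
        by auto
      have "(LINT w:{a..?u (Suc i)}|lborel. \<psi> w) = (LINT w:{a..?u i} \<union> {?u i..?u (Suc i)}|lborel. \<psi> w)"
        using le by (intro arg_cong[where f="\<lambda>A. set_lebesgue_integral lborel A \<psi>"]) auto
      also have "\<dots> = (LINT w:{a..?u i}|lborel. \<psi> w) + (LINT w:{?u i..?u (Suc i)}|lborel. \<psi> w)"
      proof (intro set_integral_Un_AE set_integrable_subset[OF int])
        show "AE w in lborel. \<not> (w \<in> {a..?u i} \<and> w \<in> {?u i..?u (Suc i)})"
          using AE_lborel_singleton[of "?u i"] by eventually_elim auto
      qed (use le in auto)
      finally show ?case using Suc by simp
    qed
    have "\<bar>(\<Sum>i<n. \<phi> (?u i) (?u (Suc i))) - (LINT w:{a..b}|lborel. \<psi> w)\<bar>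
       = \<bar>\<Sum>i<n. \<phi> (?u i) (?u (Suc i)) - (LINT w:{?u i..?u (Suc i)}|lborel. \<psi> w)\<bar>"
      using split[of n] elim by (simp add: sum_subtractf)
    also have "\<dots> \<le> (\<Sum>i<n. \<bar>\<phi> (?u i) (?u (Suc i)) - (LINT w:{?u i..?u (Suc i)}|lborel. \<psi> w)\<bar>)" by (rule sum_abs)
    also have "\<dots> \<le> (\<Sum>i<n. C * ((b - a) / n)\<^sup>2)"
    proof (intro sum_mono, goal_cases)
      case (1 i)
      then show ?case
        using close[of "?u i" "?u (Suc i)"] grid_bounds[OF ab, of i n] grid_mono[OF ab, of i "Suc i"]
          grid_bounds[OF ab, of "Suc i" n] grid_diff[OF elim, of a b i] elim by auto
    qed
    also have "\<dots> = C * (b - a)\<^sup>2 / n" using elim by (simp add: power2_eq_square field_simps)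
    finally show ?case by simp
  qed
  show ?thesis
    by (rule LIM_zero_cancel, rule Lim_null_comparison[OF bound lim_const_over_n])
qed

subsection \<open>Means of bounded reward distributions\<close>

text \<open>The upper end c is a natural number so that [0, c] splits into exactly c n cells of
  width 1/n in \<open>riemann_mean\<close>. Vanishing at all negative z allows an atom at 0.\<close>

definition supported_cdf :: "nat \<Rightarrow> (real \<Rightarrow> real) \<Rightarrow> bool" where
  "supported_cdf c F \<longleftrightarrow> distribution_function F \<and> (\<forall>z<0. F z = 0) \<and> F (real c) = 1"

text \<open>A Riemann sum for \<open>\<integral>\<^sub>0\<^sup>c (1 - F(z)) dz\<close>; it makes the mean measurable in the parameters of \<open>F\<close>.\<close>

definition riemann_mean :: "nat \<Rightarrow> nat \<Rightarrow> (real \<Rightarrow> real) \<Rightarrow> real" where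
  "riemann_mean c n F = (\<Sum>k<c * n. 1 - F (real k / real n)) / real n"

lemma distribution_function_bounds:
  assumes "distribution_function F"
  shows "0 \<le> F z" "F z \<le> 1"
proof -
  have lim: "(F \<longlongrightarrow> 0) at_bot" "(F \<longlongrightarrow> 1) at_top" and mono: "mono F"
    using assms by (auto simp: distribution_function_def)
  show "0 \<le> F z"
    using lim(1) by (rule tendsto_upperbound) (auto intro!: eventually_at_bot_linorderI[of z] monoD[OF mono])
  show "F z \<le> 1"
    using lim(2) by (rule tendsto_lowerbound) (auto intro!: eventually_at_top_linorderI[of z] monoD[OF mono])
qed

lemma supported_cdf_bounds:
  assumes "supported_cdf c F"
  shows "0 \<le> F z" "F z \<le> 1"
  using assms distribution_function_bounds by (auto simp: supported_cdf_def)

text \<open>The number of grid points k / n below z is the ceiling of z n, and z \<le> c ensures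
  that all of them are among the first c n.\<close>

lemma riemann_layer:
  fixes z :: real
  assumes z: "0 \<le> z" "z \<le> real c" and n: "0 < n"
  shows "\<bar>z - (\<Sum>k<c * n. of_bool (real k / real n < z)) / real n\<bar> \<le> 1 / real n"
proof -
  have zn: "z * n \<le> real (c * n)" using z by (simp add: mult_right_mono)
  have "k < c * n" if "real k < z * n" for k
    using less_le_trans[OF that zn] by (simp only: of_nat_less_iff)
  then have "{..<c * n} \<inter> {k. real k / real n < z} = {..<nat \<lceil>z * n\<rceil>}"
    using n by (auto simp: field_simps less_ceiling_iff zless_nat_eq_int_zless)
  then have "(\<Sum>k<c * n. of_bool (real k / real n < z)) = real (nat \<lceil>z * n\<rceil>)"
    by (simp add: sum_of_bool_eq)
  moreover have "real (nat \<lceil>z * n\<rceil>) \<ge> z * n" "real (nat \<lceil>z * n\<rceil>) \<le> z * n + 1"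
    using z by (auto simp: real_nat_ceiling_ge of_nat_ceiling)
  ultimately have "\<bar>z * n - (\<Sum>k<c * n. of_bool (real k / real n < z))\<bar> \<le> 1"
    by (simp add: abs_le_iff del: sum_of_bool_eq)
  then have "\<bar>(z * n - (\<Sum>k<c * n. of_bool (real k / real n < z))) / n\<bar> \<le> 1 / n"
    unfolding abs_divide using n by (simp add: divide_right_mono del: sum_of_bool_eq)
  then show ?thesis using n by (simp add: diff_divide_distrib del: sum_of_bool_eq)
qed

text \<open>Integrating \<open>riemann_layer\<close> against the law with distribution function F
  turns the indicator of k / n < z into 1 - F(k / n). The error 1/n is the same for all F.\<close>

lemma mean_pos_riemann:
  assumes F: "supported_cdf c F" and n: "0 < n"
  shows "\<bar>mean_pos F - riemann_mean c n F\<bar> \<le> 1 / real n" "0 \<le> mean_pos F" "mean_pos F \<le> real c"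
proof -
  let ?D = "interval_measure F"
  have df: "\<And>x y. x \<le> y \<Longrightarrow> F x \<le> F y" "\<And>a. continuous (at_right a) F" "(F \<longlongrightarrow> 0) at_bot" "(F \<longlongrightarrow> 1) at_top"
    using F by (auto simp: supported_cdf_def distribution_function_def mono_def)
  interpret D: real_distribution ?D by (rule real_distribution_interval_measure[OF df])
  have Iic: "D.prob {..z} = F z" for z by (rule measure_interval_measure_Iic[OF df(1-3)])
  have "AE z in ?D. z \<in> {..real c}"
    using Iic[of "real c"] F by (intro D.AE_prob_1) (simp add: supported_cdf_def)
  \<comment> \<open>F vanishes at each negative number, so there is no mass at or below -1/(m + 1);
    taking all m at once excludes every negative z.\<close>
  moreover have "AE z in ?D. \<not> z \<le> - inverse (Suc m)" for m
  proof -
    have "D.prob {..- inverse (Suc m)} = 0" unfolding Iic using F by (auto simp: supported_cdf_def simp del: of_nat_Suc)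
    then have "AE z in ?D. z \<notin> {..- inverse (Suc m)}"
      by (subst D.prob_eq_0[symmetric]) auto
    then show ?thesis by simp
  qed
  then have "AE z in ?D. \<forall>m. \<not> z \<le> - inverse (Suc m)" by (simp add: AE_all_countable del: of_nat_Suc)
  ultimately have ae: "AE z in ?D. 0 \<le> z \<and> z \<le> c"
  proof eventually_elim
    case (elim z)
    have "0 \<le> z"
    proof (rule ccontr)
      assume "\<not> 0 \<le> z"
      then obtain m where "inverse (Suc m) < - z" using reals_Archimedean[of "- z"] by auto
      then show False using elim(2) by (auto simp del: of_nat_Suc simp: not_le dest!: spec[of _ m])
    qed
    then show ?case using elim by simp
  qed
  have int: "integrable ?D (\<lambda>z. z)"
  proof (rule D.integrable_const_bound[of _ "real c"])
    show "AE z in ?D. norm z \<le> real c" using ae by eventually_elim simp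
  qed simp
  have mean: "mean_pos F = (LINT z|?D. z)"
    unfolding mean_pos_def set_lebesgue_integral_def
  proof (rule integral_cong_AE)
    show "AE z in ?D. indicator {0..} z *\<^sub>R z = z" using ae by eventually_elim (simp add: indicator_def)
  qed simp_all
  show "0 \<le> mean_pos F" unfolding mean
  proof (rule integral_nonneg_AE)
    show "AE z in ?D. 0 \<le> z" using ae by eventually_elim simp
  qed
  have "(LINT z|?D. z) \<le> (LINT z|?D. real c)"
  proof (rule integral_mono_AE[OF int])
    show "AE z in ?D. z \<le> real c" using ae by eventually_elim simp
  qed simp
  then show "mean_pos F \<le> real c" unfolding mean by (simp add: D.prob_space[simplified])
  have ib: "integrable ?D (\<lambda>z. of_bool (a < z) :: real)" for a
    by (rule D.integrable_const_bound[of _ 1]) auto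
  have lb: "(LINT z|?D. of_bool (a < z)) = 1 - F a" for a
  proof -
    have "(LINT z|?D. of_bool (a < z)) = (LINT z|?D. indicator {a<..} z)"
      by (intro Bochner_Integration.integral_cong) (auto simp: indicator_def)
    also have "\<dots> = D.prob (space ?D - {..a})" by (simp add: Compl_eq_Diff_UNIV[symmetric])
    also have "\<dots> = 1 - F a" by (subst D.prob_compl) (auto simp: Iic)
    finally show ?thesis .
  qed
  have "(LINT z|?D. (\<Sum>k<c * n. of_bool (real k / real n < z)) / real n) = riemann_mean c n F"
    unfolding riemann_mean_def using ib lb by (simp add: Bochner_Integration.integral_sum del: sum_of_bool_eq)
  then have "mean_pos F - riemann_mean c n F = (LINT z|?D. z - (\<Sum>k<c * n. of_bool (real k / real n < z)) / real n)"
    unfolding mean using int ib by (subst Bochner_Integration.integral_diff) (auto simp del: sum_of_bool_eq)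
  also have "\<bar>\<dots>\<bar> \<le> (LINT z|?D. \<bar>z - (\<Sum>k<c * n. of_bool (real k / real n < z)) / real n\<bar>)"
    by (rule integral_abs_bound)
  also have "\<dots> \<le> (LINT z|?D. 1 / real n)"
  proof (rule integral_mono_AE)
    show "AE z in ?D. \<bar>z - (\<Sum>k<c * n. of_bool (real k / real n < z)) / real n\<bar> \<le> 1 / real n"
      using ae by eventually_elim (use riemann_layer n in blast)
  qed (use int ib in \<open>auto simp del: sum_of_bool_eq\<close>)
  also have "\<dots> = 1 / real n" by (simp add: D.prob_space[simplified])
  finally show "\<bar>mean_pos F - riemann_mean c n F\<bar> \<le> 1 / real n" .
qed

lemma measurable_mean_pos:
  assumes F: "\<And>t. t \<in> space N \<Longrightarrow> supported_cdf c (F t)" and m: "\<And>z. (\<lambda>t. F t z) \<in> borel_measurable N"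
  shows "(\<lambda>t. mean_pos (F t)) \<in> borel_measurable N"
proof (rule borel_measurable_LIMSEQ_real)
  show "(\<lambda>t. riemann_mean c (Suc n) (F t)) \<in> borel_measurable N" for n
    unfolding riemann_mean_def using m by measurable
  show "(\<lambda>n. riemann_mean c (Suc n) (F t)) \<longlonglongrightarrow> mean_pos (F t)" if "t \<in> space N" for t
  proof (rule LIM_zero_cancel, rule Lim_null_comparison)
    show "\<forall>\<^sub>F n in sequentially. norm (riemann_mean c (Suc n) (F t) - mean_pos (F t)) \<le> inverse (real (Suc n))"
      using mean_pos_riemann(1)[OF F[OF that]]
      by (intro always_eventually allI) (simp add: abs_minus_commute inverse_eq_divide del: of_nat_Suc)
    show "(\<lambda>n. inverse (real (Suc n))) \<longlonglongrightarrow> 0" by (rule LIMSEQ_inverse_real_of_nat)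
  qed
qed

text \<open>A conditional mean is computed from conditional distribution functions alone: only the
  probabilities of C \<inter> {V \<le> z} are given. V and \<open>mean_pos (W \<omega>)\<close> are
  replaced by sums over the same nodes k / n, whose expectations agree node by node. W is meaningful
  only on C, hence the factor \<open>indicator C \<omega>\<close> throughout.\<close>

lemma (in prob_space) expectation_via_cdf:
  assumes V: "V \<in> borel_measurable M" and C: "C \<in> events"
    and W: "\<And>\<omega>. \<omega> \<in> C \<Longrightarrow> supported_cdf c (W \<omega>)"
    and Wm: "\<And>z. (\<lambda>\<omega>. indicator C \<omega> * W \<omega> z) \<in> borel_measurable M"
    and eq: "\<And>z. prob (C \<inter> {\<omega>\<in>space M. V \<omega> \<le> z}) = (LINT \<omega>|M. indicator C \<omega> * W \<omega> z)"
  shows "AE \<omega> in M. \<omega> \<in> C \<longrightarrow> 0 \<le> V \<omega> \<and> V \<omega> \<le> c"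
    and "(\<lambda>\<omega>. indicator C \<omega> * mean_pos (W \<omega>)) \<in> borel_measurable M"
    and "(LINT \<omega>|M. indicator C \<omega> * V \<omega>) = (LINT \<omega>|M. indicator C \<omega> * mean_pos (W \<omega>))"
proof -
  note [measurable] = V C Wm
  have Cs: "C \<subseteq> space M" using C by (rule sets.sets_into_space)
  have "AE \<omega> in M. \<omega> \<in> C \<longrightarrow> V \<omega> \<le> c"
  proof -
    have "prob (C \<inter> {\<omega>\<in>space M. V \<omega> \<le> real c}) = (LINT \<omega>|M. indicator C \<omega>)"
      unfolding eq using W by (intro Bochner_Integration.integral_cong) (auto simp: indicator_def supported_cdf_def)
    then have "prob (C \<inter> {\<omega>\<in>space M. V \<omega> \<le> real c}) = prob C" using Cs by (simp add: Int_absorb2)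
    then have "prob (C - (C \<inter> {\<omega>\<in>space M. V \<omega> \<le> real c})) = 0"
      by (subst finite_measure_Diff) auto
    then have "AE \<omega> in M. \<omega> \<notin> C - (C \<inter> {\<omega>\<in>space M. V \<omega> \<le> real c})"
      by (subst prob_eq_0[symmetric]) auto
    then show ?thesis using AE_space by eventually_elim auto
  qed
  moreover have "AE \<omega> in M. \<omega> \<in> C \<longrightarrow> \<not> V \<omega> \<le> - inverse (Suc m)" for m
  proof -
    have "prob (C \<inter> {\<omega>\<in>space M. V \<omega> \<le> - inverse (Suc m)}) = (LINT \<omega>|M. 0)"
      unfolding eq using W by (intro Bochner_Integration.integral_cong) (auto simp: indicator_def supported_cdf_def simp del: of_nat_Suc)
    then have "AE \<omega> in M. \<omega> \<notin> C \<inter> {\<omega>\<in>space M. V \<omega> \<le> - inverse (Suc m)}"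
      by (subst prob_eq_0[symmetric]) auto
    then show ?thesis using AE_space by eventually_elim auto
  qed
  then have "AE \<omega> in M. \<forall>m. \<omega> \<in> C \<longrightarrow> \<not> V \<omega> \<le> - inverse (Suc m)" unfolding AE_all_countable by blast
  ultimately show ae: "AE \<omega> in M. \<omega> \<in> C \<longrightarrow> 0 \<le> V \<omega> \<and> V \<omega> \<le> c"
  proof eventually_elim
    case (elim \<omega>)
    show ?case
    proof
      assume w: "\<omega> \<in> C"
      have "0 \<le> V \<omega>"
      proof (rule ccontr)
        assume "\<not> 0 \<le> V \<omega>"
        then obtain m where "inverse (Suc m) < - V \<omega>" using reals_Archimedean[of "- V \<omega>"] by auto
        then show False using elim(2) w by (auto simp del: of_nat_Suc simp: not_le dest!: spec[of _ m])
      qed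
      then show "0 \<le> V \<omega> \<and> V \<omega> \<le> c" using elim w by simp
    qed
  qed
  have lim: "(\<lambda>n. indicator C \<omega> * riemann_mean c (Suc n) (W \<omega>)) \<longlonglongrightarrow> indicator C \<omega> * mean_pos (W \<omega>)" for \<omega> :: 'a
  proof (cases "\<omega> \<in> C")
    case True
    show ?thesis
    proof (intro tendsto_intros, rule LIM_zero_cancel, rule Lim_null_comparison)
      show "\<forall>\<^sub>F n in sequentially. norm (riemann_mean c (Suc n) (W \<omega>) - mean_pos (W \<omega>)) \<le> inverse (real (Suc n))"
        using mean_pos_riemann(1)[OF W[OF True]]
        by (intro always_eventually allI) (simp add: abs_minus_commute inverse_eq_divide del: of_nat_Suc)
    qed (rule LIMSEQ_inverse_real_of_nat)
  qed simp
  have Rm: "(\<lambda>\<omega>. indicator C \<omega> * riemann_mean c (Suc n) (W \<omega>)) \<in> borel_measurable M" for n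
  proof -
    have "(\<lambda>\<omega>. indicator C \<omega> * riemann_mean c (Suc n) (W \<omega>))
      = (\<lambda>\<omega>. (\<Sum>k<c * Suc n. indicator C \<omega> - indicator C \<omega> * W \<omega> (real k / real (Suc n))) / real (Suc n))"
      by (auto simp: riemann_mean_def sum_distrib_left right_diff_distrib simp del: of_nat_Suc mult_Suc_right)
    then show ?thesis by simp
  qed
  show mm [measurable]: "(\<lambda>\<omega>. indicator C \<omega> * mean_pos (W \<omega>)) \<in> borel_measurable M"
    by (rule borel_measurable_LIMSEQ_real[OF lim Rm])
  have iV: "integrable M (\<lambda>\<omega>. indicator C \<omega> * V \<omega>)"
  proof (rule integrable_const_bound[of _ "real c"])
    show "AE \<omega> in M. norm (indicator C \<omega> * V \<omega>) \<le> real c" using ae by eventually_elim (auto simp: indicator_def)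
  qed simp
  have bm: "0 \<le> mean_pos (W \<omega>) \<and> mean_pos (W \<omega>) \<le> c" if "\<omega> \<in> C" for \<omega>
    using mean_pos_riemann(2,3)[OF W[OF that], of 1] by simp
  have im: "integrable M (\<lambda>\<omega>. indicator C \<omega> * mean_pos (W \<omega>))"
  proof (rule integrable_const_bound[of _ "real c"])
    show "AE \<omega> in M. norm (indicator C \<omega> * mean_pos (W \<omega>)) \<le> real c"
      using bm by (intro AE_I2) (auto simp: indicator_def)
  qed (rule mm)
  have iW: "integrable M (\<lambda>\<omega>. indicator C \<omega> * W \<omega> z)" for z
  proof (rule integrable_const_bound[of _ 1])
    show "AE \<omega> in M. norm (indicator C \<omega> * W \<omega> z) \<le> 1"
      using supported_cdf_bounds[OF W] by (intro AE_I2) (auto simp: indicator_def)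
  qed (rule Wm)
  let ?d = "(LINT \<omega>|M. indicator C \<omega> * V \<omega>) - (LINT \<omega>|M. indicator C \<omega> * mean_pos (W \<omega>))"
  have close: "\<bar>?d\<bar> \<le> 2 / n" if n: "0 < n" for n :: nat
  proof -
    \<comment> \<open>On C, \<open>S\<close> is within 1/n of V almost surely and \<open>R\<close>
      is within 1/n of the mean of W; their expectations coincide by \<open>eq\<close>.\<close>
    define S where "S \<omega> = (\<Sum>k<c * n. indicator C \<omega> * of_bool (real k / real n < V \<omega>)) / real n" for \<omega>
    define R where "R \<omega> = (\<Sum>k<c * n. indicator C \<omega> - indicator C \<omega> * W \<omega> (real k / real n)) / real n" for \<omega>
    have iS1: "integrable M (\<lambda>\<omega>. indicator C \<omega> * of_bool (a < V \<omega>) :: real)" for a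
      by (rule integrable_const_bound[of _ 1]) (auto simp: indicator_def)
    have iS: "integrable M S" unfolding S_def by (intro integrable_divide_zero Bochner_Integration.integrable_sum iS1)
    have iC: "integrable M (indicator C :: _ \<Rightarrow> real)"
      by (rule integrable_const_bound[of _ 1]) (auto simp: indicator_def)
    have iR: "integrable M R" unfolding R_def
      by (intro integrable_divide_zero Bochner_Integration.integrable_sum Bochner_Integration.integrable_diff iC iW)
    have "(LINT \<omega>|M. indicator C \<omega> * of_bool (a < V \<omega>)) = (LINT \<omega>|M. indicator C \<omega> - indicator C \<omega> * W \<omega> a)" for a
    proof -
      have "(LINT \<omega>|M. indicator C \<omega> * of_bool (a < V \<omega>))
          = (LINT \<omega>|M. indicator C \<omega> - indicator (C \<inter> {\<omega>\<in>space M. V \<omega> \<le> a}) \<omega> :: real)"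
        by (intro Bochner_Integration.integral_cong) (auto simp: indicator_def)
      also have "\<dots> = (LINT \<omega>|M. indicator C \<omega>) - prob (C \<inter> {\<omega>\<in>space M. V \<omega> \<le> a})"
      proof (subst Bochner_Integration.integral_diff)
        show "integrable M (indicat_real (C \<inter> {\<omega>\<in>space M. V \<omega> \<le> a}))"
          by (rule integrable_const_bound[of _ 1]) (auto simp: indicator_def)
      qed (use Cs iC in \<open>simp_all add: Int_absorb2 Int_absorb1 Int_assoc\<close>)
      also have "\<dots> = (LINT \<omega>|M. indicator C \<omega> - indicator C \<omega> * W \<omega> a)"
        using iC iW by (simp add: eq)
      finally show ?thesis .
    qed
    moreover have "(LINT \<omega>|M. S \<omega>) = (\<Sum>k<c * n. LINT \<omega>|M. indicator C \<omega> * of_bool (real k / real n < V \<omega>)) / real n"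
      unfolding S_def integral_divide_zero by (subst Bochner_Integration.integral_sum[OF iS1]) (rule refl)
    moreover have "(LINT \<omega>|M. R \<omega>)
        = (\<Sum>k<c * n. LINT \<omega>|M. indicator C \<omega> - indicator C \<omega> * W \<omega> (real k / real n)) / real n"
      unfolding R_def integral_divide_zero
      by (subst Bochner_Integration.integral_sum[OF Bochner_Integration.integrable_diff[OF iC iW]]) (rule refl)
    ultimately have SR: "(LINT \<omega>|M. S \<omega>) = (LINT \<omega>|M. R \<omega>)" by (simp only:)
    have V1: "\<bar>(LINT \<omega>|M. indicator C \<omega> * V \<omega> - S \<omega>)\<bar> \<le> 1 / n"
    proof -
      have "\<bar>(LINT \<omega>|M. indicator C \<omega> * V \<omega> - S \<omega>)\<bar> \<le> (LINT \<omega>|M. \<bar>indicator C \<omega> * V \<omega> - S \<omega>\<bar>)"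
        by (rule integral_abs_bound)
      also have "\<dots> \<le> (LINT \<omega>|M. 1 / n)"
      proof (rule integral_mono_AE)
        show "AE \<omega> in M. \<bar>indicator C \<omega> * V \<omega> - S \<omega>\<bar> \<le> 1 / n"
          using ae by eventually_elim (use n riemann_layer in \<open>auto simp: S_def indicator_def simp del: sum_of_bool_eq\<close>)
      qed (use iV iS in auto)
      finally show ?thesis by (simp add: prob_space)
    qed
    have V2: "\<bar>(LINT \<omega>|M. indicator C \<omega> * mean_pos (W \<omega>) - R \<omega>)\<bar> \<le> 1 / n"
    proof -
      have "\<bar>(LINT \<omega>|M. indicator C \<omega> * mean_pos (W \<omega>) - R \<omega>)\<bar> \<le> (LINT \<omega>|M. \<bar>indicator C \<omega> * mean_pos (W \<omega>) - R \<omega>\<bar>)"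
        by (rule integral_abs_bound)
      also have "\<dots> \<le> (LINT \<omega>|M. 1 / n)"
      proof (rule integral_mono)
        show "\<bar>indicator C \<omega> * mean_pos (W \<omega>) - R \<omega>\<bar> \<le> 1 / n" for \<omega>
          using mean_pos_riemann(1)[OF W n, of \<omega>] by (auto simp: R_def indicator_def riemann_mean_def)
      qed (use im iR in auto)
      finally show ?thesis by (simp add: prob_space)
    qed
    have "?d = (LINT \<omega>|M. indicator C \<omega> * V \<omega> - S \<omega>) - (LINT \<omega>|M. indicator C \<omega> * mean_pos (W \<omega>) - R \<omega>)"
      using iV iS im iR SR by simp
    then show ?thesis using V1 V2 by (simp add: abs_le_iff)
  qed
  have "\<bar>?d\<bar> \<le> 0"
  proof (rule tendsto_lowerbound)
    show "(\<lambda>n. 2 / real n) \<longlonglongrightarrow> 0" by (rule lim_const_over_n)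
    show "\<forall>\<^sub>F n in sequentially. \<bar>?d\<bar> \<le> 2 / real n"
      using eventually_gt_at_top[of 0] by eventually_elim (rule close)
  qed simp
  then show "(LINT \<omega>|M. indicator C \<omega> * V \<omega>) = (LINT \<omega>|M. indicator C \<omega> * mean_pos (W \<omega>))" by simp
qed

subsection \<open>Transferring integral identities to generated \<open>\<sigma>\<close>-algebras\<close>

text \<open>The sets on which two integrable functions have the same integral form a Dynkin system;
  the whole space belongs to the generator to supply the complement step.\<close>

lemma (in prob_space) pi_lambda_integral_eq:
  fixes f g :: "'a \<Rightarrow> real"
  assumes stable: "Int_stable E" and E: "E \<subseteq> events" and sp: "space M \<in> E"
    and f: "integrable M f" and g: "integrable M g"
    and eq: "\<And>A. A \<in> E \<Longrightarrow> (LINT \<omega>:A|M. f \<omega>) = (LINT \<omega>:A|M. g \<omega>)"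
    and A: "A \<in> sigma_sets (space M) E"
  shows "(LINT \<omega>:A|M. f \<omega>) = (LINT \<omega>:A|M. g \<omega>)"
proof -
  have sub: "sigma_sets (space M) E \<subseteq> events" using E by (rule sets.sigma_sets_subset)
  have EP: "E \<subseteq> Pow (space M)" using E sets.sets_into_space by auto
  have si: "set_integrable M B h" if "B \<in> events" "integrable M h" for B and h :: "'a \<Rightarrow> real"
    unfolding set_integrable_def using that by (rule integrable_mult_indicator)
  show ?thesis
    using stable EP A
  proof (induction rule: sigma_sets_induct_disjoint)
    case (compl B)
    then have B: "B \<in> events" using sub by auto
    have *: "(LINT \<omega>:space M - B|M. h \<omega>) = (LINT \<omega>:space M|M. h \<omega>) - (LINT \<omega>:B|M. h \<omega>)" if "integrable M h" for h :: "'a \<Rightarrow> real"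
    proof -
      have "(LINT \<omega>:(space M - B) \<union> B|M. h \<omega>) = (LINT \<omega>:space M - B|M. h \<omega>) + (LINT \<omega>:B|M. h \<omega>)"
        using B that by (intro set_integral_Un si) auto
      then show ?thesis using sets.sets_into_space[OF B] by (simp add: Un_absorb2)
    qed
    show ?case using compl.IH eq[OF sp] *[OF f] *[OF g] by simp
  next
    case (union B)
    have B: "B i \<in> events" for i using union sub by auto
    have d: "B i \<inter> B j = {}" if "i \<noteq> j" for i j using union(1) that by (auto simp: disjoint_family_on_def)
    have UB: "(\<Union>i. B i) \<in> events" using B by auto
    show ?case
      using union.IH lebesgue_integral_countable_add[of B, OF B d si[OF UB f]]
        lebesgue_integral_countable_add[of B, OF B d si[OF UB g]] by simp
  qed (use eq in \<open>auto simp: set_lebesgue_integral_def\<close>)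
qed

lemma (in prob_space) finite_measure_subalgebraI: "subalgebra M N \<Longrightarrow> finite_measure_subalgebra M N"
  by (intro finite_measure_subalgebra.intro finite_measure_subalgebra_axioms.intro) unfold_locales

lemma (in prob_space) integrable_bounded:
  fixes f :: "'a \<Rightarrow> real"
  assumes "f \<in> borel_measurable M" "\<And>\<omega>. \<omega> \<in> space M \<Longrightarrow> \<bar>f \<omega>\<bar> \<le> B"
  shows "integrable M f"
  using assms by (intro integrable_const_bound[of _ B]) auto

text \<open>Equal integrals over all sets of the subalgebra mean equal conditional expectations, and
  a bounded measurable factor may be moved in and out of these.\<close>

lemma (in prob_space) integral_eq_bounded_weight:
  fixes f g \<phi> :: "'a \<Rightarrow> real"
  assumes sub: "subalgebra M N"
    and f: "integrable M f" and g: "integrable M g"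
    and eq: "\<And>A. A \<in> sets N \<Longrightarrow> (LINT \<omega>:A|M. f \<omega>) = (LINT \<omega>:A|M. g \<omega>)"
    and \<phi>: "\<phi> \<in> borel_measurable N" "\<And>\<omega>. \<omega> \<in> space M \<Longrightarrow> \<bar>\<phi> \<omega>\<bar> \<le> B"
  shows "(LINT \<omega>|M. \<phi> \<omega> * f \<omega>) = (LINT \<omega>|M. \<phi> \<omega> * g \<omega>)"
proof -
  interpret N: finite_measure_subalgebra M N using finite_measure_subalgebraI[OF sub] .
  have \<phi>M: "\<phi> \<in> borel_measurable M" by (rule measurable_from_subalg[OF sub \<phi>(1)])
  have int: "integrable M (\<lambda>\<omega>. \<phi> \<omega> * h \<omega>)" if h: "integrable M h" for h
  proof (rule Bochner_Integration.integrable_bound[of M "\<lambda>\<omega>. B * h \<omega>"])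
    show "AE \<omega> in M. norm (\<phi> \<omega> * h \<omega>) \<le> norm (B * h \<omega>)"
      using AE_space by eventually_elim
        (use \<phi>(2) in \<open>force simp: abs_mult intro!: mult_right_mono\<close>)
  qed (use h \<phi>M in auto)
  have "AE \<omega> in M. real_cond_exp M N f \<omega> = real_cond_exp M N g \<omega>"
  proof (rule N.real_cond_exp_charact)
    show "(LINT \<omega>:A|M. f \<omega>) = (LINT \<omega>:A|M. real_cond_exp M N g \<omega>)" if "A \<in> sets N" for A
      using eq[OF that] N.real_cond_exp_intA[OF g that] by simp
  qed (use f N.real_cond_exp_int(1)[OF g] in auto)
  then have "(LINT \<omega>|M. \<phi> \<omega> * real_cond_exp M N f \<omega>) = (LINT \<omega>|M. \<phi> \<omega> * real_cond_exp M N g \<omega>)"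
    using \<phi>M by (intro integral_cong_AE) auto
  then show ?thesis
    using N.real_cond_exp_intg(2)[OF int[OF f] \<phi>(1)] N.real_cond_exp_intg(2)[OF int[OF g] \<phi>(1)] f g by simp
qed

subsection \<open>Measurability of right-continuous paths\<close>

text \<open>The path is approximated by its value at the next grid point to the right, a function of
  countably many coordinates. As the state space is discrete, right continuity makes the
  approximants eventually equal to the limit. The function c is a clamp of the time axis: it keeps
  all observation times inside an interval on which X is known to be measurable.\<close>

lemma progressive_measurable:
  fixes X :: "real \<Rightarrow> 'w \<Rightarrow> 's::finite" and c :: "real \<Rightarrow> real"
  assumes X: "\<And>t. X (c t) \<in> measurable N (count_space UNIV)"
    and rc: "\<And>\<omega>. \<omega> \<in> space N \<Longrightarrow> right_continuous_path (\<lambda>t. X t \<omega>)"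
    and c: "mono c" "continuous_on UNIV c" "\<And>t. 0 \<le> c t"
  shows "(\<lambda>(\<omega>, t). X (c t) \<omega>) \<in> measurable (N \<Otimes>\<^sub>M borel) (count_space UNIV)"
proof -
  define d where "d n t = \<lceil>t * real (Suc n)\<rceil>" for n and t :: real
  define Xn where "Xn n z = X (c (real_of_int (d n (snd z)) / real (Suc n))) (fst z)" for n z
  have Xn: "Xn n \<in> measurable (N \<Otimes>\<^sub>M borel) (count_space UNIV)" for n
    unfolding Xn_def
  proof (rule measurable_compose_countable[where g="\<lambda>z. d n (snd z)" and f="\<lambda>i z. X (c (real_of_int i / real (Suc n))) (fst z)"])
    show "(\<lambda>z. X (c (real_of_int i / real (Suc n))) (fst z)) \<in> measurable (N \<Otimes>\<^sub>M borel) (count_space UNIV)" for i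
      using X by (rule measurable_compose[OF measurable_fst])
    show "(\<lambda>z. d n (snd z)) \<in> measurable (N \<Otimes>\<^sub>M borel) (count_space UNIV)"
      unfolding d_def by measurable
  qed
  have lim: "\<exists>m. \<forall>n\<ge>m. Xn n (\<omega>, t) = X (c t) \<omega>" if w: "\<omega> \<in> space N" for \<omega> t
  proof -
    obtain e where e: "e > 0" "\<And>s. c t \<le> s \<Longrightarrow> s < c t + e \<Longrightarrow> X s \<omega> = X (c t) \<omega>"
      by (rule right_continuous_pathE[OF rc[OF w] c(3)[of t]]) blast
    have d1: "t \<le> real_of_int (d n t) / real (Suc n)" for n
      unfolding d_def by (subst pos_le_divide_eq) (auto simp del: of_nat_Suc)
    have "real_of_int (d n t) \<le> t * real (Suc n) + 1" for n
      unfolding d_def using ceiling_correct[of "t * real (Suc n)"] by linarith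
    then have d2: "real_of_int (d n t) / real (Suc n) \<le> t + inverse (real (Suc n))" for n
      by (subst pos_divide_le_eq) (auto simp: distrib_right simp del: of_nat_Suc)
    have l1: "(\<lambda>n. t + inverse (real (Suc n))) \<longlonglongrightarrow> t"
      using tendsto_add[OF tendsto_const[of t] LIMSEQ_inverse_real_of_nat] by (simp del: of_nat_Suc)
    have "(\<lambda>n. real_of_int (d n t) / real (Suc n)) \<longlonglongrightarrow> t"
      by (rule tendsto_sandwich[OF _ _ tendsto_const[of t] l1])
         (use d1 d2 in \<open>auto simp del: of_nat_Suc\<close>)
    moreover have "isCont c t" using c(2) by (simp add: continuous_on_eq_continuous_at)
    ultimately have "(\<lambda>n. c (real_of_int (d n t) / real (Suc n))) \<longlonglongrightarrow> c t"
      by (rule isCont_tendsto_compose[rotated])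
    then have "\<forall>\<^sub>F n in sequentially. c (real_of_int (d n t) / real (Suc n)) < c t + e"
      using e(1) by (intro order_tendstoD(2)) auto
    then have "\<forall>\<^sub>F n in sequentially. Xn n (\<omega>, t) = X (c t) \<omega>"
    proof eventually_elim
      case (elim n)
      have "c t \<le> c (real_of_int (d n t) / real (Suc n))" using monoD[OF c(1) d1] .
      then show ?case using elim unfolding Xn_def fst_conv snd_conv by (rule e(2))
    qed
    then show ?thesis by (simp add: eventually_sequentially)
  qed
  have "(\<lambda>z. X (c (snd z)) (fst z)) \<in> measurable (N \<Otimes>\<^sub>M borel) (count_space UNIV)"
    unfolding measurable_count_space_eq2[OF finite[of UNIV]]
  proof (intro conjI ballI)
    fix x :: 's
    have "(\<lambda>z. X (c (snd z)) (fst z)) -` {x} \<inter> space (N \<Otimes>\<^sub>M borel)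
        = {z \<in> space (N \<Otimes>\<^sub>M borel). \<exists>m. \<forall>n\<ge>m. Xn n z = x}" (is "?L = ?R")
    proof (intro set_eqI)
      fix z
      show "z \<in> ?L \<longleftrightarrow> z \<in> ?R"
      proof (cases "z \<in> space (N \<Otimes>\<^sub>M borel)")
        case True
        then have "fst z \<in> space N" by (auto simp: space_pair_measure)
        then obtain m where m: "\<And>n. n \<ge> m \<Longrightarrow> Xn n z = X (c (snd z)) (fst z)"
          using lim[of "fst z" "snd z"] by auto
        have "X (c (snd z)) (fst z) = x \<longleftrightarrow> (\<exists>m. \<forall>n\<ge>m. Xn n z = x)"
          using m by (metis nle_le)
        then show ?thesis using True by simp
      qed simp
    qed
    also have "\<dots> \<in> sets (N \<Otimes>\<^sub>M borel)"
      using Xn by measurable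
    finally show "(\<lambda>z. X (c (snd z)) (fst z)) -` {x} \<inter> space (N \<Otimes>\<^sub>M borel) \<in> sets (N \<Otimes>\<^sub>M borel)" .
  qed simp
  then show ?thesis by (simp add: case_prod_beta')
qed

subsection \<open>Campbell's formula\<close>

text \<open>The mean measure of a point process on \<open>(s, t]\<close> is determined by its values on intervals.\<close>

lemma (in prob_space) campbell:
  fixes D :: "nat \<Rightarrow> 'a set" and \<theta> :: "nat \<Rightarrow> 'a \<Rightarrow> real" and \<rho> g :: "real \<Rightarrow> ennreal"
  assumes D: "\<And>k. D k \<in> events" and \<theta>: "\<And>k. \<theta> k \<in> borel_measurable M"
    and \<rho>: "\<rho> \<in> borel_measurable borel" and g: "g \<in> borel_measurable borel"
    and range: "\<And>k \<omega>. \<omega> \<in> D k \<Longrightarrow> s < \<theta> k \<omega> \<and> \<theta> k \<omega> \<le> t"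
    and st: "s \<le> t"
    and eq: "\<And>a. s \<le> a \<Longrightarrow> a \<le> t \<Longrightarrow>
       (\<Sum>k. emeasure M (D k \<inter> {\<omega>\<in>space M. a < \<theta> k \<omega>})) = (\<integral>\<^sup>+u\<in>{a<..t}. \<rho> u \<partial>lborel)"
    and fin: "(\<integral>\<^sup>+u\<in>{s<..t}. \<rho> u \<partial>lborel) < \<infinity>"
  shows "(\<Sum>k. \<integral>\<^sup>+\<omega>. indicator (D k) \<omega> * g (\<theta> k \<omega>) \<partial>M) = (\<integral>\<^sup>+u\<in>{s<..t}. \<rho> u * g u \<partial>lborel)"
proof -
  note [measurable] = D \<theta> \<rho>
  have \<theta>' [measurable]: "(\<lambda>(k, \<omega>). \<theta> k \<omega>) \<in> borel_measurable (count_space UNIV \<Otimes>\<^sub>M M)"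
    by (rule measurable_pair_measure_countable1) auto
  have D' [measurable]: "(\<lambda>(k, \<omega>). indicator (D k) \<omega> :: ennreal) \<in> borel_measurable (count_space UNIV \<Otimes>\<^sub>M M)"
    by (rule measurable_pair_measure_countable1) auto
  \<comment> \<open>\<open>\<mu>1\<close> is the mean measure of the points
    \<open>\<theta> k\<close> retained on \<open>D k\<close>; the index k is integrated against
    counting measure.\<close>
  define \<mu>1 where "\<mu>1 = distr (density (count_space UNIV \<Otimes>\<^sub>M M) (\<lambda>(k, \<omega>). indicator (D k) \<omega>)) borel (\<lambda>(k, \<omega>). \<theta> k \<omega>)"
  define \<mu>2 where "\<mu>2 = density lborel (\<lambda>u. \<rho> u * indicator {s<..t} u)"
  have I1: "integral\<^sup>N \<mu>1 h = (\<Sum>k. \<integral>\<^sup>+\<omega>. indicator (D k) \<omega> * h (\<theta> k \<omega>) \<partial>M)"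
    if h [measurable]: "h \<in> borel_measurable borel" for h
  proof -
    have "integral\<^sup>N \<mu>1 h = (\<integral>\<^sup>+z. (case z of (k, \<omega>) \<Rightarrow> indicator (D k) \<omega> * h (\<theta> k \<omega>)) \<partial>(count_space UNIV \<Otimes>\<^sub>M M))"
      unfolding \<mu>1_def by (subst nn_integral_distr, measurable, subst nn_integral_density)
        (auto intro!: nn_integral_cong simp: case_prod_beta')
    also have "\<dots> = (\<integral>\<^sup>+k. \<integral>\<^sup>+\<omega>. indicator (D k) \<omega> * h (\<theta> k \<omega>) \<partial>M \<partial>count_space UNIV)"
      by (subst nn_integral_fst[symmetric]) (auto intro!: measurable_pair_measure_countable1)
    finally show ?thesis by (simp add: nn_integral_count_space_nat)
  qed
  have I2: "integral\<^sup>N \<mu>2 h = (\<integral>\<^sup>+u\<in>{s<..t}. \<rho> u * h u \<partial>lborel)"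
    if h [measurable]: "h \<in> borel_measurable borel" for h
    unfolding \<mu>2_def by (subst nn_integral_density) (auto intro!: nn_integral_cong simp: ac_simps)
  have "\<mu>1 = \<mu>2"
  proof (rule measure_eqI_lessThan)
    show "sets \<mu>1 = sets borel" "sets \<mu>2 = sets borel" by (simp_all add: \<mu>1_def \<mu>2_def)
    then have em: "emeasure \<mu>1 {x<..} = integral\<^sup>N \<mu>1 (indicator {x<..})"
      "emeasure \<mu>2 {x<..} = integral\<^sup>N \<mu>2 (indicator {x<..})" for x by simp_all
    \<comment> \<open>All points lie in (s, t], so a half-line beginning before s may be taken to
      begin at s.\<close>
    have e1: "emeasure \<mu>1 {x<..} = (\<integral>\<^sup>+u\<in>{max x s<..t}. \<rho> u \<partial>lborel)" for x
    proof (cases "x \<le> t")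
      case True
      have "emeasure \<mu>1 {x<..} = (\<Sum>k. emeasure M (D k \<inter> {\<omega>\<in>space M. max x s < \<theta> k \<omega>}))"
        unfolding em I1[OF borel_measurable_indicator[OF borel_open[OF open_greaterThan]]]
      proof (intro suminf_cong)
        fix k
        have "(\<integral>\<^sup>+\<omega>. indicator (D k) \<omega> * indicator {x<..} (\<theta> k \<omega>) \<partial>M)
          = (\<integral>\<^sup>+\<omega>. indicator (D k \<inter> {\<omega>\<in>space M. max x s < \<theta> k \<omega>}) \<omega> \<partial>M)"
          using range[of _ k] by (intro nn_integral_cong) (auto simp: indicator_def)
        then show "(\<integral>\<^sup>+\<omega>. indicator (D k) \<omega> * indicator {x<..} (\<theta> k \<omega>) \<partial>M) = emeasure M (D k \<inter> {\<omega>\<in>space M. max x s < \<theta> k \<omega>})"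
          by simp
      qed
      also have "\<dots> = (\<integral>\<^sup>+u\<in>{max x s<..t}. \<rho> u \<partial>lborel)" using True st by (intro eq) auto
      finally show ?thesis .
    next
      case False
      have "emeasure \<mu>1 {x<..} = (\<Sum>k. \<integral>\<^sup>+\<omega>. 0 \<partial>M)"
        unfolding em I1[OF borel_measurable_indicator[OF borel_open[OF open_greaterThan]]]
        using range False by (intro suminf_cong nn_integral_cong) (force simp: indicator_def)
      moreover have "{max x s<..t} = {}" using False by auto
      ultimately show ?thesis by (simp only:) simp
    qed
    show "emeasure \<mu>1 {x<..} < \<infinity>" for x
      unfolding e1 by (rule le_less_trans[OF nn_integral_mono fin]) (auto simp: indicator_def)
    show "emeasure \<mu>1 {x<..} = emeasure \<mu>2 {x<..}" for x
      unfolding e1 em(2) I2[OF borel_measurable_indicator[OF borel_open[OF open_greaterThan]]]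
      by (intro nn_integral_cong) (auto simp: indicator_def)
  qed
  then show ?thesis using I1[OF g] I2[OF g] by simp
qed

subsection \<open>Transition functions with bounded rates\<close>

text \<open>Data are specified on [0, \<infinity>) only. Composition with \<open>max 0\<close> turns
  them into Borel functions on the whole line, and measurability in time is expressed in this form
  throughout.\<close>

locale bounded_rate_transitions =
  fixes Q :: "real \<Rightarrow> 's::finite \<Rightarrow> 's \<Rightarrow> real" and p :: "real \<Rightarrow> real \<Rightarrow> 's \<Rightarrow> 's \<Rightarrow> real" and q :: real
  assumes trans: "transition_function Q p"
    and Q_bound: "\<And>t x y. 0 \<le> t \<Longrightarrow> \<bar>Q t x y\<bar> \<le> q"
    and Q_measurable: "\<And>x y. (\<lambda>t. Q (max 0 t) x y) \<in> borel_measurable borel"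
begin

text \<open>Bounds the sum of absolute values along any row or column of Q(t), and serves as
  Lipschitz constant of \<open>p\<close>.\<close>

definition L :: real where "L = real CARD('s) * q"

lemma q_nonneg: "0 \<le> q"
  using Q_bound[of 0] by (metis abs_ge_zero order.refl order_trans)

lemma L_nonneg: "0 \<le> L"
  using q_nonneg by (simp add: L_def)

lemma p_nonneg: "0 \<le> s \<Longrightarrow> s \<le> t \<Longrightarrow> 0 \<le> p s t x y"
  and p_sum: "0 \<le> s \<Longrightarrow> s \<le> t \<Longrightarrow> (\<Sum>y\<in>UNIV. p s t x y) = 1"
  and p_chapman: "0 \<le> s \<Longrightarrow> s \<le> u \<Longrightarrow> u \<le> t \<Longrightarrow> p s t x y = (\<Sum>z\<in>UNIV. p s u x z * p u t z y)"
  and p_forward: "0 \<le> s \<Longrightarrow> s \<le> t \<Longrightarrow>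
     ((\<lambda>u. \<Sum>z\<in>UNIV. p s u x z * Q u z y) has_integral (p s t x y - of_bool (x = y))) {s..t}"
  using trans unfolding transition_function_def by blast+

lemma p_le_1: "0 \<le> s \<Longrightarrow> s \<le> t \<Longrightarrow> p s t x y \<le> 1"
  using member_le_sum[of y UNIV "p s t x"] p_nonneg p_sum by (metis UNIV_I finite)

lemma p_average_abs_le:
  assumes "0 \<le> s" "s \<le> t" "\<And>y. \<bar>f y\<bar> \<le> B"
  shows "\<bar>\<Sum>y\<in>UNIV. p s t x y * f y\<bar> \<le> B"
proof -
  have "\<bar>\<Sum>y\<in>UNIV. p s t x y * f y\<bar> \<le> (\<Sum>y\<in>UNIV. \<bar>p s t x y * f y\<bar>)" by (rule sum_abs)
  also have "\<dots> \<le> (\<Sum>y\<in>UNIV. p s t x y * B)"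
    using assms p_nonneg by (intro sum_mono) (simp add: abs_mult mult_left_mono)
  also have "\<dots> = B" using p_sum[OF assms(1,2)] by (simp add: sum_distrib_right[symmetric])
  finally show ?thesis .
qed

text \<open>By the forward equation the difference is the integral over [s, t] of an average of
  entries of Q, each at most q \<le> L.\<close>

lemma p_near_identity:
  assumes "0 \<le> s" "s \<le> t"
  shows "\<bar>p s t x y - of_bool (x = y)\<bar> \<le> L * (t - s)"
proof -
  have "\<bar>\<Sum>z\<in>UNIV. p s u x z * Q u z y\<bar> \<le> L" if u: "u \<in> {s..t}" for u
  proof -
    have "\<bar>\<Sum>z\<in>UNIV. p s u x z * Q u z y\<bar> \<le> q"
      using u assms Q_bound by (intro p_average_abs_le) auto
    also have "q \<le> L" using q_nonneg by (simp add: L_def mult_le_cancel_right1)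
    finally show ?thesis .
  qed
  then show ?thesis
    using has_integral_bound_real[OF L_nonneg _ p_forward[OF assms, of x y], of "{}"] assms
    by (auto simp: mult.commute content_real)
qed

lemma p_refl: "0 \<le> s \<Longrightarrow> p s s x y = of_bool (x = y)"
  using p_near_identity[of s s x y] by auto

text \<open>Chapman-Kolmogorov at u reduces this to \<open>p_near_identity\<close> on [u, t],
  averaged over the state at u.\<close>

lemma p_lipschitz:
  assumes "0 \<le> s" "s \<le> u" "u \<le> t"
  shows "\<bar>p s t x y - p s u x y\<bar> \<le> L * (t - u)"
proof -
  have "p s t x y - p s u x y = (\<Sum>z\<in>UNIV. p s u x z * (p u t z y - of_bool (z = y)))"
    by (simp add: p_chapman[OF assms] right_diff_distrib sum_subtractf)
  also have "\<bar>\<dots>\<bar> \<le> L * (t - u)"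
    using assms p_near_identity by (intro p_average_abs_le) auto
  finally show ?thesis .
qed

lemma p_measurable:
  assumes "0 \<le> s"
  shows "(\<lambda>t. p s (max s t) x y) \<in> borel_measurable borel"
proof -
  have *: "\<bar>p s (max s t) x y - p s (max s u) x y\<bar> \<le> L * \<bar>t - u\<bar>" if "u \<le> t" for t u
  proof -
    have "\<bar>p s (max s t) x y - p s (max s u) x y\<bar> \<le> L * (max s t - max s u)"
      using assms that by (intro p_lipschitz) auto
    also have "\<dots> \<le> L * \<bar>t - u\<bar>" using L_nonneg that by (intro mult_left_mono) auto
    finally show ?thesis .
  qed
  have "L-lipschitz_on UNIV (\<lambda>t. p s (max s t) x y)"
  proof (rule lipschitz_onI)
    fix t u :: real
    show "dist (p s (max s t) x y) (p s (max s u) x y) \<le> L * dist t u"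
      using *[of u t] *[of t u] by (cases "u \<le> t") (auto simp: dist_real_def abs_minus_commute)
  qed (rule L_nonneg)
  then show ?thesis by (intro borel_measurable_continuous_onI lipschitz_on_continuous_on)
qed

lemma set_integrable_bounded_on_interval:
  fixes f :: "real \<Rightarrow> real"
  assumes "(\<lambda>t. f (max 0 t)) \<in> borel_measurable borel" "\<And>t. 0 \<le> t \<Longrightarrow> \<bar>f t\<bar> \<le> B" "0 \<le> a"
  shows "set_integrable lborel {a..b} f"
proof -
  have "set_integrable lborel {a..b} (\<lambda>t. f (max 0 t))"
    unfolding set_integrable_def
  proof (rule Bochner_Integration.integrable_bound)
    show "integrable lborel (\<lambda>t. indicator {a..b} t *\<^sub>R B)"
      using borel_integrable_atLeastAtMost'[of a b "\<lambda>_. B"] by (simp add: set_integrable_def)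
    have "\<bar>f t\<bar> \<le> \<bar>B\<bar>" if "0 \<le> t" for t using assms(2)[OF that] by simp
    then show "AE t in lborel. norm (indicator {a..b} t *\<^sub>R f (max 0 t)) \<le> norm (indicator {a..b} t *\<^sub>R B)"
      by (intro AE_I2) (auto simp: indicator_def)
  qed (use assms(1) in simp)
  also have "?this \<longleftrightarrow> set_integrable lborel {a..b} f"
    using assms(3) by (intro set_integrable_cong) auto
  finally show ?thesis .
qed

text \<open>In the integrated forward equation \<open>p s v\<close> is replaced by the identity
  matrix. Each of the \<open>CARD('s)\<close> entries is off by at most L (t - s) and is multiplied
  by a rate of at most q, which gives an integrand error of L^2 (t - s).\<close>

lemma p_first_order:
  assumes st: "0 \<le> s" "s \<le> t" and xy: "x \<noteq> y"
  shows "\<bar>p s t x y - (LINT v:{s..t}|lborel. Q v x y)\<bar> \<le> L\<^sup>2 * (t - s)\<^sup>2"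
proof -
  have "set_integrable lborel {s..t} (\<lambda>v. Q v x y)"
    by (rule set_integrable_bounded_on_interval[OF Q_measurable Q_bound st(1)])
  from set_borel_integral_eq_integral[OF this]
  have Qi: "((\<lambda>v. Q v x y) has_integral (LINT v:{s..t}|lborel. Q v x y)) {s..t}"
    by (simp add: has_integral_integrable_integral)
  have I: "((\<lambda>v. (\<Sum>z\<in>UNIV. p s v x z * Q v z y) - Q v x y) has_integral
      (p s t x y - of_bool (x = y) - (LINT v:{s..t}|lborel. Q v x y))) {s..t}"
    by (rule has_integral_diff[OF p_forward[OF st] Qi])
  have "\<bar>(\<Sum>z\<in>UNIV. p s v x z * Q v z y) - Q v x y\<bar> \<le> L\<^sup>2 * (t - s)" if v: "v \<in> {s..t}" for v
  proof -
    have "(\<Sum>z\<in>UNIV. p s v x z * Q v z y) - Q v x y = (\<Sum>z\<in>UNIV. (p s v x z - of_bool (x = z)) * Q v z y)"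
      by (simp add: left_diff_distrib sum_subtractf of_bool_def if_distrib[of "\<lambda>a. a * _"] cong: if_cong)
    also have "\<bar>\<dots>\<bar> \<le> (\<Sum>z\<in>UNIV. \<bar>(p s v x z - of_bool (x = z)) * Q v z y\<bar>)" by (rule sum_abs)
    also have "\<dots> \<le> (\<Sum>z\<in>(UNIV :: 's set). (L * (t - s)) * q)"
    proof (rule sum_mono)
      fix z
      have "\<bar>p s v x z - of_bool (x = z)\<bar> \<le> L * (v - s)" using v st by (intro p_near_identity) auto
      also have "\<dots> \<le> L * (t - s)" using v L_nonneg by (intro mult_left_mono) auto
      finally show "\<bar>(p s v x z - of_bool (x = z)) * Q v z y\<bar> \<le> (L * (t - s)) * q"
        unfolding abs_mult using Q_bound v st L_nonneg by (intro mult_mono) auto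
    qed
    also have "\<dots> = L\<^sup>2 * (t - s)" by (simp add: L_def power2_eq_square)
    finally show ?thesis .
  qed
  then have "norm (p s t x y - of_bool (x = y) - (LINT v:{s..t}|lborel. Q v x y)) \<le> L\<^sup>2 * (t - s) * measure lborel {s..t}"
    using st by (intro has_integral_bound_real[OF _ finite.emptyI I]) auto
  then show ?thesis using st xy by (simp add: power2_eq_square mult.assoc content_real)
qed

end

subsection \<open>Exponential ergodicity\<close>

text \<open>E is a set of transitions whose rates stay above c0 at all times. This makes the lower
  bounds on \<open>p\<close> below uniform in the starting time, as the inhomogeneous chain
  requires.\<close>

locale ergodic_transitions = bounded_rate_transitions Q p q
  for Q :: "real \<Rightarrow> 's::finite \<Rightarrow> 's \<Rightarrow> real" and p q +
  fixes E :: "('s \<times> 's) set" and c0 :: real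
  assumes c0: "0 < c0" and E_rate: "\<And>x y t. (x, y) \<in> E \<Longrightarrow> 0 \<le> t \<Longrightarrow> c0 \<le> Q t x y"
    and E_irred: "\<And>x y. (x, y) \<in> E\<^sup>*"
begin

text \<open>The reflexive closure includes staying put. That is what later allows paths of different
  lengths to be compared.\<close>

lemma one_step_lower_bound:
  obtains \<delta> \<epsilon> where "0 < \<delta>" "0 < \<epsilon>" "\<And>s x y. 0 \<le> s \<Longrightarrow> (x, y) \<in> E\<^sup>= \<Longrightarrow> \<epsilon> \<le> p s (s + \<delta>) x y"
proof -
  \<comment> \<open>The first bound gives L \<delta> \<le> 1/2, so the chain stays put with
    probability at least 1/2. The second gives L^2 \<delta>^2 \<le> c0 \<delta> / 2, so the error in
    \<open>p_first_order\<close> eats at most half of the main term. The summand 1 guards against L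
    = 0.\<close>
  define \<delta> where "\<delta> = min (1 / (2 * L + 1)) (c0 / (2 * L\<^sup>2 + 1))"
  define \<epsilon> where "\<epsilon> = min (1 / 2) (c0 * \<delta> / 2)"
  have L2: "0 < 2 * L + 1" "0 < 2 * L\<^sup>2 + 1" using L_nonneg by (auto intro: add_nonneg_pos)
  have \<delta>: "0 < \<delta>" using c0 L2 by (simp add: \<delta>_def)
  show ?thesis
  proof (rule that[of \<delta> \<epsilon>])
    show "0 < \<delta>" "0 < \<epsilon>" using \<delta> c0 by (simp_all add: \<epsilon>_def)
    fix s :: real and x y assume s: "0 \<le> s" and xy: "(x, y) \<in> E\<^sup>="
    show "\<epsilon> \<le> p s (s + \<delta>) x y"
    proof (cases "x = y")
      case True
      have "\<delta> \<le> 1 / (2 * L + 1)" by (simp add: \<delta>_def)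
      then have "\<delta> * (2 * L + 1) \<le> 1" using L2 by (simp add: pos_le_divide_eq)
      then have "L * \<delta> \<le> 1 / 2" using \<delta> by (simp add: algebra_simps)
      then show ?thesis using p_near_identity[of s "s + \<delta>" x y] s \<delta> True
        by (simp add: \<epsilon>_def abs_le_iff min_le_iff_disj)
    next
      case False
      have "c0 * \<delta> \<le> (LINT v:{s..s + \<delta>}|lborel. Q v x y)"
      proof -
        have "(LINT v:{s..s + \<delta>}|lborel. c0) \<le> (LINT v:{s..s + \<delta>}|lborel. Q v x y)"
          using s xy False E_rate
          by (intro set_integral_mono set_integrable_bounded_on_interval[of _ q] Q_bound Q_measurable
              set_integrable_bounded_on_interval[of _ c0]) (use c0 in auto)
        then show ?thesis using \<delta> by (simp add: mult.commute set_lebesgue_integral_def)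
      qed
      moreover have "L\<^sup>2 * \<delta>\<^sup>2 \<le> c0 * \<delta> / 2"
      proof -
        have "\<delta> \<le> c0 / (2 * L\<^sup>2 + 1)" by (simp add: \<delta>_def)
        then have "\<delta> * (2 * L\<^sup>2 + 1) \<le> c0" using L2 by (simp add: pos_le_divide_eq)
        then have "L\<^sup>2 * \<delta> \<le> c0 / 2" using \<delta> by (simp add: algebra_simps)
        from mult_right_mono[OF this, of \<delta>] show ?thesis using \<delta> by (simp add: power2_eq_square mult.assoc)
      qed
      ultimately show ?thesis
        using p_first_order[of s "s + \<delta>" x y] s \<delta> False by (simp add: \<epsilon>_def abs_le_iff min_le_iff_disj)
    qed
  qed
qed

text \<open>Paths between different pairs of states have different lengths; waiting steps pad all of
  them to one common length n, and then every entry is at least \<epsilon>^n over n steps of length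
  \<delta>.\<close>

lemma doeblin:
  obtains h \<eta> where "0 < h" "0 < \<eta>" "\<And>s x y. 0 \<le> s \<Longrightarrow> \<eta> \<le> p s (s + h) x y"
proof -
  obtain \<delta> \<epsilon> where \<delta>: "0 < \<delta>" and \<epsilon>: "0 < \<epsilon>"
    and step: "\<And>s x y. 0 \<le> s \<Longrightarrow> (x, y) \<in> E\<^sup>= \<Longrightarrow> \<epsilon> \<le> p s (s + \<delta>) x y"
    by (rule one_step_lower_bound) blast
  have power: "\<epsilon> ^ n \<le> p s (s + real n * \<delta>) x y" if "0 \<le> s" "(x, y) \<in> (E\<^sup>=) ^^ n" for n s x y
    using that(2)
  proof (induction n arbitrary: y)
    case 0
    then show ?case using p_refl[OF that(1)] by simp
  next
    case (Suc n)
    then obtain z where z: "(x, z) \<in> (E\<^sup>=) ^^ n" "(z, y) \<in> E\<^sup>=" by auto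
    let ?u = "s + real n * \<delta>"
    have u: "s \<le> ?u" "0 \<le> ?u" "?u \<le> s + real (Suc n) * \<delta>" "s + real (Suc n) * \<delta> = ?u + \<delta>"
      using \<delta> that(1) by (auto simp: algebra_simps)
    have "\<epsilon> ^ Suc n \<le> p s ?u x z * p ?u (?u + \<delta>) z y"
      using mult_mono[OF Suc.IH[OF z(1)] step[OF u(2) z(2)]] \<epsilon> p_nonneg[OF that(1) u(1)] by (simp add: mult.commute)
    also have "\<dots> \<le> (\<Sum>z\<in>UNIV. p s ?u x z * p ?u (?u + \<delta>) z y)"
      using that(1) u \<delta> by (intro member_le_sum) (auto intro!: mult_nonneg_nonneg p_nonneg)
    also have "\<dots> = p s (s + real (Suc n) * \<delta>) x y"
      unfolding u(4) by (rule p_chapman[symmetric]) (use that(1) u(1) \<delta> in auto)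
    finally show ?case .
  qed
  have "\<exists>n. (x, y) \<in> (E\<^sup>=) ^^ n" for x y
  proof -
    have "(x, y) \<in> (E\<^sup>=)\<^sup>*" using E_irred[of x y] by (simp add: rtrancl_reflcl)
    then show ?thesis by (rule rtrancl_imp_relpow)  qed
  then obtain l where l: "\<And>x y. (x, y) \<in> (E\<^sup>=) ^^ l x y" by metis
  \<comment> \<open>\<open>Suc\<close> keeps n positive even if all path lengths are 0, so that the
    time span n \<delta> is positive.\<close>
  define n where "n = Suc (Max (range (\<lambda>(x, y). l x y)))"
  have ln: "l x y \<le> n" for x y
  proof -
    have "l x y \<le> Max (range (\<lambda>(x, y). l x y))" by (intro Max_ge) (auto intro: image_eqI[of _ _ "(x, y)"])
    then show ?thesis by (simp add: n_def)
  qed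
  have pad: "(x, y) \<in> (E\<^sup>=) ^^ (m + k)" if "(x, y) \<in> (E\<^sup>=) ^^ m" for m k x y
    using that by (induction k) auto
  have "(x, y) \<in> (E\<^sup>=) ^^ n" for x y
    using pad[OF l, of x y "n - l x y"] ln by simp
  then show ?thesis
    by (intro that[of "real n * \<delta>" "\<epsilon> ^ n"] power) (use \<delta> \<epsilon> n_def in auto)
qed

text \<open>Averaging over one step of length h shrinks the oscillation of a function by the factor
  \<kappa>, whatever the starting time. Iterating over whole steps, with an incomplete step that
  does not increase the oscillation, gives exponential decay.\<close>

lemma ergodic:
  obtains C \<alpha> where "0 < \<alpha>" "0 \<le> C"
    "\<And>s t x x' f B. 0 \<le> s \<Longrightarrow> s \<le> t \<Longrightarrow> (\<And>y. \<bar>f y\<bar> \<le> B) \<Longrightarrow>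
       \<bar>(\<Sum>y\<in>UNIV. p s t x y * f y) - (\<Sum>y\<in>UNIV. p s t x' y * f y)\<bar> \<le> C * B * exp (- \<alpha> * (t - s))"
proof -
  obtain h \<eta>0 where h: "0 < h" and \<eta>0: "0 < \<eta>0" and low0: "\<And>s x y. 0 \<le> s \<Longrightarrow> \<eta>0 \<le> p s (s + h) x y"
    by (rule doeblin) blast
  \<comment> \<open>Capping at 1/2 keeps \<kappa> at least 1/2: its logarithm exists, and 1/\<kappa>
    is at most 2.\<close>
  define \<eta> where "\<eta> = min \<eta>0 (1 / 2)"
  have \<eta>: "0 < \<eta>" "\<eta> \<le> 1 / 2" and low: "\<And>s x y. 0 \<le> s \<Longrightarrow> \<eta> \<le> p s (s + h) x y"
    using \<eta>0 low0 by (auto simp: \<eta>_def intro: min.coboundedI1)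
  define \<kappa> where "\<kappa> = 1 - \<eta>"
  have \<kappa>: "1 / 2 \<le> \<kappa>" "\<kappa> < 1" using \<eta> by (auto simp: \<kappa>_def)
  define P where "P s t f x = (\<Sum>y\<in>UNIV. p s t x y * f y)" for s t f and x :: 's
  have comp: "P s t f = P s u (P u t f)" if "0 \<le> s" "s \<le> u" "u \<le> t" for s u t f
  proof
    fix x
    have "P s t f x = (\<Sum>y\<in>UNIV. \<Sum>z\<in>UNIV. p s u x z * p u t z y * f y)"
      unfolding P_def by (simp add: p_chapman[OF that] sum_distrib_right)
    also have "\<dots> = (\<Sum>z\<in>UNIV. \<Sum>y\<in>UNIV. p s u x z * p u t z y * f y)" by (rule sum.swap)
    also have "\<dots> = P s u (P u t f) x" unfolding P_def by (simp add: sum_distrib_left mult.assoc)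
    finally show "P s t f x = P s u (P u t f) x" .
  qed
  have osc0: "P s t f x - P s t f x' \<le> d" if st: "0 \<le> s" "s \<le> t" and f: "\<And>y y'. f y - f y' \<le> d" for s t f x x' d
  proof -
    obtain m where m: "\<And>y. f m \<le> f y" using ex_min_if_finite[of "range f"] by (metis finite rangeE rangeI finite_imageI UNIV_not_empty image_is_empty linorder_not_le)
    have "P s t f x - f m = (\<Sum>y\<in>UNIV. p s t x y * (f y - f m))"
      unfolding P_def using p_sum[OF st, of x] by (simp add: right_diff_distrib sum_subtractf sum_distrib_right[symmetric])
    also have "\<dots> \<le> (\<Sum>y\<in>UNIV. p s t x y * d)"
      using f p_nonneg[OF st] by (intro sum_mono mult_left_mono) auto
    finally have 1: "P s t f x - f m \<le> d" using p_sum[OF st, of x] by (simp add: sum_distrib_right[symmetric])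
    have "P s t f x' - f m = (\<Sum>y\<in>UNIV. p s t x' y * (f y - f m))"
      unfolding P_def using p_sum[OF st, of x'] by (simp add: right_diff_distrib sum_subtractf sum_distrib_right[symmetric])
    also have "0 \<le> \<dots>" using m p_nonneg[OF st] by (intro sum_nonneg) auto
    finally show ?thesis using 1 by simp
  qed
  have contract: "P s (s + h) f x - P s (s + h) f x' \<le> \<kappa> * d" if s: "0 \<le> s" and f: "\<And>y y'. f y - f y' \<le> d" for s f x x' d
  proof -
    let ?w = "\<lambda>x y. p s (s + h) x y - \<eta>"
    have st: "0 \<le> s" "s \<le> s + h" using s h by auto
    have d: "0 \<le> d" using f[of undefined undefined] by simp
    obtain m where m: "\<And>y. f m \<le> f y" using ex_min_if_finite[of "range f"] by (metis finite rangeE rangeI finite_imageI UNIV_not_empty image_is_empty linorder_not_le)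
    have w: "0 \<le> ?w x y" for x y using low[OF s] by simp
    \<comment> \<open>The mass \<eta> is split off from every entry. This part contributes the same
      for every x, and the remaining weights are nonnegative with total mass 1 -
      \<open>CARD('s)\<close> \<eta> \<le> \<kappa>. Subtracting the minimum f m makes all terms
      nonnegative.\<close>
    have eq: "P s (s + h) f x = (\<Sum>y\<in>UNIV. ?w x y * (f y - f m)) + (f m + \<eta> * (\<Sum>y\<in>UNIV. f y - f m))" for x
    proof -
      define k where "k = p s (s + h) x"
      have "(\<Sum>y\<in>UNIV. (k y - \<eta>) * (f y - f m))
          = (\<Sum>y\<in>UNIV. k y * f y) - (\<Sum>y\<in>UNIV. k y) * f m - \<eta> * (\<Sum>y\<in>UNIV. f y - f m)"
        by (simp add: algebra_simps sum_subtractf sum.distrib sum_distrib_left sum_distrib_right)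
      then show ?thesis using p_sum[OF st, of x] by (simp add: P_def k_def)
    qed
    have "(\<Sum>y\<in>UNIV. ?w x y * (f y - f m)) \<le> (\<Sum>y\<in>UNIV. ?w x y * d)"
      using f w by (intro sum_mono mult_left_mono) auto
    also have "\<dots> = (1 - real CARD('s) * \<eta>) * d"
      using p_sum[OF st, of x] by (simp add: sum_distrib_right[symmetric] sum_subtractf)
    also have "\<dots> \<le> \<kappa> * d"
    proof -
      have "1 * \<eta> \<le> real CARD('s) * \<eta>" using \<eta> by (intro mult_right_mono) (auto simp: Suc_le_eq)
      then show ?thesis using d by (intro mult_right_mono) (auto simp: \<kappa>_def)
    qed
    finally have "(\<Sum>y\<in>UNIV. ?w x y * (f y - f m)) \<le> \<kappa> * d" .
    moreover have "0 \<le> (\<Sum>y\<in>UNIV. ?w x' y * (f y - f m))" using w m by (intro sum_nonneg) auto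
    ultimately show ?thesis by (simp add: eq)
  qed
  have iter: "P s (s + real k * h) f x - P s (s + real k * h) f x' \<le> \<kappa> ^ k * d"
    if s: "0 \<le> s" and f: "\<And>y y'. f y - f y' \<le> d" for s f x x' d k
    using s
  proof (induction k arbitrary: s x x')
    case 0
    then show ?case using f by (simp add: P_def p_refl if_distrib[of "\<lambda>a. a * _"] of_bool_def cong: if_cong)
  next
    case (Suc k)
    have e: "s + real (Suc k) * h = s + h + real k * h" by (simp add: algebra_simps)
    have "0 \<le> s + h" using Suc.prems h by simp
    then have "P (s + h) (s + h + real k * h) f y - P (s + h) (s + h + real k * h) f y' \<le> \<kappa> ^ k * d" for y y'
      by (rule Suc.IH)
    from contract[OF Suc.prems this, where x=x and x'=x']
    show ?case unfolding e using comp[of s "s + h" "s + h + real k * h" f] Suc.prems h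
      by (simp add: mult.assoc)
  qed
  \<comment> \<open>With this choice \<kappa> raised to (t - s) / h is exp(-\<alpha> (t - s)).
    Rounding the exponent down to an integer costs at most the factor 1/\<kappa> \<le> 2.\<close>
  define \<alpha> where "\<alpha> = - ln \<kappa> / h"
  have \<alpha>: "0 < \<alpha>" using \<kappa> h by (simp add: \<alpha>_def divide_neg_pos)
  have decay: "P s t f x - P s t f x' \<le> 2 * exp (- \<alpha> * (t - s)) * d"
    if st: "0 \<le> s" "s \<le> t" and f: "\<And>y y'. f y - f y' \<le> d" for s t f x x' d
  proof -
    define k where "k = nat \<lfloor>(t - s) / h\<rfloor>"
    have d: "0 \<le> d" using f[of undefined undefined] by simp
    have k: "real k \<le> (t - s) / h" "(t - s) / h < real k + 1" using st h by (auto simp: k_def)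
    have le: "s + real k * h \<le> t" using k(1) h by (simp add: field_simps)
    have "\<kappa> ^ k = exp (real k * ln \<kappa>)" using \<kappa> by (simp add: exp_of_nat_mult)
    also have "\<dots> \<le> exp (((t - s) / h - 1) * ln \<kappa>)"
      using k \<kappa> by (intro exp_mono mult_right_mono_neg) auto
    also have "\<dots> = exp (- \<alpha> * (t - s)) / \<kappa>"
    proof -
      have "((t - s) / h - 1) * ln \<kappa> = - \<alpha> * (t - s) - ln \<kappa>" by (simp add: \<alpha>_def algebra_simps)
      then show ?thesis using \<kappa> by (simp add: exp_diff)
    qed
    also have "\<dots> \<le> 2 * exp (- \<alpha> * (t - s))"
      using \<kappa> by (simp add: field_simps)
    finally have \<kappa>k: "\<kappa> ^ k \<le> 2 * exp (- \<alpha> * (t - s))" .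
    have "P s (s + real k * h) (P (s + real k * h) t f) x - P s (s + real k * h) (P (s + real k * h) t f) x' \<le> \<kappa> ^ k * d"
      using st le h by (intro iter osc0 f) auto
    then have "P s t f x - P s t f x' \<le> \<kappa> ^ k * d"
      using comp[of s "s + real k * h" t f] st le h by simp
    also have "\<dots> \<le> 2 * exp (- \<alpha> * (t - s)) * d" using \<kappa>k d by (rule mult_right_mono)
    finally show ?thesis .
  qed
  show ?thesis
  \<comment> \<open>One factor 2 comes from the rounding in \<open>decay\<close>, the other from the
    oscillation of f being at most 2 B.\<close>
  proof (rule that[of \<alpha> 4])
    fix s t :: real and x x' :: 's and f :: "'s \<Rightarrow> real" and B
    assume st: "0 \<le> s" "s \<le> t" and f: "\<And>y. \<bar>f y\<bar> \<le> B"
    have "f y - f y' \<le> 2 * B" for y y' using f[of y] f[of y'] by (auto simp: abs_le_iff)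
    from decay[OF st this, where x=x and x'=x'] decay[OF st this, where x=x' and x'=x]
    show "\<bar>(\<Sum>y\<in>UNIV. p s t x y * f y) - (\<Sum>y\<in>UNIV. p s t x' y * f y)\<bar> \<le> 4 * B * exp (- \<alpha> * (t - s))"
      by (auto simp: P_def abs_le_iff algebra_simps)
  qed (use \<alpha> in auto)
qed

end

subsection \<open>Sums over the deterministic reward times\<close>

text \<open>The indices with \<tau> i > t form a tail, and its j-th member lies at least j a after
  t; the sum is dominated by a geometric series of ratio exp(-\<alpha> a), with a bound independent
  of t.\<close>

lemma sum_exp_separated:
  fixes \<tau> :: "nat \<Rightarrow> real" and f :: "nat \<Rightarrow> real"
  assumes \<tau>: "strict_mono \<tau>" "filterlim \<tau> at_top sequentially" and a: "0 < a" "\<And>i. a \<le> \<tau> (Suc i) - \<tau> i"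
    and \<alpha>: "0 < \<alpha>" and f: "\<And>i. t < \<tau> i \<Longrightarrow> \<bar>f i\<bar> \<le> C * exp (- \<alpha> * (\<tau> i - t))" and C: "0 \<le> C"
  shows "f summable_on {i. t < \<tau> i}" "\<bar>\<Sum>\<^sub>\<infinity>i\<in>{i. t < \<tau> i}. f i\<bar> \<le> C / (1 - exp (- \<alpha> * a))"
proof -
  have ex: "\<exists>i. t < \<tau> i" using \<tau>(2) by (metis filterlim_at_top_dense eventually_sequentially order_refl)
  define i0 where "i0 = (LEAST i. t < \<tau> i)"
  have i0: "t < \<tau> i0" unfolding i0_def using ex by (rule LeastI_ex)
  have set: "{i. t < \<tau> i} = {i0..}"
  proof (intro set_eqI iffI)
    fix i assume "i \<in> {i. t < \<tau> i}"
    then show "i \<in> {i0..}" by (simp add: i0_def Least_le)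
  next
    fix i assume "i \<in> {i0..}"
    then have "\<tau> i0 \<le> \<tau> i" using \<tau>(1) by (simp add: strict_mono_less_eq)
    then show "i \<in> {i. t < \<tau> i}" using i0 by simp
  qed
  define r where "r = exp (- \<alpha> * a)"
  have r: "0 < r" "r < 1" using a \<alpha> by (auto simp: r_def)
  have grow: "\<tau> i0 + real j * a \<le> \<tau> (i0 + j)" for j
  proof (induction j)
    case (Suc j)
    then show ?case using a(2)[of "i0 + j"] by (simp add: algebra_simps)
  qed simp
  have fj: "norm (f (i0 + j)) \<le> C * r ^ j" for j
  proof -
    have "real j * a \<le> \<tau> (i0 + j) - t" using grow[of j] i0 by simp
    then have "exp (- \<alpha> * (\<tau> (i0 + j) - t)) \<le> exp (- \<alpha> * (real j * a))" using \<alpha> by simp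
    also have "\<dots> = exp (real j * (- \<alpha> * a))" by (simp add: ac_simps)
    also have "\<dots> = r ^ j" unfolding r_def by (rule exp_of_nat_mult)
    finally have "C * exp (- \<alpha> * (\<tau> (i0 + j) - t)) \<le> C * r ^ j" using C by (rule mult_left_mono)
    moreover have "i0 + j \<in> {i. t < \<tau> i}" unfolding set by simp
    then have "t < \<tau> (i0 + j)" by simp
    ultimately show ?thesis using f[of "i0 + j"] by simp
  qed
  have geo: "summable (\<lambda>j. C * r ^ j)" using r by (intro summable_mult summable_geometric) simp
  have sn: "summable (\<lambda>j. norm (f (i0 + j)))"
    by (rule summable_comparison_test'[OF geo, of 0]) (use fj in auto)
  have hs: "((\<lambda>j. f (i0 + j)) has_sum (\<Sum>j. f (i0 + j))) UNIV"
    by (rule norm_summable_imp_has_sum[OF sn summable_sums[OF summable_norm_cancel[OF sn]]])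
  have bij: "bij_betw (\<lambda>j. i0 + j) UNIV {i0..}"
    by (rule bij_betw_byWitness[where f'="\<lambda>i. i - i0"]) auto
  have hs': "(f has_sum (\<Sum>j. f (i0 + j))) {i. t < \<tau> i}"
    using hs unfolding set has_sum_reindex_bij_betw[OF bij] .
  then show "f summable_on {i. t < \<tau> i}" by (rule has_sum_imp_summable)
  have "\<bar>\<Sum>j. f (i0 + j)\<bar> \<le> (\<Sum>j. norm (f (i0 + j)))" using summable_norm[OF sn] by simp
  also have "\<dots> \<le> (\<Sum>j. C * r ^ j)" by (rule suminf_le[OF _ sn geo]) (rule fj)
  also have "\<dots> = C / (1 - r)" using r by (simp add: suminf_mult suminf_geometric summable_geometric)
  finally show "\<bar>\<Sum>\<^sub>\<infinity>i\<in>{i. t < \<tau> i}. f i\<bar> \<le> C / (1 - exp (- \<alpha> * a))"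
    using infsumI[OF hs'] by (simp add: r_def)
qed

subsection \<open>Generated \<open>\<sigma>\<close>-algebras\<close>

lemma space_generated_by [simp]: "space (generated_by M E Y I) = space M"
  unfolding generated_by_def by (rule space_measure_of) auto

lemma sets_generated_by:
  "sets (generated_by M E Y I) = sigma_sets (space M) (\<Union>s\<in>I. {Y s -` A \<inter> space M |A. A \<in> sets E})"
  unfolding generated_by_def by (rule sets_measure_of) auto

lemma measurable_generated_by:
  assumes "s \<in> I" "\<And>\<omega>. \<omega> \<in> space M \<Longrightarrow> Y s \<omega> \<in> space E"
  shows "Y s \<in> measurable (generated_by M E Y I) E"
proof (rule measurableI)
  show "Y s -` A \<inter> space (generated_by M E Y I) \<in> sets (generated_by M E Y I)" if "A \<in> sets E" for A
    unfolding sets_generated_by space_generated_by using assms(1) that by (intro sigma_sets.Basic) auto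
qed (use assms in auto)

lemma sets_generated_by_subset:
  assumes "space N = space M" "\<And>s. s \<in> I \<Longrightarrow> Y s \<in> measurable N E"
  shows "sets (generated_by M E Y I) \<subseteq> sets N"
  unfolding sets_generated_by assms(1)[symmetric]
  using assms(2) by (intro sets.sigma_sets_subset) (auto intro: measurable_sets)

lemma subalgebra_generated_by:
  assumes "space N = space M" "\<And>s. s \<in> I \<Longrightarrow> Y s \<in> measurable N E"
  shows "subalgebra N (generated_by M E Y I)"
  unfolding subalgebra_def using sets_generated_by_subset[OF assms] assms(1) by simp

subsection \<open>Paths observed up to a given time\<close>

text \<open>An event time is not observable at s if the event comes later, so it is set to 0 in that
  case. Where the event has occurred, its time is at most a iff it is at most
  \<open>min a s\<close>, a statement about the count at an observed time.\<close>

lemma masked_event_time_measurable: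
  assumes f: "\<And>\<omega>. \<omega> \<in> space F \<Longrightarrow> step_path (f \<omega>)" and s: "0 \<le> s"
    and m: "\<And>u. 0 \<le> u \<Longrightarrow> u \<le> s \<Longrightarrow> (\<lambda>\<omega>. f \<omega> u) \<in> measurable F (count_space UNIV)"
  shows "(\<lambda>\<omega>. if k \<le> f \<omega> s then event_time (f \<omega>) k else 0) \<in> borel_measurable F"
proof (rule borel_measurableI_le)
  fix a :: real
  show "{\<omega> \<in> space F. (if k \<le> f \<omega> s then event_time (f \<omega>) k else 0) \<le> a} \<in> sets F"
  proof (cases "0 \<le> a")
    case False
    have "0 \<le> (if k \<le> f \<omega> s then event_time (f \<omega>) k else 0)" if "\<omega> \<in> space F" for \<omega>
      using event_time_nonneg event_occursI[OF s] by auto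
    then have "{\<omega> \<in> space F. (if k \<le> f \<omega> s then event_time (f \<omega>) k else 0) \<le> a} = {}"
      using False by force
    then show ?thesis by (simp only: sets.empty_sets)
  next
    case True
    have "(if k \<le> f \<omega> s then event_time (f \<omega>) k else 0) \<le> a \<longleftrightarrow> \<not> k \<le> f \<omega> s \<or> k \<le> f \<omega> (min a s)"
      if w: "\<omega> \<in> space F" for \<omega>
    proof (cases "k \<le> f \<omega> s")
      case k: True
      have oc: "event_occurs (f \<omega>) k" using event_occursI[of s k "f \<omega>"] s k by blast
      have "event_time (f \<omega>) k \<le> s" using event_time_le_iff[OF f[OF w] oc s] k by simp
      then have "event_time (f \<omega>) k \<le> a \<longleftrightarrow> event_time (f \<omega>) k \<le> min a s" by simp
      also have "\<dots> \<longleftrightarrow> k \<le> f \<omega> (min a s)"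
        by (rule event_time_le_iff[OF f[OF w] oc]) (use True s in simp)
      finally show ?thesis using k by simp
    qed (use True in simp)
    then have "{\<omega> \<in> space F. (if k \<le> f \<omega> s then event_time (f \<omega>) k else 0) \<le> a}
       = {\<omega> \<in> space F. \<not> k \<le> f \<omega> s \<or> k \<le> f \<omega> (min a s)}" by blast
    also have "\<dots> \<in> sets F"
    proof -
      have [measurable]: "(\<lambda>\<omega>. f \<omega> s) \<in> measurable F (count_space UNIV)" "(\<lambda>\<omega>. f \<omega> (min a s)) \<in> measurable F (count_space UNIV)"
        using m s True by auto
      show ?thesis by measurable
    qed
    finally show ?thesis .
  qed
qed

text \<open>Stated for any \<sigma>-algebra that sees X up to s; it is instantiated with the history
  of X, with that of (X, N), and with the full space.\<close>

locale observed_paths =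
  fixes F :: "'w measure" and X :: "real \<Rightarrow> 'w \<Rightarrow> 's::finite" and s :: real
  assumes s_nonneg: "0 \<le> s"
    and X_obs: "\<And>u. 0 \<le> u \<Longrightarrow> u \<le> s \<Longrightarrow> X u \<in> measurable F (count_space UNIV)"
    and X_jump_path: "\<And>\<omega>. \<omega> \<in> space F \<Longrightarrow> jump_path (\<lambda>t. X t \<omega>)"
begin

lemma joint_measurable:
  "(\<lambda>(\<omega>, t). X (max 0 (min s t)) \<omega>) \<in> measurable (F \<Otimes>\<^sub>M borel) (count_space UNIV)"
proof (rule progressive_measurable)
  show "X (max 0 (min s t)) \<in> measurable F (count_space UNIV)" for t
    using s_nonneg by (intro X_obs) auto
  show "right_continuous_path (\<lambda>t. X t \<omega>)" if "\<omega> \<in> space F" for \<omega>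
    using jump_path_right_continuous[OF X_jump_path[OF that]] .
  show "mono (\<lambda>t::real. max 0 (min s t))" by (auto intro!: monoI)
  show "continuous_on UNIV (\<lambda>t::real. max 0 (min s t))" by (intro continuous_intros)
qed auto

lemma observe_at_measurable:
  assumes \<theta>: "\<theta> \<in> borel_measurable F" and range: "\<And>\<omega>. \<omega> \<in> space F \<Longrightarrow> 0 \<le> \<theta> \<omega> \<and> \<theta> \<omega> \<le> s"
  shows "(\<lambda>\<omega>. X (\<theta> \<omega>) \<omega>) \<in> measurable F (count_space UNIV)"
proof -
  have "(\<lambda>\<omega>. (\<omega>, \<theta> \<omega>)) \<in> measurable F (F \<Otimes>\<^sub>M borel)" using \<theta> by measurable
  from measurable_compose[OF this joint_measurable]
  have "(\<lambda>\<omega>. X (max 0 (min s (\<theta> \<omega>))) \<omega>) \<in> measurable F (count_space UNIV)" by simp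
  also have "?this \<longleftrightarrow> ?thesis"
  proof (rule measurable_cong)
    fix \<omega> assume "\<omega> \<in> space F"
    then have "max 0 (min s (\<theta> \<omega>)) = \<theta> \<omega>" using range[of \<omega>] by (simp add: max_absorb2 min_absorb2)
    then show "X (max 0 (min s (\<theta> \<omega>))) \<omega> = X (\<theta> \<omega>) \<omega>" by simp
  qed
  finally show ?thesis .
qed

text \<open>On each path the jump count is the eventual value of grid counts, which look at X only
  at finitely many times up to u.\<close>

lemma jump_count_measurable:
  assumes u: "0 \<le> u" "u \<le> s"
  shows "(\<lambda>\<omega>. jump_count (\<lambda>t. X t \<omega>) u) \<in> measurable F (count_space UNIV)"
proof -
  let ?S = "{z :: 's \<times> 's. fst z \<noteq> snd z}"
  let ?a = "\<lambda>n \<omega>. \<Sum>z\<in>?S. \<Sum>i<n. of_bool (X (grid 0 u n i) \<omega> = fst z \<and> X (grid 0 u n (Suc i)) \<omega> = snd z) :: real"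
  have "(\<lambda>\<omega>. real (jump_count (\<lambda>t. X t \<omega>) u)) \<in> borel_measurable F"
  proof (rule borel_measurable_LIMSEQ_real[of F "\<lambda>n. ?a (Suc n)"])
    show "?a (Suc n) \<in> borel_measurable F" for n
    proof (intro borel_measurable_sum)
      fix z :: "'s \<times> 's" and i assume "i \<in> {..<Suc n}"
      then have [measurable]: "X (grid 0 u (Suc n) i) \<in> measurable F (count_space UNIV)"
        "X (grid 0 u (Suc n) (Suc i)) \<in> measurable F (count_space UNIV)"
        using grid_bounds[of 0 u i "Suc n"] grid_bounds[of 0 u "Suc i" "Suc n"] u
        by (auto intro!: X_obs)
      show "(\<lambda>\<omega>. of_bool (X (grid 0 u (Suc n) i) \<omega> = fst z \<and> X (grid 0 u (Suc n) (Suc i)) \<omega> = snd z) :: real) \<in> borel_measurable F"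
        by measurable
    qed
  next
    fix \<omega> assume w: "\<omega> \<in> space F"
    let ?g = "\<lambda>t. X t \<omega>"
    note g = X_jump_path[OF w]
    have "\<forall>\<^sub>F n in sequentially. ?a n \<omega> = real (jump_count ?g u)"
      using grid_count_all_jumps[OF g order.refl u(1)] step_path_0[OF step_path_jump_count[OF g]] by simp
    then have "(\<lambda>n. ?a n \<omega>) \<longlonglongrightarrow> real (jump_count ?g u)" by (rule tendsto_eventually)
    then show "(\<lambda>n. ?a (Suc n) \<omega>) \<longlonglongrightarrow> real (jump_count ?g u)" by (rule LIMSEQ_Suc)
  qed
  \<comment> \<open>The limit was taken among real functions; the floor returns to a variable with
    discrete range.\<close>
  then have "(\<lambda>\<omega>. nat \<lfloor>real (jump_count (\<lambda>t. X t \<omega>) u)\<rfloor>) \<in> measurable F (count_space UNIV)" by measurable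
  then show ?thesis by simp
qed

lemma masked_jump_time_measurable:
  "(\<lambda>\<omega>. if k \<le> jump_count (\<lambda>t. X t \<omega>) s then jump_time (\<lambda>t. X t \<omega>) k else 0) \<in> borel_measurable F"
  unfolding jump_time_def
  by (rule masked_event_time_measurable[OF step_path_jump_count[OF X_jump_path] s_nonneg jump_count_measurable])

lemma masked_jump_chain_measurable:
  "(\<lambda>\<omega>. if k \<le> jump_count (\<lambda>t. X t \<omega>) s then jump_chain (\<lambda>t. X t \<omega>) k else X 0 \<omega>) \<in> measurable F (count_space UNIV)"
proof -
  let ?\<theta> = "\<lambda>\<omega>. if k \<le> jump_count (\<lambda>t. X t \<omega>) s then jump_time (\<lambda>t. X t \<omega>) k else 0"
  have "(\<lambda>\<omega>. X (?\<theta> \<omega>) \<omega>) \<in> measurable F (count_space UNIV)"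
    by (rule observe_at_measurable[OF masked_jump_time_measurable])
       (use s_nonneg in \<open>auto simp: jump_time_def intro: event_time_le event_time_nonneg event_occursI\<close>)
  then show ?thesis by (simp add: jump_chain_def if_distrib[of "\<lambda>t. X t _"] cong: if_cong)
qed

text \<open>The integrand is a Borel function of time for each of finitely many states, composed
  with the jointly measurable clamped path; on [u, v] the clamp changes nothing.\<close>

lemma path_integral_measurable:
  fixes \<phi> :: "real \<Rightarrow> 's \<Rightarrow> real"
  assumes \<phi>: "\<And>x. (\<lambda>t. \<phi> (max 0 t) x) \<in> borel_measurable borel" and uv: "0 \<le> u" "v \<le> s"
  shows "(\<lambda>\<omega>. LINT t:{u..v}|lborel. \<phi> t (X t \<omega>)) \<in> borel_measurable F"
proof -
  note [measurable] = joint_measurable \<phi>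
  have "(\<lambda>z. \<phi> (max 0 (snd z)) (X (max 0 (min s (snd z))) (fst z))) \<in> borel_measurable (F \<Otimes>\<^sub>M borel)"
  proof (rule measurable_compose_countable'[where I=UNIV and g="\<lambda>z. X (max 0 (min s (snd z))) (fst z)" and f="\<lambda>x z. \<phi> (max 0 (snd z)) x"])
    show "(\<lambda>z. X (max 0 (min s (snd z))) (fst z)) \<in> measurable (F \<Otimes>\<^sub>M borel) (count_space UNIV)"
      using joint_measurable by (simp add: case_prod_beta')
    show "(\<lambda>z. \<phi> (max 0 (snd z)) x) \<in> borel_measurable (F \<Otimes>\<^sub>M borel)" for x
      by (rule measurable_compose[OF measurable_snd \<phi>])
  qed (simp add: countable_finite)
  then have "(\<lambda>(\<omega>, t). indicator {u..v} t *\<^sub>R \<phi> (max 0 t) (X (max 0 (min s t)) \<omega>)) \<in> borel_measurable (F \<Otimes>\<^sub>M lborel)"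
    unfolding case_prod_beta' by measurable
  from lborel.borel_measurable_lebesgue_integral[OF this]
  have "(\<lambda>\<omega>. LINT t|lborel. indicator {u..v} t *\<^sub>R \<phi> (max 0 t) (X (max 0 (min s t)) \<omega>)) \<in> borel_measurable F" .
  also have "(\<lambda>\<omega>. LINT t|lborel. indicator {u..v} t *\<^sub>R \<phi> (max 0 t) (X (max 0 (min s t)) \<omega>))
      = (\<lambda>\<omega>. LINT t:{u..v}|lborel. \<phi> t (X t \<omega>))"
    unfolding set_lebesgue_integral_def
  proof (intro ext Bochner_Integration.integral_cong refl)
    fix \<omega> t
    have "max 0 (min s t) = t" "max 0 t = t" if "t \<in> {u..v}"
      using that uv by (simp_all add: max_absorb2 min_absorb2)
    then show "indicator {u..v} t *\<^sub>R \<phi> (max 0 t) (X (max 0 (min s t)) \<omega>) = indicator {u..v} t *\<^sub>R \<phi> t (X t \<omega>)"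
      by (cases "t \<in> {u..v}") simp_all
  qed
  finally show ?thesis .
qed

end

subsection \<open>The reward process\<close>

text \<open>One index set for the three families, so that their joint conditional law is a single
  product. Rewards are numbered from 1: the argument j stands for the reward with number j +
  1.\<close>

datatype lump = Jump_lump nat | Fixed_lump nat | Poisson_lump nat

definition poisson_weight :: "nat \<Rightarrow> real \<Rightarrow> real" where
  "poisson_weight l m = m ^ l / fact l * exp (- m)"

lemma poisson_weight_bounds:
  assumes "0 \<le> m"
  shows "0 \<le> poisson_weight l m" "poisson_weight l m \<le> 1"
proof -
  show "0 \<le> poisson_weight l m" using assms by (simp add: poisson_weight_def)
  have "(\<Sum>n\<in>{l}. m ^ n /\<^sub>R fact n) \<le> (\<Sum>n. m ^ n /\<^sub>R fact n)"
    using assms by (intro sum_le_suminf summable_exp_generic) auto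
  then have "m ^ l / fact l \<le> exp m" by (simp add: exp_def divide_inverse mult.commute)
  then have "m ^ l / fact l * exp (- m) \<le> exp m * exp (- m)" by (intro mult_right_mono) auto
  then show "poisson_weight l m \<le> 1" by (simp add: poisson_weight_def exp_minus)
qed

lemma poisson_weight_mean: "(\<lambda>l. real l * poisson_weight l m) sums m"
proof -
  have "(\<lambda>n. m ^ n /\<^sub>R fact n) sums exp m" by (rule exp_converges)
  then have "(\<lambda>n. m * exp (- m) * (m ^ n /\<^sub>R fact n)) sums (m * exp (- m) * exp m)" by (rule sums_mult)
  then have "(\<lambda>n. real (Suc n) * poisson_weight (Suc n) m) sums m"
    by (simp add: poisson_weight_def exp_minus field_simps del: of_nat_Suc)
  then show ?thesis by (subst (asm) sums_Suc_iff) simp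
qed

text \<open>All bounds are uniform: b for r and \<beta>, q for the rates, c for the support of every
  lump sum. The initial law \<mu> is a parameter, so that the models started in a fixed state are
  instances too.\<close>

locale reward_process = prob_space M + bounded_rate_transitions Q p q
  for M :: "'w measure" and Q :: "real \<Rightarrow> 's::finite \<Rightarrow> 's \<Rightarrow> real" and p q +
  fixes \<mu> :: "'s pmf" and r \<beta> :: "real \<Rightarrow> 's \<Rightarrow> real"
    and G :: "real \<Rightarrow> 's \<Rightarrow> 's \<Rightarrow> real \<Rightarrow> real" and H K :: "real \<Rightarrow> 's \<Rightarrow> real \<Rightarrow> real"
    and \<tau> :: "nat \<Rightarrow> real" and X :: "real \<Rightarrow> 'w \<Rightarrow> 's" and N :: "real \<Rightarrow> 'w \<Rightarrow> nat"
    and Gr Hr Kr :: "nat \<Rightarrow> 'w \<Rightarrow> real" and b :: real and c :: nat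
  assumes mjp: "markov_jump_process M p \<mu> X" and cpp: "cond_poisson_process M \<beta> X N"
    and lsr: "lump_sum_rewards M G H K \<tau> X N Gr Hr Kr"
    and r_bound: "\<And>t x. 0 \<le> t \<Longrightarrow> 0 \<le> r t x \<and> r t x \<le> b"
    and \<beta>_bound: "\<And>t x. 0 \<le> t \<Longrightarrow> 0 \<le> \<beta> t x \<and> \<beta> t x \<le> b"
    and r_measurable: "\<And>x. (\<lambda>t. r (max 0 t) x) \<in> borel_measurable borel"
    and \<beta>_measurable: "\<And>x. (\<lambda>t. \<beta> (max 0 t) x) \<in> borel_measurable borel"
    and G_measurable: "\<And>x y z. (\<lambda>t. G (max 0 t) x y z) \<in> borel_measurable borel"
    and K_measurable: "\<And>x z. (\<lambda>t. K (max 0 t) x z) \<in> borel_measurable borel"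
    and G_cdf: "\<And>t x y. 0 \<le> t \<Longrightarrow> supported_cdf c (G t x y)"
    and H_cdf: "\<And>t x. 0 \<le> t \<Longrightarrow> supported_cdf c (H t x)"
    and K_cdf: "\<And>t x. 0 \<le> t \<Longrightarrow> supported_cdf c (K t x)"
    and \<tau>_0: "\<tau> 0 = 0" and \<tau>_mono: "strict_mono \<tau>" and \<tau>_lim: "filterlim \<tau> at_top sequentially"
begin

abbreviation "J t \<omega> \<equiv> jump_count (\<lambda>t. X t \<omega>) t"

text \<open>\<open>SX\<close> and \<open>SXN\<close> carry whole paths, futures included, and are
  what the hypotheses on N and on the rewards condition on; \<open>FX s\<close> and
  \<open>FXN s\<close> are the histories up to s.\<close>

definition "SX = generated_by M (count_space UNIV) X {0..}"
definition "FX s = generated_by M (count_space UNIV) X {0..s}"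
definition "SXN = generated_by M (count_space UNIV) (\<lambda>t \<omega>. (X t \<omega>, N t \<omega>)) {0..}"
definition "FXN s = generated_by M (count_space UNIV) (\<lambda>t \<omega>. (X t \<omega>, N t \<omega>)) {0..s}"

lemma b_nonneg: "0 \<le> b"
  using r_bound[of 0] by (meson order.refl order.trans)

lemma space_F [simp]: "space SX = space M" "space (FX s) = space M" "space SXN = space M" "space (FXN s) = space M"
  by (simp_all add: SX_def FX_def SXN_def FXN_def)

lemma X_measurable: "0 \<le> t \<Longrightarrow> X t \<in> measurable M (count_space UNIV)"
  and X_path: "\<omega> \<in> space M \<Longrightarrow> jump_path (\<lambda>t. X t \<omega>)"
  and X_initial: "prob {\<omega>\<in>space M. X 0 \<omega> = x} = pmf \<mu> x"
  and X_markov: "0 \<le> s \<Longrightarrow> s \<le> t \<Longrightarrow>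
    AE \<omega> in M. real_cond_exp M (FX s) (indicator {\<omega>\<in>space M. X t \<omega> = y}) \<omega> = p s t (X s \<omega>) y"
  using mjp unfolding markov_jump_process_def natural_filtration_def FX_def by blast+

lemma N_measurable: "0 \<le> t \<Longrightarrow> N t \<in> measurable M (count_space UNIV)"
  and N_path: "\<omega> \<in> space M \<Longrightarrow> step_path (\<lambda>t. N t \<omega>)"
  using cpp counting_path_imp_step_path unfolding cond_poisson_process_def by blast+

lemma X_in_FX: "0 \<le> u \<Longrightarrow> u \<le> s \<Longrightarrow> X u \<in> measurable (FX s) (count_space UNIV)"
  unfolding FX_def by (rule measurable_generated_by) auto

lemma X_in_SX: "0 \<le> u \<Longrightarrow> X u \<in> measurable SX (count_space UNIV)"
  unfolding SX_def by (rule measurable_generated_by) auto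

lemma XN_in_FXN:
  assumes "0 \<le> u" "u \<le> s"
  shows "X u \<in> measurable (FXN s) (count_space UNIV)" "N u \<in> measurable (FXN s) (count_space UNIV)"
proof -
  have *: "(\<lambda>\<omega>. (X u \<omega>, N u \<omega>)) \<in> measurable (FXN s) (count_space UNIV)"
    unfolding FXN_def using assms by (intro measurable_generated_by[of u]) auto
  have f: "fst \<in> measurable (count_space UNIV) (count_space UNIV)" "snd \<in> measurable (count_space UNIV) (count_space UNIV)"
    by simp_all
  show "X u \<in> measurable (FXN s) (count_space UNIV)" "N u \<in> measurable (FXN s) (count_space UNIV)"
    using measurable_compose[OF * f(1)] measurable_compose[OF * f(2)] by simp_all
qed

lemma XN_pair_measurable:
  assumes "X u \<in> measurable F (count_space UNIV)" "N u \<in> measurable F (count_space UNIV)"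
  shows "(\<lambda>\<omega>. (X u \<omega>, N u \<omega>)) \<in> measurable F (count_space UNIV)"
proof -
  note [measurable] = assms
  show ?thesis
    by (subst measurable_count_space_eq_countable)
       (auto simp: vimage_def Int_def conj_commute intro!: sets.Int[of _ F, unfolded Int_def])
qed

lemma subalgebras:
  shows "subalgebra M SX" "subalgebra M SXN" "subalgebra SXN SX" "subalgebra SX (FX s)"
    "subalgebra (FXN s) (FX s)" "subalgebra SXN (FXN s)" "subalgebra M (FX s)" "subalgebra M (FXN s)"
    and "s \<le> t \<Longrightarrow> subalgebra (FX t) (FX s)" "s \<le> t \<Longrightarrow> subalgebra (FXN t) (FXN s)"
proof -
  have XN: "(\<lambda>\<omega>. (X u \<omega>, N u \<omega>)) \<in> measurable SXN (count_space UNIV)" if "0 \<le> u" for u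
    unfolding SXN_def using that by (intro measurable_generated_by[of u]) auto
  have "fst \<in> measurable (count_space UNIV) (count_space UNIV)" by simp
  from measurable_compose[OF XN this] have XS: "X u \<in> measurable SXN (count_space UNIV)" if "0 \<le> u" for u
    using that by simp
  show "subalgebra M SX" unfolding SX_def by (rule subalgebra_generated_by) (auto intro: X_measurable)
  show a: "subalgebra M SXN" unfolding SXN_def
    by (rule subalgebra_generated_by) (auto intro!: XN_pair_measurable X_measurable N_measurable)
  show "subalgebra SXN SX" unfolding SX_def by (rule subalgebra_generated_by) (auto intro: XS)
  show "subalgebra SX (FX s)" unfolding FX_def by (rule subalgebra_generated_by) (auto intro: X_in_SX)
  show "subalgebra (FXN s) (FX s)" unfolding FX_def by (rule subalgebra_generated_by) (auto intro: XN_in_FXN)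
  show b: "subalgebra SXN (FXN s)" unfolding FXN_def by (rule subalgebra_generated_by) (auto intro: XN)
  show "subalgebra M (FX s)" unfolding FX_def by (rule subalgebra_generated_by) (auto intro: X_measurable)
  show "subalgebra M (FXN s)" unfolding FXN_def
    by (rule subalgebra_generated_by) (auto intro!: XN_pair_measurable X_measurable N_measurable)
  show "subalgebra (FX t) (FX s)" if "s \<le> t" unfolding FX_def[of s]
    by (rule subalgebra_generated_by) (use that in \<open>auto intro: X_in_FX\<close>)
  show "subalgebra (FXN t) (FXN s)" if "s \<le> t" unfolding FXN_def[of s]
    by (rule subalgebra_generated_by) (use that in \<open>auto intro!: XN_pair_measurable XN_in_FXN\<close>)
qed

lemma sets_subalgebra: "subalgebra N' F \<Longrightarrow> A \<in> sets F \<Longrightarrow> A \<in> sets N'"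
  by (auto simp: subalgebra_def)

lemma observed_FX: "0 \<le> s \<Longrightarrow> observed_paths (FX s) X s"
  by unfold_locales (auto intro: X_in_FX X_path)

lemma observed_FXN: "0 \<le> s \<Longrightarrow> observed_paths (FXN s) X s"
  by unfold_locales (auto intro: XN_in_FXN X_path)

lemma observed_M: "0 \<le> s \<Longrightarrow> observed_paths M X s"
  by unfold_locales (auto intro: X_measurable X_path)

subsection \<open>Poisson increments\<close>

definition intensity :: "real \<Rightarrow> real \<Rightarrow> 'w \<Rightarrow> real" where
  "intensity u v \<omega> = (LINT t:{u..v}|lborel. \<beta> t (X t \<omega>))"

definition increments :: "nat \<Rightarrow> (nat \<Rightarrow> real) \<Rightarrow> (nat \<Rightarrow> nat) \<Rightarrow> 'w set" where
  "increments n w k = {\<omega>\<in>space M. \<forall>i<n. N (w (Suc i)) \<omega> = N (w i) \<omega> + k i}"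

text \<open>The conditional probability of \<open>increments n w k\<close> given the whole path of
  X.\<close>

definition increments_weight :: "nat \<Rightarrow> (nat \<Rightarrow> real) \<Rightarrow> (nat \<Rightarrow> nat) \<Rightarrow> 'w \<Rightarrow> real" where
  "increments_weight n w k \<omega> = (\<Prod>i<n. poisson_weight (k i) (intensity (w i) (w (Suc i)) \<omega>))"

lemma intensity_nonneg: "0 \<le> u \<Longrightarrow> 0 \<le> intensity u v \<omega>"
  unfolding intensity_def set_lebesgue_integral_def
  by (intro Bochner_Integration.integral_nonneg) (auto simp: indicator_def \<beta>_bound)

lemma intensity_measurable: "0 \<le> u \<Longrightarrow> v \<le> s \<Longrightarrow> 0 \<le> s \<Longrightarrow> intensity u v \<in> borel_measurable (FX s)"
  unfolding intensity_def[abs_def]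
  by (rule observed_paths.path_integral_measurable[where \<phi>=\<beta>, OF observed_FX \<beta>_measurable])

lemma increments_in_events:
  assumes "0 \<le> w 0" "\<And>i. i < n \<Longrightarrow> w i \<le> w (Suc i)"
  shows "increments n w k \<in> events"
proof -
  have w: "0 \<le> w i" if "i \<le> n" for i using that
  proof (induction i)
    case (Suc i)
    then show ?case using assms(2)[of i] by simp
  qed (rule assms(1))
  have "{\<omega> \<in> space M. \<forall>i\<in>{..<n}. N (w (Suc i)) \<omega> = N (w i) \<omega> + k i} \<in> events"
  proof (rule sets.sets_Collect_finite_All)
    fix i assume "i \<in> {..<n}"
    then have [measurable]: "N (w i) \<in> measurable M (count_space UNIV)" "N (w (Suc i)) \<in> measurable M (count_space UNIV)"
      by (auto intro!: N_measurable w)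
    have "{\<omega> \<in> space M. real (N (w (Suc i)) \<omega>) = real (N (w i) \<omega>) + real (k i)} \<in> events" by measurable
    then show "{\<omega> \<in> space M. N (w (Suc i)) \<omega> = N (w i) \<omega> + k i} \<in> events"
      by (simp only: of_nat_add[symmetric] of_nat_eq_iff)
  qed simp
  also have "{\<omega> \<in> space M. \<forall>i\<in>{..<n}. N (w (Suc i)) \<omega> = N (w i) \<omega> + k i} = increments n w k"
    unfolding increments_def by (simp only: Ball_def lessThan_iff)
  finally show ?thesis .
qed

lemma increments_weight_props:
  assumes "0 \<le> w 0" "\<And>i. i < n \<Longrightarrow> w i \<le> w (Suc i)"
  shows "w n \<le> s \<Longrightarrow> increments_weight n w k \<in> borel_measurable (FX s)"
    and "0 \<le> increments_weight n w k \<omega>" "increments_weight n w k \<omega> \<le> 1"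
proof -
  have w: "0 \<le> w i" if "i \<le> n" for i using that
  proof (induction i)
    case (Suc i)
    then show ?case using assms(2)[of i] by simp
  qed (rule assms(1))
  have wn: "w i \<le> w n" if "i \<le> n" for i
    using that
  proof (induction rule: inc_induct)
    case (step i)
    then show ?case using assms(2)[of i] by simp
  qed simp
  show "increments_weight n w k \<in> borel_measurable (FX s)" if "w n \<le> s"
    unfolding increments_weight_def[abs_def]
  proof (intro borel_measurable_prod)
    fix i assume i: "i \<in> {..<n}"
    have [measurable]: "intensity (w i) (w (Suc i)) \<in> borel_measurable (FX s)"
      by (rule intensity_measurable) (use w[of i] wn[of "Suc i"] w[of n] i that in auto)
    show "(\<lambda>\<omega>. poisson_weight (k i) (intensity (w i) (w (Suc i)) \<omega>)) \<in> borel_measurable (FX s)"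
      unfolding poisson_weight_def by measurable
  qed
  have "0 \<le> poisson_weight (k i) (intensity (w i) (w (Suc i)) \<omega>)" "poisson_weight (k i) (intensity (w i) (w (Suc i)) \<omega>) \<le> 1"
    if "i < n" for i using poisson_weight_bounds[OF intensity_nonneg[OF w]] that by auto
  then show "0 \<le> increments_weight n w k \<omega>" "increments_weight n w k \<omega> \<le> 1"
    unfolding increments_weight_def by (auto intro!: prod_nonneg prod_le_1)
qed

text \<open>The integrated form of the hypothesis on N. Since the conditioning is on the whole path
  of X, the factor \<xi> may depend on the future of X.\<close>

lemma increments_expectation:
  fixes \<xi> :: "'w \<Rightarrow> real"
  assumes w: "0 \<le> w 0" "\<And>i. i < n \<Longrightarrow> w i \<le> w (Suc i)"
    and \<xi>: "\<xi> \<in> borel_measurable SX" "\<And>\<omega>. \<omega> \<in> space M \<Longrightarrow> \<bar>\<xi> \<omega>\<bar> \<le> B"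
  shows "(LINT \<omega>|M. \<xi> \<omega> * indicator (increments n w k) \<omega>) = (LINT \<omega>|M. \<xi> \<omega> * increments_weight n w k \<omega>)"
proof -
  interpret S: finite_measure_subalgebra M SX by (rule finite_measure_subalgebraI[OF subalgebras(1)])
  note ev = increments_in_events[OF w, where k=k]
  have \<xi>M: "\<xi> \<in> borel_measurable M" using measurable_from_subalg[OF subalgebras(1) \<xi>(1)] .
  have "AE \<omega> in M. real_cond_exp M SX (indicator (increments n w k)) \<omega> = increments_weight n w k \<omega>"
    using cpp w unfolding cond_poisson_process_def increments_def increments_weight_def SX_def intensity_def
      poisson_weight_def Let_def by blast
  then have "(LINT \<omega>|M. \<xi> \<omega> * increments_weight n w k \<omega>) = (LINT \<omega>|M. \<xi> \<omega> * real_cond_exp M SX (indicator (increments n w k)) \<omega>)"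
    using \<xi>M measurable_from_subalg[OF subalgebras(7) increments_weight_props(1)[OF w order.refl]]
    by (intro integral_cong_AE) auto
  also have "\<dots> = (LINT \<omega>|M. \<xi> \<omega> * indicator (increments n w k) \<omega>)"
  proof (rule S.real_cond_exp_intg(2)[OF _ \<xi>(1)])
    show "integrable M (\<lambda>\<omega>. \<xi> \<omega> * indicator (increments n w k) \<omega>)"
      by (rule integrable_bounded[of _ "\<bar>B\<bar>"]) (use \<xi>M ev \<xi>(2) in \<open>force simp: indicator_def\<close>)+
  qed (use ev in auto)
  finally show ?thesis by simp
qed

end

section \<open>Events in the joint history of X and N\<close>

lemma finite_set_increasing_enumeration:
  fixes V :: "real set"
  assumes V: "finite V" "0 \<in> V" "s \<in> V" "V \<subseteq> {0..s}"
  obtains n w where "w 0 = 0" "w n = s" "\<And>i. i < n \<Longrightarrow> w i \<le> w (Suc i)" "w ` {..n} = V"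
proof -
  define l where "l = sorted_list_of_set V"
  have l: "sorted l" "set l = V" "l \<noteq> []" using V by (auto simp: l_def)
  define n where "n = length l - 1"
  have n: "length l = Suc n" using l(3) by (simp add: n_def)
  have mono: "l ! i \<le> l ! j" if "i \<le> j" "j \<le> n" for i j
    using sorted_nth_mono[OF l(1) that(1)] that n by simp
  have im: "(!) l ` {..n} = V"
    using l(2) n by (auto simp: set_conv_nth less_Suc_eq_le image_def)
  have "l ! 0 = 0"
  proof -
    obtain i where "i \<le> n" "l ! i = 0" using im V(2) by (auto simp: image_def)
    moreover have "l ! 0 \<in> V" using im by auto
    ultimately show ?thesis using mono[of 0 i] V(4) by force
  qed
  moreover have "l ! n = s"
  proof -
    obtain i where "i \<le> n" "l ! i = s" using im V(3) by (auto simp: image_def)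
    moreover have "l ! n \<in> V" using im by auto
    ultimately show ?thesis using mono[of i n] V(4) by force
  qed
  ultimately show ?thesis using im mono by (intro that[of "(!) l" n]) auto
qed

context reward_process
begin

definition pinned :: "real set \<Rightarrow> (real \<Rightarrow> nat) \<Rightarrow> 'w set" where
  "pinned V k = {\<omega>\<in>space M. \<forall>v\<in>V. N v \<omega> = k v}"

text \<open>Prescribed values of N at finitely many times are equivalent to prescribed increments,
  since N starts at 0. If the values do not start at 0 or decrease somewhere, no path attains
  them.\<close>

lemma pinned_increments:
  assumes V: "finite V" "0 \<in> V" "s \<in> V" "V \<subseteq> {0..s}"
  shows "pinned V k = {} \<or> (\<exists>n w l. w 0 = 0 \<and> w n = s \<and> (\<forall>i<n. w i \<le> w (Suc i)) \<and> pinned V k = increments n w l)"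
proof -
  obtain n w where w: "w 0 = 0" "w n = s" "\<And>i. i < n \<Longrightarrow> w i \<le> w (Suc i)" "w ` {..n} = V"
    by (rule finite_set_increasing_enumeration[OF V]) blast
  have pin: "pinned V k = {\<omega>\<in>space M. \<forall>i\<le>n. N (w i) \<omega> = k (w i)}"
    unfolding pinned_def w(4)[symmetric] by auto
  have w0: "0 \<le> w i" if "i \<le> n" for i
    using that
  proof (induction i)
    case (Suc i)
    then show ?case using w(3)[of i] by simp
  qed (simp add: w)
  show ?thesis
  proof (cases "k 0 = 0 \<and> (\<forall>i<n. k (w i) \<le> k (w (Suc i)))")
    case True
    have "(\<forall>i\<le>n. N (w i) \<omega> = k (w i)) \<longleftrightarrow> (\<forall>i<n. N (w (Suc i)) \<omega> = N (w i) \<omega> + (k (w (Suc i)) - k (w i)))"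
      if om: "\<omega> \<in> space M" for \<omega>
    proof (intro iffI allI impI)
      fix i assume a: "\<forall>i\<le>n. N (w i) \<omega> = k (w i)" and i: "i < n"
      have "N (w (Suc i)) \<omega> = k (w (Suc i))" "N (w i) \<omega> = k (w i)" using a i by auto
      then show "N (w (Suc i)) \<omega> = N (w i) \<omega> + (k (w (Suc i)) - k (w i))" using True i by simp
    next
      fix i assume a: "\<forall>i<n. N (w (Suc i)) \<omega> = N (w i) \<omega> + (k (w (Suc i)) - k (w i))" and i: "i \<le> n"
      from i show "N (w i) \<omega> = k (w i)"
      proof (induction i)
        case 0
        show ?case using True w(1) step_path_0[OF N_path[OF om]] by simp
      next
        case (Suc i)
        then have "N (w i) \<omega> = k (w i)" "k (w i) \<le> k (w (Suc i))" using True by auto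
        then show ?case using a Suc.prems by simp
      qed
    qed
    then have "pinned V k = increments n w (\<lambda>i. k (w (Suc i)) - k (w i))"
      unfolding pin increments_def by blast
    then show ?thesis using w by blast
  next
    case False
    have "\<not> (\<forall>i\<le>n. N (w i) \<omega> = k (w i))" if om: "\<omega> \<in> space M" for \<omega>
    proof
      assume a: "\<forall>i\<le>n. N (w i) \<omega> = k (w i)"
      have "k 0 = 0" using a[rule_format, of 0] w(1) step_path_0[OF N_path[OF om]] by simp
      moreover have "k (w i) \<le> k (w (Suc i))" if "i < n" for i
        using step_path_mono[OF N_path[OF om] w0[of i] w(3)[OF that]] a that by simp
      ultimately show False using False by blast
    qed
    then show ?thesis unfolding pin by blast
  qed
qed

text \<open>Pinning at \<open>0\<close> and \<open>s\<close> turns each event into one about the increments over a partition of \<open>[0, s]\<close>.\<close>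

definition pinned_system :: "real \<Rightarrow> 'w set set" where
  "pinned_system s = {B \<inter> pinned V k |B V k. B \<in> sets (FX s) \<and> finite V \<and> 0 \<in> V \<and> s \<in> V \<and> V \<subseteq> {0..s}}"

lemma pinned_in_FXN:
  assumes "finite V" "V \<subseteq> {0..s}"
  shows "pinned V k \<in> sets (FXN s)"
proof -
  have "{\<omega>\<in>space (FXN s). \<forall>v\<in>V. N v \<omega> = k v} \<in> sets (FXN s)"
  proof (rule sets.sets_Collect_finite_All[OF _ assms(1)])
    fix v assume "v \<in> V"
    then have [measurable]: "N v \<in> measurable (FXN s) (count_space UNIV)" using assms by (intro XN_in_FXN) auto
    show "{\<omega>\<in>space (FXN s). N v \<omega> = k v} \<in> sets (FXN s)" by measurable
  qed
  then show ?thesis by (simp add: pinned_def)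
qed

lemma pinned_system_subset: "pinned_system s \<subseteq> sets (FXN s)"
  unfolding pinned_system_def
  using pinned_in_FXN sets_subalgebra[OF subalgebras(5)] by blast

text \<open>Two prescriptions that agree where they overlap merge into one; otherwise the
  intersection is empty, and the empty set belongs to the system through B = {}. The whole space is
  inserted because pinning N at s confines it to one value.\<close>

lemma Int_stable_pinned_system: "Int_stable (insert (space M) (pinned_system s))"
proof -
  have sub: "A \<subseteq> space M" if "A \<in> pinned_system s" for A
    using that pinned_system_subset sets.sets_into_space[of A "FXN s"] by auto
  have "A \<inter> A' \<in> pinned_system s" if "A \<in> pinned_system s" "A' \<in> pinned_system s" for A A'
  proof -
    obtain B V k where A: "A = B \<inter> pinned V k" "B \<in> sets (FX s)" "finite V" "0 \<in> V" "s \<in> V" "V \<subseteq> {0..s}"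
      using \<open>A \<in> pinned_system s\<close> unfolding pinned_system_def by blast
    obtain B' V' k' where A': "A' = B' \<inter> pinned V' k'" "B' \<in> sets (FX s)" "finite V'" "V' \<subseteq> {0..s}"
      using \<open>A' \<in> pinned_system s\<close> unfolding pinned_system_def by blast
    show ?thesis
    proof (cases "\<forall>v\<in>V \<inter> V'. k v = k' v")
      case True
      define k'' where "k'' v = (if v \<in> V then k v else k' v)" for v
      have "N v \<omega> = k v" if "\<forall>v\<in>V \<union> V'. N v \<omega> = k'' v" "v \<in> V" for v \<omega>
        using that by (metis UnI1 k''_def)
      moreover have "N v \<omega> = k' v" if "\<forall>v\<in>V \<union> V'. N v \<omega> = k'' v" "v \<in> V'" for v \<omega>
        using that True by (metis UnI2 IntI k''_def)
      moreover have "N v \<omega> = k'' v" if "\<forall>v\<in>V. N v \<omega> = k v" "\<forall>v\<in>V'. N v \<omega> = k' v" "v \<in> V \<union> V'" for v \<omega>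
        using that by (metis UnE k''_def)
      ultimately have "pinned V k \<inter> pinned V' k' = pinned (V \<union> V') k''"
        unfolding pinned_def by blast
      then have "A \<inter> A' = (B \<inter> B') \<inter> pinned (V \<union> V') k''" unfolding A(1) A'(1) by blast
      moreover have "B \<inter> B' \<in> sets (FX s)" "finite (V \<union> V')" "0 \<in> V \<union> V'" "s \<in> V \<union> V'" "V \<union> V' \<subseteq> {0..s}"
        using A A' by auto
      ultimately show ?thesis unfolding pinned_system_def by blast
    next
      case False
      then have "pinned V k \<inter> pinned V' k' = {}" unfolding pinned_def by force
      then have "A \<inter> A' = {} \<inter> pinned V k" unfolding A(1) A'(1) by blast
      moreover have "{} \<in> sets (FX s)" by simp
      ultimately show ?thesis using A unfolding pinned_system_def by blast
    qed
  qed
  then show ?thesis using sub unfolding Int_stable_def by (auto simp: Int_absorb1 Int_absorb2)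
qed

lemma FXN_generated_by_pinned:
  assumes s: "0 \<le> s" and A: "A \<in> sets (FXN s)"
  shows "A \<in> sigma_sets (space M) (insert (space M) (pinned_system s))"
proof -
  let ?E = "insert (space M) (pinned_system s)"
  have EP: "?E \<subseteq> Pow (space M)"
    using pinned_system_subset[of s] sets.sets_into_space[of _ "FXN s"] by auto
  let ?S = "sigma (space M) ?E"
  have S: "sets ?S = sigma_sets (space M) ?E" "space ?S = space M" using EP by simp_all
  have "sets (FXN s) \<subseteq> sets ?S"
    unfolding FXN_def
  proof (rule sets_generated_by_subset)
    fix u assume u: "u \<in> {0..s}"
    show "(\<lambda>\<omega>. (X u \<omega>, N u \<omega>)) \<in> measurable ?S (count_space UNIV)"
      unfolding measurable_count_space_eq_countable[OF countableI_type[of UNIV]]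
    proof (intro conjI ballI)
      fix z :: "'s \<times> nat"
      obtain x l where z: "z = (x, l)" by (cases z)
      let ?V = "{0, u, s}"
      \<comment> \<open>The value of N at s is pinned to an arbitrary k', over which a countable
        union is taken. If u is 0 or s, the clause for u takes precedence.\<close>
      define k where "k k' v = (if v = u then l else if v = s then k' else 0)" for k' :: nat and v
      define B where "B = X u -` {x} \<inter> space (FX s)"
      have B: "B \<in> sets (FX s)" unfolding B_def by (rule measurable_sets[OF X_in_FX]) (use u in auto)
      have eq: "(\<lambda>\<omega>. (X u \<omega>, N u \<omega>)) -` {z} \<inter> space ?S = (\<Union>k'. B \<inter> pinned ?V (k k'))"
      proof (intro set_eqI iffI)
        fix \<omega> assume "\<omega> \<in> (\<lambda>\<omega>. (X u \<omega>, N u \<omega>)) -` {z} \<inter> space ?S"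
        then have om: "\<omega> \<in> space M" "X u \<omega> = x" "N u \<omega> = l" by (auto simp: z S)
        have "N v \<omega> = k (N s \<omega>) v" if "v \<in> ?V" for v
        proof (cases "v = u \<or> v = s")
          case True
          then show ?thesis using om(3) by (simp add: k_def) metis
        next
          case False
          then have "v = 0" using that by simp
          then show ?thesis using False step_path_0[OF N_path[OF om(1)]] by (simp add: k_def)
        qed
        then have "\<omega> \<in> pinned ?V (k (N s \<omega>))" unfolding pinned_def using om(1) by blast
        moreover have "\<omega> \<in> B" using om by (simp add: B_def)
        ultimately show "\<omega> \<in> (\<Union>k'. B \<inter> pinned ?V (k k'))" by blast
      next
        fix \<omega> assume "\<omega> \<in> (\<Union>k'. B \<inter> pinned ?V (k k'))"
        then obtain k' where "\<omega> \<in> B" "\<omega> \<in> pinned ?V (k k')" by blast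
        then show "\<omega> \<in> (\<lambda>\<omega>. (X u \<omega>, N u \<omega>)) -` {z} \<inter> space ?S"
          by (simp add: B_def pinned_def k_def z S)
      qed
      have "B \<inter> pinned ?V (k k') \<in> sets ?S" for k'
      proof -
        have "B \<inter> pinned ?V (k k') \<in> pinned_system s"
          unfolding pinned_system_def using B u s by (intro CollectI exI conjI) auto
        then show ?thesis unfolding S by (intro sigma_sets.Basic) simp
      qed
      then show "(\<lambda>\<omega>. (X u \<omega>, N u \<omega>)) -` {z} \<inter> space ?S \<in> sets ?S" unfolding eq by blast
    qed simp
  qed (rule S(2))
  with A S(1) show ?thesis by blast
qed

text \<open>Reduces an identity on the history of (X, N) to events that combine a past event of X
  with increments of N over a partition of [0, s]. The total integral covers the whole space, the
  one generator of a different kind.\<close>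

lemma FXN_integral_eqI:
  fixes f g :: "'w \<Rightarrow> real"
  assumes s: "0 \<le> s" and f: "integrable M f" and g: "integrable M g"
    and total: "(LINT \<omega>|M. f \<omega>) = (LINT \<omega>|M. g \<omega>)"
    and eq: "\<And>B n w k. B \<in> sets (FX s) \<Longrightarrow> w 0 = 0 \<Longrightarrow> w n = s \<Longrightarrow> (\<And>i. i < n \<Longrightarrow> w i \<le> w (Suc i)) \<Longrightarrow>
      (LINT \<omega>|M. indicator B \<omega> * indicator (increments n w k) \<omega> * f \<omega>)
        = (LINT \<omega>|M. indicator B \<omega> * indicator (increments n w k) \<omega> * g \<omega>)"
    and A: "A \<in> sets (FXN s)"
  shows "(LINT \<omega>:A|M. f \<omega>) = (LINT \<omega>:A|M. g \<omega>)"
proof (rule pi_lambda_integral_eq[OF Int_stable_pinned_system _ _ f g _ FXN_generated_by_pinned[OF s A]])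
  show "insert (space M) (pinned_system s) \<subseteq> events"
    using pinned_system_subset sets_subalgebra[OF subalgebras(8)] by blast
  fix A assume "A \<in> insert (space M) (pinned_system s)"
  then consider "A = space M" | "A \<in> pinned_system s" by blast
  then show "(LINT \<omega>:A|M. f \<omega>) = (LINT \<omega>:A|M. g \<omega>)"
  proof cases
    case 1
    then show ?thesis using total set_integral_space[OF f] set_integral_space[OF g] by simp
  next
    case 2
    then obtain B V k where A: "A = B \<inter> pinned V k" "B \<in> sets (FX s)" "finite V" "0 \<in> V" "s \<in> V" "V \<subseteq> {0..s}"
      unfolding pinned_system_def by blast
    from pinned_increments[OF A(3-6), of k] consider "pinned V k = {}"
      | n w l where "w 0 = 0" "w n = s" "\<forall>i<n. w i \<le> w (Suc i)" "pinned V k = increments n w l" by blast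
    then show ?thesis
    proof cases
      case 1
      then show ?thesis unfolding A(1) by (simp add: set_lebesgue_integral_def)
    next
      case 2
      have *: "(LINT \<omega>:A|M. h \<omega>) = (LINT \<omega>|M. indicator B \<omega> * indicator (increments n w l) \<omega> * h \<omega>)" for h :: "'w \<Rightarrow> real"
        unfolding set_lebesgue_integral_def A(1) 2(4) by (simp add: indicator_inter_arith)
      show ?thesis unfolding * by (rule eq) (use 2 A in auto)
    qed
  qed
qed simp

text \<open>Observing the past of N teaches nothing new about X: given X, the indicator of past
  increments becomes \<open>increments_weight\<close>, which involves the intensity only up to s and
  is thus a bounded weight measurable for \<open>FX s\<close>.\<close>

lemma transfer_FX_FXN:
  fixes W W' :: "'w \<Rightarrow> real"
  assumes s: "0 \<le> s" and W: "W \<in> borel_measurable SX" "\<And>\<omega>. \<omega> \<in> space M \<Longrightarrow> \<bar>W \<omega>\<bar> \<le> C"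
    and W': "W' \<in> borel_measurable SX" "\<And>\<omega>. \<omega> \<in> space M \<Longrightarrow> \<bar>W' \<omega>\<bar> \<le> C"
    and eq: "\<And>A. A \<in> sets (FX s) \<Longrightarrow> (LINT \<omega>:A|M. W \<omega>) = (LINT \<omega>:A|M. W' \<omega>)"
    and A: "A \<in> sets (FXN s)"
  shows "(LINT \<omega>:A|M. W \<omega>) = (LINT \<omega>:A|M. W' \<omega>)"
proof (rule FXN_integral_eqI[OF s _ _ _ _ A])
  have WM: "W \<in> borel_measurable M" "W' \<in> borel_measurable M"
    using W W' measurable_from_subalg[OF subalgebras(1)] by auto
  show iW: "integrable M W" "integrable M W'" using WM W(2) W'(2) by (auto intro: integrable_bounded)
  show "(LINT \<omega>|M. W \<omega>) = (LINT \<omega>|M. W' \<omega>)"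
    using eq[of "space M"] set_integral_space[OF iW(1)] set_integral_space[OF iW(2)] sets.top[of "FX s"] by simp
  fix B n w k
  assume B: "B \<in> sets (FX s)" and w: "w 0 = 0" "w n = s" "\<And>i. i < n \<Longrightarrow> w i \<le> w (Suc i)"
  let ?w = "increments_weight n w k"
  have w0: "0 \<le> w 0" using w(1) by simp
  have ws: "w n \<le> s" using w(2) by simp
  note wp = increments_weight_props[of w n, OF w0 w(3)]
  have *: "(LINT \<omega>|M. indicator B \<omega> * indicator (increments n w k) \<omega> * U \<omega>) = (LINT \<omega>|M. (indicator B \<omega> * ?w \<omega>) * U \<omega>)"
    if U: "U \<in> borel_measurable SX" "\<And>\<omega>. \<omega> \<in> space M \<Longrightarrow> \<bar>U \<omega>\<bar> \<le> C" for U
  proof -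
    have [measurable]: "B \<in> sets SX" using B sets_subalgebra[OF subalgebras(4)] by blast
    have "(LINT \<omega>|M. (indicator B \<omega> * U \<omega>) * indicator (increments n w k) \<omega>) = (LINT \<omega>|M. (indicator B \<omega> * U \<omega>) * ?w \<omega>)"
    proof (rule increments_expectation[where B="\<bar>C\<bar>"])
      show "\<bar>indicator B \<omega> * U \<omega>\<bar> \<le> \<bar>C\<bar>" if "\<omega> \<in> space M" for \<omega>
        using U(2)[OF that] by (auto simp: indicator_def)
    qed (use w U(1) in auto)
    then show ?thesis by (simp add: ac_simps)
  qed
  have "(LINT \<omega>|M. (indicator B \<omega> * ?w \<omega>) * W \<omega>) = (LINT \<omega>|M. (indicator B \<omega> * ?w \<omega>) * W' \<omega>)"
  proof (rule integral_eq_bounded_weight[OF subalgebras(7)[of s] iW eq, where B=1])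
    show "(\<lambda>\<omega>. indicator B \<omega> * ?w \<omega>) \<in> borel_measurable (FX s)"
      using B wp(1)[OF _ ws, of k] by measurable
    show "\<bar>indicator B \<omega> * ?w \<omega>\<bar> \<le> 1" for \<omega>
      using wp(2,3)[of k \<omega>] by (simp add: indicator_def)
  qed
  moreover have "(LINT \<omega>|M. indicator B \<omega> * indicator (increments n w k) \<omega> * W \<omega>) = (LINT \<omega>|M. (indicator B \<omega> * ?w \<omega>) * W \<omega>)"
    by (rule *) (use W in auto)
  moreover have "(LINT \<omega>|M. indicator B \<omega> * indicator (increments n w k) \<omega> * W' \<omega>) = (LINT \<omega>|M. (indicator B \<omega> * ?w \<omega>) * W' \<omega>)"
    by (rule *) (use W' in auto)
  ultimately show "(LINT \<omega>|M. indicator B \<omega> * indicator (increments n w k) \<omega> * W \<omega>)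
      = (LINT \<omega>|M. indicator B \<omega> * indicator (increments n w k) \<omega> * W' \<omega>)" by (simp only:)
qed

text \<open>The cell [u, v] is appended to the partition of [0, u]. The conditional probability
  given X is a product over cells, so the last factor splits off and the remaining weight is turned
  back into an indicator.\<close>

lemma increment_given_FXN:
  fixes \<xi> :: "'w \<Rightarrow> real"
  assumes uv: "0 \<le> u" "u \<le> v" and \<xi>: "\<xi> \<in> borel_measurable SX" "\<And>\<omega>. \<omega> \<in> space M \<Longrightarrow> \<bar>\<xi> \<omega>\<bar> \<le> C"
    and A: "A \<in> sets (FXN u)"
  shows "(LINT \<omega>:A|M. \<xi> \<omega> * of_bool (N v \<omega> = N u \<omega> + l)) = (LINT \<omega>:A|M. \<xi> \<omega> * poisson_weight l (intensity u v \<omega>))"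
proof (rule FXN_integral_eqI[OF uv(1) _ _ _ _ A])
  have v: "0 \<le> v" using uv by simp
  have \<xi>M [measurable]: "\<xi> \<in> borel_measurable M" using \<xi> measurable_from_subalg[OF subalgebras(1)] by blast
  have iSX [measurable]: "intensity u v \<in> borel_measurable SX"
    using intensity_measurable[OF uv(1) order.refl v] measurable_from_subalg[OF subalgebras(4)] by blast
  have iM [measurable]: "intensity u v \<in> borel_measurable M"
    using iSX measurable_from_subalg[OF subalgebras(1)] by blast
  have NM [measurable]: "N u \<in> measurable M (count_space UNIV)" "N v \<in> measurable M (count_space UNIV)"
    using uv v by (auto intro: N_measurable)
  have ob: "(\<lambda>\<omega>. of_bool (N v \<omega> = N u \<omega> + l) :: real) \<in> borel_measurable M"
  proof -
    have "{\<omega>\<in>space M. real (N v \<omega>) = real (N u \<omega>) + real l} \<in> events" by measurable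
    then have "{\<omega>\<in>space M. N v \<omega> = N u \<omega> + l} \<in> events" by (simp only: of_nat_add[symmetric] of_nat_eq_iff)
    then have [measurable]: "Measurable.pred M (\<lambda>\<omega>. N v \<omega> = N u \<omega> + l)" by (simp add: pred_def)
    show ?thesis by measurable
  qed
  show "integrable M (\<lambda>\<omega>. \<xi> \<omega> * of_bool (N v \<omega> = N u \<omega> + l))"
  proof (rule integrable_bounded[of _ "\<bar>C\<bar>"])
    show "\<bar>\<xi> \<omega> * of_bool (N v \<omega> = N u \<omega> + l)\<bar> \<le> \<bar>C\<bar>" if "\<omega> \<in> space M" for \<omega>
      using \<xi>(2)[OF that] by auto
  qed (intro borel_measurable_times \<xi>M ob)
  have pw: "\<bar>poisson_weight l (intensity u v \<omega>)\<bar> \<le> 1" for \<omega>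
    using poisson_weight_bounds[OF intensity_nonneg[OF uv(1)]] by simp
  have pwb: "\<bar>\<xi> \<omega> * poisson_weight l (intensity u v \<omega>)\<bar> \<le> \<bar>C\<bar>" if "\<omega> \<in> space M" for \<omega>
    using mult_mono[OF order.trans[OF \<xi>(2)[OF that] abs_ge_self] pw] by (simp add: abs_mult)
  show "integrable M (\<lambda>\<omega>. \<xi> \<omega> * poisson_weight l (intensity u v \<omega>))"
    by (rule integrable_bounded[OF _ pwb]) (simp_all add: poisson_weight_def)
  let ?w1 = "\<lambda>i. if i = (0::nat) then u else v"
  have "(LINT \<omega>|M. \<xi> \<omega> * indicator (increments 1 ?w1 (\<lambda>_. l)) \<omega>) = (LINT \<omega>|M. \<xi> \<omega> * increments_weight 1 ?w1 (\<lambda>_. l) \<omega>)"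
    by (rule increments_expectation[OF _ _ \<xi>]) (use uv in auto)
  moreover have "(LINT \<omega>|M. \<xi> \<omega> * indicator (increments 1 ?w1 (\<lambda>_. l)) \<omega>) = (LINT \<omega>|M. \<xi> \<omega> * of_bool (N v \<omega> = N u \<omega> + l))"
    by (intro Bochner_Integration.integral_cong) (auto simp: increments_def indicator_def)
  ultimately show "(LINT \<omega>|M. \<xi> \<omega> * of_bool (N v \<omega> = N u \<omega> + l)) = (LINT \<omega>|M. \<xi> \<omega> * poisson_weight l (intensity u v \<omega>))"
    by (simp add: increments_weight_def)
  fix B n w k
  assume B: "B \<in> sets (FX u)" and w: "w 0 = 0" "w n = u" "\<And>i. i < n \<Longrightarrow> w i \<le> w (Suc i)"
  have [measurable]: "B \<in> sets SX" using B sets_subalgebra[OF subalgebras(4)] by blast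
  note [measurable] = \<xi>(1)
  \<comment> \<open>\<open>w' n\<close> is still u, so cell number n is [u, v].\<close>
  define w' where "w' = w(Suc n := v)"
  define k' where "k' = k(n := l)"
  have w': "w' 0 = 0" "\<And>i. i < Suc n \<Longrightarrow> w' i \<le> w' (Suc i)"
    using w uv by (auto simp: w'_def less_Suc_eq)
  have inc: "increments (Suc n) w' k' = increments n w k \<inter> {\<omega>\<in>space M. N v \<omega> = N u \<omega> + l}"
    using w(2) by (auto simp: increments_def w'_def k'_def less_Suc_eq)
  have wt: "increments_weight (Suc n) w' k' \<omega> = increments_weight n w k \<omega> * poisson_weight l (intensity u v \<omega>)" for \<omega>
  proof -
    have "(\<Prod>i<n. poisson_weight (k' i) (intensity (w' i) (w' (Suc i)) \<omega>)) = (\<Prod>i<n. poisson_weight (k i) (intensity (w i) (w (Suc i)) \<omega>))"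
      by (intro prod.cong) (auto simp: w'_def k'_def)
    then show ?thesis unfolding increments_weight_def prod.lessThan_Suc using w(2) by (simp add: w'_def k'_def)
  qed
  have B1: "\<bar>indicator B \<omega> * \<xi> \<omega>\<bar> \<le> \<bar>C\<bar>" if "\<omega> \<in> space M" for \<omega>
    using \<xi>(2)[OF that] by (auto simp: indicator_def)
  have "(LINT \<omega>|M. indicator B \<omega> * indicator (increments n w k) \<omega> * (\<xi> \<omega> * of_bool (N v \<omega> = N u \<omega> + l)))
      = (LINT \<omega>|M. (indicator B \<omega> * \<xi> \<omega>) * indicator (increments (Suc n) w' k') \<omega>)"
    by (intro Bochner_Integration.integral_cong) (auto simp: inc indicator_def)
  also have "\<dots> = (LINT \<omega>|M. (indicator B \<omega> * \<xi> \<omega>) * increments_weight (Suc n) w' k' \<omega>)"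
  proof (rule increments_expectation[where B="\<bar>C\<bar>"])
    show "(\<lambda>\<omega>. indicator B \<omega> * \<xi> \<omega>) \<in> borel_measurable SX" by measurable
  qed (use w' B1 in auto)
  also have "\<dots> = (LINT \<omega>|M. (indicator B \<omega> * (\<xi> \<omega> * poisson_weight l (intensity u v \<omega>))) * increments_weight n w k \<omega>)"
    unfolding wt by (simp add: ac_simps)
  also have "\<dots> = (LINT \<omega>|M. (indicator B \<omega> * (\<xi> \<omega> * poisson_weight l (intensity u v \<omega>))) * indicator (increments n w k) \<omega>)"
  proof (rule increments_expectation[symmetric, where B="\<bar>C\<bar>"])
    show "(\<lambda>\<omega>. indicator B \<omega> * (\<xi> \<omega> * poisson_weight l (intensity u v \<omega>))) \<in> borel_measurable SX"
      unfolding poisson_weight_def by measurable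
    show "\<bar>indicator B \<omega> * (\<xi> \<omega> * poisson_weight l (intensity u v \<omega>))\<bar> \<le> \<bar>C\<bar>" if "\<omega> \<in> space M" for \<omega>
      using pwb[OF that] by (auto simp: indicator_def)
  qed (use w in auto)
  also have "\<dots> = (LINT \<omega>|M. indicator B \<omega> * indicator (increments n w k) \<omega> * (\<xi> \<omega> * poisson_weight l (intensity u v \<omega>)))"
    by (simp add: ac_simps)
  finally show "(LINT \<omega>|M. indicator B \<omega> * indicator (increments n w k) \<omega> * (\<xi> \<omega> * of_bool (N v \<omega> = N u \<omega> + l)))
      = (LINT \<omega>|M. indicator B \<omega> * indicator (increments n w k) \<omega> * (\<xi> \<omega> * poisson_weight l (intensity u v \<omega>)))" .
qed

end

context reward_process
begin

subsection \<open>Lump-sum rewards\<close>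

primrec lump_val :: "lump \<Rightarrow> 'w \<Rightarrow> real" where
  "lump_val (Jump_lump j) = Gr (Suc j)"
| "lump_val (Fixed_lump i) = Hr (Suc i)"
| "lump_val (Poisson_lump k) = Kr (Suc k)"

primrec lump_happened :: "lump \<Rightarrow> real \<Rightarrow> 'w \<Rightarrow> bool" where
  "lump_happened (Jump_lump j) = (\<lambda>t \<omega>. Suc j \<le> J t \<omega>)"
| "lump_happened (Fixed_lump i) = (\<lambda>t \<omega>. \<tau> (Suc i) \<le> t)"
| "lump_happened (Poisson_lump k) = (\<lambda>t \<omega>. Suc k \<le> N t \<omega>)"

primrec lump_cdf :: "lump \<Rightarrow> 'w \<Rightarrow> real \<Rightarrow> real" where
  "lump_cdf (Jump_lump j) = (\<lambda>\<omega>. G (jump_time (\<lambda>t. X t \<omega>) (Suc j)) (jump_chain (\<lambda>t. X t \<omega>) j) (jump_chain (\<lambda>t. X t \<omega>) (Suc j)))"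
| "lump_cdf (Fixed_lump i) = (\<lambda>\<omega>. H (\<tau> (Suc i)) (X (\<tau> (Suc i)) \<omega>))"
| "lump_cdf (Poisson_lump k) = (\<lambda>\<omega>. K (event_time (\<lambda>t. N t \<omega>) (Suc k)) (X (event_time (\<lambda>t. N t \<omega>) (Suc k)) \<omega>))"

definition lump_done :: "lump \<Rightarrow> real \<Rightarrow> 'w set" where
  "lump_done \<iota> t = {\<omega>\<in>space M. lump_happened \<iota> t \<omega>}"

lemma \<tau>_pos: "0 < \<tau> (Suc i)"
  using strict_monoD[OF \<tau>_mono, of 0 "Suc i"] by (simp add: \<tau>_0)

lemma J_measurable:
  assumes "0 \<le> t" "t \<le> s"
  shows "J t \<in> measurable (FXN s) (count_space UNIV)"
proof -
  have "0 \<le> s" using assms by simp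
  from observed_paths.jump_count_measurable[OF observed_FXN[OF this] assms] show ?thesis .
qed

lemma lump_done_in_FXN:
  assumes "0 \<le> t" "t \<le> s"
  shows "lump_done \<iota> t \<in> sets (FXN s)"
proof -
  note [measurable] = J_measurable[OF assms] XN_in_FXN(2)[OF assms]
  have "{\<omega>\<in>space (FXN s). lump_happened \<iota> t \<omega>} \<in> sets (FXN s)"
  proof (cases \<iota>)
    case (Fixed_lump i)
    then show ?thesis using sets.top[of "FXN s"] by (cases "\<tau> (Suc i) \<le> t") simp_all
  qed (simp_all only: lump_happened.simps, measurable)
  then show ?thesis by (simp add: lump_done_def)
qed

lemma lump_happened_mono:
  assumes "0 \<le> s" "s \<le> t" "\<omega> \<in> space M" "lump_happened \<iota> s \<omega>"
  shows "lump_happened \<iota> t \<omega>"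
proof (cases \<iota>)
  case (Jump_lump j)
  then show ?thesis using assms(4) jump_count_mono[OF X_path[OF assms(3)] assms(2)] by simp
next
  case (Fixed_lump i)
  then show ?thesis using assms by simp
next
  case (Poisson_lump k)
  then show ?thesis using assms(4) step_path_mono[OF N_path[OF assms(3)] assms(1,2)] by simp
qed

text \<open>If the jump or event has happened, its time is a genuine nonnegative number. Otherwise
  \<open>event_time\<close> is the infimum of the empty set, and nothing is claimed about the data
  there.\<close>

lemma lump_supported:
  assumes "0 \<le> t" "\<omega> \<in> lump_done \<iota> t"
  shows "supported_cdf c (lump_cdf \<iota> \<omega>)"
proof (cases \<iota>)
  case (Jump_lump j)
  then have "event_occurs (\<lambda>t. J t \<omega>) (Suc j)"
    using assms event_occursI[of t "Suc j" "\<lambda>t. J t \<omega>"] by (simp add: lump_done_def)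
  then show ?thesis unfolding Jump_lump using G_cdf event_time_nonneg by (simp add: jump_time_def)
next
  case (Fixed_lump i)
  then show ?thesis using H_cdf \<tau>_pos[of i] by simp
next
  case (Poisson_lump k)
  then have "event_occurs (\<lambda>t. N t \<omega>) (Suc k)"
    using assms event_occursI[of t "Suc k" "\<lambda>t. N t \<omega>"] by (simp add: lump_done_def)
  then show ?thesis unfolding Poisson_lump using K_cdf event_time_nonneg by simp
qed

lemma masked_Poisson_time_measurable:
  assumes "0 \<le> s"
  shows "(\<lambda>\<omega>. if k \<le> N s \<omega> then event_time (\<lambda>t. N t \<omega>) k else 0) \<in> borel_measurable (FXN s)"
  using masked_event_time_measurable[of "FXN s" "\<lambda>\<omega> t. N t \<omega>" s k] N_path XN_in_FXN(2)[of _ s] assms by simp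

lemma masked_Poisson_state_measurable:
  assumes "0 \<le> s"
  shows "(\<lambda>\<omega>. X (if k \<le> N s \<omega> then event_time (\<lambda>t. N t \<omega>) k else 0) \<omega>) \<in> measurable (FXN s) (count_space UNIV)"
  by (rule observed_paths.observe_at_measurable[OF observed_FXN masked_Poisson_time_measurable])
     (use assms in \<open>auto intro: event_time_le event_time_nonneg event_occursI\<close>)

text \<open>Restricted to rewards already earned, the parameters of the distribution function are
  masked times and states, all observable at s; finitely many states allow them to be inserted one
  after the other.\<close>

lemma lump_cdf_measurable:
  assumes s: "0 \<le> s"
  shows "(\<lambda>\<omega>. indicator (lump_done \<iota> s) \<omega> * lump_cdf \<iota> \<omega> z) \<in> borel_measurable (FXN s)"
proof (cases \<iota>)
  case (Jump_lump j)
  interpret O: observed_paths "FXN s" X s by (rule observed_FXN[OF s])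
  let ?T = "\<lambda>\<omega>. if Suc j \<le> J s \<omega> then jump_time (\<lambda>t. X t \<omega>) (Suc j) else 0"
  let ?Y = "\<lambda>k \<omega>. if k \<le> J s \<omega> then jump_chain (\<lambda>t. X t \<omega>) k else X 0 \<omega>"
  have "(\<lambda>\<omega>. G (max 0 (?T \<omega>)) x y z) \<in> borel_measurable (FXN s)" for x y
    by (rule measurable_compose[OF O.masked_jump_time_measurable G_measurable])
  then have "(\<lambda>\<omega>. G (max 0 (?T \<omega>)) x (?Y (Suc j) \<omega>) z) \<in> borel_measurable (FXN s)" for x
    by (rule measurable_compose_countable'[OF _ O.masked_jump_chain_measurable countable_finite[OF finite]])
  then have "(\<lambda>\<omega>. G (max 0 (?T \<omega>)) (?Y j \<omega>) (?Y (Suc j) \<omega>) z) \<in> borel_measurable (FXN s)"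
    by (rule measurable_compose_countable'[OF _ O.masked_jump_chain_measurable countable_finite[OF finite]])
  then have "(\<lambda>\<omega>. indicator (lump_done \<iota> s) \<omega> * G (max 0 (?T \<omega>)) (?Y j \<omega>) (?Y (Suc j) \<omega>) z) \<in> borel_measurable (FXN s)"
    by (rule borel_measurable_times[OF borel_measurable_indicator[OF lump_done_in_FXN[OF s order.refl]]])
  also have "?this \<longleftrightarrow> ?thesis"
  proof (rule measurable_cong)
    fix \<omega> assume "\<omega> \<in> space (FXN s)"
    show "indicator (lump_done \<iota> s) \<omega> * G (max 0 (?T \<omega>)) (?Y j \<omega>) (?Y (Suc j) \<omega>) z = indicator (lump_done \<iota> s) \<omega> * lump_cdf \<iota> \<omega> z"
    proof (cases "\<omega> \<in> lump_done \<iota> s")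
      case True
      then have k: "Suc j \<le> J s \<omega>" by (simp add: Jump_lump lump_done_def)
      then have "event_occurs (\<lambda>t. J t \<omega>) (Suc j)" using s event_occursI[of s "Suc j" "\<lambda>t. J t \<omega>"] by simp
      then have "max 0 (?T \<omega>) = jump_time (\<lambda>t. X t \<omega>) (Suc j)"
        using event_time_nonneg k by (simp add: jump_time_def max_absorb2)
      then show ?thesis using k by (simp add: Jump_lump)
    qed simp
  qed
  finally show ?thesis .
next
  case (Fixed_lump i)
  show ?thesis
  proof (cases "\<tau> (Suc i) \<le> s")
    case True
    then have "X (\<tau> (Suc i)) \<in> measurable (FXN s) (count_space UNIV)"
      using \<tau>_pos[of i] by (intro XN_in_FXN) auto
    then have "(\<lambda>\<omega>. H (\<tau> (Suc i)) (X (\<tau> (Suc i)) \<omega>) z) \<in> borel_measurable (FXN s)"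
      by (rule measurable_compose) simp
    then have "(\<lambda>\<omega>. indicator (lump_done \<iota> s) \<omega> * H (\<tau> (Suc i)) (X (\<tau> (Suc i)) \<omega>) z) \<in> borel_measurable (FXN s)"
      by (rule borel_measurable_times[OF borel_measurable_indicator[OF lump_done_in_FXN[OF s order.refl]]])
    then show ?thesis by (simp only: Fixed_lump lump_cdf.simps)
  next
    case False
    then have "lump_done \<iota> s = {}" by (simp add: Fixed_lump lump_done_def)
    then show ?thesis by simp
  qed
next
  case (Poisson_lump k)
  let ?T = "\<lambda>\<omega>. if Suc k \<le> N s \<omega> then event_time (\<lambda>t. N t \<omega>) (Suc k) else 0"
  have "(\<lambda>\<omega>. K (max 0 (?T \<omega>)) x z) \<in> borel_measurable (FXN s)" for x
    by (rule measurable_compose[OF masked_Poisson_time_measurable[OF s] K_measurable])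
  then have "(\<lambda>\<omega>. K (max 0 (?T \<omega>)) (X (?T \<omega>) \<omega>) z) \<in> borel_measurable (FXN s)"
    by (rule measurable_compose_countable'[OF _ masked_Poisson_state_measurable[OF s] countable_finite[OF finite]])
  then have "(\<lambda>\<omega>. indicator (lump_done \<iota> s) \<omega> * K (max 0 (?T \<omega>)) (X (?T \<omega>) \<omega>) z) \<in> borel_measurable (FXN s)"
    by (rule borel_measurable_times[OF borel_measurable_indicator[OF lump_done_in_FXN[OF s order.refl]]])
  also have "?this \<longleftrightarrow> ?thesis"
  proof (rule measurable_cong)
    fix \<omega> assume "\<omega> \<in> space (FXN s)"
    show "indicator (lump_done \<iota> s) \<omega> * K (max 0 (?T \<omega>)) (X (?T \<omega>) \<omega>) z = indicator (lump_done \<iota> s) \<omega> * lump_cdf \<iota> \<omega> z"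
    proof (cases "\<omega> \<in> lump_done \<iota> s")
      case True
      then have k: "Suc k \<le> N s \<omega>" by (simp add: Poisson_lump lump_done_def)
      then have "event_occurs (\<lambda>t. N t \<omega>) (Suc k)" using s event_occursI[of s "Suc k" "\<lambda>t. N t \<omega>"] by simp
      then have "max 0 (?T \<omega>) = event_time (\<lambda>t. N t \<omega>) (Suc k)"
        using event_time_nonneg k by (simp add: max_absorb2)
      then show ?thesis using k by (simp add: Poisson_lump)
    qed simp
  qed
  finally show ?thesis .
qed

lemma lump_val_measurable: "lump_val \<iota> \<in> borel_measurable M"
  using lsr by (cases \<iota>) (auto simp: lump_sum_rewards_def)

text \<open>The hypothesis on the rewards, rewritten for one finite set of mixed indices. Its
  proviso that the events occur at some time follows from their having happened by t.\<close>

lemma lump_joint: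
  assumes t: "0 \<le> t" and I: "finite I"
  shows "AE \<omega> in M. (\<forall>\<iota>\<in>I. lump_happened \<iota> t \<omega>) \<longrightarrow>
    real_cond_exp M SXN (indicator {\<omega>\<in>space M. \<forall>\<iota>\<in>I. lump_val \<iota> \<omega> \<le> a \<iota>}) \<omega> = (\<Prod>\<iota>\<in>I. lump_cdf \<iota> \<omega> (a \<iota>))"
proof -
  define A1 where "A1 = {j. Jump_lump j \<in> I}"
  define A2 where "A2 = {i. Fixed_lump i \<in> I}"
  define A3 where "A3 = {k. Poisson_lump k \<in> I}"
  have I_eq: "I = Jump_lump ` A1 \<union> (Fixed_lump ` A2 \<union> Poisson_lump ` A3)"
  proof (intro set_eqI)
    fix \<iota> show "\<iota> \<in> I \<longleftrightarrow> \<iota> \<in> Jump_lump ` A1 \<union> (Fixed_lump ` A2 \<union> Poisson_lump ` A3)"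
      by (cases \<iota>) (auto simp: A1_def A2_def A3_def)
  qed
  have fin: "finite A1" "finite A2" "finite A3"
    using finite_vimageI[OF I, of Jump_lump] finite_vimageI[OF I, of Fixed_lump] finite_vimageI[OF I, of Poisson_lump]
    by (auto simp: A1_def A2_def A3_def vimage_def inj_on_def)
  let ?I1 = "Suc ` A1" and ?I2 = "Suc ` A2" and ?I3 = "Suc ` A3"
  let ?a = "\<lambda>k. a (Jump_lump (k - 1))" and ?b = "\<lambda>k. a (Fixed_lump (k - 1))" and ?c = "\<lambda>k. a (Poisson_lump (k - 1))"
  have "AE \<omega> in M.
           (\<forall>k\<in>?I1. event_occurs (jump_count (\<lambda>t. X t \<omega>)) k) \<and> (\<forall>k\<in>?I3. event_occurs (\<lambda>t. N t \<omega>) k) \<longrightarrow>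
           real_cond_exp M (generated_by M (count_space UNIV) (\<lambda>t \<omega>. (X t \<omega>, N t \<omega>)) {0..})
             (indicator {\<omega>\<in>space M. (\<forall>k\<in>?I1. Gr k \<omega> \<le> ?a k) \<and> (\<forall>k\<in>?I2. Hr k \<omega> \<le> ?b k) \<and> (\<forall>k\<in>?I3. Kr k \<omega> \<le> ?c k)}) \<omega>
           = (\<Prod>k\<in>?I1. let f = (\<lambda>t. X t \<omega>) in G (jump_time f k) (jump_chain f (k - 1)) (jump_chain f k) (?a k)) *
             (\<Prod>k\<in>?I2. H (\<tau> k) (X (\<tau> k) \<omega>) (?b k)) *
             (\<Prod>k\<in>?I3. let l = event_time (\<lambda>t. N t \<omega>) k in K l (X l \<omega>) (?c k))"
    by (rule lsr[unfolded lump_sum_rewards_def, THEN conjunct2, rule_format]) (use fin in auto)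
  then show ?thesis
  proof eventually_elim
    case (elim \<omega>)
    show ?case
    proof
      assume hap: "\<forall>\<iota>\<in>I. lump_happened \<iota> t \<omega>"
      have "event_occurs (jump_count (\<lambda>t. X t \<omega>)) k" if "k \<in> ?I1" for k
      proof -
        from that obtain j where j: "k = Suc j" "Jump_lump j \<in> I" by (auto simp: A1_def)
        then have "lump_happened (Jump_lump j) t \<omega>" using hap by blast
        then show ?thesis using t j(1) by (intro event_occursI[of t]) auto
      qed
      moreover have "event_occurs (\<lambda>t. N t \<omega>) k" if "k \<in> ?I3" for k
      proof -
        from that obtain j where j: "k = Suc j" "Poisson_lump j \<in> I" by (auto simp: A3_def)
        then have "lump_happened (Poisson_lump j) t \<omega>" using hap by blast
        then show ?thesis using t j(1) by (intro event_occursI[of t]) auto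
      qed
      moreover have "{\<omega>\<in>space M. (\<forall>k\<in>?I1. Gr k \<omega> \<le> ?a k) \<and> (\<forall>k\<in>?I2. Hr k \<omega> \<le> ?b k) \<and> (\<forall>k\<in>?I3. Kr k \<omega> \<le> ?c k)}
        = {\<omega>\<in>space M. \<forall>\<iota>\<in>I. lump_val \<iota> \<omega> \<le> a \<iota>}"
        unfolding I_eq by (auto simp: ball_Un)
      moreover have "(\<Prod>k\<in>?I1. let f = (\<lambda>t. X t \<omega>) in G (jump_time f k) (jump_chain f (k - 1)) (jump_chain f k) (?a k)) *
             (\<Prod>k\<in>?I2. H (\<tau> k) (X (\<tau> k) \<omega>) (?b k)) *
             (\<Prod>k\<in>?I3. let l = event_time (\<lambda>t. N t \<omega>) k in K l (X l \<omega>) (?c k)) = (\<Prod>\<iota>\<in>I. lump_cdf \<iota> \<omega> (a \<iota>))"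
      proof -
        have d: "Jump_lump ` A1 \<inter> (Fixed_lump ` A2 \<union> Poisson_lump ` A3) = {}" "Fixed_lump ` A2 \<inter> Poisson_lump ` A3 = {}" by auto
        have "(\<Prod>\<iota>\<in>I. lump_cdf \<iota> \<omega> (a \<iota>)) = (\<Prod>j\<in>A1. lump_cdf (Jump_lump j) \<omega> (a (Jump_lump j))) *
          ((\<Prod>j\<in>A2. lump_cdf (Fixed_lump j) \<omega> (a (Fixed_lump j))) * (\<Prod>j\<in>A3. lump_cdf (Poisson_lump j) \<omega> (a (Poisson_lump j))))"
          unfolding I_eq using fin d
          by (simp add: prod.union_disjoint prod.reindex inj_on_def)
        then show ?thesis by (simp add: prod.reindex Let_def mult.assoc)
      qed
      ultimately show "real_cond_exp M SXN (indicator {\<omega>\<in>space M. \<forall>\<iota>\<in>I. lump_val \<iota> \<omega> \<le> a \<iota>}) \<omega> = (\<Prod>\<iota>\<in>I. lump_cdf \<iota> \<omega> (a \<iota>))"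
        using elim unfolding SXN_def by simp
    qed
  qed
qed

lemma lump_val_sets:
  assumes "finite I"
  shows "{\<omega>\<in>space M. \<forall>\<iota>\<in>I. lump_val \<iota> \<omega> \<le> a \<iota>} \<in> events"
proof (rule sets.sets_Collect_finite_All[OF _ assms])
  fix \<iota>
  note [measurable] = lump_val_measurable[of \<iota>]
  show "{\<omega>\<in>space M. lump_val \<iota> \<omega> \<le> a \<iota>} \<in> events" by measurable
qed

text \<open>The integrated form of \<open>lump_joint\<close>. The factor f vanishes unless all
  rewards in I have been earned by t, which puts the proviso in force wherever it matters.\<close>

lemma lump_product:
  assumes t: "0 \<le> t" and I: "finite I" and f: "f \<in> borel_measurable SXN" "\<And>\<omega>. \<omega> \<in> space M \<Longrightarrow> \<bar>f \<omega>\<bar> \<le> C"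
    and supp: "\<And>\<omega> \<iota>. \<omega> \<in> space M \<Longrightarrow> \<iota> \<in> I \<Longrightarrow> \<not> lump_happened \<iota> t \<omega> \<Longrightarrow> f \<omega> = 0"
  shows "(LINT \<omega>|M. f \<omega> * indicator {\<omega>\<in>space M. \<forall>\<iota>\<in>I. lump_val \<iota> \<omega> \<le> a \<iota>} \<omega>)
       = (LINT \<omega>|M. f \<omega> * (\<Prod>\<iota>\<in>I. indicator (lump_done \<iota> t) \<omega> * lump_cdf \<iota> \<omega> (a \<iota>)))"
proof -
  interpret S: finite_measure_subalgebra M SXN by (rule finite_measure_subalgebraI[OF subalgebras(2)])
  let ?E = "{\<omega>\<in>space M. \<forall>\<iota>\<in>I. lump_val \<iota> \<omega> \<le> a \<iota>}"
  have E: "?E \<in> events" by (rule lump_val_sets[OF I])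
  have fM: "f \<in> borel_measurable M" using measurable_from_subalg[OF subalgebras(2) f(1)] .
  have "(LINT \<omega>|M. f \<omega> * indicator ?E \<omega>) = (LINT \<omega>|M. f \<omega> * real_cond_exp M SXN (indicator ?E) \<omega>)"
  proof (rule S.real_cond_exp_intg(2)[symmetric, OF _ f(1)])
    show "integrable M (\<lambda>\<omega>. f \<omega> * indicator ?E \<omega>)"
    proof (rule integrable_bounded[of _ "\<bar>C\<bar>"])
      show "\<bar>f \<omega> * indicator ?E \<omega>\<bar> \<le> \<bar>C\<bar>" if "\<omega> \<in> space M" for \<omega>
        using f(2)[OF that] by (auto simp: indicator_def)
    qed (use fM E in auto)
  qed (use E in auto)
  also have "\<dots> = (LINT \<omega>|M. f \<omega> * (\<Prod>\<iota>\<in>I. indicator (lump_done \<iota> t) \<omega> * lump_cdf \<iota> \<omega> (a \<iota>)))"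
  proof (rule integral_cong_AE)
    show "(\<lambda>\<omega>. f \<omega> * (\<Prod>\<iota>\<in>I. indicator (lump_done \<iota> t) \<omega> * lump_cdf \<iota> \<omega> (a \<iota>))) \<in> borel_measurable M"
      by (rule borel_measurable_times[OF fM borel_measurable_prod])
         (rule measurable_from_subalg[OF subalgebras(8) lump_cdf_measurable[OF t]])
    show "AE \<omega> in M. f \<omega> * real_cond_exp M SXN (indicator ?E) \<omega>
       = f \<omega> * (\<Prod>\<iota>\<in>I. indicator (lump_done \<iota> t) \<omega> * lump_cdf \<iota> \<omega> (a \<iota>))"
      using lump_joint[OF t I, of a] AE_space
    proof eventually_elim
      case (elim \<omega>)
      show ?case
      proof (cases "\<forall>\<iota>\<in>I. lump_happened \<iota> t \<omega>")
        case True
        then have "(\<Prod>\<iota>\<in>I. indicator (lump_done \<iota> t) \<omega> * lump_cdf \<iota> \<omega> (a \<iota>)) = (\<Prod>\<iota>\<in>I. lump_cdf \<iota> \<omega> (a \<iota>))"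
          using elim(2) by (intro prod.cong) (auto simp: lump_done_def)
        then show ?thesis using elim True by simp
      next
        case False
        then show ?thesis using supp elim(2) by auto
      qed
    qed
  qed (use fM in auto)
  finally show ?thesis .
qed

text \<open>A reward enters an event only together with the fact that it has been earned by s, so
  that no future reward is disclosed.\<close>

definition lump_system :: "real \<Rightarrow> 'w set set" where
  "lump_system s = {B \<inter> {\<omega>\<in>space M. \<forall>\<iota>\<in>I. lump_happened \<iota> s \<omega> \<and> lump_val \<iota> \<omega> \<le> a \<iota>} |B I a. B \<in> sets (FXN s) \<and> finite I}"

lemma lump_systemI:
  "B \<in> sets (FXN s) \<Longrightarrow> finite I \<Longrightarrow>
    B \<inter> {\<omega>\<in>space M. \<forall>\<iota>\<in>I. lump_happened \<iota> s \<omega> \<and> lump_val \<iota> \<omega> \<le> a \<iota>} \<in> lump_system s"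
  unfolding lump_system_def by (intro CollectI exI[of _ B] exI[of _ I] exI[of _ a] conjI refl)

text \<open>This is the \<sigma>-algebra on which all mean values are tested.\<close>

definition FH :: "real \<Rightarrow> 'w measure" where
  "FH s = sigma (space M) (lump_system s)"

lemma all_happened_in_FXN:
  assumes "0 \<le> s" "finite I"
  shows "{\<omega>\<in>space M. \<forall>\<iota>\<in>I. lump_happened \<iota> s \<omega>} \<in> sets (FXN s)"
proof -
  have "{\<omega>\<in>space (FXN s). \<forall>\<iota>\<in>I. lump_happened \<iota> s \<omega>} \<in> sets (FXN s)"
  proof (rule sets.sets_Collect_finite_All[OF _ assms(2)])
    fix \<iota> show "{\<omega>\<in>space (FXN s). lump_happened \<iota> s \<omega>} \<in> sets (FXN s)"
      using lump_done_in_FXN[OF assms(1) order.refl, of \<iota>] by (simp add: lump_done_def)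
  qed
  then show ?thesis by simp
qed

lemma lump_system_events:
  assumes "0 \<le> s"
  shows "lump_system s \<subseteq> events"
proof
  fix A assume "A \<in> lump_system s"
  then obtain B I a where A: "A = B \<inter> {\<omega>\<in>space M. \<forall>\<iota>\<in>I. lump_happened \<iota> s \<omega> \<and> lump_val \<iota> \<omega> \<le> a \<iota>}"
    and B: "B \<in> sets (FXN s)" and I: "finite I" unfolding lump_system_def by blast
  have "A = B \<inter> ({\<omega>\<in>space M. \<forall>\<iota>\<in>I. lump_happened \<iota> s \<omega>} \<inter> {\<omega>\<in>space M. \<forall>\<iota>\<in>I. lump_val \<iota> \<omega> \<le> a \<iota>})"
    unfolding A by blast
  then show "A \<in> events"
    using sets_subalgebra[OF subalgebras(8) B] sets_subalgebra[OF subalgebras(8) all_happened_in_FXN[OF assms I]]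
      lump_val_sets[OF I, of a] by (simp only: sets.Int)
qed

text \<open>For a reward bounded in both events the smaller of the two levels is used.\<close>

lemma Int_stable_lump_system: "Int_stable (lump_system s)"
proof (rule Int_stableI)
  fix A A' assume "A \<in> lump_system s" "A' \<in> lump_system s"
  then obtain B I a B' I' a' where
    A: "A = B \<inter> {\<omega>\<in>space M. \<forall>\<iota>\<in>I. lump_happened \<iota> s \<omega> \<and> lump_val \<iota> \<omega> \<le> a \<iota>}" "B \<in> sets (FXN s)" "finite I" and
    A': "A' = B' \<inter> {\<omega>\<in>space M. \<forall>\<iota>\<in>I'. lump_happened \<iota> s \<omega> \<and> lump_val \<iota> \<omega> \<le> a' \<iota>}" "B' \<in> sets (FXN s)" "finite I'"
    unfolding lump_system_def by blast
  define a'' where "a'' \<iota> = (if \<iota> \<notin> I' then a \<iota> else if \<iota> \<notin> I then a' \<iota> else min (a \<iota>) (a' \<iota>))" for \<iota>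
  have key: "(\<forall>\<iota>\<in>I. P \<iota> \<and> v \<iota> \<le> a \<iota>) \<and> (\<forall>\<iota>\<in>I'. P \<iota> \<and> v \<iota> \<le> a' \<iota>) \<longleftrightarrow> (\<forall>\<iota>\<in>I \<union> I'. P \<iota> \<and> v \<iota> \<le> a'' \<iota>)" for P and v :: "lump \<Rightarrow> real"
    unfolding a''_def by auto
  have "A \<inter> A' = (B \<inter> B') \<inter> {\<omega>\<in>space M. \<forall>\<iota>\<in>I \<union> I'. lump_happened \<iota> s \<omega> \<and> lump_val \<iota> \<omega> \<le> a'' \<iota>}"
  proof (intro set_eqI)
    fix \<omega>
    have "\<omega> \<in> A \<inter> A' \<longleftrightarrow> \<omega> \<in> B \<inter> B' \<and> \<omega> \<in> space M \<and>
      ((\<forall>\<iota>\<in>I. lump_happened \<iota> s \<omega> \<and> lump_val \<iota> \<omega> \<le> a \<iota>) \<and> (\<forall>\<iota>\<in>I'. lump_happened \<iota> s \<omega> \<and> lump_val \<iota> \<omega> \<le> a' \<iota>))"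
      unfolding A(1) A'(1) Int_iff mem_Collect_eq by argo
    then show "\<omega> \<in> A \<inter> A' \<longleftrightarrow> \<omega> \<in> (B \<inter> B') \<inter> {\<omega>\<in>space M. \<forall>\<iota>\<in>I \<union> I'. lump_happened \<iota> s \<omega> \<and> lump_val \<iota> \<omega> \<le> a'' \<iota>}"
      unfolding key[of "\<lambda>\<iota>. lump_happened \<iota> s \<omega>" "\<lambda>\<iota>. lump_val \<iota> \<omega>"] Int_iff mem_Collect_eq by argo
  qed
  moreover have "B \<inter> B' \<in> sets (FXN s)" "finite (I \<union> I')" using A A' by auto
  ultimately show "A \<inter> A' \<in> lump_system s" by (simp only: lump_systemI)
qed

lemma space_FH [simp]: "space (FH s) = space M"
  unfolding FH_def by (rule space_measure_of) (auto simp: lump_system_def)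

lemma sets_FH: "sets (FH s) = sigma_sets (space M) (lump_system s)"
  unfolding FH_def by (rule sets_measure_of) (auto simp: lump_system_def)

lemma subalgebra_FH: "0 \<le> s \<Longrightarrow> subalgebra M (FH s)"
  unfolding subalgebra_def sets_FH using sets.sigma_sets_subset[OF lump_system_events] by simp

lemma subalgebra_FH_FXN: "subalgebra (FH s) (FXN s)"
proof -
  have "B \<in> sets (FH s)" if B: "B \<in> sets (FXN s)" for B
  proof -
    have "B \<inter> {\<omega>\<in>space M. \<forall>\<iota>\<in>{}. lump_happened \<iota> s \<omega> \<and> lump_val \<iota> \<omega> \<le> (\<lambda>_. 0) \<iota>} \<in> lump_system s"
      using B by (rule lump_systemI) simp
    also have "B \<inter> {\<omega>\<in>space M. \<forall>\<iota>\<in>{}. lump_happened \<iota> s \<omega> \<and> lump_val \<iota> \<omega> \<le> (\<lambda>_. 0) \<iota>} = B"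
      using sets.sets_into_space[OF B] by auto
    finally have "B \<in> lump_system s" .
    then show ?thesis unfolding sets_FH by (rule sigma_sets.Basic)
  qed
  then show ?thesis by (auto simp: subalgebra_def)
qed

lemma space_in_lump_system: "space M \<in> lump_system s"
proof -
  have "space (FXN s) \<inter> {\<omega>\<in>space M. \<forall>\<iota>\<in>{}. lump_happened \<iota> s \<omega> \<and> lump_val \<iota> \<omega> \<le> (\<lambda>_. 0) \<iota>} \<in> lump_system s"
    by (rule lump_systemI[OF sets.top]) simp
  then show ?thesis by simp
qed

lemma masked_lump_measurable:
  assumes s: "0 \<le> s"
  shows "(\<lambda>\<omega>. indicator (lump_done \<iota> s) \<omega> * lump_val \<iota> \<omega>) \<in> borel_measurable (FH s)"
proof (rule borel_measurableI_le)
  fix a :: real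
  have D: "lump_done \<iota> s \<in> sets (FH s)"
    using sets_subalgebra[OF subalgebra_FH_FXN lump_done_in_FXN[OF s order.refl]] .
  have "space (FXN s) \<inter> {\<omega>\<in>space M. \<forall>\<iota>'\<in>{\<iota>}. lump_happened \<iota>' s \<omega> \<and> lump_val \<iota>' \<omega> \<le> (\<lambda>_. a) \<iota>'} \<in> lump_system s"
    by (rule lump_systemI[OF sets.top]) simp
  also have "space (FXN s) \<inter> {\<omega>\<in>space M. \<forall>\<iota>'\<in>{\<iota>}. lump_happened \<iota>' s \<omega> \<and> lump_val \<iota>' \<omega> \<le> (\<lambda>_. a) \<iota>'}
     = {\<omega>\<in>lump_done \<iota> s. lump_val \<iota> \<omega> \<le> a}" by (auto simp: lump_done_def)
  finally have V: "{\<omega>\<in>lump_done \<iota> s. lump_val \<iota> \<omega> \<le> a} \<in> sets (FH s)"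
    unfolding sets_FH by (rule sigma_sets.Basic)
  \<comment> \<open>Off \<open>lump_done\<close> the product is 0, so the complement enters as soon
    as a \<ge> 0.\<close>
  have "{\<omega>\<in>space (FH s). indicator (lump_done \<iota> s) \<omega> * lump_val \<iota> \<omega> \<le> a}
    = {\<omega>\<in>lump_done \<iota> s. lump_val \<iota> \<omega> \<le> a} \<union> (if 0 \<le> a then space (FH s) - lump_done \<iota> s else {})"
    by (auto simp: lump_done_def indicator_def split: if_splits)
  also have "\<dots> \<in> sets (FH s)"
    using sets.Un[OF V sets.compl_sets[OF D]] V by (cases "0 \<le> a") simp_all
  finally show "{\<omega>\<in>space (FH s). indicator (lump_done \<iota> s) \<omega> * lump_val \<iota> \<omega> \<le> a} \<in> sets (FH s)" .
qed

text \<open>The counterpart of \<open>transfer_FX_FXN\<close> one level up: given (X, N), the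
  indicator of the observed rewards becomes a product of distribution functions of rewards already
  earned, a bounded weight measurable for \<open>FXN s\<close>.\<close>

lemma transfer_FXN_FH:
  fixes f g :: "'w \<Rightarrow> real"
  assumes s: "0 \<le> s"
    and f: "f \<in> borel_measurable SXN" "\<And>\<omega>. \<omega> \<in> space M \<Longrightarrow> \<bar>f \<omega>\<bar> \<le> C"
    and g: "g \<in> borel_measurable SXN" "\<And>\<omega>. \<omega> \<in> space M \<Longrightarrow> \<bar>g \<omega>\<bar> \<le> C"
    and eq: "\<And>A. A \<in> sets (FXN s) \<Longrightarrow> (LINT \<omega>:A|M. f \<omega>) = (LINT \<omega>:A|M. g \<omega>)"
    and A: "A \<in> sets (FH s)"
  shows "(LINT \<omega>:A|M. f \<omega>) = (LINT \<omega>:A|M. g \<omega>)"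
proof (rule pi_lambda_integral_eq[OF Int_stable_lump_system lump_system_events[OF s] space_in_lump_system _ _ _ A[unfolded sets_FH]])
  have fM: "f \<in> borel_measurable M" "g \<in> borel_measurable M"
    using f g measurable_from_subalg[OF subalgebras(2)] by auto
  show int: "integrable M f" "integrable M g" using fM f(2) g(2) by (auto intro: integrable_bounded)
  fix A assume "A \<in> lump_system s"
  then obtain B I a where A: "A = B \<inter> {\<omega>\<in>space M. \<forall>\<iota>\<in>I. lump_happened \<iota> s \<omega> \<and> lump_val \<iota> \<omega> \<le> a \<iota>}"
    and B: "B \<in> sets (FXN s)" and I: "finite I" unfolding lump_system_def by blast
  let ?H = "{\<omega>\<in>space M. \<forall>\<iota>\<in>I. lump_happened \<iota> s \<omega>}"
  let ?P = "\<lambda>\<omega>. \<Prod>\<iota>\<in>I. indicator (lump_done \<iota> s) \<omega> * lump_cdf \<iota> \<omega> (a \<iota>)"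
  note H = all_happened_in_FXN[OF s I]
  have Pb: "\<bar>?P \<omega>\<bar> \<le> 1" for \<omega>
  proof -
    have "0 \<le> ?P \<omega> \<and> ?P \<omega> \<le> 1"
      using supported_cdf_bounds[OF lump_supported[OF s]]
      by (intro conjI prod_nonneg prod_le_1) (auto simp: indicator_def)
    then show ?thesis by simp
  qed
  have *: "(LINT \<omega>:A|M. h \<omega>) = (LINT \<omega>|M. (indicator (B \<inter> ?H) \<omega> * ?P \<omega>) * h \<omega>)"
    if h: "h \<in> borel_measurable SXN" "\<And>\<omega>. \<omega> \<in> space M \<Longrightarrow> \<bar>h \<omega>\<bar> \<le> C" for h
  proof -
    have "(LINT \<omega>:A|M. h \<omega>) = (LINT \<omega>|M. (indicator (B \<inter> ?H) \<omega> * h \<omega>) * indicator {\<omega>\<in>space M. \<forall>\<iota>\<in>I. lump_val \<iota> \<omega> \<le> a \<iota>} \<omega>)"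
      unfolding A set_lebesgue_integral_def by (intro Bochner_Integration.integral_cong) (auto simp: indicator_def)
    also have "\<dots> = (LINT \<omega>|M. (indicator (B \<inter> ?H) \<omega> * h \<omega>) * ?P \<omega>)"
    proof (rule lump_product[OF s I, where C="\<bar>C\<bar>"])
      have "B \<inter> ?H \<in> sets SXN" using B H sets_subalgebra[OF subalgebras(6)] by blast
      then show "(\<lambda>\<omega>. indicator (B \<inter> ?H) \<omega> * h \<omega>) \<in> borel_measurable SXN" using h(1) by simp
      show "\<bar>indicator (B \<inter> ?H) \<omega> * h \<omega>\<bar> \<le> \<bar>C\<bar>" if "\<omega> \<in> space M" for \<omega>
        using h(2)[OF that] by (auto simp: indicator_def)
      show "indicator (B \<inter> ?H) \<omega> * h \<omega> = 0" if "\<iota> \<in> I" "\<not> lump_happened \<iota> s \<omega>" for \<omega> \<iota>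
        using that by (auto simp: indicator_def)
    qed
    finally show ?thesis by (simp add: ac_simps)
  qed
  have "(LINT \<omega>|M. (indicator (B \<inter> ?H) \<omega> * ?P \<omega>) * f \<omega>) = (LINT \<omega>|M. (indicator (B \<inter> ?H) \<omega> * ?P \<omega>) * g \<omega>)"
  proof (rule integral_eq_bounded_weight[OF subalgebras(8)[of s] int eq, where B=1])
    show "(\<lambda>\<omega>. indicator (B \<inter> ?H) \<omega> * ?P \<omega>) \<in> borel_measurable (FXN s)"
      by (rule borel_measurable_times[OF borel_measurable_indicator[OF sets.Int[OF B H]] borel_measurable_prod])
         (rule lump_cdf_measurable[OF s])
    show "\<bar>indicator (B \<inter> ?H) \<omega> * ?P \<omega>\<bar> \<le> 1" for \<omega>
      using Pb[of \<omega>] by (simp add: indicator_def)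
  qed
  moreover have "(LINT \<omega>:A|M. f \<omega>) = (LINT \<omega>|M. (indicator (B \<inter> ?H) \<omega> * ?P \<omega>) * f \<omega>)" by (rule *) (use f in auto)
  moreover have "(LINT \<omega>:A|M. g \<omega>) = (LINT \<omega>|M. (indicator (B \<inter> ?H) \<omega> * ?P \<omega>) * g \<omega>)" by (rule *) (use g in auto)
  ultimately show "(LINT \<omega>:A|M. f \<omega>) = (LINT \<omega>:A|M. g \<omega>)" by (simp only:)
qed

text \<open>A reward earned in (s, t] has its prescribed distribution even given the rewards
  observed by s, because all rewards are conditionally independent given (X, N).\<close>

lemma lump_given_FH:
  fixes \<iota> :: lump and s t :: real
  assumes st: "0 \<le> s" "s \<le> t" and A: "A \<in> sets (FH s)"
  defines "D \<equiv> lump_done \<iota> t - lump_done \<iota> s"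
  shows "prob ((A \<inter> D) \<inter> {\<omega>\<in>space M. lump_val \<iota> \<omega> \<le> z}) = (LINT \<omega>|M. indicator (A \<inter> D) \<omega> * lump_cdf \<iota> \<omega> z)"
proof -
  have t: "0 \<le> t" using st by simp
  have D_XN [measurable]: "D \<in> sets (FXN t)"
    unfolding D_def using lump_done_in_FXN[OF t order.refl] lump_done_in_FXN[OF st] by (intro sets.Diff)
  have D_SXN [measurable]: "D \<in> sets SXN" using sets_subalgebra[OF subalgebras(6) D_XN] .
  have D_M [measurable]: "D \<in> events" using sets_subalgebra[OF subalgebras(8) D_XN] .
  have A_M [measurable]: "A \<in> events" using sets_subalgebra[OF subalgebra_FH[OF st(1)] A] .
  note [measurable] = lump_val_measurable[of \<iota>]
  have D_sub: "D \<subseteq> lump_done \<iota> t" by (auto simp: D_def)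
  have Dc: "(\<lambda>\<omega>. indicator D \<omega> * lump_cdf \<iota> \<omega> z) \<in> borel_measurable (FXN t)"
  proof -
    have "(\<lambda>\<omega>. indicator D \<omega> * (indicator (lump_done \<iota> t) \<omega> * lump_cdf \<iota> \<omega> z)) \<in> borel_measurable (FXN t)"
      using lump_cdf_measurable[OF t] by simp
    also have "(\<lambda>\<omega>. indicator D \<omega> * (indicator (lump_done \<iota> t) \<omega> * lump_cdf \<iota> \<omega> z)) = (\<lambda>\<omega>. indicator D \<omega> * lump_cdf \<iota> \<omega> z)"
    proof
      fix \<omega>
      show "indicator D \<omega> * (indicator (lump_done \<iota> t) \<omega> * lump_cdf \<iota> \<omega> z) = indicator D \<omega> * lump_cdf \<iota> \<omega> z"
        using D_sub by (cases "\<omega> \<in> D") auto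
    qed
    finally show ?thesis .
  qed
  have Db: "\<bar>indicator D \<omega> * lump_cdf \<iota> \<omega> z\<bar> \<le> 1" for \<omega>
    using supported_cdf_bounds[OF lump_supported[OF t], of \<omega> \<iota> z] D_sub by (auto simp: indicator_def)
  let ?f = "\<lambda>\<omega>. indicator D \<omega> * indicator {\<omega>\<in>space M. lump_val \<iota> \<omega> \<le> z} \<omega> :: real"
  let ?g = "\<lambda>\<omega>. indicator D \<omega> * lump_cdf \<iota> \<omega> z"
  have "(LINT \<omega>:A|M. ?f \<omega>) = (LINT \<omega>:A|M. ?g \<omega>)"
  proof (rule pi_lambda_integral_eq[OF Int_stable_lump_system lump_system_events[OF st(1)] space_in_lump_system _ _ _ A[unfolded sets_FH]])
    show "integrable M ?f" by (rule integrable_bounded[of _ 1]) (auto simp: indicator_def)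
    show "integrable M ?g" using measurable_from_subalg[OF subalgebras(8) Dc] Db by (rule integrable_bounded)
    fix A assume "A \<in> lump_system s"
    then obtain B I a where A: "A = B \<inter> {\<omega>\<in>space M. \<forall>\<iota>\<in>I. lump_happened \<iota> s \<omega> \<and> lump_val \<iota> \<omega> \<le> a \<iota>}"
      and B: "B \<in> sets (FXN s)" and I: "finite I" unfolding lump_system_def by blast
    show "(LINT \<omega>:A|M. ?f \<omega>) = (LINT \<omega>:A|M. ?g \<omega>)"
    proof (cases "\<iota> \<in> I")
      case True
      \<comment> \<open>A reward recorded in A was earned by s, while D requires it to be earned
        later.\<close>
      then have "A \<inter> D = {}" unfolding A D_def lump_done_def by blast
      then have "indicator A \<omega> *\<^sub>R ?f \<omega> = 0" "indicator A \<omega> *\<^sub>R ?g \<omega> = 0" for \<omega> by (auto simp: indicator_def)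
      then show ?thesis unfolding set_lebesgue_integral_def by (simp only:)
    next
      case False
      let ?H = "{\<omega>\<in>space M. \<forall>\<iota>\<in>I. lump_happened \<iota> s \<omega>}"
      let ?b = "\<lambda>\<iota>'. if \<iota>' = \<iota> then z else a \<iota>'"
      let ?BH = "B \<inter> ?H \<inter> D"
      let ?V = "{\<omega>\<in>space M. \<forall>\<iota>\<in>I. lump_val \<iota> \<omega> \<le> a \<iota>}"
      have BH: "?BH \<in> sets SXN"
        using sets_subalgebra[OF subalgebras(6) B] sets_subalgebra[OF subalgebras(6) all_happened_in_FXN[OF st(1) I]] D_SXN
        by blast
      have happened: "lump_happened \<iota>' t \<omega>" if "\<omega> \<in> ?H" "\<iota>' \<in> I" for \<omega> \<iota>'
        using that lump_happened_mono[OF st] by blast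
      have "(LINT \<omega>:A|M. ?f \<omega>) = (LINT \<omega>|M. indicator ?BH \<omega> * indicator {\<omega>\<in>space M. \<forall>\<iota>'\<in>insert \<iota> I. lump_val \<iota>' \<omega> \<le> ?b \<iota>'} \<omega>)"
        unfolding A set_lebesgue_integral_def using False
        by (intro Bochner_Integration.integral_cong) (auto simp: indicator_def)
      also have "\<dots> = (LINT \<omega>|M. indicator ?BH \<omega> * (\<Prod>\<iota>'\<in>insert \<iota> I. indicator (lump_done \<iota>' t) \<omega> * lump_cdf \<iota>' \<omega> (?b \<iota>')))"
      proof (rule lump_product[OF t, where C=1])
        show "indicator ?BH \<omega> = (0::real)" if "\<iota>' \<in> insert \<iota> I" "\<not> lump_happened \<iota>' t \<omega>" for \<omega> \<iota>'
          using that happened[of \<omega> \<iota>'] by (auto simp: indicator_def D_def lump_done_def)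
        show "(\<lambda>\<omega>. indicator ?BH \<omega> :: real) \<in> borel_measurable SXN" using BH by (rule borel_measurable_indicator)
        show "\<bar>indicator ?BH \<omega> :: real\<bar> \<le> 1" for \<omega> by (simp add: indicator_def)
      qed (use I in simp)
      \<comment> \<open>The factor of \<iota> is split off; the product over I is then turned back
        into the indicator of the observed rewards.\<close>
      also have "\<dots> = (LINT \<omega>|M. (indicator ?BH \<omega> * ?g \<omega>) * (\<Prod>\<iota>'\<in>I. indicator (lump_done \<iota>' t) \<omega> * lump_cdf \<iota>' \<omega> (a \<iota>')))"
      proof (intro Bochner_Integration.integral_cong refl)
        fix \<omega>
        have "(\<Prod>\<iota>'\<in>I. indicator (lump_done \<iota>' t) \<omega> * lump_cdf \<iota>' \<omega> (?b \<iota>')) = (\<Prod>\<iota>'\<in>I. indicator (lump_done \<iota>' t) \<omega> * lump_cdf \<iota>' \<omega> (a \<iota>'))"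
          using False by (intro prod.cong) auto
        then show "indicator ?BH \<omega> * (\<Prod>\<iota>'\<in>insert \<iota> I. indicator (lump_done \<iota>' t) \<omega> * lump_cdf \<iota>' \<omega> (?b \<iota>'))
          = (indicator ?BH \<omega> * ?g \<omega>) * (\<Prod>\<iota>'\<in>I. indicator (lump_done \<iota>' t) \<omega> * lump_cdf \<iota>' \<omega> (a \<iota>'))"
          using False I D_sub by (auto simp: indicator_def)
      qed
      also have "\<dots> = (LINT \<omega>|M. (indicator ?BH \<omega> * ?g \<omega>) * indicator ?V \<omega>)"
      proof (rule lump_product[OF t I, where C=1, symmetric])
        show "(\<lambda>\<omega>. indicator ?BH \<omega> * ?g \<omega>) \<in> borel_measurable SXN"
          by (rule borel_measurable_times[OF borel_measurable_indicator[OF BH] measurable_from_subalg[OF subalgebras(6) Dc]])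
        show "\<bar>indicator ?BH \<omega> * ?g \<omega>\<bar> \<le> 1" for \<omega> using Db[of \<omega>] by (auto simp: indicator_def)
        show "indicator ?BH \<omega> * ?g \<omega> = (0::real)" if "\<iota>' \<in> I" "\<not> lump_happened \<iota>' t \<omega>" for \<omega> \<iota>'
          using that happened[of \<omega> \<iota>'] by (auto simp: indicator_def)
      qed
      also have "\<dots> = (LINT \<omega>:A|M. ?g \<omega>)"
        unfolding A set_lebesgue_integral_def
        by (intro Bochner_Integration.integral_cong) (auto simp: indicator_def)
      finally show ?thesis .
    qed
  qed
  moreover have "(LINT \<omega>:A|M. ?g \<omega>) = (LINT \<omega>|M. indicator (A \<inter> D) \<omega> * lump_cdf \<iota> \<omega> z)"
    unfolding set_lebesgue_integral_def by (intro Bochner_Integration.integral_cong) (auto simp: indicator_def)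
  moreover have "(LINT \<omega>:A|M. ?f \<omega>) = (LINT \<omega>|M. indicator ((A \<inter> D) \<inter> {\<omega>\<in>space M. lump_val \<iota> \<omega> \<le> z}) \<omega>)"
    unfolding set_lebesgue_integral_def by (intro Bochner_Integration.integral_cong) (auto simp: indicator_def)
  moreover have "(A \<inter> D \<inter> {\<omega>\<in>space M. lump_val \<iota> \<omega> \<le> z}) \<inter> space M = A \<inter> D \<inter> {\<omega>\<in>space M. lump_val \<iota> \<omega> \<le> z}" by blast
  ultimately show ?thesis by simp
qed

lemma lump_mean_given_FH:
  fixes \<iota> :: lump and s t :: real
  assumes st: "0 \<le> s" "s \<le> t" and A: "A \<in> sets (FH s)"
  defines "D \<equiv> lump_done \<iota> t - lump_done \<iota> s"
  shows "AE \<omega> in M. \<omega> \<in> A \<inter> D \<longrightarrow> 0 \<le> lump_val \<iota> \<omega> \<and> lump_val \<iota> \<omega> \<le> c"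
    and "(\<lambda>\<omega>. indicator (A \<inter> D) \<omega> * mean_pos (lump_cdf \<iota> \<omega>)) \<in> borel_measurable M"
    and "(LINT \<omega>|M. indicator (A \<inter> D) \<omega> * lump_val \<iota> \<omega>) = (LINT \<omega>|M. indicator (A \<inter> D) \<omega> * mean_pos (lump_cdf \<iota> \<omega>))"
proof -
  have t: "0 \<le> t" using st by simp
  have D_XN: "D \<in> sets (FXN t)"
    unfolding D_def using lump_done_in_FXN[OF t order.refl] lump_done_in_FXN[OF st] by (intro sets.Diff)
  have D_M: "D \<in> events" using sets_subalgebra[OF subalgebras(8) D_XN] .
  have A_M: "A \<in> events" using sets_subalgebra[OF subalgebra_FH[OF st(1)] A] .
  have C: "A \<inter> D \<in> events" using A_M D_M by (rule sets.Int)
  have supp: "\<And>\<omega>. \<omega> \<in> A \<inter> D \<Longrightarrow> supported_cdf c (lump_cdf \<iota> \<omega>)"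
    using lump_supported[OF t] by (auto simp: D_def)
  have m: "(\<lambda>\<omega>. indicator (A \<inter> D) \<omega> * lump_cdf \<iota> \<omega> z) \<in> borel_measurable M" for z
  proof -
    have "(\<lambda>\<omega>. indicator (A \<inter> D) \<omega> * (indicator (lump_done \<iota> t) \<omega> * lump_cdf \<iota> \<omega> z)) \<in> borel_measurable M"
      by (rule borel_measurable_times[OF borel_measurable_indicator[OF C] measurable_from_subalg[OF subalgebras(8) lump_cdf_measurable[OF t]]])
    also have "(\<lambda>\<omega>. indicator (A \<inter> D) \<omega> * (indicator (lump_done \<iota> t) \<omega> * lump_cdf \<iota> \<omega> z)) = (\<lambda>\<omega>. indicator (A \<inter> D) \<omega> * lump_cdf \<iota> \<omega> z)"
    proof
      fix \<omega>
      show "indicator (A \<inter> D) \<omega> * (indicator (lump_done \<iota> t) \<omega> * lump_cdf \<iota> \<omega> z) = indicator (A \<inter> D) \<omega> * lump_cdf \<iota> \<omega> z"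
        by (cases "\<omega> \<in> D") (auto simp: D_def)
    qed
    finally show ?thesis .
  qed
  note * = expectation_via_cdf[OF lump_val_measurable C supp m lump_given_FH[OF st A, of \<iota>, folded D_def]]
  show "AE \<omega> in M. \<omega> \<in> A \<inter> D \<longrightarrow> 0 \<le> lump_val \<iota> \<omega> \<and> lump_val \<iota> \<omega> \<le> c" by (rule *(1)) auto
  show "(\<lambda>\<omega>. indicator (A \<inter> D) \<omega> * mean_pos (lump_cdf \<iota> \<omega>)) \<in> borel_measurable M" by (rule *(2)) auto
  show "(LINT \<omega>|M. indicator (A \<inter> D) \<omega> * lump_val \<iota> \<omega>) = (LINT \<omega>|M. indicator (A \<inter> D) \<omega> * mean_pos (lump_cdf \<iota> \<omega>))"
    by (rule *(3)) auto
qed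

end

subsection \<open>Compensators of marked counting processes\<close>

lemma sum_greaterThanAtMost_nat_suminf:
  fixes h :: "nat \<Rightarrow> real"
  shows "(\<lambda>k. of_bool (m < Suc k \<and> Suc k \<le> n) * h (Suc k)) sums (\<Sum>k\<in>{m<..n}. h k)"
proof -
  have "(\<lambda>k. of_bool (m < Suc k \<and> Suc k \<le> n) * h (Suc k)) sums
      (\<Sum>k\<in>{m..<n}. of_bool (m < Suc k \<and> Suc k \<le> n) * h (Suc k))"
    by (rule sums_finite) auto
  also have "(\<Sum>k\<in>{m..<n}. of_bool (m < Suc k \<and> Suc k \<le> n) * h (Suc k)) = (\<Sum>k\<in>{m..<n}. h (Suc k))"
    by (intro sum.cong) auto
  also have "\<dots> = (\<Sum>k\<in>{m<..n}. h k)"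
    by (rule sum.reindex_bij_witness[of _ "\<lambda>k. k - 1" Suc]) auto
  finally show ?thesis .
qed

text \<open>\<open>H\<close> knows only the mean number of marked events in (a, t] on A, for each a.
  As the intervals (a, t] determine the mean measure, \<open>campbell\<close> extends this to sums
  of g over the event times. Nonnegativity of \<psi> and g permits the detour through extended
  nonnegative integrals.\<close>

lemma (in prob_space) compensator_of_marks:
  fixes f :: "'a \<Rightarrow> real \<Rightarrow> nat" and mk :: "nat \<Rightarrow> 'a \<Rightarrow> bool" and g \<psi> :: "real \<Rightarrow> real"
  assumes f: "\<And>\<omega>. \<omega> \<in> space M \<Longrightarrow> step_path (f \<omega>)"
    and fm: "\<And>u. 0 \<le> u \<Longrightarrow> u \<le> t \<Longrightarrow> (\<lambda>\<omega>. f \<omega> u) \<in> measurable M (count_space UNIV)"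
    and mk: "\<And>k. {\<omega>\<in>space M. Suc k \<le> f \<omega> t \<and> mk k \<omega>} \<in> events"
    and A: "A \<in> events" and st: "0 \<le> s" "s \<le> t"
    and int: "integrable M (\<lambda>\<omega>. real (f \<omega> t))"
    and \<psi>: "(\<lambda>u. \<psi> (max 0 u)) \<in> borel_measurable borel" "\<And>u. 0 \<le> u \<Longrightarrow> 0 \<le> \<psi> u \<and> \<psi> u \<le> B"
    and g: "(\<lambda>u. g (max 0 u)) \<in> borel_measurable borel" "\<And>u. 0 \<le> u \<Longrightarrow> 0 \<le> g u \<and> g u \<le> C"
    and H: "\<And>a. s \<le> a \<Longrightarrow> a \<le> t \<Longrightarrow>
      (LINT \<omega>|M. indicator A \<omega> * (\<Sum>k\<in>{f \<omega> a<..f \<omega> t}. of_bool (mk (k - 1) \<omega>))) = (LINT u:{a..t}|lborel. \<psi> u)"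
  shows "(\<lambda>k. LINT \<omega>|M. indicator (A \<inter> {\<omega>\<in>space M. f \<omega> s < Suc k \<and> Suc k \<le> f \<omega> t \<and> mk k \<omega>}) \<omega> * g (event_time (f \<omega>) (Suc k)))
      sums (LINT u:{s..t}|lborel. \<psi> u * g u)"
    and "\<And>k. integrable M (\<lambda>\<omega>. indicator (A \<inter> {\<omega>\<in>space M. f \<omega> s < Suc k \<and> Suc k \<le> f \<omega> t \<and> mk k \<omega>}) \<omega> * g (event_time (f \<omega>) (Suc k)))"
proof -
  have t: "0 \<le> t" using st by simp
  define D where "D k = A \<inter> {\<omega>\<in>space M. f \<omega> s < Suc k \<and> Suc k \<le> f \<omega> t \<and> mk k \<omega>}" for k
  define \<theta> where "\<theta> k \<omega> = (if Suc k \<le> f \<omega> t then event_time (f \<omega>) (Suc k) else 0)" for k \<omega>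
  have \<theta>m: "\<theta> k \<in> borel_measurable M" for k
    unfolding \<theta>_def[abs_def] by (rule masked_event_time_measurable[OF f t fm])
  have fs: "(\<lambda>\<omega>. f \<omega> s) \<in> measurable M (count_space UNIV)" by (rule fm[OF st])
  have D: "D k \<in> events" for k
  proof -
    have "{\<omega>\<in>space M. f \<omega> s < Suc k} \<in> events" using fs by measurable
    moreover have "D k = A \<inter> ({\<omega>\<in>space M. f \<omega> s < Suc k} \<inter> {\<omega>\<in>space M. Suc k \<le> f \<omega> t \<and> mk k \<omega>})"
      unfolding D_def by blast
    ultimately show ?thesis using A mk by (simp only: sets.Int)
  qed
  have after: "a < \<theta> k \<omega> \<longleftrightarrow> f \<omega> a < Suc k" if "\<omega> \<in> D k" "0 \<le> a" for a k \<omega>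
  proof -
    have om: "\<omega> \<in> space M" "Suc k \<le> f \<omega> t" using that by (auto simp: D_def)
    then show ?thesis using event_time_less_iff[OF f[OF om(1)] event_occursI[of t "Suc k" "f \<omega>"] that(2)] t
      by (simp add: \<theta>_def)
  qed
  have range: "s < \<theta> k \<omega> \<and> \<theta> k \<omega> \<le> t" if "\<omega> \<in> D k" for k \<omega>
  proof
    show "s < \<theta> k \<omega>" using after[OF that st(1)] that by (simp add: D_def)
    show "\<theta> k \<omega> \<le> t" using after[OF that t] that by (simp add: D_def not_less[symmetric])
  qed
  have eq: "(\<Sum>k. emeasure M (D k \<inter> {\<omega>\<in>space M. a < \<theta> k \<omega>})) = (\<integral>\<^sup>+u\<in>{a<..t}. ennreal (\<psi> (max 0 u)) \<partial>lborel)"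
    if a: "s \<le> a" "a \<le> t" for a
  proof -
    have a0: "0 \<le> a" using a st by simp
    have fa: "(\<lambda>\<omega>. f \<omega> a) \<in> measurable M (count_space UNIV)" by (rule fm[OF a0 a(2)])
    let ?c = "\<lambda>\<omega>. indicator A \<omega> * (\<Sum>k\<in>{f \<omega> a<..f \<omega> t}. of_bool (mk (k - 1) \<omega>)) :: real"
    have Da: "D k \<inter> {\<omega>\<in>space M. a < \<theta> k \<omega>} \<in> events" for k using D \<theta>m by measurable
    \<comment> \<open>Adding the indicators over k counts the marked events in (a, t] on A, the
      quantity integrated in \<open>H\<close>.\<close>
    have ptw: "(\<Sum>k. indicator (D k \<inter> {\<omega>\<in>space M. a < \<theta> k \<omega>}) \<omega>) = ennreal (?c \<omega>)" if om: "\<omega> \<in> space M" for \<omega>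
    proof -
      define h where "h k = (of_bool (f \<omega> a < Suc k \<and> Suc k \<le> f \<omega> t) * (indicator A \<omega> * of_bool (mk (Suc k - 1) \<omega>)) :: real)" for k
      have e: "indicator (D k \<inter> {\<omega>\<in>space M. a < \<theta> k \<omega>}) \<omega> = ennreal (h k)" for k
      proof -
        have "f \<omega> s \<le> f \<omega> a" using step_path_mono[OF f[OF om] st(1) a(1)] .
        then have "\<omega> \<in> D k \<inter> {\<omega>\<in>space M. a < \<theta> k \<omega>} \<longleftrightarrow> \<omega> \<in> A \<and> f \<omega> a < Suc k \<and> Suc k \<le> f \<omega> t \<and> mk k \<omega>"
          using after[of \<omega> k a] a0 om by (auto simp: D_def)
        then show ?thesis by (simp add: indicator_def h_def)
      qed
      have "h sums (\<Sum>k\<in>{f \<omega> a<..f \<omega> t}. indicator A \<omega> * of_bool (mk (k - 1) \<omega>))"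
        unfolding h_def[abs_def] by (rule sum_greaterThanAtMost_nat_suminf)
      then have hs: "h sums ?c \<omega>" by (simp only: sum_distrib_left)
      have "(\<Sum>k. indicator (D k \<inter> {\<omega>\<in>space M. a < \<theta> k \<omega>}) \<omega>) = (\<Sum>k. ennreal (h k))" by (simp only: e)
      also have "\<dots> = ennreal (suminf h)"
        by (rule suminf_ennreal2[OF _ sums_summable[OF hs]]) (simp add: h_def)
      finally show ?thesis by (simp only: sums_unique[OF hs, symmetric])
    qed
    have cm: "?c \<in> borel_measurable M"
    proof -
      have "(\<lambda>\<omega>. enn2real (\<Sum>k. indicator (D k \<inter> {\<omega>\<in>space M. a < \<theta> k \<omega>}) \<omega>)) \<in> borel_measurable M"
        using Da by measurable
      also have "?this \<longleftrightarrow> ?thesis" by (rule measurable_cong) (simp add: ptw sum_nonneg)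
      finally show ?thesis .
    qed
    have ci: "integrable M ?c"
    proof (rule Bochner_Integration.integrable_bound[OF int cm])
      show "AE \<omega> in M. norm (?c \<omega>) \<le> norm (real (f \<omega> t))"
      proof (rule AE_I2)
        fix \<omega>
        have "(\<Sum>k\<in>{f \<omega> a<..f \<omega> t}. of_bool (mk (k - 1) \<omega>)) \<le> (\<Sum>k\<in>{f \<omega> a<..f \<omega> t}. 1 :: real)"
          by (intro sum_mono) auto
        also have "\<dots> \<le> real (f \<omega> t)" by simp
        finally show "norm (?c \<omega>) \<le> norm (real (f \<omega> t))"
          by (auto simp: indicator_def sum_nonneg simp del: sum_of_bool_eq)
      qed
    qed
    have "(\<Sum>k. emeasure M (D k \<inter> {\<omega>\<in>space M. a < \<theta> k \<omega>})) = (\<integral>\<^sup>+\<omega>. (\<Sum>k. indicator (D k \<inter> {\<omega>\<in>space M. a < \<theta> k \<omega>}) \<omega>) \<partial>M)"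
      using Da by (subst nn_integral_suminf) auto
    also have "\<dots> = (\<integral>\<^sup>+\<omega>. ennreal (?c \<omega>) \<partial>M)" by (intro nn_integral_cong ptw)
    also have "\<dots> = ennreal (LINT \<omega>|M. ?c \<omega>)"
      by (rule nn_integral_eq_integral[OF ci]) (simp add: sum_nonneg)
    also have "\<dots> = ennreal (LINT u:{a..t}|lborel. \<psi> u)" unfolding H[OF a] ..
    also have "\<dots> = (\<integral>\<^sup>+u. ennreal (indicator {a..t} u *\<^sub>R \<psi> u) \<partial>lborel)"
      unfolding set_lebesgue_integral_def
    proof (rule nn_integral_eq_integral[symmetric])
      have \<psi>b: "\<bar>\<psi> u\<bar> \<le> B" if "0 \<le> u" for u using \<psi>(2)[OF that] by simp
      show "integrable lborel (\<lambda>u. indicator {a..t} u *\<^sub>R \<psi> u)"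
      proof (rule Bochner_Integration.integrable_bound)
        show "integrable lborel (\<lambda>u. indicator {a..t} u *\<^sub>R B)"
          using borel_integrable_atLeastAtMost'[of a t "\<lambda>_. B"] by (simp add: set_integrable_def)
        have "(\<lambda>u. indicator {a..t} u *\<^sub>R \<psi> u) = (\<lambda>u. indicator {a..t} u *\<^sub>R \<psi> (max 0 u))"
          using a0 by (auto simp: indicator_def max_def)
        then show "(\<lambda>u. indicator {a..t} u *\<^sub>R \<psi> u) \<in> borel_measurable lborel" using \<psi>(1) by simp
        have "\<bar>\<psi> u\<bar> \<le> \<bar>B\<bar>" if "0 \<le> u" for u using \<psi>b[OF that] by simp
        then show "AE u in lborel. norm (indicator {a..t} u *\<^sub>R \<psi> u) \<le> norm (indicator {a..t} u *\<^sub>R B)"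
          using a0 by (intro AE_I2) (auto simp: indicator_def)
      qed
      show "AE u in lborel. 0 \<le> indicator {a..t} u *\<^sub>R \<psi> u"
        using \<psi>(2) a0 by (intro AE_I2) (auto simp: indicator_def)
    qed
    also have "\<dots> = (\<integral>\<^sup>+u\<in>{a<..t}. ennreal (\<psi> (max 0 u)) \<partial>lborel)"
    proof (rule nn_integral_cong_AE)
      show "AE u in lborel. ennreal (indicator {a..t} u *\<^sub>R \<psi> u) = ennreal (\<psi> (max 0 u)) * indicator {a<..t} u"
        using AE_lborel_singleton[of a] by eventually_elim (use a0 in \<open>auto simp: indicator_def max_def\<close>)
    qed
    finally show ?thesis .
  qed
  have "0 \<le> B" using \<psi>(2)[of 0] by simp
  have fin: "(\<integral>\<^sup>+u\<in>{s<..t}. ennreal (\<psi> (max 0 u)) \<partial>lborel) < \<infinity>"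
  proof -
    have "(\<integral>\<^sup>+u\<in>{s<..t}. ennreal (\<psi> (max 0 u)) \<partial>lborel) \<le> (\<integral>\<^sup>+u\<in>{s<..t}. ennreal B \<partial>lborel)"
      using \<psi>(2) by (intro nn_integral_mono mult_right_mono ennreal_leI) auto
    also have "\<dots> < \<infinity>" using st by (subst nn_integral_cmult_indicator) (auto simp: ennreal_mult_less_top)
    finally show ?thesis .
  qed
  have cam: "(\<Sum>k. \<integral>\<^sup>+\<omega>. indicator (D k) \<omega> * ennreal (g (max 0 (\<theta> k \<omega>))) \<partial>M)
      = (\<integral>\<^sup>+u\<in>{s<..t}. ennreal (\<psi> (max 0 u)) * ennreal (g (max 0 u)) \<partial>lborel)"
    by (rule campbell[OF D \<theta>m _ _ range st(2) eq fin, of "\<lambda>u. ennreal (g (max 0 u))"]) (use \<psi> g in auto)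
  let ?h = "\<lambda>k \<omega>. indicator (D k) \<omega> * g (event_time (f \<omega>) (Suc k))"
  have h_eq: "?h k \<omega> = indicator (D k) \<omega> * g (max 0 (\<theta> k \<omega>))" for k \<omega>
    using range[of \<omega> k] st by (auto simp: indicator_def D_def \<theta>_def max_def)
  have "0 \<le> C" using g(2)[of 0] by simp
  have h0: "0 \<le> ?h k \<omega>" for k \<omega> unfolding h_eq using g(2)[of "max 0 (\<theta> k \<omega>)"] by simp
  have hi: "integrable M (?h k)" for k
  proof (rule integrable_bounded[of _ C])
    have "(\<lambda>\<omega>. g (max 0 (\<theta> k \<omega>))) \<in> borel_measurable M" by (rule measurable_compose[OF \<theta>m g(1)])
    then show "?h k \<in> borel_measurable M" unfolding h_eq using D by simp
    show "\<bar>?h k \<omega>\<bar> \<le> C" for \<omega> unfolding h_eq using g(2)[of "max 0 (\<theta> k \<omega>)"] \<open>0 \<le> C\<close> by (simp add: indicator_def)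
  qed
  have nn: "(\<integral>\<^sup>+\<omega>. indicator (D k) \<omega> * ennreal (g (max 0 (\<theta> k \<omega>))) \<partial>M) = ennreal (LINT \<omega>|M. ?h k \<omega>)" for k
  proof -
    have "(\<integral>\<^sup>+\<omega>. indicator (D k) \<omega> * ennreal (g (max 0 (\<theta> k \<omega>))) \<partial>M) = (\<integral>\<^sup>+\<omega>. ennreal (?h k \<omega>) \<partial>M)"
      unfolding h_eq by (intro nn_integral_cong) (auto simp: indicator_def)
    also have "\<dots> = ennreal (LINT \<omega>|M. ?h k \<omega>)" by (rule nn_integral_eq_integral[OF hi]) (use h0 in auto)
    finally show ?thesis .
  qed
  let ?q = "\<lambda>u. indicator {s..t} u *\<^sub>R (\<psi> u * g u)"
  have qb: "\<bar>\<psi> u * g u\<bar> \<le> B * C" if "0 \<le> u" for u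
    using \<psi>(2)[OF that] g(2)[OF that] \<open>0 \<le> B\<close> by (auto simp: abs_mult intro!: mult_mono)
  have qi: "integrable lborel ?q"
  proof (rule Bochner_Integration.integrable_bound)
    show "integrable lborel (\<lambda>u. indicator {s..t} u *\<^sub>R (B * C))"
      using borel_integrable_atLeastAtMost'[of s t "\<lambda>_. B * C"] by (simp add: set_integrable_def)
    have "?q = (\<lambda>u. indicator {s..t} u *\<^sub>R (\<psi> (max 0 u) * g (max 0 u)))"
      using st by (auto simp: indicator_def max_def)
    then show "?q \<in> borel_measurable lborel" using \<psi>(1) g(1) by simp
    have "\<bar>\<psi> u * g u\<bar> \<le> \<bar>B * C\<bar>" if "0 \<le> u" for u using qb[OF that] by simp
    then show "AE u in lborel. norm (?q u) \<le> norm (indicator {s..t} u *\<^sub>R (B * C))"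
      using st by (intro AE_I2) (auto simp: indicator_def)
  qed
  have q0: "0 \<le> ?q u" for u using \<psi>(2) g(2) st by (auto simp: indicator_def)
  have "(\<integral>\<^sup>+u\<in>{s<..t}. ennreal (\<psi> (max 0 u)) * ennreal (g (max 0 u)) \<partial>lborel) = (\<integral>\<^sup>+u. ennreal (?q u) \<partial>lborel)"
  proof (rule nn_integral_cong_AE)
    show "AE u in lborel. ennreal (\<psi> (max 0 u)) * ennreal (g (max 0 u)) * indicator {s<..t} u = ennreal (?q u)"
      using AE_lborel_singleton[of s]
    proof eventually_elim
      case (elim u)
      show ?case
      proof (cases "u \<in> {s<..t}")
        case True
        then show ?thesis using \<psi>(2)[of u] st by (simp add: max_def ennreal_mult' indicator_def)
      qed (use elim in \<open>auto simp: indicator_def\<close>)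
    qed
  qed
  also have "\<dots> = ennreal (LINT u:{s..t}|lborel. \<psi> u * g u)"
    unfolding set_lebesgue_integral_def by (rule nn_integral_eq_integral[OF qi]) (use q0 in auto)
  finally have n1: "(\<Sum>k. ennreal (LINT \<omega>|M. ?h k \<omega>)) = ennreal (LINT u:{s..t}|lborel. \<psi> u * g u)"
    using cam unfolding nn by simp
  have n2: "0 \<le> (LINT u:{s..t}|lborel. \<psi> u * g u)"
    unfolding set_lebesgue_integral_def by (rule Bochner_Integration.integral_nonneg) (rule q0)
  have n3: "(\<lambda>k. ennreal (LINT \<omega>|M. ?h k \<omega>)) sums (\<Sum>k. ennreal (LINT \<omega>|M. ?h k \<omega>))"
    by (rule summable_sums) simp
  have "(\<lambda>k. LINT \<omega>|M. ?h k \<omega>) sums (LINT u:{s..t}|lborel. \<psi> u * g u)"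
    using n3 unfolding n1
    by (subst (asm) sums_ennreal) (use h0 n2 in \<open>auto intro!: Bochner_Integration.integral_nonneg\<close>)
  then show "(\<lambda>k. LINT \<omega>|M. indicator (A \<inter> {\<omega>\<in>space M. f \<omega> s < Suc k \<and> Suc k \<le> f \<omega> t \<and> mk k \<omega>}) \<omega> * g (event_time (f \<omega>) (Suc k)))
      sums (LINT u:{s..t}|lborel. \<psi> u * g u)" unfolding D_def .
  show "integrable M (\<lambda>\<omega>. indicator (A \<inter> {\<omega>\<in>space M. f \<omega> s < Suc k \<and> Suc k \<le> f \<omega> t \<and> mk k \<omega>}) \<omega> * g (event_time (f \<omega>) (Suc k)))" for k
    using hi[of k] unfolding D_def .
qed

text \<open>A sum with a random number of terms becomes a series over all k with indicators. The
  terms are nonnegative, so convergence of their means is absolute convergence and allows the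
  exchange with the integral.\<close>

lemma (in prob_space) sum_of_lumps:
  fixes f :: "'a \<Rightarrow> real \<Rightarrow> nat" and V :: "nat \<Rightarrow> 'a \<Rightarrow> real"
  assumes V: "\<And>k. integrable M (\<lambda>\<omega>. indicator (A \<inter> {\<omega>\<in>space M. f \<omega> s < Suc k \<and> Suc k \<le> f \<omega> t}) \<omega> * V (Suc k) \<omega>)"
    and pos: "\<And>k. AE \<omega> in M. 0 \<le> indicator (A \<inter> {\<omega>\<in>space M. f \<omega> s < Suc k \<and> Suc k \<le> f \<omega> t}) \<omega> * V (Suc k) \<omega>"
    and sums: "(\<lambda>k. LINT \<omega>|M. indicator (A \<inter> {\<omega>\<in>space M. f \<omega> s < Suc k \<and> Suc k \<le> f \<omega> t}) \<omega> * V (Suc k) \<omega>) sums S"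
  shows "integrable M (\<lambda>\<omega>. indicator A \<omega> * (\<Sum>k\<in>{f \<omega> s<..f \<omega> t}. V k \<omega>))"
    and "(LINT \<omega>|M. indicator A \<omega> * (\<Sum>k\<in>{f \<omega> s<..f \<omega> t}. V k \<omega>)) = S"
proof -
  let ?h = "\<lambda>k \<omega>. indicator (A \<inter> {\<omega>\<in>space M. f \<omega> s < Suc k \<and> Suc k \<le> f \<omega> t}) \<omega> * V (Suc k) \<omega>"
  have ptw: "(\<lambda>k. ?h k \<omega>) sums (indicator A \<omega> * (\<Sum>k\<in>{f \<omega> s<..f \<omega> t}. V k \<omega>))" if "\<omega> \<in> space M" for \<omega>
  proof -
    have "(\<lambda>k. of_bool (f \<omega> s < Suc k \<and> Suc k \<le> f \<omega> t) * (indicator A \<omega> * V (Suc k) \<omega>)) sums (\<Sum>k\<in>{f \<omega> s<..f \<omega> t}. indicator A \<omega> * V k \<omega>)"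
      by (rule sum_greaterThanAtMost_nat_suminf)
    moreover have "of_bool (f \<omega> s < Suc k \<and> Suc k \<le> f \<omega> t) * (indicator A \<omega> * V (Suc k) \<omega>) = ?h k \<omega>" for k
      using that by (auto simp: indicator_def)
    ultimately show ?thesis by (simp only: sum_distrib_left)
  qed
  have fin: "summable (\<lambda>k. norm (?h k \<omega>))" for \<omega>
    by (rule summable_finite[of "{..<f \<omega> t}"]) (auto simp: indicator_def)
  have "(LINT \<omega>|M. norm (?h k \<omega>)) = (LINT \<omega>|M. ?h k \<omega>)" for k
  proof (rule integral_cong_AE)
    show "AE \<omega> in M. norm (?h k \<omega>) = ?h k \<omega>" using pos[of k] by eventually_elim simp
  qed (use V[of k] in \<open>auto intro!: borel_measurable_norm borel_measurable_integrable simp del: real_norm_def\<close>)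
  then have sn: "summable (\<lambda>k. LINT \<omega>|M. norm (?h k \<omega>))" using sums by (simp add: sums_iff)
  note I = integrable_suminf[OF V AE_I2[OF fin] sn] integral_suminf[OF V AE_I2[OF fin] sn]
  have "integrable M (\<lambda>\<omega>. \<Sum>k. ?h k \<omega>) \<longleftrightarrow> integrable M (\<lambda>\<omega>. indicator A \<omega> * (\<Sum>k\<in>{f \<omega> s<..f \<omega> t}. V k \<omega>))"
    using ptw by (intro Bochner_Integration.integrable_cong refl) (simp add: sums_iff)
  with I(1) show "integrable M (\<lambda>\<omega>. indicator A \<omega> * (\<Sum>k\<in>{f \<omega> s<..f \<omega> t}. V k \<omega>))" by blast
  have "(LINT \<omega>|M. indicator A \<omega> * (\<Sum>k\<in>{f \<omega> s<..f \<omega> t}. V k \<omega>)) = (LINT \<omega>|M. (\<Sum>k. ?h k \<omega>))"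
    using ptw by (intro Bochner_Integration.integral_cong refl) (simp add: sums_iff)
  also have "\<dots> = S" using I(2) sums by (simp add: sums_iff)
  finally show "(LINT \<omega>|M. indicator A \<omega> * (\<Sum>k\<in>{f \<omega> s<..f \<omega> t}. V k \<omega>)) = S" .
qed

subsection \<open>The Markov property relative to the reward history\<close>

locale reward_process_rates = reward_process M Q p q \<mu> r \<beta> G H K \<tau> X N Gr Hr Kr b c
  for M :: "'w measure" and Q :: "real \<Rightarrow> 's::finite \<Rightarrow> 's \<Rightarrow> real" and p q \<mu> r \<beta> G H K \<tau> X N Gr Hr Kr b c +
  assumes Q_nonneg: "\<And>t x y. 0 \<le> t \<Longrightarrow> x \<noteq> y \<Longrightarrow> 0 \<le> Q t x y"
    and Q_support: "\<And>t x y. 0 \<le> t \<Longrightarrow> x \<noteq> y \<Longrightarrow> (x, y) \<notin> support_at Q 1 \<Longrightarrow> Q t x y = 0"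
    and Q_diag: "\<And>x. (x, x) \<notin> support_at Q 1"
begin

definition state :: "real \<Rightarrow> 's \<Rightarrow> 'w set" where
  "state u x = {\<omega>\<in>space M. X u \<omega> = x}"

text \<open>The state changes between two given states with probability at most L (v - u), and
  \<open>CARD('s)\<close> counts the possible partners.\<close>

definition Lip :: real where "Lip = real CARD('s) * L"

lemma Lip_nonneg: "0 \<le> Lip"
  using L_nonneg by (simp add: Lip_def)

lemma state_in:
  assumes "X u \<in> measurable F (count_space UNIV)" "space F = space M"
  shows "state u x \<in> sets F"
proof -
  have "X u -` {x} \<inter> space F \<in> sets F" by (rule measurable_sets[OF assms(1)]) simp
  also have "X u -` {x} \<inter> space F = state u x" using assms(2) by (auto simp: state_def)
  finally show ?thesis .
qed

lemma state_events: "0 \<le> u \<Longrightarrow> state u x \<in> events"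
  by (rule state_in[OF X_measurable]) auto

lemma state_FX: "0 \<le> u \<Longrightarrow> u \<le> s \<Longrightarrow> state u x \<in> sets (FX s)"
  by (rule state_in[OF X_in_FX]) auto

lemma state_SX: "0 \<le> u \<Longrightarrow> state u x \<in> sets SX"
  by (rule state_in[OF X_in_SX]) auto

lemma FH_events: "0 \<le> s \<Longrightarrow> A \<in> sets (FH s) \<Longrightarrow> A \<in> events"
  using sets_subalgebra[OF subalgebra_FH] by blast

lemma state_indicator_sum: "\<omega> \<in> space M \<Longrightarrow> (\<Sum>x\<in>UNIV. indicator (state u x) \<omega> * h x) = (h (X u \<omega>) :: real)"
  by (simp add: state_def indicator_def of_bool_def if_distrib[of "\<lambda>a. a * _"] cong: if_cong)

lemma prob_split_state:
  assumes "A \<in> events" "0 \<le> u"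
  shows "prob A = (\<Sum>x\<in>UNIV. prob (A \<inter> state u x))"
proof -
  have "A = (\<Union>x\<in>UNIV. A \<inter> state u x)"
    using sets.sets_into_space[OF assms(1)] by (auto simp: state_def)
  also have "prob \<dots> = (\<Sum>x\<in>UNIV. prob (A \<inter> state u x))"
    by (rule finite_measure_finite_Union)
       (use assms state_events in \<open>auto simp: disjoint_family_on_def state_def\<close>)
  finally show ?thesis .
qed

text \<open>Both sides are expectations of functionals of X, so the Markov property is lifted from
  the history of X to that of (X, N), and from there to the history with rewards, by the two
  transfer lemmas.\<close>

lemma markov_FH:
  assumes su: "0 \<le> s" "s \<le> u" "u \<le> v" and A: "A \<in> sets (FH s)"
  shows "prob (A \<inter> state u x \<inter> state v y) = prob (A \<inter> state u x) * p u v x y"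
proof -
  have u: "0 \<le> u" and v: "0 \<le> v" using su by auto
  let ?W = "\<lambda>\<omega>. indicator (state u x) \<omega> * indicator (state v y) \<omega> :: real"
  let ?W' = "\<lambda>\<omega>. p u v x y * indicator (state u x) \<omega> :: real"
  interpret U: finite_measure_subalgebra M "FX u" by (rule finite_measure_subalgebraI[OF subalgebras(7)])
  have SXm: "?W \<in> borel_measurable SX" "?W' \<in> borel_measurable SX"
    using state_SX[OF u] state_SX[OF v] by simp_all
  have SXNm: "?W \<in> borel_measurable SXN" "?W' \<in> borel_measurable SXN"
    using SXm measurable_from_subalg[OF subalgebras(3)] by blast+
  have bd: "\<bar>?W \<omega>\<bar> \<le> 1" "\<bar>?W' \<omega>\<bar> \<le> 1" for \<omega>
    using p_nonneg[OF u su(3), of x y] p_le_1[OF u su(3), of x y] by (auto simp: indicator_def)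
  have FX_eq: "(LINT \<omega>:B|M. ?W \<omega>) = (LINT \<omega>:B|M. ?W' \<omega>)" if B: "B \<in> sets (FX s)" for B
  proof -
    have BU: "B \<inter> state u x \<in> sets (FX u)"
      using sets_subalgebra[OF subalgebras(9)[OF su(2)] B] state_FX[OF u order.refl] by (rule sets.Int)
    have BM: "B \<inter> state u x \<in> events" using sets_subalgebra[OF subalgebras(7) BU] .
    have ind: "indicator {\<omega>\<in>space M. X v \<omega> = y} = (indicator (state v y) :: 'w \<Rightarrow> real)" by (simp add: state_def)
    have "(LINT \<omega>:B|M. ?W \<omega>) = (LINT \<omega>|M. indicator (B \<inter> state u x) \<omega> * indicator (state v y) \<omega>)"
      unfolding set_lebesgue_integral_def by (intro Bochner_Integration.integral_cong) (auto simp: indicator_def)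
    also have "\<dots> = (LINT \<omega>|M. indicator (B \<inter> state u x) \<omega> * real_cond_exp M (FX u) (indicator (state v y)) \<omega>)"
    proof (rule U.real_cond_exp_intg(2)[symmetric])
      show "integrable M (\<lambda>\<omega>. indicator (B \<inter> state u x) \<omega> * indicator (state v y) \<omega> :: real)"
        by (rule integrable_bounded[where B=1, OF borel_measurable_times[OF borel_measurable_indicator[OF BM] borel_measurable_indicator[OF state_events[OF v]]]])
           (simp add: indicator_def)
    qed (use BU state_events[OF v] in auto)
    also have "\<dots> = (LINT \<omega>|M. indicator (B \<inter> state u x) \<omega> * p u v x y)"
    proof (rule integral_cong_AE)
      show "AE \<omega> in M. indicator (B \<inter> state u x) \<omega> * real_cond_exp M (FX u) (indicator (state v y)) \<omega> = indicator (B \<inter> state u x) \<omega> * p u v x y"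
        using X_markov[OF u su(3), of y, unfolded ind] by eventually_elim (auto simp: indicator_def state_def)
    qed (use BM in auto)
    also have "\<dots> = (LINT \<omega>:B|M. ?W' \<omega>)"
      unfolding set_lebesgue_integral_def by (intro Bochner_Integration.integral_cong) (auto simp: indicator_def)
    finally show ?thesis .
  qed
  have "(LINT \<omega>:A|M. ?W \<omega>) = (LINT \<omega>:A|M. ?W' \<omega>)"
    by (rule transfer_FXN_FH[OF su(1) SXNm(1) bd(1) SXNm(2) bd(2) _ A])
       (rule transfer_FX_FXN[OF su(1) SXm(1) bd(1) SXm(2) bd(2) FX_eq])
  moreover have "(LINT \<omega>:A|M. ?W \<omega>) = (LINT \<omega>|M. indicator (A \<inter> state u x \<inter> state v y) \<omega>)"
    unfolding set_lebesgue_integral_def by (intro Bochner_Integration.integral_cong) (auto simp: indicator_def)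
  moreover have "(LINT \<omega>:A|M. ?W' \<omega>) = (LINT \<omega>|M. p u v x y * indicator (A \<inter> state u x) \<omega>)"
    unfolding set_lebesgue_integral_def by (intro Bochner_Integration.integral_cong) (auto simp: indicator_def)
  moreover have "A \<inter> state u x \<inter> state v y \<inter> space M = A \<inter> state u x \<inter> state v y" "A \<inter> state u x \<inter> space M = A \<inter> state u x"
    by (auto simp: state_def)
  ultimately show ?thesis by (simp add: mult.commute)
qed

lemma markov_state:
  assumes "0 \<le> u" "u \<le> v"
  shows "prob (state u x \<inter> state v y) = prob (state u x) * p u v x y"
proof -
  have "space M \<in> sets (FH u)" using sets.top[of "FH u"] by simp
  from markov_FH[OF assms(1) order.refl assms(2) this, of x y] show ?thesis
    by (simp add: state_def Int_def)
qed

lemma prob_state: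
  assumes "0 \<le> t"
  shows "prob (state t y) = (\<Sum>x\<in>UNIV. pmf \<mu> x * p 0 t x y)"
proof -
  have "prob (state t y) = (\<Sum>x\<in>UNIV. prob (state t y \<inter> state 0 x))"
    by (rule prob_split_state) (use assms state_events in auto)
  also have "\<dots> = (\<Sum>x\<in>UNIV. prob (state 0 x) * p 0 t x y)"
    using markov_state[OF order.refl assms] by (simp add: Int_commute)
  finally show ?thesis using X_initial by (simp add: state_def)
qed

text \<open>The event A is discarded first, so it may be any event, even one that depends on the
  future.\<close>

lemma change_bound:
  assumes uv: "0 \<le> u" "u \<le> v" and xy: "x \<noteq> y" and A: "A \<in> events"
  shows "prob (A \<inter> state u x \<inter> state v y) \<le> L * (v - u)"
proof -
  have "prob (A \<inter> state u x \<inter> state v y) \<le> prob (state u x \<inter> state v y)"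
    by (rule finite_measure_mono) (use uv state_events in auto)
  also have "\<dots> \<le> 1 * p u v x y"
    unfolding markov_state[OF uv] using p_nonneg[OF uv] by (intro mult_right_mono) auto
  also have "\<dots> \<le> L * (v - u)" using p_near_identity[OF uv, of x y] xy by (simp add: abs_le_iff)
  finally show ?thesis .
qed

text \<open>Splitting by the state at the other time, the terms without a change of state cancel;
  each remaining one is controlled by \<open>change_bound\<close>.\<close>

lemma state_lipschitz:
  assumes uv: "0 \<le> u" "u \<le> v" and A: "A \<in> events"
  shows "\<bar>prob (A \<inter> state u x) - prob (A \<inter> state v x)\<bar> \<le> Lip * (v - u)"
proof -
  have v: "0 \<le> v" using uv by simp
  have "prob (A \<inter> state u x) = (\<Sum>y\<in>UNIV. prob (A \<inter> state u x \<inter> state v y))"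
    by (rule prob_split_state) (use A state_events uv v in auto)
  moreover have "prob (A \<inter> state v x) = (\<Sum>y\<in>UNIV. prob (A \<inter> state v x \<inter> state u y))"
    by (rule prob_split_state) (use A state_events uv v in auto)
  ultimately have "prob (A \<inter> state u x) - prob (A \<inter> state v x)
     = (\<Sum>y\<in>UNIV. prob (A \<inter> state u x \<inter> state v y) - prob (A \<inter> state v x \<inter> state u y))"
    by (simp add: sum_subtractf)
  also have "\<bar>\<dots>\<bar> \<le> (\<Sum>y\<in>UNIV. \<bar>prob (A \<inter> state u x \<inter> state v y) - prob (A \<inter> state v x \<inter> state u y)\<bar>)"
    by (rule sum_abs)
  also have "\<dots> \<le> (\<Sum>y\<in>(UNIV :: 's set). L * (v - u))"
  proof (rule sum_mono)
    fix y
    show "\<bar>prob (A \<inter> state u x \<inter> state v y) - prob (A \<inter> state v x \<inter> state u y)\<bar> \<le> L * (v - u)"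
    proof (cases "x = y")
      case True
      then have "A \<inter> state u x \<inter> state v y = A \<inter> state v x \<inter> state u y" by blast
      then show ?thesis using L_nonneg uv by simp
    next
      case False
      have "A \<inter> state v x \<inter> state u y = A \<inter> state u y \<inter> state v x" by blast
      then have "prob (A \<inter> state v x \<inter> state u y) \<le> L * (v - u)"
        using change_bound[OF uv _ A, of y x] False by simp
      moreover have "prob (A \<inter> state u x \<inter> state v y) \<le> L * (v - u)" using change_bound[OF uv False A] .
      ultimately show ?thesis by (simp add: abs_le_iff) (smt (verit) measure_nonneg)
    qed
  qed
  also have "\<dots> = Lip * (v - u)" by (simp add: Lip_def)
  finally show ?thesis .
qed

lemma state_prob_measurable:
  assumes A: "A \<in> events"
  shows "(\<lambda>u. prob (A \<inter> state (max 0 u) x)) \<in> borel_measurable borel"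
proof -
  have *: "\<bar>prob (A \<inter> state (max 0 u) x) - prob (A \<inter> state (max 0 v) x)\<bar> \<le> Lip * \<bar>u - v\<bar>" if "u \<le> v" for u v
  proof -
    have "\<bar>prob (A \<inter> state (max 0 u) x) - prob (A \<inter> state (max 0 v) x)\<bar> \<le> Lip * (max 0 v - max 0 u)"
      by (rule state_lipschitz[OF _ _ A]) (use that in auto)
    also have "\<dots> \<le> Lip * \<bar>u - v\<bar>" using Lip_nonneg that by (intro mult_left_mono) auto
    finally show ?thesis .
  qed
  have "Lip-lipschitz_on UNIV (\<lambda>u. prob (A \<inter> state (max 0 u) x))"
  proof (rule lipschitz_onI)
    fix u v :: real
    show "dist (prob (A \<inter> state (max 0 u) x)) (prob (A \<inter> state (max 0 v) x)) \<le> Lip * dist u v"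
      using *[of u v] *[of v u] by (cases "u \<le> v") (auto simp: dist_real_def abs_minus_commute)
  qed (rule Lip_nonneg)
  then show ?thesis by (intro borel_measurable_continuous_onI lipschitz_on_continuous_on)
qed

subsection \<open>Integrals along the path\<close>

lemma path_fubini:
  fixes \<phi> :: "real \<Rightarrow> 's \<Rightarrow> real"
  assumes \<phi>: "\<And>x. (\<lambda>t. \<phi> (max 0 t) x) \<in> borel_measurable borel" "\<And>t x. 0 \<le> t \<Longrightarrow> \<bar>\<phi> t x\<bar> \<le> B"
    and st: "0 \<le> s" "s \<le> t" and A: "A \<in> events"
  shows "integrable M (\<lambda>\<omega>. indicator A \<omega> * (LINT u:{s..t}|lborel. \<phi> u (X u \<omega>)))"
    and "(LINT \<omega>|M. indicator A \<omega> * (LINT u:{s..t}|lborel. \<phi> u (X u \<omega>)))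
      = (LINT u:{s..t}|lborel. \<Sum>x\<in>UNIV. prob (A \<inter> state u x) * \<phi> u x)"
proof -
  have t: "0 \<le> t" using st by simp
  interpret O: observed_paths M X t by (rule observed_M[OF t])
  interpret P: pair_sigma_finite M lborel by unfold_locales
  \<comment> \<open>The clamped path is jointly measurable on the whole line and agrees with X on
    [s, t], where the indicator is 1.\<close>
  define f where "f \<omega> u = indicator A \<omega> * (indicator {s..t} u * \<phi> (max 0 u) (X (max 0 (min t u)) \<omega>))" for \<omega> u
  have "(\<lambda>z. \<phi> (max 0 (snd z)) (X (max 0 (min t (snd z))) (fst z))) \<in> borel_measurable (M \<Otimes>\<^sub>M borel)"
  proof (rule measurable_compose_countable'[where I=UNIV and g="\<lambda>z. X (max 0 (min t (snd z))) (fst z)" and f="\<lambda>x z. \<phi> (max 0 (snd z)) x"])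
    show "(\<lambda>z. X (max 0 (min t (snd z))) (fst z)) \<in> measurable (M \<Otimes>\<^sub>M borel) (count_space UNIV)"
      using O.joint_measurable by (simp add: case_prod_beta')
    show "(\<lambda>z. \<phi> (max 0 (snd z)) x) \<in> borel_measurable (M \<Otimes>\<^sub>M borel)" for x
      by (rule measurable_compose[OF measurable_snd \<phi>(1)])
  qed (simp add: countable_finite)
  then have [measurable]: "(\<lambda>z. \<phi> (max 0 (snd z)) (X (max 0 (min t (snd z))) (fst z))) \<in> borel_measurable (M \<Otimes>\<^sub>M lborel)"
    by measurable
  note [measurable] = A
  have fm: "case_prod f \<in> borel_measurable (M \<Otimes>\<^sub>M lborel)"
    unfolding f_def case_prod_beta' by measurable
  have B0: "0 \<le> B" using \<phi>(2)[of 0] by (meson abs_ge_zero order.refl order_trans)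
  have fb: "\<bar>f \<omega> u\<bar> \<le> B * indicator {s..t} u" for \<omega> u
    unfolding f_def using \<phi>(2)[of "max 0 u"] B0 by (auto simp: indicator_def)
  have fi: "integrable (M \<Otimes>\<^sub>M lborel) (case_prod f)"
  proof (rule Bochner_Integration.integrable_bound[OF _ fm])
    have "emeasure (M \<Otimes>\<^sub>M lborel) (space M \<times> {s..t}) < \<infinity>"
      using st by (subst lborel.emeasure_pair_measure_Times) (auto simp: emeasure_space_1)
    then have "integrable (M \<Otimes>\<^sub>M lborel) (\<lambda>z. indicator (space M \<times> {s..t}) z *\<^sub>R B)"
      by (intro integrable_scaleR_left integrable_real_indicator) auto
    then show "integrable (M \<Otimes>\<^sub>M lborel) (\<lambda>z. indicator (space M \<times> {s..t}) z *\<^sub>R B)" .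
    show "AE z in M \<Otimes>\<^sub>M lborel. norm (case_prod f z) \<le> norm (indicator (space M \<times> {s..t}) z *\<^sub>R B)"
    proof (rule AE_I2)
      fix z assume "z \<in> space (M \<Otimes>\<^sub>M (lborel :: real measure))"
      then have "fst z \<in> space M" by (auto simp: space_pair_measure)
      then show "norm (case_prod f z) \<le> norm (indicator (space M \<times> {s..t}) z *\<^sub>R B)"
        using fb[of "fst z" "snd z"] B0 by (cases z) (auto simp: indicator_def)
    qed
  qed
  have inner: "(LINT u|lborel. f \<omega> u) = indicator A \<omega> * (LINT u:{s..t}|lborel. \<phi> u (X u \<omega>))" for \<omega>
  proof -
    have "(LINT u|lborel. f \<omega> u) = indicator A \<omega> * (LINT u|lborel. indicator {s..t} u * \<phi> (max 0 u) (X (max 0 (min t u)) \<omega>))"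
      unfolding f_def by simp
    also have "(LINT u|lborel. indicator {s..t} u * \<phi> (max 0 u) (X (max 0 (min t u)) \<omega>)) = (LINT u:{s..t}|lborel. \<phi> u (X u \<omega>))"
      unfolding set_lebesgue_integral_def
    proof (intro Bochner_Integration.integral_cong refl)
      fix u
      have "max 0 (min t u) = u" "max 0 u = u" if "u \<in> {s..t}"
        using that st by (simp_all add: max_absorb2 min_absorb2)
      then show "indicator {s..t} u * \<phi> (max 0 u) (X (max 0 (min t u)) \<omega>) = indicator {s..t} u *\<^sub>R \<phi> u (X u \<omega>)"
        by (cases "u \<in> {s..t}") simp_all
    qed
    finally show ?thesis .
  qed
  show "integrable M (\<lambda>\<omega>. indicator A \<omega> * (LINT u:{s..t}|lborel. \<phi> u (X u \<omega>)))"
    using P.integrable_fst[OF fi] unfolding inner .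
  have "(LINT \<omega>|M. indicator A \<omega> * (LINT u:{s..t}|lborel. \<phi> u (X u \<omega>))) = (LINT u|lborel. (LINT \<omega>|M. f \<omega> u))"
    using P.Fubini_integral[OF fi] unfolding inner by simp
  also have "\<dots> = (LINT u:{s..t}|lborel. \<Sum>x\<in>UNIV. prob (A \<inter> state u x) * \<phi> u x)"
    unfolding set_lebesgue_integral_def
  proof (intro Bochner_Integration.integral_cong refl)
    fix u
    show "(LINT \<omega>|M. f \<omega> u) = indicator {s..t} u *\<^sub>R (\<Sum>x\<in>UNIV. prob (A \<inter> state u x) * \<phi> u x)"
    proof (cases "u \<in> {s..t}")
      case True
      then have u: "max 0 (min t u) = u" "max 0 u = u" "0 \<le> u" using st by (simp_all add: max_absorb2 min_absorb2)
      have "(LINT \<omega>|M. f \<omega> u) = (LINT \<omega>|M. (\<Sum>x\<in>UNIV. indicator (A \<inter> state u x) \<omega> * \<phi> u x))"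
      proof (intro Bochner_Integration.integral_cong refl)
        fix \<omega> assume om: "\<omega> \<in> space M"
        have "f \<omega> u = indicator A \<omega> * \<phi> u (X u \<omega>)" using True unfolding f_def u by simp
        also have "\<dots> = indicator A \<omega> * (\<Sum>x\<in>UNIV. indicator (state u x) \<omega> * \<phi> u x)"
          by (simp only: state_indicator_sum[OF om])
        finally show "f \<omega> u = (\<Sum>x\<in>UNIV. indicator (A \<inter> state u x) \<omega> * \<phi> u x)"
          by (simp add: sum_distrib_left indicator_inter_arith mult.assoc)
      qed
      also have "\<dots> = (\<Sum>x\<in>UNIV. LINT \<omega>|M. indicator (A \<inter> state u x) \<omega> * \<phi> u x)"
      proof (rule Bochner_Integration.integral_sum)
        fix x
        have "A \<inter> state u x \<in> events" using A state_events[OF u(3)] by (rule sets.Int)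
        then show "integrable M (\<lambda>\<omega>. indicator (A \<inter> state u x) \<omega> * \<phi> u x)"
          by (intro integrable_mult_left integrable_real_indicator) (auto simp: less_top[symmetric])
      qed
      also have "\<dots> = (\<Sum>x\<in>UNIV. prob (A \<inter> state u x) * \<phi> u x)"
        by (intro sum.cong refl) (simp add: Int_absorb2 state_def Int_assoc)
      finally show ?thesis using True by simp
    next
      case False
      then show ?thesis by (simp add: f_def)
    qed
  qed
  finally show "(LINT \<omega>|M. indicator A \<omega> * (LINT u:{s..t}|lborel. \<phi> u (X u \<omega>)))
      = (LINT u:{s..t}|lborel. \<Sum>x\<in>UNIV. prob (A \<inter> state u x) * \<phi> u x)" .
qed

end

context reward_process_rates
begin

lemma set_integrable_state_product:
  assumes A: "A \<in> events" and f: "(\<lambda>u. f (max 0 u)) \<in> borel_measurable borel" "\<And>u. 0 \<le> u \<Longrightarrow> \<bar>f u\<bar> \<le> B" and s: "0 \<le> s"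
  shows "set_integrable lborel {s..t} (\<lambda>u. prob (A \<inter> state u x) * f u)"
proof (rule set_integrable_bounded_on_interval[OF _ _ s])
  show "(\<lambda>u. prob (A \<inter> state (max 0 u) x) * f (max 0 u)) \<in> borel_measurable borel"
    using state_prob_measurable[OF A] f(1) by (rule borel_measurable_times)
  show "\<bar>prob (A \<inter> state u x) * f u\<bar> \<le> B" if "0 \<le> u" for u
  proof -
    have "\<bar>prob (A \<inter> state u x) * f u\<bar> \<le> 1 * \<bar>f u\<bar>" unfolding abs_mult by (intro mult_right_mono) auto
    then show ?thesis using f(2)[OF that] by simp
  qed
qed

subsection \<open>Jump rewards\<close>

lemma J_measurable_M: "0 \<le> t \<Longrightarrow> (\<lambda>\<omega>. J t \<omega>) \<in> measurable M (count_space UNIV)"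
  using measurable_from_subalg[OF subalgebras(8) J_measurable[OF _ order.refl]] .

lemma J_path: "\<omega> \<in> space M \<Longrightarrow> step_path (\<lambda>t. J t \<omega>)"
  by (rule step_path_jump_count[OF X_path])

text \<open>The grid counts converge to the jump count, and each has mean at most the number of
  ordered pairs of distinct states times L t, because n cells contribute at most L t / n each.
  Fatou's lemma transfers the bound.\<close>

lemma integrable_J:
  assumes t: "0 \<le> t"
  shows "integrable M (\<lambda>\<omega>. real (J t \<omega>))"
proof -
  let ?S = "{z :: 's \<times> 's. fst z \<noteq> snd z}"
  let ?u = "grid 0 t"
  define a where "a n \<omega> = (\<Sum>z\<in>?S. \<Sum>i<n. indicator (state (?u n i) (fst z) \<inter> state (?u n (Suc i)) (snd z)) \<omega> :: real)" for n \<omega>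
  have u0: "0 \<le> ?u n i" for n i using grid_mono[OF t, of 0 i n] by simp
  have ev: "state (?u n i) x \<inter> state (?u n j) y \<in> events" for n i j x y
    using state_events[OF u0] state_events[OF u0] by (rule sets.Int)
  have am: "a n \<in> borel_measurable M" for n
    unfolding a_def[abs_def] using ev by (intro borel_measurable_sum borel_measurable_indicator)
  have lim: "\<forall>\<^sub>F n in sequentially. a n \<omega> = real (J t \<omega>)" if om: "\<omega> \<in> space M" for \<omega>
    using grid_count_all_jumps[OF X_path[OF om] order.refl t]
  proof eventually_elim
    case (elim n)
    have "a n \<omega> = (\<Sum>z\<in>?S. \<Sum>i<n. of_bool (X (?u n i) \<omega> = fst z \<and> X (?u n (Suc i)) \<omega> = snd z))"
      unfolding a_def using om by (intro sum.cong refl) (simp add: state_def indicator_def)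
    then show ?case using elim step_path_0[OF J_path[OF om]] by simp
  qed
  have le: "(\<integral>\<^sup>+\<omega>. ennreal (a n \<omega>) \<partial>M) \<le> ennreal (real (card ?S) * (L * t))" if n: "0 < n" for n
  proof -
    have "(\<integral>\<^sup>+\<omega>. ennreal (a n \<omega>) \<partial>M) = ennreal (LINT \<omega>|M. a n \<omega>)"
    proof (rule nn_integral_eq_integral)
      show "integrable M (a n)" unfolding a_def[abs_def]
        using ev by (intro Bochner_Integration.integrable_sum integrable_real_indicator) (auto simp: less_top[symmetric])
    qed (simp add: a_def sum_nonneg)
    also have "(LINT \<omega>|M. a n \<omega>) = (\<Sum>z\<in>?S. \<Sum>i<n. prob (state (?u n i) (fst z) \<inter> state (?u n (Suc i)) (snd z)))"
    proof -
      have i: "integrable M (indicator (state (?u n i) x \<inter> state (?u n j) y) :: 'w \<Rightarrow> real)" for i j x y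
        using ev by (intro integrable_real_indicator) (auto simp: less_top[symmetric])
      have "state (?u n i) x \<inter> state (?u n j) y \<inter> space M = state (?u n i) x \<inter> state (?u n j) y" for i j x y
        by (auto simp: state_def)
      then show ?thesis unfolding a_def using i by (simp add: Bochner_Integration.integral_sum)
    qed
    also have "\<dots> \<le> (\<Sum>z\<in>?S. \<Sum>i<n. L * (t / n))"
    proof (intro sum_mono)
      fix z i assume z: "z \<in> ?S"
      have "prob (space M \<inter> state (?u n i) (fst z) \<inter> state (?u n (Suc i)) (snd z)) \<le> L * (?u n (Suc i) - ?u n i)"
        by (rule change_bound) (use z u0 grid_mono[OF t, of i "Suc i" n] in auto)
      also have "space M \<inter> state (?u n i) (fst z) = state (?u n i) (fst z)" by (auto simp: state_def)
      finally show "prob (state (?u n i) (fst z) \<inter> state (?u n (Suc i)) (snd z)) \<le> L * (t / n)"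
        using grid_diff[OF n, of 0 t i] by simp
    qed
    also have "\<dots> = real (card ?S) * (L * t)" using n by simp
    finally show ?thesis by (simp add: ennreal_leI)
  qed
  have "(\<integral>\<^sup>+\<omega>. ennreal (real (J t \<omega>)) \<partial>M) = (\<integral>\<^sup>+\<omega>. liminf (\<lambda>n. ennreal (a n \<omega>)) \<partial>M)"
  proof (rule nn_integral_cong)
    fix \<omega> assume "\<omega> \<in> space M"
    from lim[OF this] have "\<forall>\<^sub>F n in sequentially. ennreal (a n \<omega>) = ennreal (real (J t \<omega>))" by eventually_elim simp
    then have "(\<lambda>n. ennreal (a n \<omega>)) \<longlonglongrightarrow> ennreal (real (J t \<omega>))" by (rule tendsto_eventually)
    then show "ennreal (real (J t \<omega>)) = liminf (\<lambda>n. ennreal (a n \<omega>))"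
      by (rule lim_imp_Liminf[OF trivial_limit_sequentially, symmetric])
  qed
  also have "\<dots> \<le> liminf (\<lambda>n. \<integral>\<^sup>+\<omega>. ennreal (a n \<omega>) \<partial>M)"
    using am by (intro nn_integral_liminf) simp
  also have "\<dots> \<le> liminf (\<lambda>n. ennreal (real (card ?S) * (L * t)))"
    by (rule Liminf_mono) (use eventually_gt_at_top[of 0] in eventually_elim, rule le)
  also have "\<dots> < \<infinity>" by (simp add: Liminf_const)
  finally have "(\<integral>\<^sup>+\<omega>. ennreal (norm (real (J t \<omega>))) \<partial>M) < \<infinity>" by simp
  moreover have "(\<lambda>\<omega>. real (J t \<omega>)) \<in> borel_measurable M" using J_measurable_M[OF t] by measurable
  ultimately show ?thesis by (intro integrableI_bounded)
qed

text \<open>Grid counts converge to the number of jumps under domination by the total jump count.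
  Their means follow cell by cell from the Markov property and form a sum covered by
  \<open>grid_sum_limit\<close>.\<close>

lemma jump_count_integral:
  assumes sa: "0 \<le> s" "s \<le> a" "a \<le> t" and A: "A \<in> sets (FH s)" and xy: "x \<noteq> y"
  shows "(LINT \<omega>|M. indicator A \<omega> * (\<Sum>k\<in>{J a \<omega><..J t \<omega>}. of_bool (jump_chain (\<lambda>t. X t \<omega>) (k - 1) = x \<and> jump_chain (\<lambda>t. X t \<omega>) k = y)))
    = (LINT u:{a..t}|lborel. prob (A \<inter> state u x) * Q u x y)"
proof -
  let ?u = "grid a t"
  have a0: "0 \<le> a" and t0: "0 \<le> t" using sa by auto
  have AM: "A \<in> events" using FH_events[OF sa(1) A] .
  have u0: "0 \<le> ?u n i" "a \<le> ?u n i" for n i using grid_mono[OF sa(3), of 0 i n] a0 by auto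
  let ?c = "\<lambda>\<omega>. indicator A \<omega> * (\<Sum>k\<in>{J a \<omega><..J t \<omega>}. of_bool (jump_chain (\<lambda>t. X t \<omega>) (k - 1) = x \<and> jump_chain (\<lambda>t. X t \<omega>) k = y)) :: real"
  let ?f = "\<lambda>n \<omega>. \<Sum>i<n. indicator (A \<inter> state (?u n i) x \<inter> state (?u n (Suc i)) y) \<omega> :: real"
  have ev: "A \<inter> state (?u n i) x \<inter> state (?u n (Suc i)) y \<in> events" for n i
    using AM state_events[OF u0(1)] by (intro sets.Int)
  have fm: "?f n \<in> borel_measurable M" for n
    using ev by (intro borel_measurable_sum borel_measurable_indicator)
  have f_eq: "?f n \<omega> = indicator A \<omega> * (\<Sum>i<n. of_bool (X (?u n i) \<omega> = x \<and> X (?u n (Suc i)) \<omega> = y))" if "\<omega> \<in> space M" for n \<omega>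
    unfolding sum_distrib_left using that by (intro sum.cong refl) (auto simp: state_def indicator_def)
  have lim: "(\<lambda>n. ?f n \<omega>) \<longlonglongrightarrow> ?c \<omega>" if om: "\<omega> \<in> space M" for \<omega>
  proof (rule tendsto_eventually)
    show "\<forall>\<^sub>F n in sequentially. ?f n \<omega> = ?c \<omega>"
      using grid_count_jumps[OF X_path[OF om] a0 sa(3) xy]
      by eventually_elim (simp only: f_eq[OF om])
  qed
  have "(\<lambda>n. LINT \<omega>|M. ?f (Suc n) \<omega>) \<longlonglongrightarrow> (LINT \<omega>|M. ?c \<omega>)"
  proof (rule integral_dominated_convergence[where w="\<lambda>\<omega>. real (J t \<omega>)"])
    show "?c \<in> borel_measurable M" by (rule borel_measurable_LIMSEQ_real[OF lim fm])
    show "AE \<omega> in M. (\<lambda>n. ?f (Suc n) \<omega>) \<longlonglongrightarrow> ?c \<omega>" using LIMSEQ_Suc[OF lim] by (intro AE_I2)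
    show "AE \<omega> in M. norm (?f (Suc n) \<omega>) \<le> real (J t \<omega>)" for n
    proof (rule AE_I2)
      fix \<omega> assume om: "\<omega> \<in> space M"
      have "(\<Sum>i<Suc n. of_bool (X (?u (Suc n) i) \<omega> = x \<and> X (?u (Suc n) (Suc i)) \<omega> = y))
        \<le> (\<Sum>i<Suc n. of_bool (X (?u (Suc n) i) \<omega> \<noteq> X (?u (Suc n) (Suc i)) \<omega>) :: real)"
        using xy by (intro sum_mono) auto
      also have "\<dots> \<le> real (J t \<omega>) - real (J a \<omega>)"
        by (rule grid_jumps_le[OF X_path[OF om] a0 sa(3)]) simp
      finally have "(\<Sum>i<Suc n. of_bool (X (?u (Suc n) i) \<omega> = x \<and> X (?u (Suc n) (Suc i)) \<omega> = y)) \<le> real (J t \<omega>)" by linarith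
      moreover have "0 \<le> (\<Sum>i<Suc n. of_bool (X (?u (Suc n) i) \<omega> = x \<and> X (?u (Suc n) (Suc i)) \<omega> = y) :: real)" by (rule sum_nonneg) simp
      ultimately show "norm (?f (Suc n) \<omega>) \<le> real (J t \<omega>)"
        unfolding f_eq[OF om] by (simp add: indicator_def del: sum_of_bool_eq sum.lessThan_Suc)
    qed
    show "?f (Suc n) \<in> borel_measurable M" for n by (rule fm)
    show "integrable M (\<lambda>\<omega>. real (J t \<omega>))" by (rule integrable_J[OF t0])
  qed
  then have l1: "(\<lambda>n. LINT \<omega>|M. ?f n \<omega>) \<longlonglongrightarrow> (LINT \<omega>|M. ?c \<omega>)" by (rule LIMSEQ_imp_Suc)
  have Ef: "(LINT \<omega>|M. ?f n \<omega>) = (\<Sum>i<n. prob (A \<inter> state (?u n i) x) * p (?u n i) (?u n (Suc i)) x y)" for n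
  proof -
    have "(LINT \<omega>|M. ?f n \<omega>) = (\<Sum>i<n. prob (A \<inter> state (?u n i) x \<inter> state (?u n (Suc i)) y))"
    proof -
      have i: "integrable M (indicator (A \<inter> state (?u n i) x \<inter> state (?u n (Suc i)) y) :: 'w \<Rightarrow> real)" for i
        using ev by (intro integrable_real_indicator) (auto simp: less_top[symmetric])
      have "A \<inter> state (?u n i) x \<inter> state (?u n (Suc i)) y \<inter> space M = A \<inter> state (?u n i) x \<inter> state (?u n (Suc i)) y" for i
        by (auto simp: state_def)
      then show ?thesis using i by (simp add: Bochner_Integration.integral_sum)
    qed
    also have "\<dots> = (\<Sum>i<n. prob (A \<inter> state (?u n i) x) * p (?u n i) (?u n (Suc i)) x y)"
    proof (rule sum.cong[OF refl])
      fix i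
      show "prob (A \<inter> state (?u n i) x \<inter> state (?u n (Suc i)) y) = prob (A \<inter> state (?u n i) x) * p (?u n i) (?u n (Suc i)) x y"
        by (rule markov_FH[OF sa(1) _ _ A]) (use u0[of n i] sa grid_mono[OF sa(3), of i "Suc i" n] in auto)
    qed
    finally show ?thesis .
  qed
  have l2: "(\<lambda>n. \<Sum>i<n. prob (A \<inter> state (?u n i) x) * p (?u n i) (?u n (Suc i)) x y) \<longlonglongrightarrow> (LINT u:{a..t}|lborel. prob (A \<inter> state u x) * Q u x y)"
  \<comment> \<open>L^2 is the error of replacing p(u, v, x, y) by the integral of the rate; Lip q
    is the error of freezing the probability of the state at the left end of the cell.\<close>
  proof (rule grid_sum_limit[OF sa(3), where C="L\<^sup>2 + Lip * q"])
    show "set_integrable lborel {a..t} (\<lambda>u. prob (A \<inter> state u x) * Q u x y)"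
      by (rule set_integrable_state_product[OF AM Q_measurable Q_bound a0])
    fix u v assume uv: "a \<le> u" "u \<le> v" "v \<le> t"
    have u: "0 \<le> u" using uv a0 by simp
    have Qi: "set_integrable lborel {u..v} (\<lambda>w. Q w x y)" by (rule set_integrable_bounded_on_interval[OF Q_measurable Q_bound u])
    have Pi: "set_integrable lborel {u..v} (\<lambda>w. prob (A \<inter> state w x) * Q w x y)" by (rule set_integrable_state_product[OF AM Q_measurable Q_bound u])
    have Qi': "set_integrable lborel {u..v} (\<lambda>w. prob (A \<inter> state u x) * Q w x y)" using Qi by simp
    have "\<bar>prob (A \<inter> state u x) * p u v x y - (LINT w:{u..v}|lborel. prob (A \<inter> state w x) * Q w x y)\<bar>
       = \<bar>prob (A \<inter> state u x) * (p u v x y - (LINT w:{u..v}|lborel. Q w x y))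
          + (LINT w:{u..v}|lborel. prob (A \<inter> state u x) * Q w x y - prob (A \<inter> state w x) * Q w x y)\<bar>"
      by (simp add: set_integral_diff[OF Qi' Pi] right_diff_distrib)
    also have "\<dots> \<le> L\<^sup>2 * (v - u)\<^sup>2 + Lip * q * (v - u)\<^sup>2"
    proof (rule order.trans[OF abs_triangle_ineq add_mono])
      have "\<bar>prob (A \<inter> state u x) * (p u v x y - (LINT w:{u..v}|lborel. Q w x y))\<bar> \<le> 1 * (L\<^sup>2 * (v - u)\<^sup>2)"
        unfolding abs_mult using p_first_order[OF u uv(2) xy] by (intro mult_mono) auto
      then show "\<bar>prob (A \<inter> state u x) * (p u v x y - (LINT w:{u..v}|lborel. Q w x y))\<bar> \<le> L\<^sup>2 * (v - u)\<^sup>2" by simp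
      have "\<bar>LINT w:{u..v}|lborel. prob (A \<inter> state u x) * Q w x y - prob (A \<inter> state w x) * Q w x y\<bar>
        \<le> (LINT w:{u..v}|lborel. \<bar>prob (A \<inter> state u x) * Q w x y - prob (A \<inter> state w x) * Q w x y\<bar>)"
        using set_integral_norm_bound[OF set_integral_diff(1)[OF Qi' Pi]] by simp
      also have "\<dots> \<le> (LINT w:{u..v}|lborel. Lip * (v - u) * q)"
      proof (rule set_integral_mono)
        show "set_integrable lborel {u..v} (\<lambda>w. \<bar>prob (A \<inter> state u x) * Q w x y - prob (A \<inter> state w x) * Q w x y\<bar>)"
          by (rule set_integrable_abs[OF set_integral_diff(1)[OF Qi' Pi]])
        show "set_integrable lborel {u..v} (\<lambda>w. Lip * (v - u) * q)" by (rule borel_integrable_atLeastAtMost') simp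
        fix w assume w: "w \<in> {u..v}"
        have "\<bar>prob (A \<inter> state u x) - prob (A \<inter> state w x)\<bar> \<le> Lip * (w - u)" using w u by (intro state_lipschitz AM) auto
        also have "\<dots> \<le> Lip * (v - u)" using w Lip_nonneg by (intro mult_left_mono) auto
        finally have "\<bar>(prob (A \<inter> state u x) - prob (A \<inter> state w x)) * Q w x y\<bar> \<le> Lip * (v - u) * q"
          unfolding abs_mult using Q_bound[of w] w u Lip_nonneg uv by (intro mult_mono) auto
        then show "\<bar>prob (A \<inter> state u x) * Q w x y - prob (A \<inter> state w x) * Q w x y\<bar> \<le> Lip * (v - u) * q"
          by (simp add: left_diff_distrib)
      qed
      also have "\<dots> = Lip * q * (v - u)\<^sup>2"
        using uv by (simp add: set_lebesgue_integral_def power2_eq_square)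
      finally show "\<bar>LINT w:{u..v}|lborel. prob (A \<inter> state u x) * Q w x y - prob (A \<inter> state w x) * Q w x y\<bar> \<le> Lip * q * (v - u)\<^sup>2" .
    qed
    finally show "\<bar>prob (A \<inter> state u x) * p u v x y - (LINT w:{u..v}|lborel. prob (A \<inter> state w x) * Q w x y)\<bar> \<le> (L\<^sup>2 + Lip * q) * (v - u)\<^sup>2"
      by (simp add: distrib_right)
  qed
  show ?thesis by (rule LIMSEQ_unique[OF l1]) (use l2 Ef in simp)
qed

subsection \<open>Poisson rewards\<close>

lemma N_increment_nn_integral:
  assumes su: "0 \<le> s" "s \<le> u" "u \<le> v" and A: "A \<in> sets (FH s)"
  shows "(\<integral>\<^sup>+\<omega>. ennreal (indicator (A \<inter> state v x) \<omega> * (real (N v \<omega>) - real (N u \<omega>))) \<partial>M)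
    = (\<integral>\<^sup>+\<omega>. ennreal (indicator (A \<inter> state v x) \<omega> * intensity u v \<omega>) \<partial>M)"
proof -
  have u: "0 \<le> u" and v: "0 \<le> v" using su by auto
  have AM: "A \<in> events" using FH_events[OF su(1) A] .
  have AvM: "A \<inter> state v x \<in> events" using AM state_events[OF v] by (rule sets.Int)
  define E where "E l = {\<omega>\<in>space M. N v \<omega> = N u \<omega> + l}" for l
  define w where "w l \<omega> = indicator (state v x) \<omega> * poisson_weight l (intensity u v \<omega>)" for l \<omega>
  have iSX [measurable]: "intensity u v \<in> borel_measurable SX"
    using measurable_from_subalg[OF subalgebras(4) intensity_measurable[OF u order.refl v]] .
  have wm: "w l \<in> borel_measurable SX" for l
    unfolding w_def poisson_weight_def using state_SX[OF v, of x] by measurable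
  have wM: "w l \<in> borel_measurable M" for l using measurable_from_subalg[OF subalgebras(1) wm] .
  have wb: "0 \<le> w l \<omega>" "w l \<omega> \<le> 1" for l \<omega>
    using poisson_weight_bounds[OF intensity_nonneg[OF u], of l v \<omega>] by (auto simp: w_def indicator_def)
  have ESXN: "E l \<in> sets SXN" for l
  proof -
    have [measurable]: "N u \<in> measurable SXN (count_space UNIV)" "N v \<in> measurable SXN (count_space UNIV)"
      using measurable_from_subalg[OF subalgebras(6)] XN_in_FXN(2)[OF u order.refl] XN_in_FXN(2)[OF v order.refl] by blast+
    have "{\<omega>\<in>space SXN. real (N v \<omega>) = real (N u \<omega>) + real l} \<in> sets SXN" by measurable
    then show ?thesis unfolding E_def by (simp only: of_nat_add[symmetric] of_nat_eq_iff space_F)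
  qed
  have EM: "E l \<in> events" for l using sets_subalgebra[OF subalgebras(2) ESXN] .
  let ?W = "\<lambda>l \<omega>. indicator (state v x) \<omega> * indicator (E l) \<omega> :: real"
  have eq: "(LINT \<omega>:A|M. ?W l \<omega>) = (LINT \<omega>:A|M. w l \<omega>)" for l
  proof (rule transfer_FXN_FH[OF su(1) _ _ _ _ _ A, where C=1])
    have "state v x \<in> sets SXN" using sets_subalgebra[OF subalgebras(3) state_SX[OF v]] .
    then show "?W l \<in> borel_measurable SXN" using ESXN by (intro borel_measurable_times borel_measurable_indicator)
    show "w l \<in> borel_measurable SXN" using measurable_from_subalg[OF subalgebras(3) wm] .
    show "\<bar>?W l \<omega>\<bar> \<le> 1" for \<omega> by (simp add: indicator_def)
    show "\<bar>w l \<omega>\<bar> \<le> 1" for \<omega> using wb[of l \<omega>] by simp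
    fix B assume "B \<in> sets (FXN s)"
    then have B: "B \<in> sets (FXN u)" using sets_subalgebra[OF subalgebras(10)[OF su(2)]] by blast
    have "(LINT \<omega>:B|M. indicator (state v x) \<omega> * of_bool (N v \<omega> = N u \<omega> + l)) = (LINT \<omega>:B|M. indicator (state v x) \<omega> * poisson_weight l (intensity u v \<omega>))"
      by (rule increment_given_FXN[OF u su(3) _ _ B, where C=1]) (use state_SX[OF v] in \<open>auto simp: indicator_def intro!: borel_measurable_indicator[unfolded indicator_def[abs_def]]\<close>)
    moreover have "(LINT \<omega>:B|M. ?W l \<omega>) = (LINT \<omega>:B|M. indicator (state v x) \<omega> * of_bool (N v \<omega> = N u \<omega> + l))"
      unfolding set_lebesgue_integral_def by (intro Bochner_Integration.integral_cong) (auto simp: E_def indicator_def)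
    ultimately show "(LINT \<omega>:B|M. ?W l \<omega>) = (LINT \<omega>:B|M. w l \<omega>)" unfolding w_def by simp
  qed
  have nn: "(\<integral>\<^sup>+\<omega>. ennreal (indicator A \<omega> * ?W l \<omega>) \<partial>M) = (\<integral>\<^sup>+\<omega>. ennreal (indicator A \<omega> * w l \<omega>) \<partial>M)" for l
  proof -
    have i: "integrable M (\<lambda>\<omega>. indicator A \<omega> * ?W l \<omega>)"
      by (rule integrable_bounded[where B=1, OF borel_measurable_times[OF borel_measurable_indicator[OF AM]
           borel_measurable_times[OF borel_measurable_indicator[OF state_events[OF v]] borel_measurable_indicator[OF EM]]]])
         (simp add: indicator_def)
    have i': "integrable M (\<lambda>\<omega>. indicator A \<omega> * w l \<omega>)"
      by (rule integrable_bounded[where B=1, OF borel_measurable_times[OF borel_measurable_indicator[OF AM] wM]])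
         (use wb[of l] in \<open>simp add: indicator_def\<close>)
    have "(\<integral>\<^sup>+\<omega>. ennreal (indicator A \<omega> * ?W l \<omega>) \<partial>M) = ennreal (LINT \<omega>|M. indicator A \<omega> * ?W l \<omega>)"
      by (rule nn_integral_eq_integral[OF i]) simp
    also have "\<dots> = ennreal (LINT \<omega>|M. indicator A \<omega> * w l \<omega>)" using eq[of l] by (simp add: set_lebesgue_integral_def)
    also have "\<dots> = (\<integral>\<^sup>+\<omega>. ennreal (indicator A \<omega> * w l \<omega>) \<partial>M)"
      by (rule nn_integral_eq_integral[OF i', symmetric]) (use wb in simp)
    finally show ?thesis .
  qed
  have p1: "ennreal (indicator (A \<inter> state v x) \<omega> * (real (N v \<omega>) - real (N u \<omega>))) = (\<Sum>l. ennreal (real l) * ennreal (indicator A \<omega> * ?W l \<omega>))"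
    if om: "\<omega> \<in> space M" for \<omega>
  proof -
    define l0 where "l0 = N v \<omega> - N u \<omega>"
    have l0: "N v \<omega> = N u \<omega> + l0" using step_path_mono[OF N_path[OF om] u su(3)] by (simp add: l0_def)
    have "(\<Sum>l. ennreal (real l) * ennreal (indicator A \<omega> * ?W l \<omega>)) = (\<Sum>l\<in>{l0}. ennreal (real l) * ennreal (indicator A \<omega> * ?W l \<omega>))"
      \<comment> \<open>Only the term whose index equals the actual increment is nonzero.\<close>
      by (rule suminf_finite) (use om l0 in \<open>auto simp: E_def\<close>)
    also have "\<dots> = ennreal (indicator (A \<inter> state v x) \<omega> * (real (N v \<omega>) - real (N u \<omega>)))"
      using om l0 by (auto simp: E_def indicator_def)
    finally show ?thesis by simp
  qed
  have p2: "(\<Sum>l. ennreal (real l) * ennreal (indicator A \<omega> * w l \<omega>)) = ennreal (indicator (A \<inter> state v x) \<omega> * intensity u v \<omega>)" for \<omega>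
  proof -
    let ?h = "\<lambda>l. indicator (A \<inter> state v x) \<omega> * (real l * poisson_weight l (intensity u v \<omega>))"
    have hs: "?h sums (indicator (A \<inter> state v x) \<omega> * intensity u v \<omega>)" by (rule sums_mult[OF poisson_weight_mean])
    have e: "ennreal (real l) * ennreal (indicator A \<omega> * w l \<omega>) = ennreal (?h l)" for l
      using wb[of l \<omega>] by (simp add: ennreal_mult'[symmetric] w_def indicator_inter_arith ac_simps)
    have "(\<Sum>l. ennreal (?h l)) = ennreal (suminf ?h)"
      by (rule suminf_ennreal2[OF _ sums_summable[OF hs]]) (use poisson_weight_bounds[OF intensity_nonneg[OF u]] in simp)
    then show ?thesis unfolding e by (simp only: sums_unique[OF hs, symmetric])
  qed
  have m1: "(\<lambda>\<omega>. ennreal (indicator A \<omega> * ?W l \<omega>)) \<in> borel_measurable M" for l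
    by (intro measurable_compose[OF _ measurable_ennreal] borel_measurable_times borel_measurable_indicator AM state_events v EM)
  have m2: "(\<lambda>\<omega>. ennreal (indicator A \<omega> * w l \<omega>)) \<in> borel_measurable M" for l
    by (intro measurable_compose[OF _ measurable_ennreal] borel_measurable_times borel_measurable_indicator AM wM)
  have "(\<integral>\<^sup>+\<omega>. ennreal (indicator (A \<inter> state v x) \<omega> * (real (N v \<omega>) - real (N u \<omega>))) \<partial>M)
     = (\<integral>\<^sup>+\<omega>. (\<Sum>l. ennreal (real l) * ennreal (indicator A \<omega> * ?W l \<omega>)) \<partial>M)"
    by (rule nn_integral_cong) (rule p1)
  also have "\<dots> = (\<Sum>l. \<integral>\<^sup>+\<omega>. ennreal (real l) * ennreal (indicator A \<omega> * ?W l \<omega>) \<partial>M)"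
    by (rule nn_integral_suminf) (use m1 in measurable)
  also have "\<dots> = (\<Sum>l. \<integral>\<^sup>+\<omega>. ennreal (real l) * ennreal (indicator A \<omega> * w l \<omega>) \<partial>M)"
    by (simp only: nn_integral_cmult[OF m1] nn_integral_cmult[OF m2] nn)
  also have "\<dots> = (\<integral>\<^sup>+\<omega>. (\<Sum>l. ennreal (real l) * ennreal (indicator A \<omega> * w l \<omega>)) \<partial>M)"
    by (rule nn_integral_suminf[symmetric]) (use m2 in measurable)
  also have "\<dots> = (\<integral>\<^sup>+\<omega>. ennreal (indicator (A \<inter> state v x) \<omega> * intensity u v \<omega>) \<partial>M)" by (simp only: p2)
  finally show ?thesis .
qed

lemma N_increment_integral:
  assumes su: "0 \<le> s" "s \<le> u" "u \<le> v" and A: "A \<in> sets (FH s)"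
  shows "integrable M (\<lambda>\<omega>. indicator (A \<inter> state v x) \<omega> * (real (N v \<omega>) - real (N u \<omega>)))"
    and "(LINT \<omega>|M. indicator (A \<inter> state v x) \<omega> * (real (N v \<omega>) - real (N u \<omega>)))
      = (LINT w:{u..v}|lborel. \<Sum>z\<in>UNIV. prob (A \<inter> state v x \<inter> state w z) * \<beta> w z)"
proof -
  have u: "0 \<le> u" and v: "0 \<le> v" using su by auto
  have AvM: "A \<inter> state v x \<in> events" using FH_events[OF su(1) A] state_events[OF v] by (rule sets.Int)
  have \<beta>b: "\<bar>\<beta> t z\<bar> \<le> b" if "0 \<le> t" for t z using \<beta>_bound[OF that, of z] by simp
  have F1: "integrable M (\<lambda>\<omega>. indicator (A \<inter> state v x) \<omega> * intensity u v \<omega>)"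
    unfolding intensity_def by (rule path_fubini(1)[OF \<beta>_measurable \<beta>b u su(3) AvM])
  have F2: "(LINT \<omega>|M. indicator (A \<inter> state v x) \<omega> * intensity u v \<omega>)
      = (LINT w:{u..v}|lborel. \<Sum>z\<in>UNIV. prob (A \<inter> state v x \<inter> state w z) * \<beta> w z)"
    unfolding intensity_def by (rule path_fubini(2)[OF \<beta>_measurable \<beta>b u su(3) AvM])
  have Nm [measurable]: "N u \<in> measurable M (count_space UNIV)" "N v \<in> measurable M (count_space UNIV)"
    using u v by (auto intro: N_measurable)
  have m: "(\<lambda>\<omega>. indicator (A \<inter> state v x) \<omega> * (real (N v \<omega>) - real (N u \<omega>))) \<in> borel_measurable M"
    using AvM by measurable
  have nn: "(\<integral>\<^sup>+\<omega>. ennreal (indicator (A \<inter> state v x) \<omega> * (real (N v \<omega>) - real (N u \<omega>))) \<partial>M)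
      = ennreal (LINT \<omega>|M. indicator (A \<inter> state v x) \<omega> * intensity u v \<omega>)"
    unfolding N_increment_nn_integral[OF su A]
    by (rule nn_integral_eq_integral[OF F1]) (use intensity_nonneg[OF u] in auto)
  have pos: "AE \<omega> in M. 0 \<le> indicator (A \<inter> state v x) \<omega> * (real (N v \<omega>) - real (N u \<omega>))"
  proof (rule AE_I2)
    fix \<omega> assume "\<omega> \<in> space M"
    from step_path_mono[OF N_path[OF this] u su(3)]
    show "0 \<le> indicator (A \<inter> state v x) \<omega> * (real (N v \<omega>) - real (N u \<omega>))" by simp
  qed
  show I: "integrable M (\<lambda>\<omega>. indicator (A \<inter> state v x) \<omega> * (real (N v \<omega>) - real (N u \<omega>)))"
    by (rule integrableI_nonneg[OF m pos]) (simp add: nn)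
  have "ennreal (LINT \<omega>|M. indicator (A \<inter> state v x) \<omega> * (real (N v \<omega>) - real (N u \<omega>)))
     = ennreal (LINT \<omega>|M. indicator (A \<inter> state v x) \<omega> * intensity u v \<omega>)"
    using nn nn_integral_eq_integral[OF I pos] by simp
  moreover have "0 \<le> (LINT \<omega>|M. indicator (A \<inter> state v x) \<omega> * intensity u v \<omega>)"
    using intensity_nonneg[OF u] by (intro Bochner_Integration.integral_nonneg) simp
  ultimately have "(LINT \<omega>|M. indicator (A \<inter> state v x) \<omega> * (real (N v \<omega>) - real (N u \<omega>)))
     = (LINT \<omega>|M. indicator (A \<inter> state v x) \<omega> * intensity u v \<omega>)"
    using integral_nonneg_AE[OF pos] by (simp only: ennreal_inj)
  then show "(LINT \<omega>|M. indicator (A \<inter> state v x) \<omega> * (real (N v \<omega>) - real (N u \<omega>)))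
      = (LINT w:{u..v}|lborel. \<Sum>z\<in>UNIV. prob (A \<inter> state v x \<inter> state w z) * \<beta> w z)"
    using F2 by simp
qed

text \<open>\<open>N_increment_integral\<close> over (0, t] on the whole space, summed over the
  states at t.\<close>

lemma integrable_N:
  assumes t: "0 \<le> t"
  shows "integrable M (\<lambda>\<omega>. real (N t \<omega>))"
proof -
  have S: "space M \<in> sets (FH 0)" using sets.top[of "FH 0"] by simp
  have "integrable M (\<lambda>\<omega>. \<Sum>x\<in>UNIV. indicator (space M \<inter> state t x) \<omega> * (real (N t \<omega>) - real (N 0 \<omega>)))"
    by (intro Bochner_Integration.integrable_sum N_increment_integral(1)[OF order.refl order.refl t S])
  also have "?this \<longleftrightarrow> ?thesis"
  proof (rule Bochner_Integration.integrable_cong[OF refl])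
    fix \<omega> assume om: "\<omega> \<in> space M"
    have "space M \<inter> state t x = state t x" for x by (auto simp: state_def)
    then have "(\<Sum>x\<in>UNIV. indicator (space M \<inter> state t x) \<omega> * (real (N t \<omega>) - real (N 0 \<omega>))) = real (N t \<omega>) - real (N 0 \<omega>)"
      using state_indicator_sum[OF om, of t "\<lambda>_. real (N t \<omega>) - real (N 0 \<omega>)"] by simp
    then show "(\<Sum>x\<in>UNIV. indicator (space M \<inter> state t x) \<omega> * (real (N t \<omega>) - real (N 0 \<omega>))) = real (N t \<omega>)"
      using step_path_0[OF N_path[OF om]] by simp
  qed
  finally show ?thesis .
qed

text \<open>As in \<open>jump_count_integral\<close>, but the state is read at the right end of the
  cell, which makes the grid count eventually exact; the cell mean is an integral of the intensity
  along the path up to that end.\<close>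

lemma Poisson_count_integral:
  assumes sa: "0 \<le> s" "s \<le> a" "a \<le> t" and A: "A \<in> sets (FH s)"
  shows "(LINT \<omega>|M. indicator A \<omega> * (\<Sum>k\<in>{N a \<omega><..N t \<omega>}. of_bool (X (event_time (\<lambda>t. N t \<omega>) k) \<omega> = x)))
    = (LINT u:{a..t}|lborel. prob (A \<inter> state u x) * \<beta> u x)"
proof -
  let ?u = "grid a t"
  have a0: "0 \<le> a" and t0: "0 \<le> t" using sa by auto
  have AM: "A \<in> events" using FH_events[OF sa(1) A] .
  have u0: "0 \<le> ?u n i" "a \<le> ?u n i" for n i using grid_mono[OF sa(3), of 0 i n] a0 by auto
  have um: "?u n i \<le> ?u n (Suc i)" for n i using grid_mono[OF sa(3), of i "Suc i" n] by simp
  have \<beta>b: "\<bar>\<beta> t z\<bar> \<le> b" if "0 \<le> t" for t z using \<beta>_bound[OF that, of z] by simp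
  let ?c = "\<lambda>\<omega>. indicator A \<omega> * (\<Sum>k\<in>{N a \<omega><..N t \<omega>}. of_bool (X (event_time (\<lambda>t. N t \<omega>) k) \<omega> = x)) :: real"
  let ?g = "\<lambda>n i \<omega>. indicator (A \<inter> state (?u n (Suc i)) x) \<omega> * (real (N (?u n (Suc i)) \<omega>) - real (N (?u n i) \<omega>))"
  let ?f = "\<lambda>n \<omega>. \<Sum>i<n. ?g n i \<omega>"
  have gI: "integrable M (?g n i)"
    "(LINT \<omega>|M. ?g n i \<omega>) = (LINT w:{?u n i..?u n (Suc i)}|lborel. \<Sum>z\<in>UNIV. prob (A \<inter> state (?u n (Suc i)) x \<inter> state w z) * \<beta> w z)" for n i
    using N_increment_integral[OF sa(1) order.trans[OF sa(2) u0(2)] um A] by blast+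
  have fm: "?f n \<in> borel_measurable M" for n
    by (intro borel_measurable_sum borel_measurable_integrable gI)
  have f_eq: "?f n \<omega> = indicator A \<omega> * (\<Sum>i<n. of_bool (X (?u n (Suc i)) \<omega> = x) * (real (N (?u n (Suc i)) \<omega>) - real (N (?u n i) \<omega>)))"
    if "\<omega> \<in> space M" for n \<omega>
    unfolding sum_distrib_left using that by (intro sum.cong refl) (auto simp: state_def indicator_def)
  have lim: "(\<lambda>n. ?f n \<omega>) \<longlonglongrightarrow> ?c \<omega>" if om: "\<omega> \<in> space M" for \<omega>
  proof (rule tendsto_eventually)
    show "\<forall>\<^sub>F n in sequentially. ?f n \<omega> = ?c \<omega>"
      using grid_count_event_marks[OF N_path[OF om] jump_path_right_continuous[OF X_path[OF om]] a0 sa(3), of x]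
      by eventually_elim (simp only: f_eq[OF om])
  qed
  have "(\<lambda>n. LINT \<omega>|M. ?f (Suc n) \<omega>) \<longlonglongrightarrow> (LINT \<omega>|M. ?c \<omega>)"
  proof (rule integral_dominated_convergence[where w="\<lambda>\<omega>. real (N t \<omega>)"])
    show "?c \<in> borel_measurable M" by (rule borel_measurable_LIMSEQ_real[OF lim fm])
    show "AE \<omega> in M. (\<lambda>n. ?f (Suc n) \<omega>) \<longlonglongrightarrow> ?c \<omega>" using LIMSEQ_Suc[OF lim] by (intro AE_I2)
    show "AE \<omega> in M. norm (?f (Suc n) \<omega>) \<le> real (N t \<omega>)" for n
    proof (rule AE_I2)
      fix \<omega> assume om: "\<omega> \<in> space M"
      let ?n = "Suc n"
      have inc: "0 \<le> real (N (?u ?n (Suc i)) \<omega>) - real (N (?u ?n i) \<omega>)" for i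
        using step_path_mono[OF N_path[OF om] u0(1) um] by simp
      have "0 \<le> ?f ?n \<omega>" by (intro sum_nonneg mult_nonneg_nonneg inc) simp
      moreover have "?f ?n \<omega> \<le> (\<Sum>i<?n. real (N (?u ?n (Suc i)) \<omega>) - real (N (?u ?n i) \<omega>))"
      proof (rule sum_mono)
        fix i show "?g ?n i \<omega> \<le> real (N (?u ?n (Suc i)) \<omega>) - real (N (?u ?n i) \<omega>)"
          using inc[of i] by (simp add: indicator_def)
      qed
      moreover have "(\<Sum>i<?n. real (N (?u ?n (Suc i)) \<omega>) - real (N (?u ?n i) \<omega>)) = real (N t \<omega>) - real (N a \<omega>)"
        using sum_lessThan_telescope[of "\<lambda>i. real (N (?u ?n i) \<omega>)" ?n] by (simp del: sum.lessThan_Suc)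
      ultimately show "norm (?f ?n \<omega>) \<le> real (N t \<omega>)" by (simp only: real_norm_def)
    qed
    show "?f (Suc n) \<in> borel_measurable M" for n by (rule fm)
    show "integrable M (\<lambda>\<omega>. real (N t \<omega>))" by (rule integrable_N[OF t0])
  qed
  then have l1: "(\<lambda>n. LINT \<omega>|M. ?f n \<omega>) \<longlonglongrightarrow> (LINT \<omega>|M. ?c \<omega>)" by (rule LIMSEQ_imp_Suc)
  define \<phi> where "\<phi> u v = (LINT w:{u..v}|lborel. \<Sum>z\<in>UNIV. prob (A \<inter> state v x \<inter> state w z) * \<beta> w z)" for u v
  have Ef: "(LINT \<omega>|M. ?f n \<omega>) = (\<Sum>i<n. \<phi> (?u n i) (?u n (Suc i)))" for n
    unfolding \<phi>_def gI(2)[symmetric] by (rule Bochner_Integration.integral_sum) (rule gI(1))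
  have l2: "(\<lambda>n. \<Sum>i<n. \<phi> (?u n i) (?u n (Suc i))) \<longlonglongrightarrow> (LINT u:{a..t}|lborel. prob (A \<inter> state u x) * \<beta> u x)"
  \<comment> \<open>The state at time w in the cell is compared with the state at its right end v.
    Entering x after w and leaving x after w each cost at most Lip b (v - u) in the
    integrand.\<close>
  proof (rule grid_sum_limit[OF sa(3), where C="2 * Lip * b"])
    show "set_integrable lborel {a..t} (\<lambda>u. prob (A \<inter> state u x) * \<beta> u x)"
      by (rule set_integrable_state_product[OF AM \<beta>_measurable \<beta>b a0])
    fix u v assume uv: "a \<le> u" "u \<le> v" "v \<le> t"
    have u: "0 \<le> u" and v: "0 \<le> v" using uv a0 by auto
    have AvM: "A \<inter> state v x \<in> events" using AM state_events[OF v] by (rule sets.Int)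
    have I1: "set_integrable lborel {u..v} (\<lambda>w. \<Sum>z\<in>UNIV. prob (A \<inter> state v x \<inter> state w z) * \<beta> w z)"
      unfolding set_integrable_def sum_distrib_left scaleR_sum_right
      by (intro Bochner_Integration.integrable_sum set_integrable_state_product[OF AvM \<beta>_measurable \<beta>b u, unfolded set_integrable_def])
    have I2: "set_integrable lborel {u..v} (\<lambda>w. prob (A \<inter> state w x) * \<beta> w x)"
      by (rule set_integrable_state_product[OF AM \<beta>_measurable \<beta>b u])
    have "\<bar>\<phi> u v - (LINT w:{u..v}|lborel. prob (A \<inter> state w x) * \<beta> w x)\<bar>
      = \<bar>LINT w:{u..v}|lborel. (\<Sum>z\<in>UNIV. prob (A \<inter> state v x \<inter> state w z) * \<beta> w z) - prob (A \<inter> state w x) * \<beta> w x\<bar>"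
      unfolding \<phi>_def by (simp only: set_integral_diff(2)[OF I1 I2])
    also have "\<dots> \<le> (LINT w:{u..v}|lborel. \<bar>(\<Sum>z\<in>UNIV. prob (A \<inter> state v x \<inter> state w z) * \<beta> w z) - prob (A \<inter> state w x) * \<beta> w x\<bar>)"
      using set_integral_norm_bound[OF set_integral_diff(1)[OF I1 I2]] by simp
    also have "\<dots> \<le> (LINT w:{u..v}|lborel. 2 * Lip * b * (v - u))"
    proof (rule set_integral_mono)
      show "set_integrable lborel {u..v} (\<lambda>w. \<bar>(\<Sum>z\<in>UNIV. prob (A \<inter> state v x \<inter> state w z) * \<beta> w z) - prob (A \<inter> state w x) * \<beta> w x\<bar>)"
        by (rule set_integrable_abs[OF set_integral_diff(1)[OF I1 I2]])
      show "set_integrable lborel {u..v} (\<lambda>w. 2 * Lip * b * (v - u))" by (rule borel_integrable_atLeastAtMost') simp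
      fix w assume w: "w \<in> {u..v}"
      then have w0: "0 \<le> w" "w \<le> v" using u by auto
      have Lw: "L * (v - w) \<le> L * (v - u)" using w L_nonneg by (intro mult_left_mono) auto
      have swap: "A \<inter> state v x \<inter> state w z = A \<inter> state w z \<inter> state v x" for z by blast
      have small: "prob (A \<inter> state v x \<inter> state w z) \<le> L * (v - u)" if "z \<noteq> x" for z
        unfolding swap using change_bound[OF w0 that AM] Lw by linarith
      have split: "prob (A \<inter> state w x) = (\<Sum>y\<in>UNIV. prob (A \<inter> state w x \<inter> state v y))"
        by (rule prob_split_state) (use AM state_events w0 v in auto)
      \<comment> \<open>The terms with z = x and y = x belong to the same event and cancel.\<close>
      have "(\<Sum>z\<in>UNIV. prob (A \<inter> state v x \<inter> state w z) * \<beta> w z) - prob (A \<inter> state w x) * \<beta> w x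
         = (\<Sum>z\<in>UNIV - {x}. prob (A \<inter> state v x \<inter> state w z) * \<beta> w z) - (\<Sum>y\<in>UNIV - {x}. prob (A \<inter> state w x \<inter> state v y)) * \<beta> w x"
        unfolding split by (simp add: sum.remove[of UNIV x] swap[of x] distrib_right)
      also have "\<bar>\<dots>\<bar> \<le> (\<Sum>z\<in>UNIV - {x}. L * (v - u) * b) + (\<Sum>y\<in>UNIV - {x}. L * (v - u)) * b"
      proof -
        have b1: "(\<Sum>z\<in>UNIV - {x}. prob (A \<inter> state v x \<inter> state w z) * \<beta> w z) \<le> (\<Sum>z\<in>UNIV - {x}. L * (v - u) * b)"
        proof (rule sum_mono)
          fix z assume "z \<in> UNIV - {x}"
          then show "prob (A \<inter> state v x \<inter> state w z) * \<beta> w z \<le> L * (v - u) * b"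
            using small[of z] \<beta>_bound[OF w0(1), of z] L_nonneg uv by (intro mult_mono) auto
        qed
        have b2: "(\<Sum>y\<in>UNIV - {x}. prob (A \<inter> state w x \<inter> state v y)) * \<beta> w x \<le> (\<Sum>y\<in>UNIV - {x}. L * (v - u)) * b"
        proof (rule mult_mono)
          show "(\<Sum>y\<in>UNIV - {x}. prob (A \<inter> state w x \<inter> state v y)) \<le> (\<Sum>y\<in>UNIV - {x}. L * (v - u))"
          proof (rule sum_mono)
            fix y assume "y \<in> UNIV - {x}"
            then show "prob (A \<inter> state w x \<inter> state v y) \<le> L * (v - u)"
              using change_bound[OF w0 _ AM, of x y] Lw by simp
          qed
          show "0 \<le> (\<Sum>y\<in>UNIV - {x}. L * (v - u))" using L_nonneg uv by (intro sum_nonneg) simp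
        qed (use \<beta>_bound[OF w0(1), of x] in auto)
        have n1: "0 \<le> (\<Sum>z\<in>UNIV - {x}. prob (A \<inter> state v x \<inter> state w z) * \<beta> w z)"
          using \<beta>_bound[OF w0(1)] by (intro sum_nonneg mult_nonneg_nonneg) auto
        have n2: "0 \<le> (\<Sum>y\<in>UNIV - {x}. prob (A \<inter> state w x \<inter> state v y)) * \<beta> w x"
          using \<beta>_bound[OF w0(1)] by (intro mult_nonneg_nonneg sum_nonneg) auto
        show ?thesis using b1 b2 n1 n2 by linarith
      qed
      also have "\<dots> = 2 * (real (CARD('s) - 1) * (L * (v - u) * b))" by (simp add: card_Diff_singleton)
      also have "\<dots> \<le> 2 * (real CARD('s) * (L * (v - u) * b))"
        using L_nonneg uv b_nonneg by (intro mult_left_mono mult_right_mono) auto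
      also have "\<dots> = 2 * Lip * b * (v - u)" by (simp add: Lip_def)
      finally show "\<bar>(\<Sum>z\<in>UNIV. prob (A \<inter> state v x \<inter> state w z) * \<beta> w z) - prob (A \<inter> state w x) * \<beta> w x\<bar> \<le> 2 * Lip * b * (v - u)" .
    qed
    also have "\<dots> = 2 * Lip * b * (v - u)\<^sup>2"
      using uv by (simp add: set_lebesgue_integral_def power2_eq_square)
    finally show "\<bar>\<phi> u v - (LINT w:{u..v}|lborel. prob (A \<inter> state w x) * \<beta> w x)\<bar> \<le> 2 * Lip * b * (v - u)\<^sup>2" .
  qed
  show ?thesis by (rule LIMSEQ_unique[OF l1]) (use l2 Ef in simp)
qed

end

lemma set_integral_sum_finite:
  fixes f :: "'i \<Rightarrow> 'a \<Rightarrow> real"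
  assumes "\<And>i. i \<in> I \<Longrightarrow> set_integrable M A (f i)"
  shows "set_integrable M A (\<lambda>x. \<Sum>i\<in>I. f i x)" "(LINT x:A|M. (\<Sum>i\<in>I. f i x)) = (\<Sum>i\<in>I. LINT x:A|M. f i x)"
  using assms unfolding set_integrable_def set_lebesgue_integral_def scaleR_sum_right
  by (auto intro!: Bochner_Integration.integrable_sum Bochner_Integration.integral_sum)

context reward_process_rates
begin

subsection \<open>Mean rates\<close>

lemma mean_measurable:
  "(\<lambda>u. mean_pos (G (max 0 u) x y)) \<in> borel_measurable borel" "(\<lambda>u. mean_pos (K (max 0 u) x)) \<in> borel_measurable borel"
  by (rule measurable_mean_pos[where c=c]; use G_cdf K_cdf G_measurable K_measurable in simp)+

lemma mean_bounds:
  "0 \<le> u \<Longrightarrow> 0 \<le> mean_pos (G u x y) \<and> mean_pos (G u x y) \<le> c"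
  "0 \<le> u \<Longrightarrow> 0 \<le> mean_pos (H u x) \<and> mean_pos (H u x) \<le> c"
  "0 \<le> u \<Longrightarrow> 0 \<le> mean_pos (K u x) \<and> mean_pos (K u x) \<le> c"
  using mean_pos_riemann(2,3)[OF G_cdf, of u 1 x y] mean_pos_riemann(2,3)[OF H_cdf, of u 1 x]
    mean_pos_riemann(2,3)[OF K_cdf, of u 1 x] by auto

text \<open>The function r-tilde of the statement; \<open>fixed_mean i\<close> below is h(t_i,
  .).\<close>

definition rate :: "real \<Rightarrow> 's \<Rightarrow> real" where
  "rate u x = r u x + gamma_rate Q \<beta> G K u x"

definition fixed_mean :: "nat \<Rightarrow> 's \<Rightarrow> real" where
  "fixed_mean i x = mean_pos (H (\<tau> i) x)"

text \<open>Off-diagonal rates outside the support vanish and the diagonal never belongs to it, so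
  the sum may run over all other states.\<close>

lemma gamma1_eq: "0 \<le> u \<Longrightarrow> gamma1 Q G u x = (\<Sum>y\<in>UNIV - {x}. Q u x y * mean_pos (G u x y))"
  unfolding gamma1_def using Q_support Q_diag by (intro sum.mono_neutral_left) auto

lemma rate_eq: "0 \<le> u \<Longrightarrow> rate u x = r u x + ((\<Sum>y\<in>UNIV - {x}. Q u x y * mean_pos (G u x y)) + \<beta> u x * mean_pos (K u x))"
  by (simp add: rate_def gamma_rate_def gamma2_def gamma1_eq)

lemma rate_measurable: "(\<lambda>u. rate (max 0 u) x) \<in> borel_measurable borel"
  unfolding rate_eq[OF max.cobounded1]
  using r_measurable Q_measurable \<beta>_measurable mean_measurable
  by (intro borel_measurable_add borel_measurable_sum borel_measurable_times) auto

definition rate_max :: real where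
  "rate_max = b + (real CARD('s) * (q * c) + b * c)"

lemma rate_bound:
  assumes u: "0 \<le> u"
  shows "\<bar>rate u x\<bar> \<le> rate_max"
proof -
  have "\<bar>\<Sum>y\<in>UNIV - {x}. Q u x y * mean_pos (G u x y)\<bar> \<le> (\<Sum>y\<in>UNIV - {x}. \<bar>Q u x y * mean_pos (G u x y)\<bar>)" by (rule sum_abs)
  also have "\<dots> \<le> (\<Sum>y\<in>UNIV - {x}. q * c)"
    unfolding abs_mult using Q_bound[OF u] mean_bounds(1)[OF u] q_nonneg by (intro sum_mono mult_mono) auto
  also have "\<dots> \<le> (\<Sum>y\<in>(UNIV :: 's set). q * c)" using q_nonneg by (intro sum_mono2) auto
  finally have 1: "\<bar>\<Sum>y\<in>UNIV - {x}. Q u x y * mean_pos (G u x y)\<bar> \<le> real CARD('s) * (q * c)" by simp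
  have 2: "\<bar>\<beta> u x * mean_pos (K u x)\<bar> \<le> b * c"
    unfolding abs_mult using \<beta>_bound[OF u, of x] mean_bounds(3)[OF u, of x] by (intro mult_mono) auto
  show ?thesis unfolding rate_eq[OF u] rate_max_def using 1 2 r_bound[OF u, of x] by linarith
qed

subsection \<open>Mean of the rewards earned at random times\<close>

text \<open>Treats jump and Poisson rewards together. The count f and the constructor \<kappa>
  select the family; the mark mk is the information besides the event time on which the mean reward
  depends. Rewards are first replaced by their means, and each mark is then handled by its
  compensator.\<close>

lemma lumps_integral:
  fixes \<kappa> :: "nat \<Rightarrow> lump" and f :: "'w \<Rightarrow> real \<Rightarrow> nat" and mk :: "'m \<Rightarrow> nat \<Rightarrow> 'w \<Rightarrow> bool" and g :: "'m \<Rightarrow> real \<Rightarrow> real"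
  assumes st: "0 \<le> s" "s \<le> t" and A: "A \<in> sets (FH s)"
    and hap: "\<And>k u \<omega>. lump_happened (\<kappa> k) u \<omega> \<longleftrightarrow> Suc k \<le> f \<omega> u"
    and mean: "\<And>k \<omega>. \<omega> \<in> space M \<Longrightarrow> Suc k \<le> f \<omega> t \<Longrightarrow>
        mean_pos (lump_cdf (\<kappa> k) \<omega>) = (\<Sum>z\<in>S. of_bool (mk z k \<omega>) * g z (event_time (f \<omega>) (Suc k)))"
    and comp: "\<And>z. z \<in> S \<Longrightarrow> (\<lambda>k. LINT \<omega>|M. indicator (A \<inter> {\<omega>\<in>space M. f \<omega> s < Suc k \<and> Suc k \<le> f \<omega> t \<and> mk z k \<omega>}) \<omega> * g z (event_time (f \<omega>) (Suc k))) sums I z"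
    and compi: "\<And>z k. z \<in> S \<Longrightarrow> integrable M (\<lambda>\<omega>. indicator (A \<inter> {\<omega>\<in>space M. f \<omega> s < Suc k \<and> Suc k \<le> f \<omega> t \<and> mk z k \<omega>}) \<omega> * g z (event_time (f \<omega>) (Suc k)))"
  shows "integrable M (\<lambda>\<omega>. indicator A \<omega> * (\<Sum>k\<in>{f \<omega> s<..f \<omega> t}. lump_val (\<kappa> (k - 1)) \<omega>))"
    and "(LINT \<omega>|M. indicator A \<omega> * (\<Sum>k\<in>{f \<omega> s<..f \<omega> t}. lump_val (\<kappa> (k - 1)) \<omega>)) = (\<Sum>z\<in>S. I z)"
proof -
  have t: "0 \<le> t" using st by simp
  let ?D = "\<lambda>k. {\<omega>\<in>space M. f \<omega> s < Suc k \<and> Suc k \<le> f \<omega> t}"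
  have D: "?D k = lump_done (\<kappa> k) t - lump_done (\<kappa> k) s" for k
    by (auto simp: lump_done_def hap)
  note lm = lump_mean_given_FH[OF st A, of "\<kappa> k" for k, folded D]
  have DM: "?D k \<in> events" for k
    unfolding D using sets_subalgebra[OF subalgebras(8) lump_done_in_FXN[OF t order.refl]]
      sets_subalgebra[OF subalgebras(8) lump_done_in_FXN[OF st]] by (rule sets.Diff)
  have ADM: "A \<inter> ?D k \<in> events" for k using FH_events[OF st(1) A] DM by (rule sets.Int)
  have I1: "integrable M (\<lambda>\<omega>. indicator (A \<inter> ?D k) \<omega> * lump_val (\<kappa> (Suc k - 1)) \<omega>)" for k
  proof (rule integrable_const_bound[of _ "real c"])
    show "AE \<omega> in M. norm (indicator (A \<inter> ?D k) \<omega> * lump_val (\<kappa> (Suc k - 1)) \<omega>) \<le> real c"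
      using lm(1)[of k] by eventually_elim (simp add: indicator_def)
    show "(\<lambda>\<omega>. indicator (A \<inter> ?D k) \<omega> * lump_val (\<kappa> (Suc k - 1)) \<omega>) \<in> borel_measurable M"
      using ADM lump_val_measurable by (intro borel_measurable_times borel_measurable_indicator)
  qed
  have pos: "AE \<omega> in M. 0 \<le> indicator (A \<inter> ?D k) \<omega> * lump_val (\<kappa> (Suc k - 1)) \<omega>" for k
    using lm(1)[of k] by eventually_elim (simp add: indicator_def)
  have val: "(LINT \<omega>|M. indicator (A \<inter> ?D k) \<omega> * lump_val (\<kappa> (Suc k - 1)) \<omega>)
     = (\<Sum>z\<in>S. LINT \<omega>|M. indicator (A \<inter> {\<omega>\<in>space M. f \<omega> s < Suc k \<and> Suc k \<le> f \<omega> t \<and> mk z k \<omega>}) \<omega> * g z (event_time (f \<omega>) (Suc k)))" for k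
  proof -
    have "(LINT \<omega>|M. indicator (A \<inter> ?D k) \<omega> * lump_val (\<kappa> (Suc k - 1)) \<omega>) = (LINT \<omega>|M. indicator (A \<inter> ?D k) \<omega> * mean_pos (lump_cdf (\<kappa> k) \<omega>))"
      using lm(3)[of k] by simp
    also have "\<dots> = (LINT \<omega>|M. (\<Sum>z\<in>S. indicator (A \<inter> {\<omega>\<in>space M. f \<omega> s < Suc k \<and> Suc k \<le> f \<omega> t \<and> mk z k \<omega>}) \<omega> * g z (event_time (f \<omega>) (Suc k))))"
    proof (rule Bochner_Integration.integral_cong[OF refl])
      fix \<omega> assume om: "\<omega> \<in> space M"
      show "indicator (A \<inter> ?D k) \<omega> * mean_pos (lump_cdf (\<kappa> k) \<omega>)
        = (\<Sum>z\<in>S. indicator (A \<inter> {\<omega>\<in>space M. f \<omega> s < Suc k \<and> Suc k \<le> f \<omega> t \<and> mk z k \<omega>}) \<omega> * g z (event_time (f \<omega>) (Suc k)))"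
      proof (cases "\<omega> \<in> A \<inter> ?D k")
        case True
        then have "mean_pos (lump_cdf (\<kappa> k) \<omega>) = (\<Sum>z\<in>S. of_bool (mk z k \<omega>) * g z (event_time (f \<omega>) (Suc k)))"
          using mean[OF om] by simp
        also have "\<dots> = (\<Sum>z\<in>S. indicator (A \<inter> {\<omega>\<in>space M. f \<omega> s < Suc k \<and> Suc k \<le> f \<omega> t \<and> mk z k \<omega>}) \<omega> * g z (event_time (f \<omega>) (Suc k)))"
          using True by (intro sum.cong refl) (simp add: indicator_def)
        finally show ?thesis using True by simp
      next
        case False
        then have "(\<Sum>z\<in>S. indicator (A \<inter> {\<omega>\<in>space M. f \<omega> s < Suc k \<and> Suc k \<le> f \<omega> t \<and> mk z k \<omega>}) \<omega> * g z (event_time (f \<omega>) (Suc k))) = 0"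
          by (intro sum.neutral ballI) (auto simp: indicator_def)
        then show ?thesis using False by simp
      qed
    qed
    also have "\<dots> = (\<Sum>z\<in>S. LINT \<omega>|M. indicator (A \<inter> {\<omega>\<in>space M. f \<omega> s < Suc k \<and> Suc k \<le> f \<omega> t \<and> mk z k \<omega>}) \<omega> * g z (event_time (f \<omega>) (Suc k)))"
      by (rule Bochner_Integration.integral_sum) (rule compi)
    finally show ?thesis .
  qed
  have sums: "(\<lambda>k. LINT \<omega>|M. indicator (A \<inter> ?D k) \<omega> * lump_val (\<kappa> (Suc k - 1)) \<omega>) sums (\<Sum>z\<in>S. I z)"
    unfolding val by (rule sums_sum) (rule comp)
  show "integrable M (\<lambda>\<omega>. indicator A \<omega> * (\<Sum>k\<in>{f \<omega> s<..f \<omega> t}. lump_val (\<kappa> (k - 1)) \<omega>))"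
    by (rule sum_of_lumps(1)[where V="\<lambda>k. lump_val (\<kappa> (k - 1))", OF I1 pos sums])
  show "(LINT \<omega>|M. indicator A \<omega> * (\<Sum>k\<in>{f \<omega> s<..f \<omega> t}. lump_val (\<kappa> (k - 1)) \<omega>)) = (\<Sum>z\<in>S. I z)"
    by (rule sum_of_lumps(2)[where V="\<lambda>k. lump_val (\<kappa> (k - 1))", OF I1 pos sums])
qed

text \<open>The mark is the pair of states before and after the jump; these always differ, so
  exactly one pair of the index set applies.\<close>

lemma jump_rewards_integral:
  assumes st: "0 \<le> s" "s \<le> t" and A: "A \<in> sets (FH s)"
  shows "integrable M (\<lambda>\<omega>. indicator A \<omega> * (\<Sum>k\<in>{J s \<omega><..J t \<omega>}. Gr k \<omega>))"
    and "(LINT \<omega>|M. indicator A \<omega> * (\<Sum>k\<in>{J s \<omega><..J t \<omega>}. Gr k \<omega>))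
      = (\<Sum>z\<in>{z. fst z \<noteq> snd z}. LINT u:{s..t}|lborel. prob (A \<inter> state u (fst z)) * Q u (fst z) (snd z) * mean_pos (G u (fst z) (snd z)))"
proof -
  have t: "0 \<le> t" using st by simp
  have AM: "A \<in> events" using FH_events[OF st(1) A] .
  let ?S = "{z :: 's \<times> 's. fst z \<noteq> snd z}"
  let ?ch = "\<lambda>\<omega>. jump_chain (\<lambda>t. X t \<omega>)"
  let ?mk = "\<lambda>z k \<omega>. ?ch \<omega> k = fst z \<and> ?ch \<omega> (Suc k) = snd z"
  let ?f = "\<lambda>\<omega> u. J u \<omega>"
  let ?g = "\<lambda>z u. mean_pos (G u (fst z) (snd z))"
  interpret O: observed_paths M X t by (rule observed_M[OF t])
  have mkM: "{\<omega>\<in>space M. Suc k \<le> J t \<omega> \<and> ?mk z k \<omega>} \<in> events" for z k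
  proof -
    let ?Y = "\<lambda>k \<omega>. if k \<le> J t \<omega> then ?ch \<omega> k else X 0 \<omega>"
    note [measurable] = O.masked_jump_chain_measurable[of k] O.masked_jump_chain_measurable[of "Suc k"] J_measurable_M[OF t]
    have "{\<omega>\<in>space M. Suc k \<le> J t \<omega> \<and> ?Y k \<omega> = fst z \<and> ?Y (Suc k) \<omega> = snd z} \<in> events" by measurable
    also have "{\<omega>\<in>space M. Suc k \<le> J t \<omega> \<and> ?Y k \<omega> = fst z \<and> ?Y (Suc k) \<omega> = snd z} = {\<omega>\<in>space M. Suc k \<le> J t \<omega> \<and> ?mk z k \<omega>}"
      by (intro Collect_cong) auto
    finally show ?thesis .
  qed
  have C: "(\<lambda>k. LINT \<omega>|M. indicator (A \<inter> {\<omega>\<in>space M. ?f \<omega> s < Suc k \<and> Suc k \<le> ?f \<omega> t \<and> ?mk z k \<omega>}) \<omega> * ?g z (event_time (?f \<omega>) (Suc k)))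
      sums (LINT u:{s..t}|lborel. prob (A \<inter> state u (fst z)) * Q u (fst z) (snd z) * ?g z u)
     \<and> (\<forall>k. integrable M (\<lambda>\<omega>. indicator (A \<inter> {\<omega>\<in>space M. ?f \<omega> s < Suc k \<and> Suc k \<le> ?f \<omega> t \<and> ?mk z k \<omega>}) \<omega> * ?g z (event_time (?f \<omega>) (Suc k))))"
    if z: "z \<in> ?S" for z
  proof -
    have fm: "(\<lambda>\<omega>. ?f \<omega> u) \<in> measurable M (count_space UNIV)" if "0 \<le> u" "u \<le> t" for u using J_measurable_M[OF that(1)] .
    have \<psi>m: "(\<lambda>u. prob (A \<inter> state (max 0 u) (fst z)) * Q (max 0 u) (fst z) (snd z)) \<in> borel_measurable borel"
      using state_prob_measurable[OF AM] Q_measurable by (rule borel_measurable_times)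
    have \<psi>b: "0 \<le> prob (A \<inter> state u (fst z)) * Q u (fst z) (snd z) \<and> prob (A \<inter> state u (fst z)) * Q u (fst z) (snd z) \<le> q" if u: "0 \<le> u" for u
    proof
      have Q: "0 \<le> Q u (fst z) (snd z)" "Q u (fst z) (snd z) \<le> q"
        using Q_nonneg[OF u] Q_bound[OF u, of "fst z" "snd z"] z by auto
      show "0 \<le> prob (A \<inter> state u (fst z)) * Q u (fst z) (snd z)" using Q by simp
      have "prob (A \<inter> state u (fst z)) * Q u (fst z) (snd z) \<le> 1 * Q u (fst z) (snd z)" using Q by (intro mult_right_mono) auto
      then show "prob (A \<inter> state u (fst z)) * Q u (fst z) (snd z) \<le> q" using Q by simp
    qed
    have H: "(LINT \<omega>|M. indicator A \<omega> * (\<Sum>k\<in>{?f \<omega> a<..?f \<omega> t}. of_bool (?mk z (k - 1) \<omega>))) = (LINT u:{a..t}|lborel. prob (A \<inter> state u (fst z)) * Q u (fst z) (snd z))"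
      if a: "s \<le> a" "a \<le> t" for a
    proof -
      have "(\<Sum>k\<in>{?f \<omega> a<..?f \<omega> t}. of_bool (?mk z (k - 1) \<omega>)) = (\<Sum>k\<in>{J a \<omega><..J t \<omega>}. of_bool (?ch \<omega> (k - 1) = fst z \<and> ?ch \<omega> k = snd z) :: real)" for \<omega>
        by (intro sum.cong refl) auto
      then show ?thesis using jump_count_integral[OF st(1) a A, of "fst z" "snd z"] z by (simp only: mem_Collect_eq) blast
    qed
    show ?thesis
      using compensator_of_marks[of ?f t "?mk z" A s "\<lambda>u. prob (A \<inter> state u (fst z)) * Q u (fst z) (snd z)" q "?g z" "real c",
          OF J_path fm mkM AM st integrable_J[OF t] \<psi>m \<psi>b mean_measurable(1) mean_bounds(1) H]
      by blast
  qed
  have mean: "mean_pos (lump_cdf (Jump_lump k) \<omega>) = (\<Sum>z\<in>?S. of_bool (?mk z k \<omega>) * ?g z (event_time (?f \<omega>) (Suc k)))"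
    if om: "\<omega> \<in> space M" and k: "Suc k \<le> J t \<omega>" for k \<omega>
  proof -
    let ?z = "(?ch \<omega> k, ?ch \<omega> (Suc k))"
    have "event_occurs (\<lambda>t. J t \<omega>) (Suc k)" using event_occursI[of t "Suc k" "\<lambda>t. J t \<omega>"] t k by simp
    from jump_chain_Suc_neq[OF X_path[OF om] this] have z: "?z \<in> ?S" by simp
    have "(\<Sum>z\<in>?S. of_bool (?mk z k \<omega>) * ?g z (event_time (?f \<omega>) (Suc k))) = (\<Sum>z\<in>?S. if z = ?z then ?g ?z (event_time (?f \<omega>) (Suc k)) else 0)"
      by (intro sum.cong refl) (auto simp: prod_eq_iff)
    also have "\<dots> = ?g ?z (event_time (?f \<omega>) (Suc k))" using z by simp
    finally show ?thesis by (simp add: jump_time_def)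
  qed
  have eqG: "lump_val (Jump_lump (k - 1)) \<omega> = Gr k \<omega>" if "k \<in> {J s \<omega><..J t \<omega>}" for k \<omega> using that by (cases k) auto
  have sum_eq: "(\<Sum>k\<in>{J s \<omega><..J t \<omega>}. lump_val (Jump_lump (k - 1)) \<omega>) = (\<Sum>k\<in>{J s \<omega><..J t \<omega>}. Gr k \<omega>)" for \<omega>
    by (intro sum.cong refl eqG)
  note L = lumps_integral[where \<kappa>=Jump_lump and f="?f" and S="?S" and mk="?mk" and g="?g"
      and I="\<lambda>z. LINT u:{s..t}|lborel. prob (A \<inter> state u (fst z)) * Q u (fst z) (snd z) * ?g z u", OF st A _ mean, unfolded sum_eq]
  show "integrable M (\<lambda>\<omega>. indicator A \<omega> * (\<Sum>k\<in>{J s \<omega><..J t \<omega>}. Gr k \<omega>))"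
    by (rule L(1)) (use C in auto)
  show "(LINT \<omega>|M. indicator A \<omega> * (\<Sum>k\<in>{J s \<omega><..J t \<omega>}. Gr k \<omega>))
      = (\<Sum>z\<in>?S. LINT u:{s..t}|lborel. prob (A \<inter> state u (fst z)) * Q u (fst z) (snd z) * ?g z u)"
    by (rule L(2)) (use C in auto)
qed

text \<open>The mark is the state of X at the event.\<close>

lemma Poisson_rewards_integral:
  assumes st: "0 \<le> s" "s \<le> t" and A: "A \<in> sets (FH s)"
  shows "integrable M (\<lambda>\<omega>. indicator A \<omega> * (\<Sum>k\<in>{N s \<omega><..N t \<omega>}. Kr k \<omega>))"
    and "(LINT \<omega>|M. indicator A \<omega> * (\<Sum>k\<in>{N s \<omega><..N t \<omega>}. Kr k \<omega>))
      = (\<Sum>x\<in>UNIV. LINT u:{s..t}|lborel. prob (A \<inter> state u x) * \<beta> u x * mean_pos (K u x))"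
proof -
  have t: "0 \<le> t" using st by simp
  have AM: "A \<in> events" using FH_events[OF st(1) A] .
  let ?f = "\<lambda>\<omega> u. N u \<omega>"
  let ?mk = "\<lambda>x k \<omega>. X (event_time (?f \<omega>) (Suc k)) \<omega> = x"
  let ?g = "\<lambda>x u. mean_pos (K u x)"
  have mkM: "{\<omega>\<in>space M. Suc k \<le> N t \<omega> \<and> ?mk x k \<omega>} \<in> events" for x k
  proof -
    let ?Y = "\<lambda>\<omega>. X (if Suc k \<le> N t \<omega> then event_time (?f \<omega>) (Suc k) else 0) \<omega>"
    note [measurable] = measurable_from_subalg[OF subalgebras(8) masked_Poisson_state_measurable[OF t, of "Suc k"]] N_measurable[OF t]
    have "{\<omega>\<in>space M. Suc k \<le> N t \<omega> \<and> ?Y \<omega> = x} \<in> events" by measurable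
    also have "{\<omega>\<in>space M. Suc k \<le> N t \<omega> \<and> ?Y \<omega> = x} = {\<omega>\<in>space M. Suc k \<le> N t \<omega> \<and> ?mk x k \<omega>}"
      by (intro Collect_cong) auto
    finally show ?thesis .
  qed
  have C: "(\<lambda>k. LINT \<omega>|M. indicator (A \<inter> {\<omega>\<in>space M. ?f \<omega> s < Suc k \<and> Suc k \<le> ?f \<omega> t \<and> ?mk x k \<omega>}) \<omega> * ?g x (event_time (?f \<omega>) (Suc k)))
      sums (LINT u:{s..t}|lborel. prob (A \<inter> state u x) * \<beta> u x * ?g x u)
     \<and> (\<forall>k. integrable M (\<lambda>\<omega>. indicator (A \<inter> {\<omega>\<in>space M. ?f \<omega> s < Suc k \<and> Suc k \<le> ?f \<omega> t \<and> ?mk x k \<omega>}) \<omega> * ?g x (event_time (?f \<omega>) (Suc k))))"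
    for x
  proof -
    have fm: "(\<lambda>\<omega>. ?f \<omega> u) \<in> measurable M (count_space UNIV)" if "0 \<le> u" "u \<le> t" for u using N_measurable[OF that(1)] .
    have \<psi>m: "(\<lambda>u. prob (A \<inter> state (max 0 u) x) * \<beta> (max 0 u) x) \<in> borel_measurable borel"
      using state_prob_measurable[OF AM] \<beta>_measurable by (rule borel_measurable_times)
    have \<psi>b: "0 \<le> prob (A \<inter> state u x) * \<beta> u x \<and> prob (A \<inter> state u x) * \<beta> u x \<le> b" if u: "0 \<le> u" for u
    proof
      show "0 \<le> prob (A \<inter> state u x) * \<beta> u x" using \<beta>_bound[OF u] by simp
      have "prob (A \<inter> state u x) * \<beta> u x \<le> 1 * \<beta> u x" using \<beta>_bound[OF u] by (intro mult_right_mono) auto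
      then show "prob (A \<inter> state u x) * \<beta> u x \<le> b" using \<beta>_bound[OF u, of x] by simp
    qed
    have H: "(LINT \<omega>|M. indicator A \<omega> * (\<Sum>k\<in>{?f \<omega> a<..?f \<omega> t}. of_bool (?mk x (k - 1) \<omega>))) = (LINT u:{a..t}|lborel. prob (A \<inter> state u x) * \<beta> u x)"
      if a: "s \<le> a" "a \<le> t" for a
    proof -
      have "(\<Sum>k\<in>{?f \<omega> a<..?f \<omega> t}. of_bool (?mk x (k - 1) \<omega>)) = (\<Sum>k\<in>{N a \<omega><..N t \<omega>}. of_bool (X (event_time (\<lambda>t. N t \<omega>) k) \<omega> = x) :: real)" for \<omega>
        by (intro sum.cong refl) auto
      then show ?thesis using Poisson_count_integral[OF st(1) a A, of x] by (simp only:)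
    qed
    show ?thesis
      using compensator_of_marks[of ?f t "?mk x" A s "\<lambda>u. prob (A \<inter> state u x) * \<beta> u x" b "?g x" "real c",
          OF N_path fm mkM AM st integrable_N[OF t] \<psi>m \<psi>b mean_measurable(2) mean_bounds(3) H]
      by blast
  qed
  have mean: "mean_pos (lump_cdf (Poisson_lump k) \<omega>) = (\<Sum>x\<in>UNIV. of_bool (?mk x k \<omega>) * ?g x (event_time (?f \<omega>) (Suc k)))" for k \<omega>
  proof -
    have "(\<Sum>x\<in>UNIV. of_bool (?mk x k \<omega>) * ?g x (event_time (?f \<omega>) (Suc k)))
      = (\<Sum>x\<in>UNIV. if x = X (event_time (?f \<omega>) (Suc k)) \<omega> then ?g (X (event_time (?f \<omega>) (Suc k)) \<omega>) (event_time (?f \<omega>) (Suc k)) else 0)"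
      by (intro sum.cong refl) auto
    then show ?thesis by simp
  qed
  have eqK: "lump_val (Poisson_lump (k - 1)) \<omega> = Kr k \<omega>" if "k \<in> {N s \<omega><..N t \<omega>}" for k \<omega> using that by (cases k) auto
  have sum_eq: "(\<Sum>k\<in>{N s \<omega><..N t \<omega>}. lump_val (Poisson_lump (k - 1)) \<omega>) = (\<Sum>k\<in>{N s \<omega><..N t \<omega>}. Kr k \<omega>)" for \<omega>
    by (intro sum.cong refl eqK)
  note L = lumps_integral[where \<kappa>=Poisson_lump and f="?f" and S=UNIV and mk="?mk" and g="?g"
      and I="\<lambda>x. LINT u:{s..t}|lborel. prob (A \<inter> state u x) * \<beta> u x * ?g x u", OF st A _ mean, unfolded sum_eq]
  show "integrable M (\<lambda>\<omega>. indicator A \<omega> * (\<Sum>k\<in>{N s \<omega><..N t \<omega>}. Kr k \<omega>))"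
    by (rule L(1)) (use C in auto)
  show "(LINT \<omega>|M. indicator A \<omega> * (\<Sum>k\<in>{N s \<omega><..N t \<omega>}. Kr k \<omega>))
      = (\<Sum>x\<in>UNIV. LINT u:{s..t}|lborel. prob (A \<inter> state u x) * \<beta> u x * ?g x u)"
    by (rule L(2)) (use C in auto)
qed

subsection \<open>Rewards earned at deterministic times\<close>

text \<open>Taking \<tau> i itself as the later time, the reward is earned in (s, \<tau> i] on every
  path, so the conditioning event of \<open>lump_mean_given_FH\<close> is all of A.\<close>

lemma fixed_reward_integral:
  assumes s: "0 \<le> s" "s < \<tau> i" and A: "A \<in> sets (FH s)"
  shows "integrable M (\<lambda>\<omega>. indicator A \<omega> * Hr i \<omega>)"
    and "(LINT \<omega>|M. indicator A \<omega> * Hr i \<omega>) = (\<Sum>x\<in>UNIV. prob (A \<inter> state (\<tau> i) x) * fixed_mean i x)"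
proof -
  have "i \<noteq> 0" using s \<tau>_0 by (intro notI) simp
  then obtain j where j: "i = Suc j" by (cases i) auto
  have ti: "0 \<le> \<tau> i" "s \<le> \<tau> i" using s by auto
  have AM: "A \<in> events" using FH_events[OF s(1) A] .
  note lm = lump_mean_given_FH[OF s(1) ti(2) A, of "Fixed_lump j"]
  have D: "A \<inter> (lump_done (Fixed_lump j) (\<tau> i) - lump_done (Fixed_lump j) s) = A"
    using s sets.sets_into_space[OF AM] by (auto simp: lump_done_def j)
  have v: "lump_val (Fixed_lump j) = Hr i" by (simp add: j)
  note lm = lm[unfolded D v]
  show "integrable M (\<lambda>\<omega>. indicator A \<omega> * Hr i \<omega>)"
  proof (rule integrable_const_bound[of _ "real c"])
    show "AE \<omega> in M. norm (indicator A \<omega> * Hr i \<omega>) \<le> real c" using lm(1) by eventually_elim (simp add: indicator_def)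
    show "(\<lambda>\<omega>. indicator A \<omega> * Hr i \<omega>) \<in> borel_measurable M"
      using AM lump_val_measurable[of "Fixed_lump j"] unfolding v by (intro borel_measurable_times borel_measurable_indicator)
  qed
  have "(LINT \<omega>|M. indicator A \<omega> * Hr i \<omega>) = (LINT \<omega>|M. indicator A \<omega> * mean_pos (lump_cdf (Fixed_lump j) \<omega>))" by (rule lm(3))
  also have "\<dots> = (LINT \<omega>|M. (\<Sum>x\<in>UNIV. indicator (A \<inter> state (\<tau> i) x) \<omega> * fixed_mean i x))"
  proof (rule Bochner_Integration.integral_cong[OF refl])
    fix \<omega> assume om: "\<omega> \<in> space M"
    have "mean_pos (lump_cdf (Fixed_lump j) \<omega>) = (\<Sum>x\<in>UNIV. indicator (state (\<tau> i) x) \<omega> * fixed_mean i x)"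
      unfolding state_indicator_sum[OF om] by (simp add: fixed_mean_def j)
    then show "indicator A \<omega> * mean_pos (lump_cdf (Fixed_lump j) \<omega>) = (\<Sum>x\<in>UNIV. indicator (A \<inter> state (\<tau> i) x) \<omega> * fixed_mean i x)"
      by (simp only: sum_distrib_left indicator_inter_arith mult.assoc)
  qed
  also have "\<dots> = (\<Sum>x\<in>UNIV. LINT \<omega>|M. indicator (A \<inter> state (\<tau> i) x) \<omega> * fixed_mean i x)"
  proof (rule Bochner_Integration.integral_sum)
    fix x
    have "A \<inter> state (\<tau> i) x \<in> events" using AM state_events[OF ti(1)] by (rule sets.Int)
    then show "integrable M (\<lambda>\<omega>. indicator (A \<inter> state (\<tau> i) x) \<omega> * fixed_mean i x)"
      by (intro integrable_mult_left integrable_real_indicator) (auto simp: less_top[symmetric])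
  qed
  also have "\<dots> = (\<Sum>x\<in>UNIV. prob (A \<inter> state (\<tau> i) x) * fixed_mean i x)"
    by (intro sum.cong refl) (simp add: Int_absorb2 state_def Int_assoc)
  finally show "(LINT \<omega>|M. indicator A \<omega> * Hr i \<omega>) = (\<Sum>x\<in>UNIV. prob (A \<inter> state (\<tau> i) x) * fixed_mean i x)" .
qed

text \<open>The supremum is a maximum: the set is finite because the times tend to infinity, and
  nonempty because \<tau> 0 = 0.\<close>

lemma le_last_fixed_iff:
  assumes "0 \<le> t"
  shows "i \<le> Sup {i. \<tau> i \<le> t} \<longleftrightarrow> \<tau> i \<le> t"
proof -
  have "\<forall>\<^sub>F i in sequentially. t < \<tau> i" using \<tau>_lim by (simp add: filterlim_at_top_dense)
  then obtain n where n: "\<And>i. n \<le> i \<Longrightarrow> t < \<tau> i" by (auto simp: eventually_sequentially)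
  have fin: "finite {i. \<tau> i \<le> t}" by (rule finite_subset[of _ "{..<n}"]) (use n in \<open>auto simp: not_le[symmetric]\<close>)
  have ne: "{i. \<tau> i \<le> t} \<noteq> {}" using assms \<tau>_0 by (auto intro!: exI[of _ 0])
  have S: "Sup {i. \<tau> i \<le> t} = Max {i. \<tau> i \<le> t}" unfolding Sup_nat_def by (rule if_not_P[OF ne])
  show ?thesis
  proof
    assume "i \<le> Sup {i. \<tau> i \<le> t}"
    moreover have "\<tau> (Max {i. \<tau> i \<le> t}) \<le> t" using Max_in[OF fin ne] by simp
    ultimately show "\<tau> i \<le> t" unfolding S using strict_mono_less_eq[OF \<tau>_mono] order_trans by blast
  next
    assume "\<tau> i \<le> t"
    then show "i \<le> Sup {i. \<tau> i \<le> t}" unfolding S using fin by (intro Max_ge) auto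
  qed
qed

abbreviation "R \<equiv> cumulative_reward r \<tau> X N Gr Hr Kr"

lemma R_parts_integrable:
  assumes t: "0 \<le> t" and A: "A \<in> events"
  shows "integrable M (\<lambda>\<omega>. \<Sum>j = 1..J t \<omega>. Gr j \<omega>)" "integrable M (\<lambda>\<omega>. \<Sum>i = 1..Sup {i. \<tau> i \<le> t}. Hr i \<omega>)"
    "integrable M (\<lambda>\<omega>. \<Sum>k = 1..N t \<omega>. Kr k \<omega>)" "integrable M (\<lambda>\<omega>. LINT s:{0..t}|lborel. r s (X s \<omega>))"
proof -
  have S: "space M \<in> sets (FH 0)" using sets.top[of "FH 0"] by simp
  have "integrable M (\<lambda>\<omega>. indicator (space M) \<omega> * (\<Sum>k\<in>{J 0 \<omega><..J t \<omega>}. Gr k \<omega>))" by (rule jump_rewards_integral(1)[OF order.refl t S])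
  also have "?this \<longleftrightarrow> integrable M (\<lambda>\<omega>. \<Sum>j = 1..J t \<omega>. Gr j \<omega>)"
    using step_path_0[OF J_path] by (intro Bochner_Integration.integrable_cong refl) (simp add: atLeastSucAtMost_greaterThanAtMost[symmetric])
  finally show "integrable M (\<lambda>\<omega>. \<Sum>j = 1..J t \<omega>. Gr j \<omega>)" .
  have "integrable M (\<lambda>\<omega>. indicator (space M) \<omega> * (\<Sum>k\<in>{N 0 \<omega><..N t \<omega>}. Kr k \<omega>))" by (rule Poisson_rewards_integral(1)[OF order.refl t S])
  also have "?this \<longleftrightarrow> integrable M (\<lambda>\<omega>. \<Sum>k = 1..N t \<omega>. Kr k \<omega>)"
    using step_path_0[OF N_path] by (intro Bochner_Integration.integrable_cong refl) (simp add: atLeastSucAtMost_greaterThanAtMost[symmetric])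
  finally show "integrable M (\<lambda>\<omega>. \<Sum>k = 1..N t \<omega>. Kr k \<omega>)" .
  show "integrable M (\<lambda>\<omega>. \<Sum>i = 1..Sup {i. \<tau> i \<le> t}. Hr i \<omega>)"
  proof (rule Bochner_Integration.integrable_sum)
    fix i assume "i \<in> {1..Sup {i. \<tau> i \<le> t}}"
    then obtain j where "i = Suc j" by (cases i) auto
    then have "0 < \<tau> i" using \<tau>_pos by simp
    from fixed_reward_integral(1)[OF order.refl this S] show "integrable M (Hr i)"
      by (rule Bochner_Integration.integrable_cong[THEN iffD1, rotated 2]) auto
  qed
  have "integrable M (\<lambda>\<omega>. indicator (space M) \<omega> * (LINT s:{0..t}|lborel. r s (X s \<omega>)))"
    by (rule path_fubini(1)[OF r_measurable _ order.refl t, where B=b]) (use r_bound in \<open>auto simp: abs_le_iff intro: order_trans[OF _ b_nonneg]\<close>)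
  also have "?this \<longleftrightarrow> integrable M (\<lambda>\<omega>. LINT s:{0..t}|lborel. r s (X s \<omega>))"
    by (intro Bochner_Integration.integrable_cong refl) simp
  finally show "integrable M (\<lambda>\<omega>. LINT s:{0..t}|lborel. r s (X s \<omega>))" .
qed

lemma integrable_R: "0 \<le> t \<Longrightarrow> integrable M (R t)"
  unfolding cumulative_reward_def[abs_def]
  using R_parts_integrable[OF _ sets.top] by (intro Bochner_Integration.integrable_add) auto

text \<open>The path integral, the two random sums and the finite sum over deterministic times are
  evaluated separately; the first three then combine into r-tilde.\<close>

lemma R_increment_integral:
  assumes st: "0 \<le> s" "s \<le> t" and A: "A \<in> sets (FH s)"
  shows "(LINT \<omega>|M. indicator A \<omega> * (R t \<omega> - R s \<omega>))
    = (LINT u:{s..t}|lborel. \<Sum>x\<in>UNIV. prob (A \<inter> state u x) * rate u x)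
      + (\<Sum>i | s < \<tau> i \<and> \<tau> i \<le> t. \<Sum>x\<in>UNIV. prob (A \<inter> state (\<tau> i) x) * fixed_mean i x)"
proof -
  have t: "0 \<le> t" using st by simp
  have AM: "A \<in> events" using FH_events[OF st(1) A] .
  let ?I = "\<lambda>t \<omega>. LINT s:{0..t}|lborel. r s (X s \<omega>)"
  let ?F = "{i. s < \<tau> i \<and> \<tau> i \<le> t}"
  let ?S = "{z :: 's \<times> 's. fst z \<noteq> snd z}"
  have rb: "\<bar>r u x\<bar> \<le> b" if "0 \<le> u" for u x using r_bound[OF that, of x] by simp
  have \<beta>b: "\<bar>\<beta> u x\<bar> \<le> b" if "0 \<le> u" for u x using \<beta>_bound[OF that, of x] by simp
  have F: "{Sup {i. \<tau> i \<le> s}<..Sup {i. \<tau> i \<le> t}} = ?F"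
    using le_last_fixed_iff[OF st(1)] le_last_fixed_iff[OF t] by (auto simp: not_le[symmetric])
  have Sle: "Sup {i. \<tau> i \<le> s} \<le> Sup {i. \<tau> i \<le> t}"
    using le_last_fixed_iff[OF st(1), of "Sup {i. \<tau> i \<le> s}"] le_last_fixed_iff[OF t, of "Sup {i. \<tau> i \<le> s}"] st by simp
  have split: "(\<Sum>k = 1..n. h k) - (\<Sum>k = 1..m. h k) = (\<Sum>k\<in>{m<..n}. h k)" if "m \<le> n" for m n and h :: "nat \<Rightarrow> real"
  proof -
    have "{1..n} = {1..m} \<union> {m<..n}" using that by auto
    then have "(\<Sum>k = 1..n. h k) = (\<Sum>k = 1..m. h k) + (\<Sum>k\<in>{m<..n}. h k)" by (auto intro!: sum.union_disjoint)
    then show ?thesis by simp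
  qed
  have decomp: "indicator A \<omega> * (R t \<omega> - R s \<omega>)
     = (indicator A \<omega> * ?I t \<omega> - indicator A \<omega> * ?I s \<omega>) + indicator A \<omega> * (\<Sum>k\<in>{J s \<omega><..J t \<omega>}. Gr k \<omega>)
       + (\<Sum>i\<in>?F. indicator A \<omega> * Hr i \<omega>) + indicator A \<omega> * (\<Sum>k\<in>{N s \<omega><..N t \<omega>}. Kr k \<omega>)"
    if om: "\<omega> \<in> space M" for \<omega>
    unfolding cumulative_reward_def split[OF step_path_mono[OF J_path[OF om] st], symmetric]
      split[OF step_path_mono[OF N_path[OF om] st], symmetric] F[symmetric] sum_distrib_left[symmetric] split[OF Sle, symmetric]
    by (simp add: algebra_simps)
  have i1: "integrable M (\<lambda>\<omega>. indicator A \<omega> * ?I t \<omega>)" "integrable M (\<lambda>\<omega>. indicator A \<omega> * ?I s \<omega>)"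
    by (rule path_fubini(1)[OF r_measurable rb order.refl t AM], assumption)
       (rule path_fubini(1)[OF r_measurable rb order.refl st(1) AM], assumption)
  have v1: "(LINT \<omega>|M. indicator A \<omega> * ?I t \<omega>) = (LINT u:{0..t}|lborel. \<Sum>x\<in>UNIV. prob (A \<inter> state u x) * r u x)"
    "(LINT \<omega>|M. indicator A \<omega> * ?I s \<omega>) = (LINT u:{0..s}|lborel. \<Sum>x\<in>UNIV. prob (A \<inter> state u x) * r u x)"
    by (rule path_fubini(2)[OF r_measurable rb order.refl t AM], assumption)
       (rule path_fubini(2)[OF r_measurable rb order.refl st(1) AM], assumption)
  have Pr: "set_integrable lborel {a..t} (\<lambda>u. prob (A \<inter> state u x) * r u x)" if "0 \<le> a" for a x
    by (rule set_integrable_state_product[OF AM r_measurable rb that])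
  note Prs = set_integral_sum_finite[of UNIV lborel "{a..t}" "\<lambda>x u. prob (A \<inter> state u x) * r u x" for a, OF Pr]
  have rsplit: "(LINT u:{0..t}|lborel. \<Sum>x\<in>UNIV. prob (A \<inter> state u x) * r u x)
    = (LINT u:{0..s}|lborel. \<Sum>x\<in>UNIV. prob (A \<inter> state u x) * r u x) + (LINT u:{s..t}|lborel. \<Sum>x\<in>UNIV. prob (A \<inter> state u x) * r u x)"
  proof -
    let ?h = "\<lambda>u. \<Sum>x\<in>UNIV. prob (A \<inter> state u x) * r u x"
    have "(LINT u:{0..s} \<union> {s..t}|lborel. ?h u) = (LINT u:{0..s}|lborel. ?h u) + (LINT u:{s..t}|lborel. ?h u)"
    proof (rule set_integral_Un_AE)
      show "AE u in lborel. \<not> (u \<in> {0..s} \<and> u \<in> {s..t})" using AE_lborel_singleton[of s] by eventually_elim auto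
      show "set_integrable lborel {0..s} ?h" by (rule set_integrable_subset[OF Prs(1)[OF order.refl]]) (use st in auto)
      show "set_integrable lborel {s..t} ?h" by (rule Prs(1)[OF st(1)])
    qed auto
    moreover have "{0..s} \<union> {s..t} = {0..t}" using st by auto
    ultimately show ?thesis by simp
  qed
  have Fpos: "s < \<tau> i" if "i \<in> ?F" for i using that by simp
  have "(LINT \<omega>|M. indicator A \<omega> * (R t \<omega> - R s \<omega>))
     = (LINT \<omega>|M. (indicator A \<omega> * ?I t \<omega> - indicator A \<omega> * ?I s \<omega>) + indicator A \<omega> * (\<Sum>k\<in>{J s \<omega><..J t \<omega>}. Gr k \<omega>)
       + (\<Sum>i\<in>?F. indicator A \<omega> * Hr i \<omega>) + indicator A \<omega> * (\<Sum>k\<in>{N s \<omega><..N t \<omega>}. Kr k \<omega>))"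
    by (rule Bochner_Integration.integral_cong[OF refl]) (rule decomp)
  also have "\<dots> = (LINT \<omega>|M. indicator A \<omega> * ?I t \<omega>) - (LINT \<omega>|M. indicator A \<omega> * ?I s \<omega>)
      + (LINT \<omega>|M. indicator A \<omega> * (\<Sum>k\<in>{J s \<omega><..J t \<omega>}. Gr k \<omega>))
      + (LINT \<omega>|M. (\<Sum>i\<in>?F. indicator A \<omega> * Hr i \<omega>))
      + (LINT \<omega>|M. indicator A \<omega> * (\<Sum>k\<in>{N s \<omega><..N t \<omega>}. Kr k \<omega>))"
    using i1 jump_rewards_integral(1)[OF st A] Poisson_rewards_integral(1)[OF st A]
      Bochner_Integration.integrable_sum[of ?F M "\<lambda>i \<omega>. indicator A \<omega> * Hr i \<omega>", OF fixed_reward_integral(1)[OF st(1) Fpos A]]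
    by (simp add: Bochner_Integration.integral_add Bochner_Integration.integral_diff)
  also have "(LINT \<omega>|M. (\<Sum>i\<in>?F. indicator A \<omega> * Hr i \<omega>)) = (\<Sum>i\<in>?F. LINT \<omega>|M. indicator A \<omega> * Hr i \<omega>)"
    by (rule Bochner_Integration.integral_sum) (rule fixed_reward_integral(1)[OF st(1) Fpos A])
  also have "\<dots> = (\<Sum>i\<in>?F. \<Sum>x\<in>UNIV. prob (A \<inter> state (\<tau> i) x) * fixed_mean i x)"
    by (intro sum.cong refl fixed_reward_integral(2)[OF st(1) Fpos A])
  also have "(LINT \<omega>|M. indicator A \<omega> * ?I t \<omega>) - (LINT \<omega>|M. indicator A \<omega> * ?I s \<omega>) = (LINT u:{s..t}|lborel. \<Sum>x\<in>UNIV. prob (A \<inter> state u x) * r u x)"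
    unfolding v1 rsplit by simp
  finally have total: "(LINT \<omega>|M. indicator A \<omega> * (R t \<omega> - R s \<omega>))
     = (LINT u:{s..t}|lborel. \<Sum>x\<in>UNIV. prob (A \<inter> state u x) * r u x)
      + (\<Sum>z\<in>?S. LINT u:{s..t}|lborel. prob (A \<inter> state u (fst z)) * Q u (fst z) (snd z) * mean_pos (G u (fst z) (snd z)))
      + (\<Sum>i\<in>?F. \<Sum>x\<in>UNIV. prob (A \<inter> state (\<tau> i) x) * fixed_mean i x)
      + (\<Sum>x\<in>UNIV. LINT u:{s..t}|lborel. prob (A \<inter> state u x) * \<beta> u x * mean_pos (K u x))"
    unfolding jump_rewards_integral(2)[OF st A] Poisson_rewards_integral(2)[OF st A] .
  have Pj: "set_integrable lborel {s..t} (\<lambda>u. prob (A \<inter> state u x) * Q u x y * mean_pos (G u x y))" for x y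
    unfolding mult.assoc
  proof (rule set_integrable_state_product[OF AM _ _ st(1)])
    show "(\<lambda>u. Q (max 0 u) x y * mean_pos (G (max 0 u) x y)) \<in> borel_measurable borel"
      using Q_measurable mean_measurable(1) by (rule borel_measurable_times)
    show "\<bar>Q u x y * mean_pos (G u x y)\<bar> \<le> q * c" if "0 \<le> u" for u
      unfolding abs_mult using Q_bound[OF that, of x y] mean_bounds(1)[OF that, of x y] q_nonneg by (intro mult_mono) auto
  qed
  have Pn: "set_integrable lborel {s..t} (\<lambda>u. prob (A \<inter> state u x) * \<beta> u x * mean_pos (K u x))" for x
    unfolding mult.assoc
  proof (rule set_integrable_state_product[OF AM _ _ st(1)])
    show "(\<lambda>u. \<beta> (max 0 u) x * mean_pos (K (max 0 u) x)) \<in> borel_measurable borel"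
      using \<beta>_measurable mean_measurable(2) by (rule borel_measurable_times)
    show "\<bar>\<beta> u x * mean_pos (K u x)\<bar> \<le> b * c" if "0 \<le> u" for u
      unfolding abs_mult using \<beta>b[OF that, of x] mean_bounds(3)[OF that, of x] b_nonneg by (intro mult_mono) auto
  qed
  note Pjs = set_integral_sum_finite[of ?S lborel "{s..t}" "\<lambda>z u. prob (A \<inter> state u (fst z)) * Q u (fst z) (snd z) * mean_pos (G u (fst z) (snd z))", OF Pj]
  note Pns = set_integral_sum_finite[of UNIV lborel "{s..t}" "\<lambda>x u. prob (A \<inter> state u x) * \<beta> u x * mean_pos (K u x)", OF Pn]
  have "(LINT u:{s..t}|lborel. \<Sum>x\<in>UNIV. prob (A \<inter> state u x) * rate u x)
    = (LINT u:{s..t}|lborel. (\<Sum>x\<in>UNIV. prob (A \<inter> state u x) * r u x)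
        + ((\<Sum>z\<in>?S. prob (A \<inter> state u (fst z)) * Q u (fst z) (snd z) * mean_pos (G u (fst z) (snd z)))
        + (\<Sum>x\<in>UNIV. prob (A \<inter> state u x) * \<beta> u x * mean_pos (K u x))))"
  proof (rule set_lebesgue_integral_cong)
    show "\<forall>u. u \<in> {s..t} \<longrightarrow> (\<Sum>x\<in>UNIV. prob (A \<inter> state u x) * rate u x) = (\<Sum>x\<in>UNIV. prob (A \<inter> state u x) * r u x)
        + ((\<Sum>z\<in>?S. prob (A \<inter> state u (fst z)) * Q u (fst z) (snd z) * mean_pos (G u (fst z) (snd z)))
        + (\<Sum>x\<in>UNIV. prob (A \<inter> state u x) * \<beta> u x * mean_pos (K u x)))"
    proof (intro allI impI)
      fix u assume "u \<in> {s..t}"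
      then have u: "0 \<le> u" using st by simp
      let ?h = "\<lambda>x y. prob (A \<inter> state u x) * Q u x y * mean_pos (G u x y)"
      \<comment> \<open>Pairs of distinct states are regrouped by their first component, which
        produces the sum in \<open>rate_eq\<close>.\<close>
      have "?S = Sigma UNIV (\<lambda>x. UNIV - {x})" by auto
      then have "(\<Sum>z\<in>?S. ?h (fst z) (snd z)) = (\<Sum>x\<in>UNIV. \<Sum>y\<in>UNIV - {x}. ?h x y)"
        by (simp add: sum.Sigma case_prod_beta')
      then show "(\<Sum>x\<in>UNIV. prob (A \<inter> state u x) * rate u x) = (\<Sum>x\<in>UNIV. prob (A \<inter> state u x) * r u x)
        + ((\<Sum>z\<in>?S. ?h (fst z) (snd z)) + (\<Sum>x\<in>UNIV. prob (A \<inter> state u x) * \<beta> u x * mean_pos (K u x)))"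
        by (simp add: rate_eq[OF u] distrib_left sum.distrib sum_distrib_left mult.assoc)
    qed
  qed simp
  also have "\<dots> = (LINT u:{s..t}|lborel. \<Sum>x\<in>UNIV. prob (A \<inter> state u x) * r u x)
      + ((\<Sum>z\<in>?S. LINT u:{s..t}|lborel. prob (A \<inter> state u (fst z)) * Q u (fst z) (snd z) * mean_pos (G u (fst z) (snd z)))
      + (\<Sum>x\<in>UNIV. LINT u:{s..t}|lborel. prob (A \<inter> state u x) * \<beta> u x * mean_pos (K u x)))"
    using set_integral_add(2)[OF Prs(1)[OF st(1)] set_integral_add(1)[OF Pjs(1) Pns(1)]] set_integral_add(2)[OF Pjs(1) Pns(1)] Pjs(2) Pns(2)
    by simp
  finally show ?thesis unfolding total by simp
qed

section \<open>Measurability of the reward and its filtration\<close>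

text \<open>Every reward in the sum up to u has been earned by s, so it equals its masked version,
  which is measurable; the random number of terms is handled by countability.\<close>

lemma R_measurable_FH:
  assumes u: "0 \<le> u" "u \<le> s"
  shows "R u \<in> borel_measurable (FH s)"
proof -
  have s: "0 \<le> s" using u by simp
  note up = measurable_from_subalg[OF subalgebra_FH_FXN]
  have Jm: "(\<lambda>\<omega>. J u \<omega>) \<in> measurable (FH s) (count_space UNIV)" by (rule up[OF J_measurable[OF u]])
  have Nm: "N u \<in> measurable (FH s) (count_space UNIV)" by (rule up[OF XN_in_FXN(2)[OF u]])
  have random_sum: "(\<lambda>\<omega>. \<Sum>k = 1..f \<omega>. V k \<omega>) \<in> borel_measurable (FH s)"
    if f: "f \<in> measurable (FH s) (count_space UNIV)" and V: "\<And>k. V (Suc k) = lump_val (\<kappa> k)"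
      and hap: "\<And>k \<omega>. \<omega> \<in> space M \<Longrightarrow> Suc k \<le> f \<omega> \<Longrightarrow> lump_happened (\<kappa> k) s \<omega>"
    for f :: "'w \<Rightarrow> nat" and V :: "nat \<Rightarrow> 'w \<Rightarrow> real" and \<kappa> :: "nat \<Rightarrow> lump"
  proof -
    have "(\<lambda>\<omega>. \<Sum>k\<in>{..<f \<omega>}. indicator (lump_done (\<kappa> k) s) \<omega> * lump_val (\<kappa> k) \<omega>) \<in> borel_measurable (FH s)"
      by (rule measurable_compose_countable[OF _ f]) (intro borel_measurable_sum masked_lump_measurable[OF s])
    also have "?this \<longleftrightarrow> ?thesis"
    proof (rule measurable_cong)
      fix \<omega> assume "\<omega> \<in> space (FH s)"
      then have om: "\<omega> \<in> space M" by simp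
      have "(\<Sum>k\<in>{..<f \<omega>}. indicator (lump_done (\<kappa> k) s) \<omega> * lump_val (\<kappa> k) \<omega>) = (\<Sum>k\<in>{..<f \<omega>}. V (Suc k) \<omega>)"
        using hap[OF om] om by (intro sum.cong refl) (auto simp: V lump_done_def)
      also have "\<dots> = (\<Sum>k = 1..f \<omega>. V k \<omega>)"
        by (rule sum.reindex_bij_witness[of _ "\<lambda>k. k - 1" Suc]) auto
      finally show "(\<Sum>k\<in>{..<f \<omega>}. indicator (lump_done (\<kappa> k) s) \<omega> * lump_val (\<kappa> k) \<omega>) = (\<Sum>k = 1..f \<omega>. V k \<omega>)" .
    qed
    finally show ?thesis .
  qed
  have 1: "(\<lambda>\<omega>. \<Sum>k = 1..J u \<omega>. Gr k \<omega>) \<in> borel_measurable (FH s)"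
  proof (rule random_sum[of "\<lambda>\<omega>. J u \<omega>" Gr Jump_lump, OF Jm])
    show "lump_happened (Jump_lump k) s \<omega>" if "\<omega> \<in> space M" "Suc k \<le> J u \<omega>" for k \<omega>
      using that jump_count_mono[OF X_path[OF that(1)] u(2)] by simp
  qed simp
  have 2: "(\<lambda>\<omega>. \<Sum>k = 1..N u \<omega>. Kr k \<omega>) \<in> borel_measurable (FH s)"
  proof (rule random_sum[of "N u" Kr Poisson_lump, OF Nm])
    show "lump_happened (Poisson_lump k) s \<omega>" if "\<omega> \<in> space M" "Suc k \<le> N u \<omega>" for k \<omega>
      using that step_path_mono[OF N_path[OF that(1)] u] by simp
  qed simp
  have 3: "(\<lambda>\<omega>. \<Sum>k = 1..Sup {i. \<tau> i \<le> u}. Hr k \<omega>) \<in> borel_measurable (FH s)"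
  proof (rule random_sum[of "\<lambda>_. Sup {i. \<tau> i \<le> u}" Hr Fixed_lump])
    show "lump_happened (Fixed_lump k) s \<omega>" if "Suc k \<le> Sup {i. \<tau> i \<le> u}" for k \<omega>
      using that le_last_fixed_iff[OF u(1), of "Suc k"] u by simp
  qed simp_all
  have 4: "(\<lambda>\<omega>. LINT v:{0..u}|lborel. r v (X v \<omega>)) \<in> borel_measurable (FH s)"
    by (rule up[OF observed_paths.path_integral_measurable[OF observed_FXN[OF s] r_measurable order.refl u(2)]])
  show ?thesis unfolding cumulative_reward_def[abs_def]
    by (intro borel_measurable_add 1 2 3 4)
qed

definition "FR s = generated_by M (count_space UNIV \<Otimes>\<^sub>M borel) (\<lambda>t \<omega>. (X t \<omega>, R t \<omega>)) {0..s}"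

text \<open>The history of (X, R) lies between that of X and \<open>FH s\<close>, so identities on
  \<open>FH s\<close> restrict to it.\<close>

lemma FR_subalgebra: "subalgebra (FH s) (FR s)" "0 \<le> s \<Longrightarrow> subalgebra M (FR s)" "subalgebra (FR s) (FX s)"
proof -
  have XR: "(\<lambda>\<omega>. (X u \<omega>, R u \<omega>)) \<in> measurable (FH s) (count_space UNIV \<Otimes>\<^sub>M borel)" if "0 \<le> u" "u \<le> s" for u s
    using measurable_from_subalg[OF subalgebra_FH_FXN XN_in_FXN(1)[OF that]] R_measurable_FH[OF that] by (rule measurable_Pair)
  show a: "subalgebra (FH s) (FR s)"
    unfolding FR_def by (rule subalgebra_generated_by) (use XR in auto)
  show "subalgebra M (FR s)" if "0 \<le> s"
    using a subalgebra_FH[OF that] by (auto simp: subalgebra_def)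
  have "(\<lambda>\<omega>. (X u \<omega>, R u \<omega>)) \<in> measurable (FR s) (count_space UNIV \<Otimes>\<^sub>M borel)" if "0 \<le> u" "u \<le> s" for u
    unfolding FR_def by (rule measurable_generated_by) (use that in \<open>auto simp: space_pair_measure\<close>)
  from measurable_compose[OF this measurable_fst]
  have "X u \<in> measurable (FR s) (count_space UNIV)" if "0 \<le> u" "u \<le> s" for u using that by simp
  then show "subalgebra (FR s) (FX s)"
    unfolding FX_def by (intro subalgebra_generated_by) (auto simp: FR_def)
qed

end

section \<open>Integrals over half-lines\<close>

lemma exp_decay_integral:
  fixes \<alpha> :: real
  assumes "0 < \<alpha>"
  shows "set_integrable lborel {0..} (\<lambda>u. exp (- \<alpha> * u))" "(LINT u:{0..}|lborel. exp (- \<alpha> * u)) = 1 / \<alpha>"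
proof -
  have hi: "((\<lambda>u. exp (- \<alpha> * u)) has_integral (1 / \<alpha>)) {0..}"
    using has_integral_exp_minus_to_infinity[OF assms, of 0] by simp
  then have "(\<lambda>u. exp (- \<alpha> * u)) absolutely_integrable_on {0..}"
    by (intro nonnegative_absolutely_integrable_1) (auto simp: integrable_on_def)
  then show I: "set_integrable lborel {0..} (\<lambda>u. exp (- \<alpha> * u))"
    unfolding set_integrable_def by (subst (asm) integrable_completion) auto
  show "(LINT u:{0..}|lborel. exp (- \<alpha> * u)) = 1 / \<alpha>"
    using set_borel_integral_eq_integral(2)[OF I] integral_unique[OF hi] by simp
qed

lemma set_integrable_exp_bound:
  fixes f :: "real \<Rightarrow> real"
  assumes \<alpha>: "0 < \<alpha>" and f: "(\<lambda>u. f (max 0 u)) \<in> borel_measurable borel" "\<And>u. 0 \<le> u \<Longrightarrow> \<bar>f u\<bar> \<le> D * exp (- \<alpha> * u)"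
  shows "set_integrable lborel {0..} f" "\<bar>LINT u:{0..}|lborel. f u\<bar> \<le> D / \<alpha>"
proof -
  have D: "set_integrable lborel {0..} (\<lambda>u. D * exp (- \<alpha> * u))" using exp_decay_integral(1)[OF \<alpha>] by simp
  show I: "set_integrable lborel {0..} f"
    unfolding set_integrable_def
  proof (rule Bochner_Integration.integrable_bound[OF D[unfolded set_integrable_def]])
    have "(\<lambda>u. indicator {0..} u *\<^sub>R f u) = (\<lambda>u. indicator {0..} u *\<^sub>R f (max 0 u))" by (auto simp: indicator_def max_def)
    then show "(\<lambda>u. indicator {0..} u *\<^sub>R f u) \<in> borel_measurable lborel" using f(1) by simp
    have "\<bar>f u\<bar> \<le> \<bar>D * exp (- \<alpha> * u)\<bar>" if "0 \<le> u" for u using f(2)[OF that] by linarith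
    then show "AE u in lborel. norm (indicator {0..} u *\<^sub>R f u) \<le> norm (indicator {0..} u *\<^sub>R (D * exp (- \<alpha> * u)))"
      by (intro AE_I2) (auto simp: indicator_def)
  qed
  have "\<bar>LINT u:{0..}|lborel. f u\<bar> \<le> (LINT u:{0..}|lborel. \<bar>f u\<bar>)"
    using set_integral_norm_bound[OF I] by simp
  also have "\<dots> \<le> (LINT u:{0..}|lborel. D * exp (- \<alpha> * u))"
    by (rule set_integral_mono[OF set_integrable_abs[OF I] D]) (use f(2) in simp)
  also have "\<dots> = D / \<alpha>" using exp_decay_integral(2)[OF \<alpha>] by simp
  finally show "\<bar>LINT u:{0..}|lborel. f u\<bar> \<le> D / \<alpha>" .
qed

lemma set_integral_shift:
  fixes f :: "real \<Rightarrow> real"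
  shows "set_integrable lborel {0..} (\<lambda>u. f (t + u)) \<longleftrightarrow> set_integrable lborel {t..} f"
    and "(LINT u:{0..}|lborel. f (t + u)) = (LINT u:{t..}|lborel. f u)"
proof -
  have e: "indicator {t..} (t + 1 * u) *\<^sub>R f (t + 1 * u) = indicator {0..} u *\<^sub>R f (t + u)" for u
    by (simp add: indicator_def)
  show "set_integrable lborel {0..} (\<lambda>u. f (t + u)) \<longleftrightarrow> set_integrable lborel {t..} f"
    unfolding set_integrable_def
    using lborel_integrable_real_affine_iff[of 1 "\<lambda>u. indicator {t..} u *\<^sub>R f u" t] unfolding e by simp
  show "(LINT u:{0..}|lborel. f (t + u)) = (LINT u:{t..}|lborel. f u)"
    unfolding set_lebesgue_integral_def
    using lborel_integral_real_affine[of 1 "\<lambda>u. indicator {t..} u *\<^sub>R f u" t] unfolding e by simp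
qed

lemma set_integral_split_at:
  fixes f :: "real \<Rightarrow> real"
  assumes "s \<le> t" "set_integrable lborel {s..} f"
  shows "(LINT u:{s..}|lborel. f u) = (LINT u:{s..t}|lborel. f u) + (LINT u:{t..}|lborel. f u)"
proof -
  have "(LINT u:{s..t} \<union> {t..}|lborel. f u) = (LINT u:{s..t}|lborel. f u) + (LINT u:{t..}|lborel. f u)"
  proof (rule set_integral_Un_AE)
    show "AE u in lborel. \<not> (u \<in> {s..t} \<and> u \<in> {t..})" using AE_lborel_singleton[of t] by eventually_elim auto
  qed (use assms in \<open>auto intro: set_integrable_subset\<close>)
  moreover have "{s..t} \<union> {t..} = {s..}" using assms(1) by auto
  ultimately show ?thesis by simp
qed

subsection \<open>The martingale\<close>

lemma has_sum_sum:
  fixes f :: "'i \<Rightarrow> 'j \<Rightarrow> real"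
  assumes "\<And>x. (f x has_sum S x) A"
  shows "((\<lambda>i. \<Sum>x\<in>B. f x i) has_sum (\<Sum>x\<in>B. S x)) A"
  by (induction B rule: infinite_finite_induct) (simp_all add: has_sum_0 has_sum_add[OF assms])

text \<open>Adds the laws \<open>P x\<close> started in x, the constants C and \<alpha> of
  exponential ergodicity, and the minimal spacing a of the deterministic times.\<close>

locale reward_martingale = reward_process_rates M Q p q \<mu> r \<beta> G H K \<tau> X N Gr Hr Kr b c
  for M :: "'w measure" and Q :: "real \<Rightarrow> 's::finite \<Rightarrow> 's \<Rightarrow> real" and p q \<mu> r \<beta> G H K \<tau> X N Gr Hr Kr b c +
  fixes P :: "'s \<Rightarrow> 'w measure" and C \<alpha> a :: real
  assumes P_model: "\<And>x. reward_process_rates (P x) Q p q (return_pmf x) r \<beta> G H K \<tau> X N Gr Hr Kr b c"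
    and \<alpha>_pos: "0 < \<alpha>" and C_nonneg: "0 \<le> C"
    and ergodic_bound: "\<And>s t x x' f B. 0 \<le> s \<Longrightarrow> s \<le> t \<Longrightarrow> (\<And>y. \<bar>f y\<bar> \<le> B) \<Longrightarrow>
       \<bar>(\<Sum>y\<in>UNIV. p s t x y * f y) - (\<Sum>y\<in>UNIV. p s t x' y * f y)\<bar> \<le> C * B * exp (- \<alpha> * (t - s))"
    and a_pos: "0 < a" and separated: "\<And>i. a \<le> \<tau> (Suc i) - \<tau> i"
begin

definition "rate_c u x = rate u x - (\<Sum>y\<in>UNIV. prob (state u y) * rate u y)"
definition "fixed_c i x = fixed_mean i x - (\<Sum>y\<in>UNIV. prob (state (\<tau> i) y) * fixed_mean i y)"
definition "nu_rate t x u = (\<Sum>y\<in>UNIV. p t (t + u) x y * rate_c (t + u) y)"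
definition "nu_fixed t x i = (\<Sum>y\<in>UNIV. p t (\<tau> i) x y * fixed_c i y)"
abbreviation "NU \<equiv> nu_fun M P Q r \<beta> G H K \<tau> X Hr"

lemma state_sum_1: "0 \<le> t \<Longrightarrow> (\<Sum>x\<in>UNIV. prob (state t x)) = 1"
  using prob_split_state[of "space M" t] by (simp add: prob_space state_def Int_def)

text \<open>An average over the state at t of transition probabilities to time v is an average over
  the state at v: the intermediate time t disappears. This removes t from the terms of \<nu>,
  leaving it only in the range of integration and summation.\<close>

lemma state_transport:
  assumes su: "0 \<le> s" "s \<le> t" "t \<le> v" and A: "A \<in> sets (FH s)"
  shows "(\<Sum>x\<in>UNIV. prob (A \<inter> state t x) * (\<Sum>y\<in>UNIV. p t v x y * h y)) = (\<Sum>y\<in>UNIV. prob (A \<inter> state v y) * h y)"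
proof -
  have t: "0 \<le> t" and v: "0 \<le> v" using su by auto
  have AM: "A \<in> events" using FH_events[OF su(1) A] .
  have "(\<Sum>x\<in>UNIV. prob (A \<inter> state t x) * (\<Sum>y\<in>UNIV. p t v x y * h y)) = (\<Sum>x\<in>UNIV. \<Sum>y\<in>UNIV. prob (A \<inter> state t x \<inter> state v y) * h y)"
    unfolding markov_FH[OF su A] by (simp add: sum_distrib_left mult.assoc)
  also have "\<dots> = (\<Sum>y\<in>UNIV. \<Sum>x\<in>UNIV. prob (A \<inter> state t x \<inter> state v y) * h y)" by (rule sum.swap)
  also have "\<dots> = (\<Sum>y\<in>UNIV. prob (A \<inter> state v y) * h y)"
  proof (rule sum.cong[OF refl])
    fix y
    have "prob (A \<inter> state v y) = (\<Sum>x\<in>UNIV. prob (A \<inter> state v y \<inter> state t x))"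
      by (rule prob_split_state[OF sets.Int[OF AM state_events[OF v]] t])
    also have "\<dots> = (\<Sum>x\<in>UNIV. prob (A \<inter> state t x \<inter> state v y))" by (simp add: Int_ac)
    finally show "(\<Sum>x\<in>UNIV. prob (A \<inter> state t x \<inter> state v y) * h y) = prob (A \<inter> state v y) * h y"
      by (simp add: sum_distrib_right)
  qed
  finally show ?thesis .
qed

lemma space_state [simp]: "space M \<inter> state t x = state t x"
  by (auto simp: state_def)

text \<open>The centring constant is itself an average, over the state at t, of averages under the
  kernel from t to v. The centred average is thus a mixture of differences between two starting
  states, to which \<open>ergodic_bound\<close> applies.\<close>

lemma centered_average_bound:
  assumes tv: "0 \<le> t" "t \<le> v" and h: "\<And>y. \<bar>h y\<bar> \<le> B"
  shows "\<bar>\<Sum>y\<in>UNIV. p t v x y * (h y - (\<Sum>y\<in>UNIV. prob (state v y) * h y))\<bar> \<le> C * B * exp (- \<alpha> * (v - t))"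
proof -
  define g where "g x = (\<Sum>y\<in>UNIV. p t v x y * h y)" for x
  have SF: "space M \<in> sets (FH t)" using sets.top[of "FH t"] by simp
  have mean: "(\<Sum>y\<in>UNIV. prob (state v y) * h y) = (\<Sum>z\<in>UNIV. prob (state t z) * g z)"
    using state_transport[OF tv(1) order.refl tv(2) SF, of h] by (simp add: g_def)
  have "(\<Sum>y\<in>UNIV. p t v x y * (h y - (\<Sum>y\<in>UNIV. prob (state v y) * h y))) = g x - (\<Sum>z\<in>UNIV. prob (state t z) * g z)"
    unfolding mean using p_sum[OF tv, of x] by (simp add: g_def right_diff_distrib sum_subtractf sum_distrib_right[symmetric])
  also have "\<dots> = (\<Sum>z\<in>UNIV. prob (state t z) * (g x - g z))"
    using state_sum_1[OF tv(1)] by (simp add: right_diff_distrib sum_subtractf sum_distrib_right[symmetric])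
  also have "\<bar>\<dots>\<bar> \<le> (\<Sum>z\<in>UNIV. \<bar>prob (state t z) * (g x - g z)\<bar>)" by (rule sum_abs)
  also have "\<dots> \<le> (\<Sum>z\<in>UNIV. prob (state t z) * (C * B * exp (- \<alpha> * (v - t))))"
    unfolding abs_mult g_def using ergodic_bound[OF tv h] by (intro sum_mono mult_mono) auto
  also have "\<dots> = C * B * exp (- \<alpha> * (v - t))" unfolding sum_distrib_right[symmetric] state_sum_1[OF tv(1)] by simp
  finally show ?thesis .
qed

lemma nu_rate_bound: "0 \<le> t \<Longrightarrow> 0 \<le> u \<Longrightarrow> \<bar>nu_rate t x u\<bar> \<le> C * rate_max * exp (- \<alpha> * u)"
  using centered_average_bound[of t "t + u" "rate (t + u)" rate_max x] rate_bound[of "t + u"]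
  by (simp add: nu_rate_def rate_c_def)

lemma nu_fixed_bound: "0 \<le> t \<Longrightarrow> t < \<tau> i \<Longrightarrow> \<bar>nu_fixed t x i\<bar> \<le> C * c * exp (- \<alpha> * (\<tau> i - t))"
  using centered_average_bound[of t "\<tau> i" "fixed_mean i" "real c" x] mean_bounds(2)[of "\<tau> i"]
  by (simp add: nu_fixed_def fixed_c_def fixed_mean_def)

lemma rate_c_measurable: "(\<lambda>u. rate_c (max 0 u) x) \<in> borel_measurable borel"
proof -
  have "(\<lambda>u. prob (state (max 0 u) y)) \<in> borel_measurable borel" for y
    using state_prob_measurable[OF sets.top, of y] by simp
  then show ?thesis unfolding rate_c_def
    by (intro borel_measurable_diff borel_measurable_sum borel_measurable_times rate_measurable)
qed

lemma nu_rate_measurable: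
  assumes t: "0 \<le> t"
  shows "(\<lambda>u. nu_rate t x (max 0 u)) \<in> borel_measurable borel"
proof -
  have "(\<lambda>u. \<Sum>y\<in>UNIV. p t (max t (t + u)) x y * rate_c (max 0 (t + max 0 u)) y) \<in> borel_measurable borel"
    by (intro borel_measurable_sum borel_measurable_times measurable_compose[OF _ p_measurable[OF t]] measurable_compose[OF _ rate_c_measurable]) auto
  moreover have "max t (t + u) = t + max 0 u" "max 0 (t + max 0 u) = t + max 0 u" for u using t by auto
  ultimately show ?thesis by (simp add: nu_rate_def)
qed

lemma expectation_state:
  assumes A: "A \<in> events" and u: "0 \<le> u"
  shows "integrable M (\<lambda>\<omega>. indicator A \<omega> * h (X u \<omega>))" "(LINT \<omega>|M. indicator A \<omega> * h (X u \<omega>)) = (\<Sum>y\<in>UNIV. prob (A \<inter> state u y) * h y)"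
proof -
  have e: "indicator A \<omega> * h (X u \<omega>) = (\<Sum>y\<in>UNIV. indicator (A \<inter> state u y) \<omega> * h y)" if "\<omega> \<in> space M" for \<omega>
    unfolding state_indicator_sum[OF that, of u h, symmetric] by (simp only: sum_distrib_left indicator_inter_arith mult.assoc)
  have i: "integrable M (\<lambda>\<omega>. indicator (A \<inter> state u y) \<omega> * h y)" for y
    using sets.Int[OF A state_events[OF u]] by (intro integrable_mult_left integrable_real_indicator) (auto simp: less_top[symmetric])
  show "integrable M (\<lambda>\<omega>. indicator A \<omega> * h (X u \<omega>))"
    using Bochner_Integration.integrable_sum[of UNIV M "\<lambda>y \<omega>. indicator (A \<inter> state u y) \<omega> * h y", OF i]
    by (rule Bochner_Integration.integrable_cong[THEN iffD1, rotated 2]) (simp_all add: e)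
  have "(LINT \<omega>|M. indicator A \<omega> * h (X u \<omega>)) = (LINT \<omega>|M. (\<Sum>y\<in>UNIV. indicator (A \<inter> state u y) \<omega> * h y))"
    by (rule Bochner_Integration.integral_cong[OF refl e])
  also have "\<dots> = (\<Sum>y\<in>UNIV. LINT \<omega>|M. indicator (A \<inter> state u y) \<omega> * h y)" by (rule Bochner_Integration.integral_sum[OF i])
  also have "\<dots> = (\<Sum>y\<in>UNIV. prob (A \<inter> state u y) * h y)"
    by (intro sum.cong refl) (simp add: Int_absorb2 state_def Int_assoc)
  finally show "(LINT \<omega>|M. indicator A \<omega> * h (X u \<omega>)) = (\<Sum>y\<in>UNIV. prob (A \<inter> state u y) * h y)" .
qed

end

lemma (in reward_process_rates) expectation_state_fun:
  assumes u: "0 \<le> u"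
  shows "(LINT \<omega>|M. h (X u \<omega>)) = (\<Sum>y\<in>UNIV. prob (state u y) * h y)"
proof -
  have i: "integrable M (\<lambda>\<omega>. indicator (state u y) \<omega> * h y)" for y
    using state_events[OF u] by (intro integrable_mult_left integrable_real_indicator) (auto simp: less_top[symmetric])
  have "(LINT \<omega>|M. h (X u \<omega>)) = (LINT \<omega>|M. (\<Sum>y\<in>UNIV. indicator (state u y) \<omega> * h y))"
    by (rule Bochner_Integration.integral_cong[OF refl]) (simp only: state_indicator_sum)
  also have "\<dots> = (\<Sum>y\<in>UNIV. LINT \<omega>|M. indicator (state u y) \<omega> * h y)" by (rule Bochner_Integration.integral_sum[OF i])
  also have "\<dots> = (\<Sum>y\<in>UNIV. prob (state u y) * h y)"
    by (intro sum.cong refl) (simp add: Int_absorb2 state_def)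
  finally show ?thesis .
qed

lemma (in reward_process_rates) expectation_fixed:
  assumes i: "0 < \<tau> i"
  shows "integrable M (Hr i)" "(LINT \<omega>|M. Hr i \<omega>) = (\<Sum>x\<in>UNIV. prob (state (\<tau> i) x) * fixed_mean i x)"
proof -
  have S: "space M \<in> sets (FH 0)" using sets.top[of "FH 0"] by simp
  have Sx: "space M \<inter> state u x = state u x" for u x by (auto simp: state_def)
  show "integrable M (Hr i)"
    using fixed_reward_integral(1)[OF order.refl i S]
    by (rule Bochner_Integration.integrable_cong[THEN iffD1, rotated 2]) auto
  have "(LINT \<omega>|M. Hr i \<omega>) = (LINT \<omega>|M. indicator (space M) \<omega> * Hr i \<omega>)"
    by (rule Bochner_Integration.integral_cong) auto
  then show "(LINT \<omega>|M. Hr i \<omega>) = (\<Sum>x\<in>UNIV. prob (state (\<tau> i) x) * fixed_mean i x)"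
    using fixed_reward_integral(2)[OF order.refl i S] by (simp add: Sx)
qed

context reward_martingale
begin

text \<open>In states that are not charged at time \<open>t > 0\<close>, \<open>expectation_at\<close> divides by 0, so that \<open>\<nu>\<close> vanishes there.\<close>

definition "charged t x \<longleftrightarrow> t = 0 \<or> prob (state t x) \<noteq> 0"

lemma state_set: "{\<omega>\<in>space M. X t \<omega> = x} = state t x"
  by (simp add: state_def)

lemma centered_rate_eq: "0 \<le> u \<Longrightarrow> centered_rate M Q r \<beta> G K X u x = rate_c u x"
  unfolding centered_rate_def Let_def rate_c_def rate_def[symmetric] by (simp add: expectation_state_fun)

lemma centered_lump_eq:
  "0 < \<tau> i \<Longrightarrow> centered_lump M H \<tau> X Hr i \<omega> = Hr i \<omega> - (\<Sum>y\<in>UNIV. prob (state (\<tau> i) y) * fixed_mean i y)"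
  unfolding centered_lump_def fixed_mean_def[symmetric] by (simp add: expectation_state_fun)

lemma state_FH: "0 \<le> t \<Longrightarrow> state t x \<in> sets (FH t)"
  using sets_subalgebra[OF subalgebra_FH_FXN sets_subalgebra[OF subalgebras(5) state_FX[OF _ order.refl]]] .

lemma nu_integrand_eq:
  assumes t: "0 \<le> t" and u: "0 \<le> u"
  shows "nu_integrand M P Q r \<beta> G K X t x u = (if charged t x then nu_rate t x u else 0)"
proof -
  have tu: "0 \<le> t + u" using t u by simp
  show ?thesis
  proof (cases "t = 0")
    case True
    interpret Px: reward_process_rates "P x" Q p q "return_pmf x" r \<beta> G H K \<tau> X N Gr Hr Kr b c by (rule P_model)
    \<comment> \<open>Under \<open>P x\<close> the initial law is the point mass at x, so the
      marginals are rows of p(0, u).\<close>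
    have "Px.prob (Px.state u y) = p 0 u x y" for y
      using Px.prob_state[OF u, of y] by (simp add: of_bool_def if_distrib[of "\<lambda>a. a * _"] pmf_return cong: if_cong)
    then show ?thesis
      using Px.expectation_state_fun[OF u, of "rate_c u"] u
      by (simp add: True nu_integrand_def expectation_at_def centered_rate_eq charged_def nu_rate_def)
  next
    case False
    have "nu_integrand M P Q r \<beta> G K X t x u = (LINT \<omega>|M. indicator (state t x) \<omega> * rate_c (t + u) (X (t + u) \<omega>)) / prob (state t x)"
      using False tu by (simp add: nu_integrand_def expectation_at_def centered_rate_eq state_set set_lebesgue_integral_def)
    also have "\<dots> = (\<Sum>y\<in>UNIV. prob (state t x \<inter> state (t + u) y) * rate_c (t + u) y) / prob (state t x)"
      using expectation_state(2)[OF state_events[OF t] tu] by simp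
    also have "\<dots> = (prob (state t x) * nu_rate t x u) / prob (state t x)"
      using markov_state[OF t, of "t + u"] u by (simp add: nu_rate_def sum_distrib_left mult.assoc)
    finally show ?thesis using False by (simp add: charged_def)
  qed
qed

text \<open>The reward at \<tau> i lies after t, so conditionally on the state at t it may be
  replaced by its mean given the state at \<tau> i.\<close>

lemma nu_summand_eq:
  assumes t: "0 \<le> t" and i: "t < \<tau> i"
  shows "nu_summand M P H \<tau> X Hr t x i = (if charged t x then nu_fixed t x i else 0)"
proof -
  have ti: "0 < \<tau> i" "t \<le> \<tau> i" using t i by auto
  let ?m = "\<Sum>y\<in>UNIV. prob (state (\<tau> i) y) * fixed_mean i y"
  have nf: "nu_fixed t x i = (\<Sum>y\<in>UNIV. p t (\<tau> i) x y * fixed_mean i y) - ?m"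
    using p_sum[OF t ti(2), of x]
    by (simp add: nu_fixed_def fixed_c_def right_diff_distrib sum_subtractf sum_distrib_right[symmetric])
  show ?thesis
  proof (cases "t = 0")
    case True
    interpret Px: reward_process_rates "P x" Q p q "return_pmf x" r \<beta> G H K \<tau> X N Gr Hr Kr b c by (rule P_model)
    have ps: "Px.prob (Px.state (\<tau> i) y) = p 0 (\<tau> i) x y" for y
      using Px.prob_state[of "\<tau> i" y] ti by (simp add: of_bool_def if_distrib[of "\<lambda>a. a * _"] pmf_return cong: if_cong)
    have cl: "centered_lump M H \<tau> X Hr i = (\<lambda>\<omega>. Hr i \<omega> - ?m)"
      by (rule ext) (rule centered_lump_eq[OF ti(1)])
    have "Px.expectation (\<lambda>\<omega>. Hr i \<omega> - ?m) = (\<Sum>y\<in>UNIV. p 0 (\<tau> i) x y * fixed_mean i y) - ?m"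
      using Px.expectation_fixed[OF ti(1)] by (simp add: ps Px.fixed_mean_def fixed_mean_def Px.prob_space)
    then show ?thesis using nf ti
      by (simp add: True nu_summand_def expectation_at_def cl charged_def)
  next
    case False
    have iI: "integrable M (\<lambda>\<omega>. indicator (state t x) \<omega> * ?m)"
      using state_events[OF t] by (intro integrable_mult_left integrable_real_indicator) (auto simp: less_top[symmetric])
    have "nu_summand M P H \<tau> X Hr t x i = (LINT \<omega>|M. indicator (state t x) \<omega> * Hr i \<omega> - indicator (state t x) \<omega> * ?m) / prob (state t x)"
      using False ti by (simp add: nu_summand_def expectation_at_def centered_lump_eq state_set set_lebesgue_integral_def right_diff_distrib)
    also have "(LINT \<omega>|M. indicator (state t x) \<omega> * Hr i \<omega> - indicator (state t x) \<omega> * ?m)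
       = (\<Sum>y\<in>UNIV. prob (state t x \<inter> state (\<tau> i) y) * fixed_mean i y) - prob (state t x) * ?m"
      using fixed_reward_integral[OF t i state_FH[OF t], of x] iI by (simp add: Int_commute)
    also have "\<dots> = prob (state t x) * nu_fixed t x i"
      unfolding nf using markov_state[OF t ti(2)] by (simp add: sum_distrib_left mult.assoc right_diff_distrib)
    finally show ?thesis using False by (simp add: charged_def)
  qed
qed

lemma nu_integrable:
  assumes t: "0 \<le> t"
  shows "set_integrable lborel {0..} (nu_rate t x)" "\<bar>LINT u:{0..}|lborel. nu_rate t x u\<bar> \<le> C * rate_max / \<alpha>"
    "nu_fixed t x summable_on {i. t < \<tau> i}" "\<bar>\<Sum>\<^sub>\<infinity>i\<in>{i. t < \<tau> i}. nu_fixed t x i\<bar> \<le> C * c / (1 - exp (- \<alpha> * a))"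
  using set_integrable_exp_bound[OF \<alpha>_pos nu_rate_measurable[OF t] nu_rate_bound[OF t]]
    sum_exp_separated[OF \<tau>_mono \<tau>_lim a_pos separated \<alpha>_pos nu_fixed_bound[OF t]] C_nonneg by auto

text \<open>Besides a bound uniform in t and x, this records that the integral and the sum in \<nu>
  converge; without that their values would be mere defaults.\<close>

lemma NU_eq:
  assumes t: "0 \<le> t"
  shows "set_integrable lborel {0..} (nu_integrand M P Q r \<beta> G K X t x)"
    and "nu_summand M P H \<tau> X Hr t x summable_on {i. t < \<tau> i}"
    and "charged t x \<Longrightarrow> NU t x = (LINT u:{0..}|lborel. nu_rate t x u) + (\<Sum>\<^sub>\<infinity>i\<in>{i. t < \<tau> i}. nu_fixed t x i)"
    and "\<bar>NU t x\<bar> \<le> C * rate_max / \<alpha> + C * c / (1 - exp (- \<alpha> * a))"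
proof -
  have I: "set_integrable lborel {0..} (nu_integrand M P Q r \<beta> G K X t x) \<longleftrightarrow> set_integrable lborel {0..} (\<lambda>u. if charged t x then nu_rate t x u else 0)"
    by (rule set_integrable_cong) (simp_all add: nu_integrand_eq[OF t])
  then show "set_integrable lborel {0..} (nu_integrand M P Q r \<beta> G K X t x)"
    using nu_integrable(1)[OF t, of x] by (cases "charged t x") (auto simp: set_integrable_def)
  have S: "nu_summand M P H \<tau> X Hr t x summable_on {i. t < \<tau> i} \<longleftrightarrow> (\<lambda>i. if charged t x then nu_fixed t x i else 0) summable_on {i. t < \<tau> i}"
    by (rule summable_on_cong) (simp add: nu_summand_eq[OF t])
  then show "nu_summand M P H \<tau> X Hr t x summable_on {i. t < \<tau> i}"
    using nu_integrable(3)[OF t, of x] by (cases "charged t x") auto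
  have N: "NU t x = (LINT u:{0..}|lborel. if charged t x then nu_rate t x u else 0) + (\<Sum>\<^sub>\<infinity>i\<in>{i. t < \<tau> i}. if charged t x then nu_fixed t x i else 0)"
    unfolding nu_fun_def
    by (intro arg_cong2[where f="(+)"] set_lebesgue_integral_cong infsum_cong) (auto simp: nu_integrand_eq[OF t] nu_summand_eq[OF t])
  then show ch: "charged t x \<Longrightarrow> NU t x = (LINT u:{0..}|lborel. nu_rate t x u) + (\<Sum>\<^sub>\<infinity>i\<in>{i. t < \<tau> i}. nu_fixed t x i)"
    by simp
  have e1: "exp (- \<alpha> * a) < 1" using \<alpha>_pos a_pos by simp
  show "\<bar>NU t x\<bar> \<le> C * rate_max / \<alpha> + C * c / (1 - exp (- \<alpha> * a))"
  proof (cases "charged t x")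
    case True
    then show ?thesis using ch nu_integrable(2,4)[OF t, of x] by linarith
  next
    case False
    then have "NU t x = 0" using N by (simp add: set_lebesgue_integral_def)
    moreover have "0 \<le> C * rate_max / \<alpha>" using nu_integrable(2)[OF t, of x] by linarith
    moreover have "0 \<le> C * c / (1 - exp (- \<alpha> * a))" using nu_integrable(4)[OF t, of x] by linarith
    ultimately show ?thesis by linarith
  qed
qed

text \<open>Neither \<Theta> nor \<Xi> depends on t, which occurs only as the lower end of the
  tail.\<close>

lemma NU_integral:
  assumes st: "0 \<le> s" "s \<le> t" and A: "A \<in> sets (FH s)"
  defines "\<Theta> \<equiv> \<lambda>u. \<Sum>x\<in>UNIV. prob (A \<inter> state u x) * rate_c u x"
    and "\<Xi> \<equiv> \<lambda>i. \<Sum>x\<in>UNIV. prob (A \<inter> state (\<tau> i) x) * fixed_c i x"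
  shows "set_integrable lborel {t..} \<Theta>" "\<Xi> summable_on {i. t < \<tau> i}"
    "(LINT \<omega>|M. indicator A \<omega> * NU t (X t \<omega>)) = (LINT u:{t..}|lborel. \<Theta> u) + (\<Sum>\<^sub>\<infinity>i\<in>{i. t < \<tau> i}. \<Xi> i)"
proof -
  have t: "0 \<le> t" using st by simp
  have AM: "A \<in> events" using FH_events[OF st(1) A] .
  let ?P = "\<lambda>x. prob (A \<inter> state t x)"
  have Th: "(\<Sum>x\<in>UNIV. ?P x * nu_rate t x u) = \<Theta> (t + u)" if "0 \<le> u" for u
    unfolding nu_rate_def \<Theta>_def by (rule state_transport[OF st _ A]) (use that in simp)
  have Xi: "(\<Sum>x\<in>UNIV. ?P x * nu_fixed t x i) = \<Xi> i" if "t < \<tau> i" for i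
    unfolding nu_fixed_def \<Xi>_def by (rule state_transport[OF st _ A]) (use that in simp)
  have iP: "set_integrable lborel {0..} (\<lambda>u. ?P x * nu_rate t x u)" for x using nu_integrable(1)[OF t] by simp
  note sP = set_integral_sum_finite[of UNIV lborel "{0..}" "\<lambda>x u. ?P x * nu_rate t x u", OF iP]
  have "set_integrable lborel {0..} (\<lambda>u. \<Theta> (t + u))"
    using sP(1) by (rule set_integrable_cong[THEN iffD1, rotated -1]) (simp_all add: Th)
  then show "set_integrable lborel {t..} \<Theta>" by (simp add: set_integral_shift(1))
  have I: "(\<Sum>x\<in>UNIV. ?P x * (LINT u:{0..}|lborel. nu_rate t x u)) = (LINT u:{t..}|lborel. \<Theta> u)"
  proof -
    have "(\<Sum>x\<in>UNIV. ?P x * (LINT u:{0..}|lborel. nu_rate t x u)) = (LINT u:{0..}|lborel. \<Sum>x\<in>UNIV. ?P x * nu_rate t x u)"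
      using sP(2) by simp
    also have "\<dots> = (LINT u:{0..}|lborel. \<Theta> (t + u))"
      by (rule set_lebesgue_integral_cong) (auto simp: Th)
    finally show ?thesis by (simp add: set_integral_shift(2))
  qed
  have hs: "((\<lambda>i. \<Sum>x\<in>UNIV. ?P x * nu_fixed t x i) has_sum (\<Sum>x\<in>UNIV. ?P x * (\<Sum>\<^sub>\<infinity>i\<in>{i. t < \<tau> i}. nu_fixed t x i))) {i. t < \<tau> i}"
    by (intro has_sum_sum has_sum_cmult_right has_sum_infsum nu_integrable(3)[OF t])
  have hs': "(\<Xi> has_sum (\<Sum>x\<in>UNIV. ?P x * (\<Sum>\<^sub>\<infinity>i\<in>{i. t < \<tau> i}. nu_fixed t x i))) {i. t < \<tau> i}"
    using hs by (rule has_sum_cong[THEN iffD1, rotated]) (simp add: Xi)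
  then show "\<Xi> summable_on {i. t < \<tau> i}" by (rule has_sum_imp_summable)
  have "(LINT \<omega>|M. indicator A \<omega> * NU t (X t \<omega>)) = (\<Sum>x\<in>UNIV. ?P x * NU t x)"
    by (rule expectation_state(2)[OF AM t])
  also have "\<dots> = (\<Sum>x\<in>UNIV. ?P x * ((LINT u:{0..}|lborel. nu_rate t x u) + (\<Sum>\<^sub>\<infinity>i\<in>{i. t < \<tau> i}. nu_fixed t x i)))"
  proof (rule sum.cong[OF refl])
    fix x
    show "?P x * NU t x = ?P x * ((LINT u:{0..}|lborel. nu_rate t x u) + (\<Sum>\<^sub>\<infinity>i\<in>{i. t < \<tau> i}. nu_fixed t x i))"
    proof (cases "charged t x")
      case True
      then show ?thesis by (simp add: NU_eq(3)[OF t])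
    next
      case False
      \<comment> \<open>A state with probability 0 has weight 0, so the default value of \<nu> in
        such states has no effect.\<close>
      have "?P x \<le> prob (state t x)" by (rule finite_measure_mono) (use state_events[OF t] in auto)
      then have "?P x = 0" using False by (simp add: charged_def antisym)
      then show ?thesis by simp
    qed
  qed
  also have "\<dots> = (LINT u:{t..}|lborel. \<Theta> u) + (\<Sum>\<^sub>\<infinity>i\<in>{i. t < \<tau> i}. \<Xi> i)"
    using I infsumI[OF hs'] by (simp add: distrib_left sum.distrib)
  finally show "(LINT \<omega>|M. indicator A \<omega> * NU t (X t \<omega>)) = (LINT u:{t..}|lborel. \<Theta> u) + (\<Sum>\<^sub>\<infinity>i\<in>{i. t < \<tau> i}. \<Xi> i)" .
qed

definition "Z t \<omega> = R t \<omega> - (LINT \<omega>'|M. R t \<omega>') + NU t (X t \<omega>)"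

lemma integrable_Z:
  assumes t: "0 \<le> t"
  shows "integrable M (Z t)"
proof -
  have "integrable M (\<lambda>\<omega>. indicator (space M) \<omega> * NU t (X t \<omega>))" by (rule expectation_state(1)[OF sets.top t])
  then have "integrable M (\<lambda>\<omega>. NU t (X t \<omega>))"
    by (rule Bochner_Integration.integrable_cong[THEN iffD1, rotated 2]) auto
  then show ?thesis unfolding Z_def[abs_def] using integrable_R[OF t] by simp
qed

text \<open>The increment of R, centred by P(A) times its mean, is the integral of \<Theta> over
  [s, t] plus the terms \<Xi> i for deterministic times in (s, t]; this is exactly what the tail in
  \<open>NU_integral\<close> loses when its lower end moves from s to t.\<close>

lemma Z_increment:
  assumes st: "0 \<le> s" "s \<le> t" and A: "A \<in> sets (FH s)"
  shows "(LINT \<omega>:A|M. Z t \<omega>) = (LINT \<omega>:A|M. Z s \<omega>)"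
proof -
  have t: "0 \<le> t" using st by simp
  have AM: "A \<in> events" using FH_events[OF st(1) A] .
  have SF: "space M \<in> sets (FH s)" using sets.top[of "FH s"] by simp
  let ?\<Theta> = "\<lambda>u. \<Sum>x\<in>UNIV. prob (A \<inter> state u x) * rate_c u x"
  let ?\<Xi> = "\<lambda>i. \<Sum>x\<in>UNIV. prob (A \<inter> state (\<tau> i) x) * fixed_c i x"
  let ?F = "{i. s < \<tau> i \<and> \<tau> i \<le> t}"
  define \<delta> where "\<delta> = (LINT \<omega>|M. R t \<omega>) - (LINT \<omega>|M. R s \<omega>)"
  have iR: "integrable M (\<lambda>\<omega>. indicator A \<omega> * R v \<omega>)" if "0 \<le> v" for v
    using integrable_mult_indicator[OF AM integrable_R[OF that]] by simp
  have iN: "integrable M (\<lambda>\<omega>. indicator A \<omega> * NU v (X v \<omega>))" if "0 \<le> v" for v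
    by (rule expectation_state(1)[OF AM that])
  have ZA: "(LINT \<omega>:A|M. Z v \<omega>) = (LINT \<omega>|M. indicator A \<omega> * R v \<omega>) - prob A * (LINT \<omega>|M. R v \<omega>) + (LINT \<omega>|M. indicator A \<omega> * NU v (X v \<omega>))"
    if v: "0 \<le> v" for v
  proof -
    have iE: "integrable M (\<lambda>\<omega>. indicator A \<omega> * (LINT \<omega>'|M. R v \<omega>'))"
      using AM by (intro integrable_mult_left integrable_real_indicator) (auto simp: less_top[symmetric])
    have "(LINT \<omega>:A|M. Z v \<omega>) = (LINT \<omega>|M. indicator A \<omega> * R v \<omega> - indicator A \<omega> * (LINT \<omega>'|M. R v \<omega>') + indicator A \<omega> * NU v (X v \<omega>))"
      unfolding set_lebesgue_integral_def Z_def by (intro Bochner_Integration.integral_cong) (auto simp: algebra_simps)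
    also have "\<dots> = (LINT \<omega>|M. indicator A \<omega> * R v \<omega>) - (LINT \<omega>|M. indicator A \<omega> * (LINT \<omega>'|M. R v \<omega>')) + (LINT \<omega>|M. indicator A \<omega> * NU v (X v \<omega>))"
      using iR[OF v] iE iN[OF v] by simp
    also have "(LINT \<omega>|M. indicator A \<omega> * (LINT \<omega>'|M. R v \<omega>')) = prob A * (LINT \<omega>|M. R v \<omega>)"
      using sets.sets_into_space[OF AM] by (simp add: Int_absorb2)
    finally show ?thesis .
  qed
  have dA: "(LINT \<omega>|M. indicator A \<omega> * R t \<omega>) - (LINT \<omega>|M. indicator A \<omega> * R s \<omega>)
     = (LINT u:{s..t}|lborel. \<Sum>x\<in>UNIV. prob (A \<inter> state u x) * rate u x) + (\<Sum>i\<in>?F. \<Sum>x\<in>UNIV. prob (A \<inter> state (\<tau> i) x) * fixed_mean i x)"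
    using R_increment_integral[OF st A] iR[OF t] iR[OF st(1)] by (simp add: right_diff_distrib)
  have dS: "\<delta> = (LINT u:{s..t}|lborel. \<Sum>x\<in>UNIV. prob (state u x) * rate u x) + (\<Sum>i\<in>?F. \<Sum>x\<in>UNIV. prob (state (\<tau> i) x) * fixed_mean i x)"
  proof -
    have "(LINT \<omega>|M. indicator (space M) \<omega> * (R t \<omega> - R s \<omega>)) = (LINT \<omega>|M. R t \<omega> - R s \<omega>)"
      by (rule Bochner_Integration.integral_cong) auto
    then show ?thesis using R_increment_integral[OF st SF] integrable_R[OF t] integrable_R[OF st(1)] by (simp add: \<delta>_def)
  qed
  \<comment> \<open>The probabilities of A and X u = x add up to P(A), so subtracting P(A) m amounts
    to subtracting m in every state.\<close>
  have center: "(\<Sum>x\<in>UNIV. prob (A \<inter> state u x) * h x) - prob A * m = (\<Sum>x\<in>UNIV. prob (A \<inter> state u x) * (h x - m))" if "0 \<le> u" for u h m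
    using prob_split_state[OF AM that] by (simp add: right_diff_distrib sum_subtractf sum_distrib_right[symmetric])
  have Pi: "set_integrable lborel {s..t} (\<lambda>u. prob (B \<inter> state u x) * rate u x)" if "B \<in> events" for B x
    by (rule set_integrable_state_product[OF that rate_measurable rate_bound st(1)])
  note PA = set_integral_sum_finite(1)[of UNIV lborel "{s..t}" "\<lambda>x u. prob (B \<inter> state u x) * rate u x" for B, OF Pi]
  have iS: "set_integrable lborel {s..t} (\<lambda>u. prob A * (\<Sum>x\<in>UNIV. prob (state u x) * rate u x))"
    using PA[OF sets.top] by simp
  have rates: "(LINT u:{s..t}|lborel. \<Sum>x\<in>UNIV. prob (A \<inter> state u x) * rate u x) - prob A * (LINT u:{s..t}|lborel. \<Sum>x\<in>UNIV. prob (state u x) * rate u x)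
     = (LINT u:{s..t}|lborel. ?\<Theta> u)"
  proof -
    have "(LINT u:{s..t}|lborel. ?\<Theta> u) = (LINT u:{s..t}|lborel. (\<Sum>x\<in>UNIV. prob (A \<inter> state u x) * rate u x) - prob A * (\<Sum>x\<in>UNIV. prob (state u x) * rate u x))"
      by (rule set_lebesgue_integral_cong) (use st in \<open>auto simp: center rate_c_def\<close>)
    then show ?thesis using set_integral_diff(2)[OF PA[OF AM] iS] by simp
  qed
  have fixeds: "(\<Sum>i\<in>?F. \<Sum>x\<in>UNIV. prob (A \<inter> state (\<tau> i) x) * fixed_mean i x) - prob A * (\<Sum>i\<in>?F. \<Sum>x\<in>UNIV. prob (state (\<tau> i) x) * fixed_mean i x)
     = (\<Sum>i\<in>?F. ?\<Xi> i)"
  proof -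
    have "?\<Xi> i = (\<Sum>x\<in>UNIV. prob (A \<inter> state (\<tau> i) x) * fixed_mean i x) - prob A * (\<Sum>x\<in>UNIV. prob (state (\<tau> i) x) * fixed_mean i x)"
      if "i \<in> ?F" for i
    proof -
      have "0 \<le> \<tau> i" using st that by auto
      from center[OF this, of "fixed_mean i" "\<Sum>x\<in>UNIV. prob (state (\<tau> i) x) * fixed_mean i x"]
      show ?thesis by (simp add: fixed_c_def)
    qed
    then have "(\<Sum>i\<in>?F. ?\<Xi> i) = (\<Sum>i\<in>?F. (\<Sum>x\<in>UNIV. prob (A \<inter> state (\<tau> i) x) * fixed_mean i x) - prob A * (\<Sum>x\<in>UNIV. prob (state (\<tau> i) x) * fixed_mean i x))"
      by (rule sum.cong[OF refl])
    then show ?thesis by (simp add: sum_subtractf sum_distrib_left)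
  qed
  have finF: "finite ?F"
    by (rule finite_subset[of _ "{..Sup {i. \<tau> i \<le> t}}"]) (use le_last_fixed_iff[OF t] in auto)
  have R_part: "((LINT \<omega>|M. indicator A \<omega> * R t \<omega>) - (LINT \<omega>|M. indicator A \<omega> * R s \<omega>)) - prob A * \<delta> = (LINT u:{s..t}|lborel. ?\<Theta> u) + (\<Sum>i\<in>?F. ?\<Xi> i)"
    unfolding dA dS distrib_left using rates fixeds by linarith
  note Nt = NU_integral[OF st A] and Ns = NU_integral[OF st(1) order.refl A]
  have I: "(LINT u:{s..}|lborel. ?\<Theta> u) = (LINT u:{s..t}|lborel. ?\<Theta> u) + (LINT u:{t..}|lborel. ?\<Theta> u)"
    by (rule set_integral_split_at[OF st(2) Ns(1)])
  have Sm: "(\<Sum>\<^sub>\<infinity>i\<in>{i. s < \<tau> i}. ?\<Xi> i) = (\<Sum>i\<in>?F. ?\<Xi> i) + (\<Sum>\<^sub>\<infinity>i\<in>{i. t < \<tau> i}. ?\<Xi> i)"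
  proof -
    have "(\<Sum>\<^sub>\<infinity>i\<in>?F \<union> {i. t < \<tau> i}. ?\<Xi> i) = (\<Sum>\<^sub>\<infinity>i\<in>?F. ?\<Xi> i) + (\<Sum>\<^sub>\<infinity>i\<in>{i. t < \<tau> i}. ?\<Xi> i)"
      by (rule infsum_Un_disjoint[OF summable_on_finite[OF finF] Nt(2)]) auto
    moreover have "?F \<union> {i. t < \<tau> i} = {i. s < \<tau> i}" using st(2) by auto
    ultimately show ?thesis using infsum_finite[OF finF, of ?\<Xi>] by simp
  qed
  have "(LINT \<omega>:A|M. Z t \<omega>) - (LINT \<omega>:A|M. Z s \<omega>)
     = (((LINT \<omega>|M. indicator A \<omega> * R t \<omega>) - (LINT \<omega>|M. indicator A \<omega> * R s \<omega>)) - prob A * \<delta>)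
       + ((LINT \<omega>|M. indicator A \<omega> * NU t (X t \<omega>)) - (LINT \<omega>|M. indicator A \<omega> * NU s (X s \<omega>)))"
    unfolding ZA[OF t] ZA[OF st(1)] \<delta>_def by (simp add: right_diff_distrib)
  also have "\<dots> = 0" unfolding R_part Nt(3) Ns(3) I Sm by simp
  finally show ?thesis by simp
qed

lemma Z_measurable_FR:
  assumes t: "0 \<le> t"
  shows "Z t \<in> borel_measurable (FR t)"
proof -
  have XR: "(\<lambda>\<omega>. (X t \<omega>, R t \<omega>)) \<in> measurable (FR t) (count_space UNIV \<Otimes>\<^sub>M borel)"
    unfolding FR_def by (rule measurable_generated_by) (use t in \<open>auto simp: space_pair_measure\<close>)
  have "X t \<in> measurable (FR t) (count_space UNIV)" using measurable_compose[OF XR measurable_fst] by simp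
  then have "(\<lambda>\<omega>. NU t (X t \<omega>)) \<in> borel_measurable (FR t)" by (rule measurable_compose) simp
  moreover have "R t \<in> borel_measurable (FR t)" using measurable_compose[OF XR measurable_snd] by simp
  ultimately show ?thesis unfolding Z_def[abs_def] by simp
qed

lemma martingale_Z: "martingale M FR Z"
  unfolding martingale_def
proof (intro conjI allI impI)
  show "filtration (space M) FR"
  proof
    show "space (FR i) = space M" for i by (simp add: FR_def)
    show "sets (FR i) \<subseteq> sets (FR j)" if "i \<le> j" for i j :: real
      unfolding FR_def[of i]
    proof (rule sets_generated_by_subset)
      show "(\<lambda>\<omega>. (X u \<omega>, R u \<omega>)) \<in> measurable (FR j) (count_space UNIV \<Otimes>\<^sub>M borel)" if "u \<in> {0..i}" for u
        unfolding FR_def by (rule measurable_generated_by) (use that \<open>i \<le> j\<close> in \<open>auto simp: space_pair_measure\<close>)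
    qed (simp add: FR_def)
  qed
  show "subalgebra M (FR t)" if "0 \<le> t" for t using FR_subalgebra(2)[OF that] .
  show "Z t \<in> borel_measurable (FR t)" if "0 \<le> t" for t using Z_measurable_FR[OF that] .
  show "integrable M (Z t)" if "0 \<le> t" for t using integrable_Z[OF that] .
  fix s t :: real assume st: "0 \<le> s \<and> s \<le> t"
  then have s: "0 \<le> s" "s \<le> t" and t: "0 \<le> t" by auto
  interpret S: finite_measure_subalgebra M "FR s" by (rule finite_measure_subalgebraI[OF FR_subalgebra(2)[OF s(1)]])
  show "AE \<omega> in M. real_cond_exp M (FR s) (Z t) \<omega> = Z s \<omega>"
  proof (rule S.real_cond_exp_charact)
    fix A assume "A \<in> sets (FR s)"
    then have "A \<in> sets (FH s)" using sets_subalgebra[OF FR_subalgebra(1)] by blast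
    then show "(LINT \<omega>:A|M. Z t \<omega>) = (LINT \<omega>:A|M. Z s \<omega>)" by (rule Z_increment[OF s])
  qed (use integrable_Z[OF t] integrable_Z[OF s(1)] Z_measurable_FR[OF s(1)] in auto)
qed

text \<open>Formulated for the increment, because \<open>Z s\<close> contains observed rewards and
  is in general not measurable for the history of X.\<close>

lemma Z_increment_cond_exp:
  assumes st: "0 \<le> s" "s \<le> t"
  shows "AE \<omega> in M. real_cond_exp M (FX s) (\<lambda>\<omega>'. Z t \<omega>' - Z s \<omega>') \<omega> = 0"
proof -
  have t: "0 \<le> t" using st by simp
  interpret S: finite_measure_subalgebra M "FX s" by (rule finite_measure_subalgebraI[OF subalgebras(7)])
  show ?thesis
  proof (rule S.real_cond_exp_charact)
    fix A assume A: "A \<in> sets (FX s)"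
    then have AM: "A \<in> events" using sets_subalgebra[OF subalgebras(7)] by blast
    have "A \<in> sets (FH s)" using sets_subalgebra[OF subalgebra_FH_FXN sets_subalgebra[OF subalgebras(5) A]] .
    moreover have "set_integrable M A (Z v)" if "0 \<le> v" for v
      unfolding set_integrable_def using integrable_mult_indicator[OF AM integrable_Z[OF that]] .
    ultimately show "(LINT \<omega>:A|M. Z t \<omega> - Z s \<omega>) = (LINT \<omega>:A|M. 0)"
      using Z_increment[OF st] set_integral_diff(2)[of M A "Z t" "Z s"] t st(1) by (simp add: set_lebesgue_integral_def)
  qed (use integrable_Z[OF t] integrable_Z[OF st(1)] in auto)
qed

end

subsection \<open>Uniform bounds from the assumptions\<close>

lemma SUP_ereal_finite_bound:
  assumes "(SUP t\<in>A. ereal (f t)) < \<infinity>"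
  obtains B where "\<And>t. t \<in> A \<Longrightarrow> f t \<le> B"
proof -
  obtain n :: nat where n: "(SUP t\<in>A. ereal (f t)) < ereal (real n)"
    using assms less_PInf_Ex_of_nat by (metis less_irrefl)
  have "f t \<le> real n" if "t \<in> A" for t
  proof -
    have "ereal (f t) \<le> (SUP t\<in>A. ereal (f t))" using that by (rule SUP_upper)
    then show ?thesis using n by (meson ereal_less_eq(3) less_imp_le order.trans)
  qed
  then show ?thesis by (rule that)
qed

lemma INF_ereal_pos_bound:
  assumes "0 < (INF t\<in>A. ereal (f t))"
  obtains B where "0 < B" "\<And>t. t \<in> A \<Longrightarrow> B \<le> f t"
proof -
  obtain B where B: "0 < ereal B" "ereal B < (INF t\<in>A. ereal (f t))" using ereal_dense2[OF assms] by blast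
  have "B \<le> f t" if "t \<in> A" for t
  proof -
    have "(INF t\<in>A. ereal (f t)) \<le> ereal (f t)" using that by (rule INF_lower)
    then show ?thesis using B(2) by (meson ereal_less_eq(3) less_imp_le order.trans)
  qed
  then show ?thesis using B(1) by (intro that) auto
qed

lemma INF_ereal_nonneg: "0 \<le> (INF t\<in>A. ereal (f t)) \<Longrightarrow> t \<in> A \<Longrightarrow> 0 \<le> f t"
  by (metis INF_lower ereal_less_eq(5) order.trans)

lemma finite_uniform_upper_bound:
  fixes f :: "'i \<Rightarrow> 't \<Rightarrow> real"
  assumes "finite I" "\<And>i. i \<in> I \<Longrightarrow> \<exists>B. \<forall>t\<in>A. f i t \<le> B"
  obtains B where "0 \<le> B" "\<And>i t. i \<in> I \<Longrightarrow> t \<in> A \<Longrightarrow> f i t \<le> B"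
proof -
  obtain U where U: "\<And>i t. i \<in> I \<Longrightarrow> t \<in> A \<Longrightarrow> f i t \<le> U i" using assms(2) by metis
  have "U i \<le> Max (insert 0 (U ` I))" if "i \<in> I" for i using assms(1) that by (intro Max_ge) auto
  moreover have "0 \<le> Max (insert 0 (U ` I))" using assms(1) by (intro Max_ge) auto
  ultimately show ?thesis using U by (intro that) (auto intro: order.trans)
qed

lemma finite_uniform_lower_bound:
  fixes f :: "'i \<Rightarrow> 't \<Rightarrow> real"
  assumes "finite I" "\<And>i. i \<in> I \<Longrightarrow> \<exists>B>0. \<forall>t\<in>A. B \<le> f i t"
  obtains B where "0 < B" "\<And>i t. i \<in> I \<Longrightarrow> t \<in> A \<Longrightarrow> B \<le> f i t"
proof -
  obtain L where L: "\<And>i. i \<in> I \<Longrightarrow> 0 < L i" "\<And>i t. i \<in> I \<Longrightarrow> t \<in> A \<Longrightarrow> L i \<le> f i t" using assms(2) by metis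
  have "Min (insert 1 (L ` I)) \<le> L i" if "i \<in> I" for i using assms(1) that by (intro Min_le) auto
  moreover have "0 < Min (insert 1 (L ` I))" using assms(1) L(1) by (subst Min_gr_iff) auto
  ultimately show ?thesis using L(2) by (intro that) (auto intro: order.trans)
qed

text \<open>Gives access to the left limit at 0, through which (A4) expresses nonnegative rewards;
  the bounds 0 and 1 make the supremum over time meaningful in the reals.\<close>

lemma distribution_function_left_limit:
  assumes F: "distribution_function F"
  shows "z < a \<Longrightarrow> F z \<le> Lim (at_left a) F" "0 \<le> Lim (at_left a) F" "Lim (at_left a) F \<le> 1"
proof -
  have mono: "mono F" using F by (simp add: distribution_function_def)
  have "(F \<longlongrightarrow> Sup (F ` ({..<a} \<inter> UNIV))) (at a within ({..<a} \<inter> UNIV))"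
    by (rule Lim_left_bound[where K = 1]) (auto intro: monoD[OF mono] distribution_function_bounds[OF F])
  then have S: "(F \<longlongrightarrow> Sup (F ` {..<a})) (at_left a)" by simp
  have L: "(F \<longlongrightarrow> Lim (at_left a) F) (at_left a)"
    unfolding tendsto_Lim[OF trivial_limit_at_left_real S] by (rule S)
  have up: "F z \<le> Lim (at_left a) F" if "z < a" for z
    using L by (rule tendsto_lowerbound)
      (use that in \<open>auto intro!: monoD[OF mono] simp: eventually_at_left[OF that]\<close>)
  then show "z < a \<Longrightarrow> F z \<le> Lim (at_left a) F" .
  show "0 \<le> Lim (at_left a) F"
    using up[of "a - 1"] distribution_function_bounds(1)[OF F, of "a - 1"] by simp
  show "Lim (at_left a) F \<le> 1"
    using L by (rule tendsto_upperbound) (simp_all add: distribution_function_bounds[OF F])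
qed

text \<open>A supremum 0 of nonnegative left limits forces each of them to vanish, and an infimum 1
  of values at most 1 forces each value to be 1.\<close>

lemma supported_cdf_family:
  fixes F :: "real \<Rightarrow> real \<Rightarrow> real"
  assumes F: "\<And>t. 0 \<le> t \<Longrightarrow> distribution_function (F t)"
    and left: "(SUP t\<in>{0..}. Lim (at_left 0) (F t)) = 0" and right: "(INF t\<in>{0..}. F t a) = 1"
    and c: "a \<le> real c" and t: "0 \<le> t"
  shows "supported_cdf c (F t)"
proof -
  have "F t z = 0" if z: "z < 0" for z
  proof -
    have "Lim (at_left 0) (F t) \<le> (SUP t\<in>{0..}. Lim (at_left 0) (F t))"
      by (rule cSUP_upper) (use t distribution_function_left_limit(3)[OF F] in \<open>auto intro!: bdd_aboveI[of _ 1]\<close>)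
    then show ?thesis
      using left distribution_function_left_limit(1)[OF F[OF t] z] distribution_function_bounds(1)[OF F[OF t], of z] by simp
  qed
  moreover have "F t (real c) = 1"
  proof -
    have "(INF t\<in>{0..}. F t a) \<le> F t a"
      by (rule cINF_lower) (use t distribution_function_bounds(1)[OF F] in \<open>auto intro!: bdd_belowI[of _ 0]\<close>)
    moreover have "F t a \<le> F t (real c)"
      using F[OF t] c by (simp add: distribution_function_def monoD)
    ultimately show ?thesis using right distribution_function_bounds(2)[OF F[OF t], of "real c"] by simp
  qed
  ultimately show ?thesis using F[OF t] by (simp add: supported_cdf_def)
qed

lemma support_at_eq: "assumption_A2 Q \<Longrightarrow> 0 \<le> t \<Longrightarrow> support_at Q t = support_at Q 1"
  unfolding assumption_A2_def by (elim conjE allE[of _ t] impE allE[of _ 1]) simp_all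

text \<open>Off-diagonal rates are bounded by (A3) on the common support and vanish elsewhere; a
  diagonal entry is minus the sum of the others in its row.\<close>

lemma rate_matrices_bound:
  fixes Q :: "real \<Rightarrow> 's::finite \<Rightarrow> 's \<Rightarrow> real"
  assumes Q: "rate_matrices Q" and A2: "assumption_A2 Q" and A3: "assumption_A3 Q"
  obtains q where "\<And>t x y. 0 \<le> t \<Longrightarrow> \<bar>Q t x y\<bar> \<le> q"
proof -
  have nn: "0 \<le> Q t x y" if "0 \<le> t" "x \<noteq> y" for t x y using Q that by (auto simp: rate_matrices_def)
  have "\<exists>B. \<forall>t\<in>{0..}. Q t (fst e) (snd e) \<le> B" if "e \<in> support_at Q 1" for e
  proof -
    have "(SUP t\<in>{0..}. ereal (Q t (fst e) (snd e))) < \<infinity>"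
      using A3 that by (auto simp: assumption_A3_def split_beta)
    then show ?thesis by (rule SUP_ereal_finite_bound) blast
  qed
  note bnd = this
  obtain B where B0: "0 \<le> B" and B: "\<And>e t. e \<in> support_at Q 1 \<Longrightarrow> t \<in> {0..} \<Longrightarrow> Q t (fst e) (snd e) \<le> B"
    by (rule finite_uniform_upper_bound[of "support_at Q 1" "{0..}" "\<lambda>e t. Q t (fst e) (snd e)", OF finite bnd]) (assumption | blast)+
  have off: "\<bar>Q t x y\<bar> \<le> B" if t: "0 \<le> t" and xy: "x \<noteq> y" for t x y
  proof (cases "(x, y) \<in> support_at Q 1")
    case True
    then show ?thesis using B[of "(x, y)" t] nn[OF t xy] t by simp
  next
    case False
    then have "(x, y) \<notin> support_at Q t" using support_at_eq[OF A2 t] by simp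
    then show ?thesis using nn[OF t xy] B0 by (simp add: support_at_def)
  qed
  have "\<bar>Q t x y\<bar> \<le> real CARD('s) * B" if t: "0 \<le> t" for t x y
  proof (cases "x = y")
    case True
    have "(\<Sum>z\<in>UNIV. Q t x z) = 0" using Q t by (auto simp: rate_matrices_def)
    then have "Q t x x = - (\<Sum>z\<in>UNIV - {x}. Q t x z)" by (simp add: sum.remove[of UNIV x])
    then have "\<bar>Q t x x\<bar> \<le> (\<Sum>z\<in>UNIV - {x}. \<bar>Q t x z\<bar>)" by (simp add: sum_abs)
    also have "\<dots> \<le> (\<Sum>z\<in>UNIV - {x}. B)" by (rule sum_mono) (use off[OF t] in auto)
    also have "\<dots> \<le> (\<Sum>z\<in>(UNIV :: 's set). B)" by (rule sum_mono2) (use B0 in auto)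
    finally show ?thesis using True by simp
  next
    case False
    have "1 * B \<le> real CARD('s) * B" using B0 by (intro mult_right_mono) (simp_all add: Suc_leI)
    then show ?thesis using off[OF t False] by simp
  qed
  then show ?thesis by (rule that)
qed

lemma measurable_extend_nonneg:
  "f \<in> borel_measurable (restrict_space borel {0..}) \<Longrightarrow> (\<lambda>t. f (max 0 (t::real))) \<in> borel_measurable borel"
  by (rule measurable_compose[of "max 0", OF measurable_restrict_space2]) auto

section \<open>Derivation of the result from (A1)-(A5)\<close>

text \<open>The first conjunct asserts convergence of the integral and the sum in \<nu>, because
  both operators return 0 on divergent input and boundedness alone would then say little.\<close>

theorem theorem1:
  fixes M :: "'w measure"
    and P :: "'s::finite \<Rightarrow> 'w measure"
    and \<mu> :: "'s pmf"
    and Q :: "real \<Rightarrow> 's \<Rightarrow> 's \<Rightarrow> real"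
    and p :: "real \<Rightarrow> real \<Rightarrow> 's \<Rightarrow> 's \<Rightarrow> real"
    and r \<beta> :: "real \<Rightarrow> 's \<Rightarrow> real"
    and G :: "real \<Rightarrow> 's \<Rightarrow> 's \<Rightarrow> real \<Rightarrow> real"
    and H K :: "real \<Rightarrow> 's \<Rightarrow> real \<Rightarrow> real"
    and \<tau> :: "nat \<Rightarrow> real"
    and X :: "real \<Rightarrow> 'w \<Rightarrow> 's"
    and N :: "real \<Rightarrow> 'w \<Rightarrow> nat"
    and Gr Hr Kr :: "nat \<Rightarrow> 'w \<Rightarrow> real"
    and R Z :: "real \<Rightarrow> 'w \<Rightarrow> real"
    and \<nu> :: "real \<Rightarrow> 's \<Rightarrow> real"
    and F FR :: "real \<Rightarrow> 'w measure"
  assumes Q: "rate_matrices Q"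
    and p: "transition_function Q p"
    and distr: "\<And>t x y. 0 \<le> t \<Longrightarrow> distribution_function (G t x y) \<and>
                  distribution_function (H t x) \<and> distribution_function (K t x)"
    and times: "\<tau> 0 = 0" "strict_mono \<tau>" "filterlim \<tau> at_top sequentially"
    and model: "reward_model M p \<mu> \<beta> G H K \<tau> X N Gr Hr Kr"
    and model_from: "\<And>x. reward_model (P x) p (return_pmf x) \<beta> G H K \<tau> X N Gr Hr Kr"
    and mixture: "\<And>x. sets (P x) = sets M"
                 "\<And>A. A \<in> sets M \<Longrightarrow> measure M A = (\<Sum>x\<in>UNIV. pmf \<mu> x * measure (P x) A)"
    and A1: "assumption_A1 Q r \<beta> G K"
    and A2: "assumption_A2 Q"
    and A3: "assumption_A3 Q"
    and A4: "assumption_A4 Q r \<beta> G H K"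
    and A5: "assumption_A5 \<tau>"
    and R: "R = cumulative_reward r \<tau> X N Gr Hr Kr"
    and \<nu>: "\<nu> = nu_fun M P Q r \<beta> G H K \<tau> X Hr"
    and Z: "Z = (\<lambda>t \<omega>. R t \<omega> - (LINT \<omega>'|M. R t \<omega>') + \<nu> t (X t \<omega>))"
    and F: "F = natural_filtration M (count_space UNIV) X"
    and FR: "FR = natural_filtration M (count_space UNIV \<Otimes>\<^sub>M borel) (\<lambda>t \<omega>. (X t \<omega>, R t \<omega>))"
  shows "(\<forall>t\<ge>0. \<forall>x. set_integrable lborel {0..} (nu_integrand M P Q r \<beta> G K X t x) \<and>
                      nu_summand M P H \<tau> X Hr t x summable_on {i. t < \<tau> i}) \<and>
         (SUP (t, x)\<in>{0..} \<times> UNIV. ereal \<bar>\<nu> t x\<bar>) < \<infinity> \<and>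
         martingale M FR Z \<and>
         (\<forall>s t. 0 \<le> s \<and> s \<le> t \<longrightarrow>
            (AE \<omega> in M. real_cond_exp M (F s) (\<lambda>\<omega>'. Z t \<omega>' - Z s \<omega>') \<omega> = 0))"
proof -
  obtain q where Q_bound: "\<And>t x y. 0 \<le> t \<Longrightarrow> \<bar>Q t x y\<bar> \<le> q"
    by (rule rate_matrices_bound[OF Q A2 A3]) blast
  have Q_nonneg: "\<And>t x y. 0 \<le> t \<Longrightarrow> x \<noteq> y \<Longrightarrow> 0 \<le> Q t x y"
    using Q by (auto simp: rate_matrices_def)
  have Q_support: "Q t x y = 0" if "0 \<le> t" "x \<noteq> y" "(x, y) \<notin> support_at Q 1" for t x y
  proof -
    have "(x, y) \<notin> support_at Q t" using support_at_eq[OF A2 that(1)] that(3) by simp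
    then show ?thesis using Q_nonneg[OF that(1,2)] by (simp add: support_at_def)
  qed
  have Q_diag: "(x, x) \<notin> support_at Q 1" for x
  proof -
    have "(\<Sum>z\<in>UNIV. Q 1 x z) = 0" using Q by (auto simp: rate_matrices_def)
    moreover have "0 \<le> (\<Sum>z\<in>UNIV - {x}. Q 1 x z)" by (rule sum_nonneg) (auto intro: Q_nonneg)
    ultimately show ?thesis by (simp add: support_at_def sum.remove[of UNIV x])
  qed
  have "\<exists>B>0. \<forall>t\<in>{0..}. B \<le> Q t (fst e) (snd e)" if "e \<in> support_at Q 1" for e
  proof -
    have "0 < (INF t\<in>{0..}. ereal (Q t (fst e) (snd e)))"
      using A3 that by (auto simp: assumption_A3_def split_beta)
    then show ?thesis by (rule INF_ereal_pos_bound) blast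
  qed
  note bnd = this
  obtain c0 where c0: "0 < c0" and E_rate': "\<And>e t. e \<in> support_at Q 1 \<Longrightarrow> t \<in> {0..} \<Longrightarrow> c0 \<le> Q t (fst e) (snd e)"
    by (rule finite_uniform_lower_bound[of "support_at Q 1" "{0..}" "\<lambda>e t. Q t (fst e) (snd e)", OF finite bnd]) (assumption | blast)+
  have E_rate: "\<And>x y t. (x, y) \<in> support_at Q 1 \<Longrightarrow> 0 \<le> t \<Longrightarrow> c0 \<le> Q t x y"
    using E_rate' by force
  have irred: "\<And>x y. (x, y) \<in> (support_at Q 1)\<^sup>*"
    using A2 unfolding assumption_A2_def irreducible_rates_def support_at_def by blast
  have "\<And>x y. (\<lambda>t. Q t x y) \<in> borel_measurable (restrict_space borel {0..})"
    "\<And>x. (\<lambda>t. r t x) \<in> borel_measurable (restrict_space borel {0..})"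
    "\<And>x. (\<lambda>t. \<beta> t x) \<in> borel_measurable (restrict_space borel {0..})"
    "\<And>x y z. (\<lambda>t. G t x y z) \<in> borel_measurable (restrict_space borel {0..})"
    "\<And>x z. (\<lambda>t. K t x z) \<in> borel_measurable (restrict_space borel {0..})"
    using A1 by (simp_all add: assumption_A1_def Let_def)
  note meas = this[THEN measurable_extend_nonneg]
  obtain c' :: "'s \<Rightarrow> real" where A4': "\<forall>x.
        0 \<le> (INF t\<in>{0..}. ereal (r t x)) \<and> (SUP t\<in>{0..}. ereal (r t x)) < \<infinity> \<and>
        0 \<le> (INF t\<in>{0..}. ereal (\<beta> t x)) \<and> (SUP t\<in>{0..}. ereal (\<beta> t x)) < \<infinity> \<and>
        (\<forall>y. (SUP t\<in>{0..}. Lim (at_left 0) (G t x y)) = 0 \<and> (INF t\<in>{0..}. G t x y (c' x)) = 1) \<and>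
        (SUP t\<in>{0..}. Lim (at_left 0) (H t x)) = 0 \<and> (INF t\<in>{0..}. H t x (c' x)) = 1 \<and>
        (SUP t\<in>{0..}. Lim (at_left 0) (K t x)) = 0 \<and> (INF t\<in>{0..}. K t x (c' x)) = 1"
    using A4 unfolding assumption_A4_def by (elim conjE exE) (rule that)
  have
    r4: "\<And>x. 0 \<le> (INF t\<in>{0..}. ereal (r t x))" "\<And>x. (SUP t\<in>{0..}. ereal (r t x)) < \<infinity>" and
    \<beta>4: "\<And>x. 0 \<le> (INF t\<in>{0..}. ereal (\<beta> t x))" "\<And>x. (SUP t\<in>{0..}. ereal (\<beta> t x)) < \<infinity>" and
    G4: "\<And>x y. (SUP t\<in>{0..}. Lim (at_left 0) (G t x y)) = 0" "\<And>x y. (INF t\<in>{0..}. G t x y (c' x)) = 1" and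
    H4: "\<And>x. (SUP t\<in>{0..}. Lim (at_left 0) (H t x)) = 0" "\<And>x. (INF t\<in>{0..}. H t x (c' x)) = 1" and
    K4: "\<And>x. (SUP t\<in>{0..}. Lim (at_left 0) (K t x)) = 0" "\<And>x. (INF t\<in>{0..}. K t x (c' x)) = 1"
    using A4' by blast+
  have ub: "\<exists>B. \<forall>t\<in>{0..}. f t \<le> B" if "(SUP t\<in>{0..}. ereal (f t)) < \<infinity>" for f :: "real \<Rightarrow> real"
    using that by (rule SUP_ereal_finite_bound) blast
  obtain b1 where b1: "\<And>x t. x \<in> UNIV \<Longrightarrow> t \<in> {0..} \<Longrightarrow> r t x \<le> b1"
    by (rule finite_uniform_upper_bound[of UNIV "{0..}" "\<lambda>x t. r t x"]) (use ub[OF r4(2)] in auto)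
  obtain b2 where b2: "\<And>x t. x \<in> UNIV \<Longrightarrow> t \<in> {0..} \<Longrightarrow> \<beta> t x \<le> b2"
    by (rule finite_uniform_upper_bound[of UNIV "{0..}" "\<lambda>x t. \<beta> t x"]) (use ub[OF \<beta>4(2)] in auto)
  define b where "b = max b1 b2"
  have r_bound: "0 \<le> r t x \<and> r t x \<le> b" if "0 \<le> t" for t x
    using INF_ereal_nonneg[OF r4(1)[of x], of t] b1[of x t] that by (simp add: b_def)
  have \<beta>_bound: "0 \<le> \<beta> t x \<and> \<beta> t x \<le> b" if "0 \<le> t" for t x
    using INF_ereal_nonneg[OF \<beta>4(1)[of x], of t] b2[of x t] that by (simp add: b_def)
  \<comment> \<open>One natural number above all the bounds c(x), in the form that
    \<open>supported_cdf\<close> expects.\<close>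
  define c where "c = nat \<lceil>Max (range c')\<rceil>"
  have c: "c' x \<le> real c" for x
  proof -
    have "c' x \<le> Max (range c')" by (rule Max_ge) auto
    also have "\<dots> \<le> real c" unfolding c_def by (rule real_nat_ceiling_ge)
    finally show ?thesis .
  qed
  have cdf: "\<And>t x y. 0 \<le> t \<Longrightarrow> supported_cdf c (G t x y)"
    "\<And>t x. 0 \<le> t \<Longrightarrow> supported_cdf c (H t x)" "\<And>t x. 0 \<le> t \<Longrightarrow> supported_cdf c (K t x)"
    subgoal for t x y using supported_cdf_family[of "\<lambda>t. G t x y", OF _ G4 c] distr by blast
    subgoal for t x using supported_cdf_family[of "\<lambda>t. H t x", OF _ H4 c] distr by blast
    subgoal for t x using supported_cdf_family[of "\<lambda>t. K t x", OF _ K4 c] distr by blast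
    done
  \<comment> \<open>Shown for an arbitrary law and initial distribution, since it is applied to M
    and to every \<open>P x\<close>.\<close>
  have rates: "reward_process_rates L Q p q m r \<beta> G H K \<tau> X N Gr Hr Kr b c"
    if L: "reward_model L p m \<beta> G H K \<tau> X N Gr Hr Kr" for L m
  proof -
    have L': "prob_space L" "markov_jump_process L p m X" "cond_poisson_process L \<beta> X N"
      "lump_sum_rewards L G H K \<tau> X N Gr Hr Kr"
      using L by (simp_all add: reward_model_def)
    show ?thesis
      by (intro reward_process_rates.intro reward_process.intro bounded_rate_transitions.intro
          reward_process_axioms.intro reward_process_rates_axioms.intro)
        (fact p Q_bound meas L' r_bound \<beta>_bound cdf times Q_nonneg Q_support Q_diag)+
  qed
  interpret E: ergodic_transitions Q p q "support_at Q 1" c0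
    by (intro ergodic_transitions.intro bounded_rate_transitions.intro ergodic_transitions_axioms.intro)
      (fact p Q_bound meas c0 E_rate irred)+
  obtain C \<alpha> where erg: "0 < \<alpha>" "0 \<le> C"
    "\<And>s t x x' f B. 0 \<le> s \<Longrightarrow> s \<le> t \<Longrightarrow> (\<And>y. \<bar>f y\<bar> \<le> B) \<Longrightarrow>
       \<bar>(\<Sum>y\<in>UNIV. p s t x y * f y) - (\<Sum>y\<in>UNIV. p s t x' y * f y)\<bar> \<le> C * B * exp (- \<alpha> * (t - s))"
    by (rule E.ergodic) blast
  obtain a where a: "0 < a" and sep': "\<And>i. i \<in> {1..} \<Longrightarrow> a \<le> \<tau> i - \<tau> (i - 1)"
    using A5 unfolding assumption_A5_def by (rule INF_ereal_pos_bound) blast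
  have sep: "a \<le> \<tau> (Suc i) - \<tau> i" for i using sep'[of "Suc i"] by simp
  interpret L: reward_martingale M Q p q \<mu> r \<beta> G H K \<tau> X N Gr Hr Kr b c P C \<alpha> a
    by (intro reward_martingale.intro reward_martingale_axioms.intro rates model model_from) (fact erg a sep)+
  have Z_eq: "Z = L.Z" unfolding Z R \<nu> by (intro ext) (simp add: L.Z_def)
  have F_eq: "F s = L.FX s" for s unfolding F natural_filtration_def L.FX_def ..
  have FR_eq: "FR = L.FR" unfolding FR R by (intro ext) (simp add: natural_filtration_def L.FR_def)
  have "(SUP (t, x)\<in>{0..} \<times> UNIV. ereal \<bar>\<nu> t x\<bar>) \<le> ereal (C * L.rate_max / \<alpha> + C * c / (1 - exp (- \<alpha> * a)))"
    unfolding \<nu> by (rule SUP_least) (use L.NU_eq(4) in auto)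
  then have "(SUP (t, x)\<in>{0..} \<times> UNIV. ereal \<bar>\<nu> t x\<bar>) < \<infinity>"
    by (rule le_less_trans) simp
  then show ?thesis
    using L.NU_eq(1,2) L.martingale_Z L.Z_increment_cond_exp by (auto simp: Z_eq F_eq FR_eq)
qed

end
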